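(* Let $M\leqslant N$ be positive integers, let $\mathcal K=(K_n)$ and $\mathcal L=(L_n)$ be sequences of integers such that $M\leqslant K_n<K_n+L_n\leqslant 2M$ for all integers $n$ with $N<n\leqslant 2N$, and let $\mathfrak M\subseteq(M,2M]$ and $\mathfrak N\subseteq(N,2N]$ be sets of integers. With $\rho=12$ and $\Delta_\mathfrak D$, $\mathscr N_\mathfrak D$ as defined in the context, we have $$ \Delta_\mathfrak D\ll |\mathfrak M\times\mathfrak N|^{1/2} M^{3/10}N^{13/20+o(1)} +\mathscr N_\mathfrak D\, M^{1/2}N^{-1/2} $$ as $M\to\infty$, where the implied constant is absolute and the $o(1)$ term tends to $0$ as $M\to\infty$ uniformly in the choice of $N,\mathcal K,\mathcal L,\mathfrak M,\mathfrak N$.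
   Context: For $x\in\mathbb R$ let $((x))=x-\lfloor x\rfloor-1/2$ if $x\notin\mathbb Z$ and $((x))=0$ if $x\in\mathbb Z$. For coprime integers $m,n\geqslant1$ the Dedekind sum is $s(m,n)=\sum_{k=1}^{n}((k/n))((km/n))$. For a real number $t$, $\{t\}$ denotes its fractional part. For data $\mathfrak D=(\rho,M,N,\mathcal K,\mathcal L,\mathfrak M,\mathfrak N)$ as in the claim (here $\rho=12$) and $\lambda\in[0,1]$, $\mathscr A_\mathfrak D(\lambda)$ is the number of pairs $(m,n)\in\mathfrak M\times\mathfrak N$ with $K_n<m\leqslant K_n+L_n$, $\gcd(m,n)=1$, and $\{\rho\, s(m,n)\}\in[0,\lambda]$. Let $\mathscr N_\mathfrak D$ be the number of pairs $(m,n)\in\mathfrak M\times\mathfrak N$ with $K_n<m\leqslant K_n+L_n$ and $\gcd(m,n)=1$, and $\Delta_\mathfrak D=\sup_{\lambda\in[0,1]}|\mathscr A_\mathfrak D(\lambda)-\lambda\mathscr N_\mathfrak D|$. The notation $A\ll B$ means $|A|\leqslant cB$ for some constant $c$. *)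

theory Defs
  imports Complex_Main
begin

definition sawtooth :: "real \<Rightarrow> real" where
  "sawtooth x = (if x \<in> \<int> then 0 else x - of_int \<lfloor>x\<rfloor> - 1/2)"

definition dedekind_sum :: "int \<Rightarrow> int \<Rightarrow> real" where
  "dedekind_sum m n = (\<Sum>k\<in>{1..n}. sawtooth (of_int k / of_int n) * sawtooth (of_int (k * m) / of_int n))"

definition adm_pairs :: "(int \<Rightarrow> int) \<Rightarrow> (int \<Rightarrow> int) \<Rightarrow> int set \<Rightarrow> int set \<Rightarrow> (int \<times> int) set" where
  "adm_pairs K L MM NN = {(m, n) \<in> MM \<times> NN. K n < m \<and> m \<le> K n + L n \<and> coprime m n}"

definition count_N :: "(int \<Rightarrow> int) \<Rightarrow> (int \<Rightarrow> int) \<Rightarrow> int set \<Rightarrow> int set \<Rightarrow> nat" where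
  "count_N K L MM NN = card (adm_pairs K L MM NN)"

definition count_A :: "(int \<Rightarrow> int) \<Rightarrow> (int \<Rightarrow> int) \<Rightarrow> int set \<Rightarrow> int set \<Rightarrow> real \<Rightarrow> nat" where
  "count_A K L MM NN lam = card {(m, n) \<in> adm_pairs K L MM NN. frac (12 * dedekind_sum m n) \<in> {0..lam}}"

definition discrepancy :: "(int \<Rightarrow> int) \<Rightarrow> (int \<Rightarrow> int) \<Rightarrow> int set \<Rightarrow> int set \<Rightarrow> real" where
  "discrepancy K L MM NN =
     (SUP lam\<in>{0..1::real}. \<bar>real (count_A K L MM NN lam) - lam * real (count_N K L MM NN)\<bar>)"

end

theory Submission
  imports Defs "Berlekamp_Zassenhaus.Finite_Field" "HOL-Algebra.Algebraic_Closure_Type"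
    "HOL-Number_Theory.Number_Theory" "HOL-Analysis.Analysis" "HOL-Real_Asymp.Real_Asymp"
begin

text \<open>
  Modulo \<open>1\<close>, \<open>12 s(m,n)\<close> equals \<open>(m + m')/n\<close> where \<open>m m' = 1\<close> modulo \<open>n\<close>. An Erdos--Turan type inequality
  with about \<open>N/M\<close> frequencies therefore reduces the theorem to the sums of \<open>e(h (m + m')/n)\<close> with \<open>h M \<le> N\<close>.
  The factor \<open>e(h m/n)\<close> is then harmless (Taylor expansion), and so is the interval condition on \<open>m\<close>
  (Fourier expansion modulo \<open>M\<close>). What remains is a bilinear form in the Kloosterman fractions \<open>h m'/n\<close>
  with arbitrary coefficients.

  That form is bounded by the amplification method of Duke, Friedlander and Iwaniec. The sum over \<open>m\<close> is
  multiplied by a sum over primes \<open>l\<close> of size about \<open>L = N\<^bsup>7/10\<^esup> M\<^bsup>-3/5\<^esup>\<close>, and Cauchy--Schwarz is applied over the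
  residue classes of \<open>l m\<close> modulo \<open>n\<close>. Off the diagonal, \<open>l\<^sub>1 m\<^sub>1 - l\<^sub>2 m\<^sub>2 = r n\<close> with a short \<open>r\<close>, and reciprocity
  \<open>k'/n + n'/k = 1/(n k)\<close> modulo \<open>1\<close> moves the fraction to the modulus \<open>k = l\<^sub>2 m\<^sub>2\<close>. A second Cauchy--Schwarz, which removes the
  coefficients, leaves correlations that are incomplete Kloosterman sums in \<open>m\<^sub>1\<close>. Only
  the primes dividing the modulus exactly once are used, so that the Weil bound for prime moduli suffices.

  The Weil bound for Kloosterman sums is proved by Bombieri's form of Stepanov's method. On the Artin--Schreier curve
  \<open>y\<^sup>p - y = a x + b/x\<close> over the field with \<open>Q\<^sup>2\<close> elements there is a nonzero function of small pole order whose \<open>Q\<close>-th power vanishes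
  at all rational points, because the power coincides there with a function that a dimension count makes identically zero.
  This bounds the sums over all even degree extensions of the prime field up to a constant, and the \<open>L\<close>-function, which is a quadratic polynomial, turns this into the sharp bound over the prime field itself.
\<close>

text \<open>The second error term is the price of smoothing: an endpoint blurred to width
  \<open>d\<close> and resolved with \<open>H\<close> frequencies costs
  \<open>2 d + 2 / (H d)\<close>. Taking \<open>H\<close> about \<open>N / M\<close>, the largest
  value for which \<open>h m / n\<close> stays bounded, makes \<open>d = sqrt (M / N)\<close> the
  balanced choice. The length \<open>L\<close> is tied to the first error term by
  \<open>N^2 / L = (M^(3/10) N^(13/20))^2\<close>: up to divisor functions the diagonal of the
  amplified sum contributes \<open>N^2 / L\<close>. The off-diagonal terms are no larger as long as
  \<open>L^5 M^(7/2) <= N^4\<close>, and here the left side is \<open>N^(7/2) M^(1/2)\<close>. The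
  obstacle in between is arithmetical. A correlation modulo \<open>q\<close> is bounded by
  \<open>sqrt q\<close> times the square root of the part of \<open>q\<close> outside its simple
  primes, a loss that is harmless only on average over \<open>m2\<close>. Coinciding primes in the
  amplifier cause further losses, which are rare enough to be summed trivially. Logarithms and
  divisor functions all go into \<open>dmax N\<close>, and the \<open>o(1)\<close> is the supremum
  of its exponent over all \<open>N >= M\<close>, which makes it uniform in
  \<open>N\<close>.\<close>

hide_const (open) Divisibility.prime Divisibility.irreducible Polynomials.degree Polynomials.lead_coeff

section \<open>Additive characters\<close>

definition ee :: "real \<Rightarrow> complex" where "ee x = cis (2 * pi * x)"

lemma ee_add: "ee (x + y) = ee x * ee y"
  by (simp add: ee_def cis_mult distrib_left)

lemma ee_0 [simp]: "ee 0 = 1"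
  by (simp add: ee_def)

lemma norm_ee [simp]: "norm (ee x) = 1"
  by (simp add: ee_def)

lemma ee_uminus: "ee (- x) = cnj (ee x)"
  by (simp add: ee_def cis_cnj)

lemma ee_of_int [simp]: "ee (of_int k) = 1"
proof -
  have "2 * pi * real_of_int k = 2 * pi * of_int k" by simp
  then show ?thesis
    by (auto simp: ee_def complex_eq_iff cos_int_2pin sin_int_2pin)
qed

lemma ee_cong_int: "x - y \<in> \<int> \<Longrightarrow> ee x = ee y"
proof -
  assume "x - y \<in> \<int>"
  then obtain k where "x - y = of_int k" by (auto elim: Ints_cases)
  then have "x = y + of_int k" by simp
  then show ?thesis by (simp add: ee_add)
qed

lemma ee_power: "ee (of_nat k * x) = ee x ^ k"
  by (induction k) (auto simp: algebra_simps ee_add)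

definition em :: "int \<Rightarrow> int \<Rightarrow> complex" where "em n a = ee (of_int a / of_int n)"

lemma norm_em [simp]: "norm (em n a) = 1"
  by (simp add: em_def)

lemma em_0 [simp]: "em n 0 = 1"
  by (simp add: em_def)

lemma em_add: "em n (a + b) = em n a * em n b"
  by (simp add: em_def add_divide_distrib ee_add)

lemma em_uminus: "em n (- a) = cnj (em n a)"
  by (simp add: em_def ee_uminus)

lemma em_diff: "em n (a - b) = em n a * cnj (em n b)"
  using em_add[of n a "- b"] by (simp add: em_uminus)

lemma em_cong: "[a = b] (mod n) \<Longrightarrow> n \<noteq> 0 \<Longrightarrow> em n a = em n b"
proof -
  assume a: "[a = b] (mod n)" "n \<noteq> 0"
  then obtain k where "a - b = n * k" by (meson cong_iff_dvd_diff dvdE)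
  then have "real_of_int a / of_int n - of_int b / of_int n = of_int k"
    using a(2) by (metis (no_types, opaque_lifting) diff_divide_distrib nonzero_mult_div_cancel_left of_int_diff of_int_eq_0_iff of_int_mult)
  then show ?thesis unfolding em_def by (intro ee_cong_int) auto
qed

lemma em_dvd: "n dvd a \<Longrightarrow> n \<noteq> 0 \<Longrightarrow> em n a = 1"
  using em_cong[of a 0 n] by (simp add: cong_0_iff)

lemma em_scale: "k \<noteq> 0 \<Longrightarrow> em (k * n) (k * a) = em n a"
  by (simp add: em_def)

text \<open>Half of Jordan's inequality is enough and splits into two easy ranges: up to 1/3 the
  derivative \<open>cos (pi * y) * pi\<close> of the sine is at least 3/2, and beyond that the sine
  is at least 1/2.\<close>

lemma sin_pi_ge:
  assumes "0 \<le> x" "x \<le> 1/2"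
  shows "x \<le> sin (pi * x)"
proof (cases "x \<le> 1/3")
  case True
  have "sin (pi * 0) - 0 \<le> sin (pi * x) - x"
  proof (rule DERIV_nonneg_imp_nondecreasing[of 0 x "\<lambda>x. sin (pi * x) - x"])
    fix y assume y: "0 \<le> y" "y \<le> x"
    have "cos (pi * y) \<ge> cos (pi / 3)"
      using y True by (intro cos_monotone_0_pi_le) (auto simp: mult_left_mono field_simps)
    then have "cos (pi * y) \<ge> 1/2" by (simp add: cos_60)
    then have "cos (pi * y) * pi \<ge> 1/2 * 3"
      using pi_gt3 by (intro mult_mono) auto
    moreover have "((\<lambda>x. sin (pi * x) - x) has_real_derivative (cos (pi * y) * pi - 1)) (at y)"
      by (auto intro!: derivative_eq_intros)
    ultimately show "\<exists>d. ((\<lambda>x. sin (pi * x) - x) has_real_derivative d) (at y) \<and> 0 \<le> d"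
      by (intro exI conjI) auto
  qed (use assms in auto)
  then show ?thesis by simp
next
  case False
  have "sin (pi / 6) \<le> sin (pi * x)"
    using False assms pi_gt_zero by (intro sin_monotone_2pi_le) (auto simp: field_simps)
  then show ?thesis using assms by (simp add: sin_30)
qed

lemma norm_1_minus_ee: "norm (1 - ee x) = 2 * \<bar>sin (pi * x)\<bar>"
proof -
  have "(norm (1 - ee x))\<^sup>2 = (1 - cos (2*pi*x))\<^sup>2 + (sin (2*pi*x))\<^sup>2"
    by (simp add: cmod_def ee_def)
  also have "\<dots> = 2 - 2 * cos (2*(pi*x))"
    using sin_cos_squared_add[of "2*pi*x"] by (simp add: power2_eq_square algebra_simps)
  also have "\<dots> = (2 * \<bar>sin (pi * x)\<bar>)\<^sup>2"
    by (simp add: cos_double_sin power_mult_distrib)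
  finally show ?thesis
    by (metis abs_ge_zero mult_nonneg_nonneg norm_ge_zero power2_eq_imp_eq zero_le_numeral)
qed

lemma norm_geom_sum_ee:
  fixes u w :: int
  shows "norm (1 - ee x) * norm (\<Sum>v\<in>{u..<w}. ee (of_int v * x)) \<le> 2"
proof (cases "u \<le> w")
  case True
  have "(\<Sum>v\<in>{u..<w}. ee (of_int v * x)) * (1 - ee x) = ee (of_int u * x) - ee (of_int w * x)"
    using True
  proof (induction w rule: int_ge_induct)
    case (step i)
    have "{u..<i+1} = insert i {u..<i}" using step by auto
    then show ?case using step.IH
      by (simp add: distrib_right ee_add) (simp add: algebra_simps)
  qed auto
  then have "norm (1 - ee x) * norm (\<Sum>v\<in>{u..<w}. ee (of_int v * x)) = norm (ee (of_int u * x) - ee (of_int w * x))"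
    by (metis mult.commute norm_mult)
  also have "\<dots> \<le> 2" using norm_triangle_ineq4[of "ee (of_int u * x)" "ee (of_int w * x)"] by simp
  finally show ?thesis .
qed auto

text \<open>The sum \<open>1 / b + 1 / (t - b)\<close> stands in for the inverse distance from
  \<open>b / t\<close> to the nearest integer: in each half of the unit interval one of the two
  summands alone bounds the geometric sum, and summing over \<open>b\<close> gives two harmonic
  sums.\<close>

lemma norm_geom_sum_em:
  fixes u w b t :: int
  assumes "0 < b" "b < t"
  shows "norm (\<Sum>v\<in>{u..<w}. em t (b * v)) \<le> of_int t * (1 / of_int b + 1 / of_int (t - b))"
proof -
  define x where "x = real_of_int b / of_int t"
  have x: "0 < x" "x < 1" using assms by (auto simp: x_def)
  define S where "S = norm (\<Sum>v\<in>{u..<w}. em t (b * v))"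
  have S: "norm (1 - ee x) * S \<le> 2"
    using norm_geom_sum_ee[of x u w] by (simp add: S_def em_def x_def mult.commute)
  have S0: "S \<ge> 0" by (simp add: S_def)
  have sp: "sin (pi * x) \<ge> 0" using x by (intro sin_ge_zero) auto
  have "S \<le> 1 / x + 1 / (1 - x)"
  proof (cases "x \<le> 1/2")
    case True
    have "2 * x * S \<le> norm (1 - ee x) * S"
      using sin_pi_ge[of x] x True sp by (intro mult_right_mono S0) (auto simp: norm_1_minus_ee)
    then have "S \<le> 1 / x" using S x by (simp add: field_simps)
    then show ?thesis using x by (simp add: add_increasing2)
  next
    case False
    have "sin (pi * (1 - x)) = sin (pi * x)" by (simp add: algebra_simps)
    then have "2 * (1 - x) * S \<le> norm (1 - ee x) * S"
      using sin_pi_ge[of "1 - x"] x False sp by (intro mult_right_mono S0) (auto simp: norm_1_minus_ee)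
    then have "S \<le> 1 / (1 - x)" using S x by (simp add: field_simps)
    then show ?thesis using x by (simp add: add_increasing)
  qed
  also have "1 / x + 1 / (1 - x) = of_int t * (1 / of_int b + 1 / of_int (t - b))"
    using assms by (simp add: x_def field_simps)
  finally show ?thesis by (simp add: S_def)
qed

lemma sum_inverse_le_ln:
  fixes n :: int assumes "n \<ge> 1"
  shows "(\<Sum>b\<in>{1..n}. 1 / real_of_int b) \<le> 1 + ln (of_int n)"
  using assms
proof (induction n rule: int_ge_induct)
  case (step i)
  have "{1..i+1} = insert (i+1) {1..i}" using step by auto
  then have "(\<Sum>b\<in>{1..i+1}. 1 / real_of_int b) = 1 / (of_int i + 1) + (\<Sum>b\<in>{1..i}. 1 / real_of_int b)"
    by simp
  moreover have "1 / (real_of_int i + 1) \<le> ln (real_of_int i + 1) - ln (real_of_int i)"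
  proof -
    have "ln (real_of_int i / (of_int i + 1)) \<le> real_of_int i / (of_int i + 1) - 1"
      using step by (intro ln_le_minus_one) auto
    moreover have "ln (real_of_int i / (of_int i + 1)) = ln (of_int i) - ln (of_int i + 1)"
      using step by (simp add: ln_div)
    moreover have "real_of_int i / (of_int i + 1) - 1 = - (1 / (real_of_int i + 1))"
      using step by (simp add: field_simps)
    ultimately show ?thesis by linarith
  qed
  ultimately show ?case using step by simp
qed auto

text \<open>Total mass of the Fourier coefficients modulo \<open>t\<close> of the indicator function of an interval;
  the zero frequency is not counted.\<close>

lemma sum_geom_bound:
  fixes t :: int
  assumes "t \<ge> 1"
  shows "(\<Sum>b\<in>{1..<t}. of_int t * (1 / of_int b + 1 / of_int (t - b))) \<le> 2 * real_of_int t * (1 + ln (of_int t))"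
proof -
  have "(\<Sum>b\<in>{1..<t}. 1 / real_of_int (t - b)) = (\<Sum>b\<in>{1..<t}. 1 / real_of_int b)"
    by (rule sum.reindex_bij_witness[of _ "\<lambda>b. t - b" "\<lambda>b. t - b"]) auto
  moreover have "(\<Sum>b\<in>{1..<t}. 1 / real_of_int b) \<le> (\<Sum>b\<in>{1..t}. 1 / real_of_int b)"
    by (intro sum_mono2) auto
  ultimately have "(\<Sum>b\<in>{1..<t}. 1 / of_int b + 1 / real_of_int (t - b)) \<le> 2 * (1 + ln (of_int t))"
    using sum_inverse_le_ln[OF assms] by (simp add: sum.distrib)
  then have "of_int t * (\<Sum>b\<in>{1..<t}. 1 / of_int b + 1 / real_of_int (t - b)) \<le> of_int t * (2 * (1 + ln (of_int t)))"
    using assms by (intro mult_left_mono) auto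
  then show ?thesis by (simp add: sum_distrib_left mult_ac)
qed

lemma em_orthogonality:
  fixes t a :: int
  assumes "t \<ge> 1"
  shows "(\<Sum>b\<in>{0..<t}. em t (b * a)) = (if t dvd a then of_int t else 0)"
proof (cases "t dvd a")
  case True
  then have "(\<Sum>b\<in>{0..<t}. em t (b * a)) = (\<Sum>b\<in>{0..<t}. 1)"
    using assms by (intro sum.cong em_dvd) auto
  then show ?thesis using True assms by simp
next
  case False
  define z where "z = em t a"
  have "z \<noteq> 1"
  proof
    assume "z = 1"
    then have "cos (2*pi*(of_int a / of_int t)) = 1"
      by (simp add: z_def em_def ee_def complex_eq_iff)
    then obtain k :: int where "2*pi*(of_int a / of_int t) = of_int k * 2 * pi"
      using cos_one_2pi_int by blast
    then have "real_of_int a = of_int k * of_int t" using assms by (simp add: field_simps)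
    then have "a = k * t" by (metis of_int_eq_iff of_int_mult)
    then show False using False by simp
  qed
  have "(\<Sum>b\<in>{0..<t}. em t (b * a)) = (\<Sum>k<nat t. em t (int k * a))"
    by (rule sum.reindex_bij_witness[of _ int nat]) auto
  also have "\<dots> = (\<Sum>k<nat t. z ^ k)"
    by (intro sum.cong refl) (simp add: z_def em_def flip: ee_power)
  also have "\<dots> = (1 - z ^ nat t) / (1 - z)"
    using \<open>z \<noteq> 1\<close> by (simp add: sum_gp_strict)
  also have "z ^ nat t = em t (t * a)"
    using assms by (simp add: z_def em_def flip: ee_power)
  also have "\<dots> = 1" using assms by (intro em_dvd) auto
  finally show ?thesis using False by simp
qed

section \<open>Dedekind sums modulo one\<close>

lemma sum_squares_int: "n \<ge> 1 \<Longrightarrow> 6 * (\<Sum>k\<in>{1..<n}. k\<^sup>2) = n * (n - 1) * (2 * n - 1)" for n :: int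
proof (induction n rule: int_ge_induct)
  case (step i)
  have "{1..<i+1} = insert i {1..<i}" using step by auto
  then show ?case using step by (simp add: power2_eq_square algebra_simps)
qed auto

lemma sum_ident_int: "n \<ge> 1 \<Longrightarrow> 2 * (\<Sum>k\<in>{1..<n}. k) = n * (n - 1)" for n :: int
proof (induction n rule: int_ge_induct)
  case (step i)
  have "{1..<i+1} = insert i {1..<i}" using step by auto
  then show ?case using step by (simp add: algebra_simps)
qed auto

lemma bij_betw_mult_mod:
  fixes m n :: int
  assumes "n \<ge> 1" "coprime m n"
  shows "bij_betw (\<lambda>k. k * m mod n) {1..<n} {1..<n}"
proof -
  have inj: "inj_on (\<lambda>k. k * m mod n) {1..<n}"
  proof (rule inj_onI)
    fix x y assume xy: "x \<in> {1..<n}" "y \<in> {1..<n}" "x * m mod n = y * m mod n"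
    then have "[x * m = y * m] (mod n)" by (simp add: Cong.cong_def)
    then have "[x = y] (mod n)" using assms(2) by (simp add: cong_mult_rcancel)
    then show "x = y" using xy by (auto simp: Cong.cong_def)
  qed
  have "(\<lambda>k. k * m mod n) ` {1..<n} \<subseteq> {1..<n}"
  proof safe
    fix k assume k: "k \<in> {1..<n}"
    have "k * m mod n \<noteq> 0"
    proof
      assume "k * m mod n = 0"
      then have "n dvd k" using assms(2) by (metis coprime_commute coprime_dvd_mult_left_iff dvd_eq_mod_eq_0)
      then show False using k zdvd_imp_le by fastforce
    qed
    moreover have "0 \<le> k * m mod n" "k * m mod n < n" using assms by auto
    ultimately show "k * m mod n \<in> {1..<n}" by simp
  qed
  then show ?thesis
    using inj by (metis bij_betw_def endo_inj_surj finite_atLeastLessThan_int)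
qed

text \<open>Multiplication by \<open>m\<close> permutes the nonzero residues, so \<open>k\<close>
  and \<open>k * m mod n\<close> contribute the same linear sum and only the mixed product depends
  on \<open>m\<close>.\<close>

lemma dedekind_sum_eq:
  assumes "n \<ge> 1" "coprime m n"
  shows "12 * dedekind_sum m n = 12 * of_int (\<Sum>k\<in>{1..<n}. k * (k * m mod n)) / (of_int n)\<^sup>2 - 3 * (of_int n - 1)"
proof -
  define a where "a = (\<lambda>k. k * m mod n)"
  have bij: "bij_betw a {1..<n} {1..<n}" unfolding a_def by (rule bij_betw_mult_mod[OF assms])
  have n0: "real_of_int n > 0" using assms by simp
  have s: "sawtooth (of_int k / of_int n) * sawtooth (of_int (k * m) / of_int n)
      = (of_int k / of_int n - 1/2) * (of_int (a k) / of_int n - 1/2)" if k: "k \<in> {1..<n}" for k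
  proof -
    have st: "sawtooth (of_int c / of_int n) = of_int (c mod n) / of_int n - 1/2" if "c mod n \<noteq> 0" for c
    proof -
      have "real_of_int c / of_int n \<notin> \<int>"
      proof
        assume "real_of_int c / of_int n \<in> \<int>"
        then obtain j where "real_of_int c / of_int n = of_int j" by (auto elim: Ints_cases)
        then have "real_of_int c = of_int (j * n)" using n0 by (simp add: field_simps)
        then have "c = j * n" by linarith
        then show False using that by simp
      qed
      moreover have "\<lfloor>real_of_int c / of_int n\<rfloor> = c div n"
        by (simp add: floor_divide_of_int_eq)
      moreover have "real_of_int c / of_int n - of_int (c div n) = of_int (c mod n) / of_int n"
      proof -
        have "real_of_int c / of_int n = (of_int (c div n) * of_int n + of_int (c mod n)) / of_int n"
          by (metis div_mult_mod_eq of_int_add of_int_mult)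
        also have "\<dots> = of_int (c div n) + of_int (c mod n) / of_int n"
          using n0 by (simp add: add_divide_distrib)
        finally show ?thesis by simp
      qed
      ultimately show ?thesis by (simp add: sawtooth_def)
    qed
    have "a k \<in> {1..<n}" using bij k by (auto simp: bij_betw_def)
    then have "k * m mod n \<noteq> 0" by (simp add: a_def)
    moreover have "k mod n = k" using k by simp
    ultimately show ?thesis using st[of k] st[of "k * m"] k by (simp add: a_def)
  qed
  have "{1..n} = insert n {1..<n}" using assms by auto
  then have "dedekind_sum m n = (\<Sum>k\<in>{1..<n}. sawtooth (of_int k / of_int n) * sawtooth (of_int (k * m) / of_int n))"
    using n0 by (simp add: dedekind_sum_def sawtooth_def)
  also have "\<dots> = (\<Sum>k\<in>{1..<n}. (of_int k / of_int n - 1/2) * (of_int (a k) / of_int n - 1/2))"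
    using s by (rule sum.cong[OF refl])
  also have "\<dots> = (\<Sum>k\<in>{1..<n}. of_int (k * a k) / (of_int n)\<^sup>2 - of_int k / (2 * of_int n) - of_int (a k) / (2 * of_int n) + 1/4)"
    by (intro sum.cong refl) (simp add: algebra_simps power2_eq_square)
  also have "\<dots> = of_int (\<Sum>k\<in>{1..<n}. k * a k) / (of_int n)\<^sup>2 - of_int (\<Sum>k\<in>{1..<n}. k) / (2 * of_int n)
       - of_int (\<Sum>k\<in>{1..<n}. a k) / (2 * of_int n) + of_int (n - 1) / 4"
    using assms by (simp add: sum.distrib sum_subtractf sum_divide_distrib)
  also have "(\<Sum>k\<in>{1..<n}. a k) = (\<Sum>k\<in>{1..<n}. k)"
    by (rule sum.reindex_bij_betw[OF bij])
  also have "real_of_int (\<Sum>k\<in>{1..<n}. k) = of_int n * (of_int n - 1) / 2"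
  proof -
    have "2 * real_of_int (\<Sum>k\<in>{1..<n}. k) = of_int (n * (n - 1))"
      by (metis sum_ident_int[OF assms(1)] of_int_mult of_int_numeral)
    then show ?thesis by simp
  qed
  also have "of_int n * (of_int n - 1) / 2 / (2 * of_int n) = (real_of_int n - 1) / 4"
    using n0 by simp
  finally have "dedekind_sum m n = of_int (\<Sum>k\<in>{1..<n}. k * a k) / (of_int n)\<^sup>2 - (real_of_int n - 1) / 4" by simp
  then have "12 * dedekind_sum m n = 12 * (of_int (\<Sum>k\<in>{1..<n}. k * a k) / (of_int n)\<^sup>2) - 3 * (of_int n - 1)" by linarith
  then show ?thesis by (simp add: a_def)
qed

text \<open>Up to an integer, \<open>Z\<close> is the Dedekind sum scaled by
  \<open>12 * n^2\<close>. Since \<open>m\<close> is invertible modulo \<open>n^2\<close>, it is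
  enough to know \<open>m * Z\<close> modulo \<open>n^2\<close>, and this reduces to a sum of
  squares of residues, which the permutation evaluates.\<close>

theorem dedekind_sum_mod_1:
  assumes "n \<ge> 1" "coprime m n"
  shows "12 * dedekind_sum m n - of_int (m + modular_inverse n m) / of_int n \<in> \<int>"
proof -
  define a where "a = (\<lambda>k. k * m mod n)"
  define f where "f = (\<lambda>k. k * m div n)"
  define Z where "Z = 12 * (\<Sum>k\<in>{1..<n}. k * a k)"
  define mb where "mb = modular_inverse n m"
  define S where "S = (\<Sum>k\<in>{1..<n}. k\<^sup>2)"
  define F where "F = (\<Sum>k\<in>{1..<n}. (f k)\<^sup>2)"
  have bij: "bij_betw a {1..<n} {1..<n}" unfolding a_def by (rule bij_betw_mult_mod[OF assms])
  have "[m * mb = 1] (mod n)" unfolding mb_def using assms by (intro cong_modular_inverse1) auto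
  then obtain j where j: "m * mb = 1 + n * j"
    by (metis cong_iff_lin cong_sym)
  \<comment> \<open>With \<open>u = k * m = a + n f\<close> this is
    \<open>2 u a = a^2 + u^2 - (u - a)^2\<close>: the mixed product becomes squares, the last of
    which is divisible by \<open>n^2\<close>.\<close>
  have "2 * m * (k * a k) = (a k)\<^sup>2 + m\<^sup>2 * k\<^sup>2 - n\<^sup>2 * (f k)\<^sup>2" for k
  proof -
    have km: "k * m = a k + n * f k" by (simp add: a_def f_def)
    have "2 * (k * m) * a k = (a k)\<^sup>2 + (k * m)\<^sup>2 - n\<^sup>2 * (f k)\<^sup>2"
      unfolding km by (simp add: power2_eq_square algebra_simps)
    then show ?thesis by (simp add: power2_eq_square mult_ac)
  qed
  then have "2 * m * (\<Sum>k\<in>{1..<n}. k * a k) = (\<Sum>k\<in>{1..<n}. (a k)\<^sup>2) + m\<^sup>2 * S - n\<^sup>2 * F"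
    by (simp add: S_def F_def sum_distrib_left sum.distrib sum_subtractf)
  also have "(\<Sum>k\<in>{1..<n}. (a k)\<^sup>2) = S"
    unfolding S_def by (rule sum.reindex_bij_betw[OF bij])
  finally have "m * Z = (m\<^sup>2 + 1) * (6 * S) - 6 * n\<^sup>2 * F"
    by (simp add: Z_def algebra_simps)
  also have "6 * S = n * (n - 1) * (2 * n - 1)"
    unfolding S_def by (rule sum_squares_int[OF assms(1)])
  finally have Z: "m * Z = (m\<^sup>2 + 1) * (n * (n - 1) * (2 * n - 1)) - 6 * n\<^sup>2 * F" .
  have "m * (Z - (m + mb) * n) = m * Z - m\<^sup>2 * n - n * (m * mb)"
    by (simp add: algebra_simps power2_eq_square)
  also have "\<dots> = n\<^sup>2 * ((m\<^sup>2 + 1) * (2 * n - 3) - 6 * F - j)"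
    unfolding Z j by (simp add: algebra_simps power2_eq_square)
  finally have "n\<^sup>2 dvd m * (Z - (m + mb) * n)" by simp
  moreover have "coprime (n\<^sup>2) m" using assms(2) by (simp add: coprime_commute)
  ultimately have "n\<^sup>2 dvd Z - (m + mb) * n" by (simp add: coprime_dvd_mult_right_iff)
  then obtain i where i: "Z - (m + mb) * n = n\<^sup>2 * i" by blast
  have n0: "real_of_int n > 0" using assms by simp
  have D: "12 * dedekind_sum m n = of_int Z / (of_int n)\<^sup>2 - 3 * (of_int n - 1)"
    unfolding dedekind_sum_eq[OF assms] by (simp add: Z_def a_def)
  have "real_of_int Z = of_int n ^ 2 * of_int i + of_int (m + mb) * of_int n"
    by (metis i diff_add_cancel of_int_add of_int_mult of_int_power)
  then have "of_int Z / (of_int n)\<^sup>2 = of_int i + of_int (m + mb) / real_of_int n"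
    using n0 by (simp add: add_divide_distrib power2_eq_square)
  then have "12 * dedekind_sum m n - of_int (m + mb) / of_int n = of_int (i - 3 * (n - 1))"
    unfolding D by simp
  then show ?thesis unfolding mb_def by simp
qed

section \<open>An inequality of Erdos and Turan\<close>

text \<open>The odd primitive of the Fejer kernel of order \<open>H\<close>; the mean value 1 of the
  kernel gives the leading term \<open>y\<close>.\<close>

definition fejer_primitive :: "nat \<Rightarrow> real \<Rightarrow> real" where
  "fejer_primitive H y = y + (\<Sum>k\<in>{1..<H}. (1 - real k / real H) * sin (2 * pi * real k * y) / (pi * real k))"

lemma dirichlet_kernel_sin:
  "(1 + 2 * (\<Sum>k\<in>{1..<Suc H}. cos (2 * pi * real k * y))) * sin (pi * y) = sin (pi * (2 * real H + 1) * y)"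
proof (induction H)
  case (Suc H)
  have "2 * cos (2 * pi * real (Suc H) * y) * sin (pi * y) = sin (pi * (2 * real (Suc H) + 1) * y) - sin (pi * (2 * real H + 1) * y)"
  proof -
    have a: "pi * (2 * real (Suc H) + 1) * y = 2 * pi * real (Suc H) * y + pi * y"
            "pi * (2 * real H + 1) * y = 2 * pi * real (Suc H) * y - pi * y"
      by (auto simp: algebra_simps)
    show ?thesis unfolding a sin_add sin_diff by (simp add: algebra_simps)
  qed
  then show ?case using Suc by (simp add: algebra_simps)
qed auto

text \<open>Passing from \<open>H\<close> to \<open>H + 1\<close> adds one Dirichlet kernel. The
  closed form is a square, which yields positivity of the kernel and its decay away from the
  integers.\<close>

lemma fejer_kernel_sin:
  "(real H + 2 * (\<Sum>k\<in>{1..<H}. (real H - real k) * cos (2 * pi * real k * y))) * (sin (pi * y))\<^sup>2 = (sin (pi * real H * y))\<^sup>2"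
proof (induction H)
  case (Suc H)
  have "(\<Sum>k\<in>{1..<Suc H}. (real (Suc H) - real k) * cos (2 * pi * real k * y))
     = (\<Sum>k\<in>{1..<H}. (real H - real k) * cos (2 * pi * real k * y)) + (\<Sum>k\<in>{1..<Suc H}. cos (2 * pi * real k * y))"
  proof (cases "H = 0")
    case False
    then have "{1..<Suc H} = insert H {1..<H}" by auto
    moreover have "(real (Suc H) - real k) * cos (2 * pi * real k * y)
        = (real H - real k) * cos (2 * pi * real k * y) + cos (2 * pi * real k * y)" for k
      by (simp add: algebra_simps)
    ultimately show ?thesis by (simp add: sum.distrib)
  qed auto
  then have "(real (Suc H) + 2 * (\<Sum>k\<in>{1..<Suc H}. (real (Suc H) - real k) * cos (2 * pi * real k * y))) * (sin (pi * y))\<^sup>2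
     = (sin (pi * real H * y))\<^sup>2 + (1 + 2 * (\<Sum>k\<in>{1..<Suc H}. cos (2 * pi * real k * y))) * sin (pi * y) * sin (pi * y)"
    using Suc by (simp add: algebra_simps power2_eq_square)
  also have "\<dots> = (sin (pi * real H * y))\<^sup>2 + sin (pi * (2 * real H + 1) * y) * sin (pi * y)"
    unfolding dirichlet_kernel_sin ..
  also have "\<dots> = (sin (pi * real (Suc H) * y))\<^sup>2"
  proof -
    define u v where "u = pi * real H * y" and "v = pi * y"
    have a: "pi * (2 * real H + 1) * y = (u + v) + u" "pi * y = (u + v) - u" "pi * real (Suc H) * y = u + v"
      by (auto simp: u_def v_def algebra_simps)
    have "sin ((u + v) + u) * sin ((u + v) - u) = (sin (u + v))\<^sup>2 * (cos u)\<^sup>2 - (cos (u + v))\<^sup>2 * (sin u)\<^sup>2"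
      unfolding sin_add[of "u+v"] sin_diff[of "u+v"] by (simp add: algebra_simps power2_eq_square)
    also have "\<dots> = (sin (u + v))\<^sup>2 - (sin u)\<^sup>2"
      unfolding cos_squared_eq by (simp add: algebra_simps)
    finally show ?thesis unfolding a u_def[symmetric] by simp
  qed
  finally show ?case .
qed auto

lemma fejer_primitive_deriv:
  assumes "H \<ge> 1"
  obtains d where "(fejer_primitive H has_real_derivative d) (at y)" "0 \<le> d"
     "0 < y \<Longrightarrow> y \<le> 1/2 \<Longrightarrow> d \<le> 1 / (real H * y\<^sup>2)"
proof -
  define d where "d = 1 + (\<Sum>k\<in>{1..<H}. (1 - real k / real H) * (cos (2 * pi * real k * y) * (2 * pi * real k)) / (pi * real k))"
  have D: "(fejer_primitive H has_real_derivative d) (at y)"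
    unfolding fejer_primitive_def[abs_def] d_def
    by (auto intro!: derivative_eq_intros sum.cong simp: field_simps)
  define T where "T = real H + 2 * (\<Sum>k\<in>{1..<H}. (real H - real k) * cos (2 * pi * real k * y))"
  have "real H * d = T"
  proof -
    have "real H * ((1 - real k / real H) * (cos (2 * pi * real k * y) * (2 * pi * real k)) / (pi * real k))
        = 2 * ((real H - real k) * cos (2 * pi * real k * y))" if "k \<in> {1..<H}" for k
      using that assms by (simp add: field_simps)
    then have "(\<Sum>k\<in>{1..<H}. real H * ((1 - real k / real H) * (cos (2 * pi * real k * y) * (2 * pi * real k)) / (pi * real k)))
        = (\<Sum>k\<in>{1..<H}. 2 * ((real H - real k) * cos (2 * pi * real k * y)))"
      by (rule sum.cong[OF refl])
    then show ?thesis unfolding d_def T_def distrib_left sum_distrib_left by simp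
  qed
  then have dT: "d = T / real H" using assms by (simp add: field_simps)
  have Ts: "T * (sin (pi * y))\<^sup>2 = (sin (pi * real H * y))\<^sup>2"
    unfolding T_def by (rule fejer_kernel_sin)
  \<comment> \<open>At integers the closed form is void, but there every cosine equals 1.\<close>
  have "T \<ge> 0"
  proof (cases "sin (pi * y) = 0")
    case True
    then obtain i :: int where "pi * y = of_int i * pi" using sin_zero_iff_int2 by blast
    then have y: "y = of_int i" by simp
    have "cos (2 * pi * real k * y) = 1" for k
    proof -
      have "2 * pi * real k * y = of_int (int k * i) * 2 * pi" by (simp add: y)
      then show ?thesis using cos_one_2pi_int by blast
    qed
    then show ?thesis unfolding T_def by (auto intro!: add_nonneg_nonneg sum_nonneg)
  next
    case False
    then have "T = (sin (pi * real H * y))\<^sup>2 / (sin (pi * y))\<^sup>2" using Ts by (simp add: field_simps)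
    then show ?thesis by simp
  qed
  moreover have "d \<le> 1 / (real H * y\<^sup>2)" if y: "0 < y" "y \<le> 1/2"
  proof -
    have "y\<^sup>2 \<le> (sin (pi * y))\<^sup>2" using sin_pi_ge[of y] y by (intro power_mono) auto
    then have "T * y\<^sup>2 \<le> T * (sin (pi * y))\<^sup>2" using \<open>T \<ge> 0\<close> by (intro mult_left_mono)
    also have "\<dots> \<le> 1" unfolding Ts by (simp add: abs_square_le_1)
    finally show ?thesis using y assms by (simp add: dT field_simps)
  qed
  ultimately show ?thesis using D dT by (intro that) auto
qed

lemma fejer_primitive_mono:
  assumes "H \<ge> 1" "x \<le> y" shows "fejer_primitive H x \<le> fejer_primitive H y"
proof (rule DERIV_nonneg_imp_nondecreasing[OF assms(2)])
  fix z
  obtain d where "(fejer_primitive H has_real_derivative d) (at z)" "0 \<le> d"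
    using fejer_primitive_deriv[OF assms(1), of z] by metis
  then show "\<exists>d. (fejer_primitive H has_real_derivative d) (at z) \<and> 0 \<le> d" by blast
qed

lemma fejer_primitive_minus: "fejer_primitive H (- x) = - fejer_primitive H x"
  by (simp add: fejer_primitive_def sum_negf)

lemma fejer_primitive_plus_1: "fejer_primitive H (x + 1) = fejer_primitive H x + 1"
proof -
  have "sin (2 * pi * real k * (x + 1)) = sin (2 * pi * real k * x)" for k
  proof -
    have "2 * pi * real k * (x + 1) = 2 * pi * real k * x + 2 * real k * pi" by (simp add: algebra_simps)
    then show ?thesis by (simp add: sin_add flip: sin_npi cos_npi)
  qed
  then show ?thesis by (simp add: fejer_primitive_def)
qed

text \<open>Integrate the derivative bound \<open>1 / (H y^2)\<close> from \<open>d\<close> to 1/2.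
  At 1/2 all sines vanish, so the primitive is exactly 1/2 there.\<close>

lemma fejer_primitive_lower:
  assumes H: "H \<ge> 1" and d: "0 < d" "d \<le> 1/2"
  shows "fejer_primitive H d \<ge> 1/2 - 1 / (real H * d)"
proof -
  define g where "g = (\<lambda>y. fejer_primitive H y + 1 / (real H * y))"
  have "g (1/2) \<le> g d"
  proof (rule DERIV_nonpos_imp_nonincreasing[of d "1/2"])
    fix y assume y: "d \<le> y" "y \<le> 1/2"
    then have y0: "y > 0" using d by auto
    obtain e where e: "(fejer_primitive H has_real_derivative e) (at y)" "e \<le> 1 / (real H * y\<^sup>2)"
      using fejer_primitive_deriv[OF H, of y] y0 y by metis
    have "(g has_real_derivative (e - 1 / (real H * y\<^sup>2))) (at y)"
      unfolding g_def using H y0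
      by (auto intro!: derivative_eq_intros e(1) simp: power2_eq_square field_simps)
    then show "\<exists>d. (g has_real_derivative d) (at y) \<and> d \<le> 0" using e(2) by force
  qed (use d in auto)
  moreover have "fejer_primitive H (1/2) = 1/2"
    by (auto simp: fejer_primitive_def mult_ac intro!: sum.neutral sin_npi2)
  moreover have "1 / (real H * (1/2)) \<ge> 0" by simp
  ultimately show ?thesis unfolding g_def by linarith
qed

text \<open>A weak form of the Erdos--Turan inequality: the Fejer primitive is a monotone trigonometric
  perturbation of the identity that is close to a step function away from the integers.\<close>

lemma discrepancy_le_exponential_sums:
  fixes x :: "'i \<Rightarrow> real"
  assumes fin: "finite I" and x: "\<And>i. i \<in> I \<Longrightarrow> 0 \<le> x i \<and> x i < 1"
    and lam: "0 \<le> lam" "lam \<le> 1" and d: "0 < d" "d \<le> 1/2" and H: "H \<ge> 1"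
  shows "\<bar>real (card {i\<in>I. x i \<le> lam}) - lam * real (card I)\<bar>
    \<le> real (card I) * (2 * d + 2 / (real H * d)) + (\<Sum>k\<in>{1..<H}. norm (\<Sum>i\<in>I. ee (real k * x i)) / real k)"
proof -
  define G where "G = fejer_primitive H"
  define B where "B = (\<Sum>k\<in>{1..<H}. norm (\<Sum>i\<in>I. ee (real k * x i)) / real k)"
  define e where "e = 2 / (real H * d)"
  have mono: "u \<le> v \<Longrightarrow> G u \<le> G v" for u v unfolding G_def by (rule fejer_primitive_mono[OF H])
  have Gd: "1 - 2 * G d \<le> e" using fejer_primitive_lower[OF H d] by (simp add: G_def e_def)
  have Gm: "G (- u) = - G u" for u by (simp add: G_def fejer_primitive_minus)
  have G1: "G (1 - d) = 1 - G d"
    using fejer_primitive_plus_1[of H "-d"] by (simp add: G_def fejer_primitive_minus)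
  \<comment> \<open>On average a shift of \<open>G\<close> differs from the identity only by
    exponential sums. Two shifts are subtracted below, which is why half of \<open>B\<close> is
    wanted; it comes from \<open>pi >= 2\<close>.\<close>
  have psi: "\<bar>(\<Sum>i\<in>I. G (x i + c)) - (\<Sum>i\<in>I. x i + c)\<bar> \<le> B / 2" for c
  proof -
    have "(\<Sum>i\<in>I. G (x i + c)) - (\<Sum>i\<in>I. x i + c)
       = (\<Sum>i\<in>I. \<Sum>k\<in>{1..<H}. (1 - real k / real H) * sin (2 * pi * real k * (x i + c)) / (pi * real k))"
      by (simp add: G_def fejer_primitive_def sum.distrib)
    also have "\<dots> = (\<Sum>k\<in>{1..<H}. \<Sum>i\<in>I. (1 - real k / real H) * sin (2 * pi * real k * (x i + c)) / (pi * real k))"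
      by (rule sum.swap)
    also have "\<bar>\<dots>\<bar> \<le> (\<Sum>k\<in>{1..<H}. norm (\<Sum>i\<in>I. ee (real k * x i)) / real k / 2)"
    proof (rule order_trans[OF sum_abs], rule sum_mono)
      fix k assume k: "k \<in> {1..<H}"
      have "(\<Sum>i\<in>I. sin (2 * pi * real k * (x i + c))) = Im (ee (real k * c) * (\<Sum>i\<in>I. ee (real k * x i)))"
        by (simp add: sum_distrib_left ee_add[symmetric] ee_def[of "_ + _"] algebra_simps)
      also have "\<bar>\<dots>\<bar> \<le> norm (ee (real k * c) * (\<Sum>i\<in>I. ee (real k * x i)))" by (rule abs_Im_le_cmod)
      also have "\<dots> = norm (\<Sum>i\<in>I. ee (real k * x i))" by (simp add: norm_mult)
      finally have s: "\<bar>\<Sum>i\<in>I. sin (2 * pi * real k * (x i + c))\<bar> \<le> norm (\<Sum>i\<in>I. ee (real k * x i))" .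
      have "(\<Sum>i\<in>I. (1 - real k / real H) * sin (2 * pi * real k * (x i + c)) / (pi * real k))
        = (1 - real k / real H) / (pi * real k) * (\<Sum>i\<in>I. sin (2 * pi * real k * (x i + c)))"
        by (simp add: sum_distrib_left)
      also have "\<bar>\<dots>\<bar> \<le> (1 / (2 * real k)) * norm (\<Sum>i\<in>I. ee (real k * x i))"
      proof -
        have "0 \<le> (1 - real k / real H) / (pi * real k)" using k by simp
        moreover have "(1 - real k / real H) / (pi * real k) \<le> 1 / (2 * real k)"
          using k pi_gt3 by (intro frac_le) auto
        ultimately show ?thesis using s unfolding abs_mult by (intro mult_mono) auto
      qed
      finally show "\<bar>\<Sum>i\<in>I. (1 - real k / real H) * sin (2 * pi * real k * (x i + c)) / (pi * real k)\<bar>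
          \<le> norm (\<Sum>i\<in>I. ee (real k * x i)) / real k / 2" by simp
    qed
    also have "\<dots> = B / 2" by (simp add: B_def sum_divide_distrib)
    finally show ?thesis .
  qed
  have cnt: "real (card {i\<in>I. x i \<le> lam}) = (\<Sum>i\<in>I. of_bool (x i \<le> lam))"
    using fin by (simp add: of_bool_def sum.If_cases Int_def)
  \<comment> \<open>Majorant: for \<open>x i <= lam\<close> the two arguments lie on either side of
    0 at distance at least \<open>d\<close>, so \<open>G\<close> has made almost all of its unit
    jump between them; for other \<open>i\<close> monotonicity suffices.\<close>
  have "(\<Sum>i\<in>I. of_bool (x i \<le> lam)) \<le> (\<Sum>i\<in>I. G (x i + d) - G (x i + (- lam - d)) + e)"
  proof (rule sum_mono)
    fix i assume i: "i \<in> I"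
    show "of_bool (x i \<le> lam) \<le> G (x i + d) - G (x i + (- lam - d)) + e"
    proof (cases "x i \<le> lam")
      case True
      have "G d \<le> G (x i + d)" "G (x i + (- lam - d)) \<le> G (- d)"
        using x[OF i] True by (auto intro!: mono)
      then show ?thesis using Gd Gm[of d] True by simp
    next
      case False
      have "G (x i + (- lam - d)) \<le> G (x i + d)" using d lam by (intro mono) auto
      moreover have "e \<ge> 0" using d by (simp add: e_def)
      ultimately show ?thesis using False by simp
    qed
  qed
  also have "\<dots> = ((\<Sum>i\<in>I. G (x i + d)) - (\<Sum>i\<in>I. x i + d)) - ((\<Sum>i\<in>I. G (x i + (- lam - d))) - (\<Sum>i\<in>I. x i + (- lam - d)))
      + real (card I) * (lam + 2 * d + e)"
    by (simp add: sum.distrib sum_subtractf algebra_simps)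
  also have "\<dots> \<le> B + real (card I) * (lam + 2 * d + e)" using psi[of d] psi[of "- lam - d"] by linarith
  finally have up: "real (card {i\<in>I. x i \<le> lam}) \<le> B + real (card I) * (lam + 2 * d + e)" by (simp add: cnt)
  \<comment> \<open>Minorant: the shifts now move inwards by \<open>d\<close>. The identity
    \<open>G (1 - d) = 1 - G d\<close> keeps \<open>G\<close> from reaching the next jump at
    1.\<close>
  have "(\<Sum>i\<in>I. G (x i + (- d)) - G (x i + (d - lam)) - e) \<le> (\<Sum>i\<in>I. of_bool (x i \<le> lam))"
  proof (rule sum_mono)
    fix i assume i: "i \<in> I"
    have a: "G (x i + (- d)) \<le> 1 - G d" unfolding G1[symmetric] using x[OF i] by (intro mono) auto
    show "G (x i + (- d)) - G (x i + (d - lam)) - e \<le> of_bool (x i \<le> lam)"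
    proof (cases "x i \<le> lam")
      case True
      have "G (- (1 - d)) \<le> G (x i + (d - lam))" using x[OF i] lam by (intro mono) auto
      then show ?thesis using Gd a G1 Gm[of "1 - d"] True by simp
    next
      case False
      have "G d \<le> G (x i + (d - lam))" using False by (intro mono) auto
      then show ?thesis using Gd a False by simp
    qed
  qed
  moreover have "(\<Sum>i\<in>I. G (x i + (- d)) - G (x i + (d - lam)) - e) =
      ((\<Sum>i\<in>I. G (x i + (- d))) - (\<Sum>i\<in>I. x i + (- d))) - ((\<Sum>i\<in>I. G (x i + (d - lam))) - (\<Sum>i\<in>I. x i + (d - lam)))
      + real (card I) * (lam - 2 * d - e)"
    by (simp add: sum.distrib sum_subtractf algebra_simps)
  moreover have "\<dots> \<ge> - B + real (card I) * (lam - 2 * d - e)" using psi[of "-d"] psi[of "d - lam"] by linarith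
  ultimately have lo: "real (card {i\<in>I. x i \<le> lam}) \<ge> - B + real (card I) * (lam - 2 * d - e)" by (simp add: cnt)
  show ?thesis using up lo unfolding B_def[symmetric] e_def[symmetric]
    by (auto simp: abs_le_iff algebra_simps)
qed

section \<open>Finite fields inside an algebraic closure\<close>

lemma order_eq_1_if_simple_root:
  fixes f :: "'b :: field poly"
  assumes "f \<noteq> 0" "poly f a = 0" "poly (pderiv f) a \<noteq> 0"
  shows "order a f = 1"
proof -
  have "order a f \<noteq> 0" using assms by (simp add: order_root)
  moreover have "\<not> 2 \<le> order a f"
  proof
    assume "2 \<le> order a f"
    then have "[:-a, 1:] ^ 2 dvd f" by (simp add: order_divides)
    then obtain g where "f = [:-a, 1:] ^ 2 * g" by blast
    then have "poly (pderiv f) a = 0"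
      by (simp add: power2_eq_square pderiv_mult pderiv_pCons del: mult_pCons_left mult_pCons_right)
    then show False using assms by simp
  qed
  ultimately show ?thesis by linarith
qed

lemma size_proots_alg_closed:
  fixes f :: "'b :: alg_closed_field poly"
  assumes "f \<noteq> 0"
  shows "size (proots f) = degree f"
proof -
  obtain A where A: "size A = degree f" "f = smult (lead_coeff f) (\<Prod>x\<in>#A. [:- x, 1:])"
    using alg_closed_imp_factorization[OF assms] by blast
  have "proots f = proots (\<Prod>x\<in>#A. [:- x, 1:])"
    using assms by (subst A(2)) simp
  also have "\<dots> = A"
  proof (induction A)
    case (add x A)
    have "(\<Prod>x\<in>#A. [:- x, 1:]) \<noteq> 0" by (auto simp: prod_mset_zero_iff)
    then show ?case using add by (simp add: proots_mult del: mult_pCons_left)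
  qed auto
  finally show ?thesis using A by simp
qed

lemma sum_order_eq_degree:
  fixes f :: "'b :: alg_closed_field poly"
  assumes "f \<noteq> 0"
  shows "(\<Sum>x | poly f x = 0. order x f) = degree f"
  using size_proots_alg_closed[OF assms] assms
  by (simp add: size_multiset_overloaded_eq)

lemma prod_linear_dvd:
  fixes f :: "'b :: field poly"
  assumes "finite A" "\<And>a. a \<in> A \<Longrightarrow> poly f a = 0"
  shows "(\<Prod>a\<in>A. [:-a, 1:]) dvd f"
  using assms
proof (induction A arbitrary: f rule: finite_induct)
  case (insert a A)
  obtain g where g: "f = [:-a, 1:] * g"
    using insert.prems[of a] poly_eq_0_iff_dvd by blast
  have "poly g b = 0" if "b \<in> A" for b
    using insert.prems[of b] insert.hyps that by (auto simp: g)
  then have "(\<Prod>a\<in>A. [:-a, 1:]) dvd g" by (rule insert.IH)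
  then show ?case using insert.hyps by (simp add: g mult_dvd_mono del: mult_pCons_left)
qed auto

interpretation to_ac_hom: field_hom "to_ac :: 'b :: field \<Rightarrow> 'b alg_closure"
  by unfold_locales auto

interpretation to_ac_poly_hom: map_poly_inj_idom_hom "to_ac :: 'b :: field \<Rightarrow> 'b alg_closure" ..

abbreviation to_acp :: "'b :: field poly \<Rightarrow> 'b alg_closure poly" where
  "to_acp \<equiv> map_poly to_ac"

lemma coeff_reflect_to_acp: "coeff (reflect_poly (to_acp f)) n = to_ac (coeff (reflect_poly f) n)"
  by (simp add: coeff_reflect_poly)

lemma alg_closure_frob_add:
  "(x + y) ^ (CARD('a) ^ k) = x ^ (CARD('a) ^ k) + (y :: 'a :: prime_card mod_ring alg_closure) ^ (CARD('a) ^ k)"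
  by (rule freshmans_dream') (auto simp: CHAR_alg_closure prime_card)

lemma alg_closure_frob_sum:
  "(\<Sum>i\<in>I. f i) ^ (CARD('a) ^ k) = (\<Sum>i\<in>I. (f i :: 'a :: prime_card mod_ring alg_closure) ^ (CARD('a) ^ k))"
  by (rule freshmans_dream_sum') (auto simp: CHAR_alg_closure prime_card)

lemma prime_card_gt_1: "1 < CARD('a :: prime_card)"
  using prime_card[where 'a = 'a] prime_gt_1_nat by blast

lemma alg_closure_frob_minus:
  "(- x) ^ (CARD('a) ^ k) = - ((x :: 'a :: prime_card mod_ring alg_closure) ^ (CARD('a) ^ k))"
proof -
  have "(x + (- x)) ^ (CARD('a) ^ k) = 0" using prime_card_gt_1[where 'a = 'a] by simp
  then show ?thesis unfolding alg_closure_frob_add by (simp add: eq_neg_iff_add_eq_0 add.commute)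
qed

lemma alg_closure_frob_diff:
  "(x - y) ^ (CARD('a) ^ k) = x ^ (CARD('a) ^ k) - (y :: 'a :: prime_card mod_ring alg_closure) ^ (CARD('a) ^ k)"
  using alg_closure_frob_add[of x "- y" k] by (simp add: alg_closure_frob_minus)

lemma alg_closure_frob_inj:
  assumes "(x :: 'a :: prime_card mod_ring alg_closure) ^ (CARD('a) ^ k) = y ^ (CARD('a) ^ k)"
  shows "x = y"
proof -
  have "(x - y) ^ (CARD('a) ^ k) = 0" using assms by (simp add: alg_closure_frob_diff)
  then show ?thesis by simp
qed

interpretation frob_hom: field_hom "\<lambda>x :: 'a :: prime_card mod_ring alg_closure. x ^ CARD('a)"
proof -
  have "(x + y) ^ CARD('a) = x ^ CARD('a) + y ^ CARD('a)" for x y :: "'a mod_ring alg_closure"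
    using alg_closure_frob_add[of x y 1] by simp
  then show "field_hom (\<lambda>x :: 'a mod_ring alg_closure. x ^ CARD('a))"
    using prime_card_gt_1[where 'a = 'a]
    by unfold_locales (auto simp: power_mult_distrib power_0_left)
qed

interpretation frob_poly_hom: map_poly_inj_idom_hom "\<lambda>x :: 'a :: prime_card mod_ring alg_closure. x ^ CARD('a)" ..

section \<open>Finite subfields, traces and additive characters\<close>

lemma mod_ring_power_card: "(x :: 'a :: prime_card mod_ring) ^ (CARD('a) ^ k) = x"
  by (rule finite_field_power_card_power_eq_same) simp

text \<open>Subsets of one closure rather than types, so that the degree \<open>k\<close> can vary.
  For \<open>k = 0\<close> the condition is void and the set is the whole closure, hence the
  hypotheses \<open>k \<ge> 1\<close> below.\<close>

definition GFq :: "nat \<Rightarrow> 'a :: prime_card mod_ring alg_closure set" where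
  "GFq k = {x. x ^ (CARD('a) ^ k) = x}"

lemma GFq_poly:
  fixes k :: nat
  assumes "k \<ge> 1"
  defines "f \<equiv> monom 1 (CARD('a :: prime_card) ^ k) - monom (1 :: 'a mod_ring alg_closure) 1"
  shows "f \<noteq> 0" "degree f = CARD('a) ^ k" "GFq k = {x. poly f x = 0}"
proof -
  have q: "1 < CARD('a) ^ k"
    using prime_card_gt_1[where 'a = 'a] assms(1) by (metis one_less_power less_le_trans zero_less_one)
  have "coeff f (CARD('a) ^ k) = 1" using q by (simp add: f_def)
  then show "f \<noteq> 0" by auto
  show "degree f = CARD('a) ^ k"
  proof -
    have "degree (monom (1 :: 'a mod_ring alg_closure) 1) < degree (monom (1 :: 'a mod_ring alg_closure) (CARD('a) ^ k))"
      using q by (simp add: degree_monom_eq)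
    then show ?thesis unfolding f_def diff_conv_add_uminus by (subst degree_add_eq_left) (auto simp: degree_monom_eq)
  qed
  show "GFq k = {x. poly f x = 0}" by (auto simp: GFq_def f_def poly_monom)
qed

lemma finite_GFq: "k \<ge> 1 \<Longrightarrow> finite (GFq k :: 'a :: prime_card mod_ring alg_closure set)"
  using GFq_poly[of k, where 'a = 'a] poly_roots_finite by metis

text \<open>The polynomial \<open>X^q - X\<close> has derivative -1, so all its zeros are
  simple.\<close>

lemma card_GFq:
  assumes "k \<ge> 1"
  shows "card (GFq k :: 'a :: prime_card mod_ring alg_closure set) = CARD('a) ^ k"
proof -
  define f where "f = monom 1 (CARD('a) ^ k) - monom (1 :: 'a mod_ring alg_closure) 1"
  note f = GFq_poly[OF assms, where 'a = 'a, folded f_def]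
  have "(of_nat (CARD('a) ^ k) :: 'a mod_ring alg_closure) = 0"
    using assms by (auto simp: of_nat_eq_0_iff_char_dvd CHAR_alg_closure)
  then have "pderiv f = -1"
    by (simp add: f_def pderiv_diff pderiv_monom)
  then have "order x f = 1" if "poly f x = 0" for x
    using that f(1) by (intro order_eq_1_if_simple_root) auto
  then have "(\<Sum>x | poly f x = 0. order x f) = card {x. poly f x = 0}" by simp
  then show ?thesis using f sum_order_eq_degree[OF f(1)] by simp
qed

lemma GFq_1: "GFq 1 = range (to_ac :: 'a :: prime_card mod_ring \<Rightarrow> _)"
proof -
  have "range (to_ac :: 'a mod_ring \<Rightarrow> _) \<subseteq> GFq 1"
    using mod_ring_power_card[of _ 1] by (auto simp: GFq_def simp flip: to_ac_power)
  moreover have "card (range (to_ac :: 'a mod_ring \<Rightarrow> _)) = CARD('a)"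
    by (subst card_image) (auto simp: inj_def)
  ultimately show ?thesis
    using card_GFq[of 1, where 'a = 'a] finite_GFq[of 1, where 'a = 'a]
    by (metis card_subset_eq le_refl power_one_right)
qed

definition of_ac :: "'b :: field alg_closure \<Rightarrow> 'b" where "of_ac = inv_into UNIV to_ac"

lemma of_ac_to_ac [simp]: "of_ac (to_ac x) = x"
  by (simp add: of_ac_def inj_def)

lemma of_ac_0 [simp]: "of_ac 0 = 0"
  using of_ac_to_ac[of 0] by (simp del: of_ac_to_ac)

lemma to_ac_of_ac: "x ^ CARD('a) = x \<Longrightarrow> to_ac (of_ac x) = (x :: 'a :: prime_card mod_ring alg_closure)"
  using GFq_1[where 'a = 'a] by (auto simp: GFq_def set_eq_iff image_iff)

text \<open>The trace to the prime field, with values kept in the closure; on \<open>GFq k\<close>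
  they are fixed by Frobenius, so \<open>of_ac\<close> recovers them.\<close>

definition ac_trace :: "nat \<Rightarrow> 'a :: prime_card mod_ring alg_closure \<Rightarrow> 'a mod_ring alg_closure" where
  "ac_trace k x = (\<Sum>i<k. x ^ (CARD('a) ^ i))"

lemma ac_trace_frob:
  assumes "x \<in> GFq k"
  shows "ac_trace k x ^ CARD('a) = ac_trace k (x :: 'a :: prime_card mod_ring alg_closure)"
proof -
  have "ac_trace k x ^ CARD('a) = (\<Sum>i<k. x ^ (CARD('a) ^ Suc i))"
    using alg_closure_frob_sum[of "\<lambda>i. x ^ (CARD('a) ^ i)" "{..<k}" 1]
    by (simp add: ac_trace_def power_mult[symmetric] mult.commute)
  also have "\<dots> = (\<Sum>i<Suc k. x ^ (CARD('a) ^ i)) - x"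
    by (subst sum.lessThan_Suc_shift) simp
  also have "\<dots> = ac_trace k x" using assms by (simp add: ac_trace_def GFq_def)
  finally show ?thesis .
qed

definition ff_char :: "'a :: prime_card mod_ring \<Rightarrow> complex" where
  "ff_char x = em (int CARD('a)) (to_int_mod_ring x)"

lemma ff_char_add: "ff_char (x + y) = ff_char x * ff_char y"
  unfolding ff_char_def em_add[symmetric]
  by (rule em_cong) (auto simp: to_int_mod_ring_add Cong.cong_def)

lemma ff_char_0 [simp]: "ff_char 0 = 1" by (simp add: ff_char_def)

lemma norm_ff_char [simp]: "norm (ff_char x) = 1" by (simp add: ff_char_def)

lemma ff_char_sum: "(\<Sum>x\<in>UNIV. ff_char (c * x)) = (if c = 0 then of_nat CARD('a) else 0)"
  for c :: "'a :: prime_card mod_ring"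
proof (cases "c = 0")
  case False
  have "(\<Sum>x\<in>UNIV. ff_char (c * x)) = (\<Sum>x\<in>(UNIV :: 'a mod_ring set). ff_char x)"
    by (rule sum.reindex_bij_witness[where i = "\<lambda>x. x / c" and j = "\<lambda>x. c * x"]) (use False in auto)
  also have "\<dots> = (\<Sum>b\<in>{0..<int CARD('a)}. em (int CARD('a)) (b * 1))"
    by (rule sum.reindex_bij_witness[of _ of_int_mod_ring to_int_mod_ring])
       (auto simp: ff_char_def range_to_int_mod_ring[symmetric])
  also have "\<dots> = 0"
    using prime_card_gt_1[where 'a = 'a] by (subst em_orthogonality) auto
  finally show ?thesis using False by simp
qed auto

section \<open>Frobenius orbits and their polynomials\<close>

lemma coeff_mult_1: "coeff (f * g) 1 = coeff f 0 * coeff g 1 + coeff f 1 * coeff g 0"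
  by (simp add: coeff_mult)

lemma log_deriv_mult_aux: "f0 \<noteq> 0 \<Longrightarrow> g0 \<noteq> 0 \<Longrightarrow> (f0 * g1 + f1 * g0) / (f0 * g0) = f1 / f0 + g1 / g0"
  for f0 f1 g0 g1 :: "'b :: field"
  by (simp add: add_divide_distrib)

text \<open>For \<open>x\<close> in \<open>GFq j\<close> this is the characteristic polynomial of
  \<open>x\<close> over the prime field: a power of the minimal polynomial, with repeated factors if
  \<open>x\<close> lies in a smaller field.\<close>

definition conj_poly :: "nat \<Rightarrow> 'a :: prime_card mod_ring alg_closure \<Rightarrow> 'a mod_ring alg_closure poly" where
  "conj_poly j x = (\<Prod>i<j. [:- (x ^ (CARD('a) ^ i)), 1:])"

lemma conj_poly_nonzero [simp]: "conj_poly j x \<noteq> 0"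
  by (simp add: conj_poly_def)

lemma degree_conj_poly [simp]: "degree (conj_poly j x) = j"
  unfolding conj_poly_def by (subst degree_prod_eq_sum_degree) auto

lemma lead_coeff_conj_poly [simp]: "lead_coeff (conj_poly j x) = 1"
  unfolding conj_poly_def lead_coeff_prod by simp

lemma poly_conj_poly_self: "j \<ge> 1 \<Longrightarrow> poly (conj_poly j x) x = 0"
  unfolding conj_poly_def poly_prod by (intro prod_zero bexI[of _ 0]) auto

lemma conj_poly_add:
  assumes "x \<in> GFq e"
  shows "conj_poly (e + j) x = conj_poly e x * conj_poly j (x :: 'a :: prime_card mod_ring alg_closure)"
proof -
  have x: "x ^ (CARD('a) ^ (e + i)) = x ^ (CARD('a) ^ i)" for i
    using assms by (simp add: GFq_def power_add power_mult)
  have "conj_poly (e + j) x = conj_poly e x * (\<Prod>i<j. [:- (x ^ (CARD('a) ^ (e + i))), 1:])"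
    unfolding conj_poly_def by (induction j) (auto simp: mult_ac simp del: mult_pCons_left mult_pCons_right)
  then show ?thesis by (simp only: x) (simp add: conj_poly_def)
qed

text \<open>Frobenius on the coefficients moves each linear factor to the next and the last to the
  first, so it fixes the product.\<close>

lemma conj_poly_rational:
  assumes "x \<in> GFq j"
  obtains g :: "'a :: prime_card mod_ring poly" where "to_acp g = conj_poly j x"
proof -
  let ?F = "map_poly (\<lambda>c :: 'a mod_ring alg_closure. c ^ CARD('a))"
  define L where "L = (\<lambda>i. [:- (x ^ (CARD('a) ^ i)), 1:])"
  have FL: "?F (L i) = L (Suc i)" for i
  proof -
    have "(- (x ^ (CARD('a) ^ i))) ^ CARD('a) = - (x ^ (CARD('a) ^ Suc i))"
      using alg_closure_frob_minus[of "x ^ (CARD('a) ^ i)" 1] by (simp add: power_mult[symmetric] mult.commute)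
    then show ?thesis by (simp add: L_def)
  qed
  have "?F (\<Prod>i<k. L i) = (\<Prod>i<k. L (Suc i))" for k
    by (induction k) (simp_all add: frob_poly_hom.hom_mult FL)
  then have "?F (conj_poly j x) = (\<Prod>i<j. L (Suc i))"
    unfolding conj_poly_def L_def[symmetric] .
  moreover have "L 0 * (\<Prod>i<j. L (Suc i)) = L 0 * (\<Prod>i<j. L i)"
  proof -
    have "L j = L 0" using assms by (simp add: L_def GFq_def)
    then show ?thesis
      by (metis mult.commute prod.lessThan_Suc prod.lessThan_Suc_shift)
  qed
  moreover have "L 0 \<noteq> 0" by (simp add: L_def)
  moreover have "conj_poly j x = (\<Prod>i<j. L i)" by (simp add: conj_poly_def L_def)
  ultimately have fix_: "?F (conj_poly j x) = conj_poly j x"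
    by (metis mult_left_cancel)
  define g where "g = map_poly of_ac (conj_poly j x)"
  have "to_acp g = conj_poly j x"
  proof (rule poly_eqI)
    fix n
    have "coeff (conj_poly j x) n ^ CARD('a) = coeff (conj_poly j x) n"
      using fix_ by (metis frob_hom.coeff_map_poly_hom)
    then show "coeff (to_acp g) n = coeff (conj_poly j x) n"
      by (simp add: g_def coeff_map_poly to_ac_of_ac)
  qed
  then show ?thesis by (rule that)
qed

lemma poly_to_acp_frob:
  "poly (to_acp f) (x ^ CARD('a)) = poly (to_acp f) x ^ CARD('a)"
  for f :: "'a :: prime_card mod_ring poly"
proof -
  have "(\<lambda>c :: 'a mod_ring. to_ac c ^ CARD('a)) = to_ac"
    using mod_ring_power_card[of _ 1, where 'a = 'a] by (simp flip: to_ac_power)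
  then have "map_poly (\<lambda>c. c ^ CARD('a)) (to_acp f) = to_acp f"
    by (simp add: poly_eq_iff coeff_map_poly fun_eq_iff)
  then show ?thesis
    by (metis frob_hom.poly_map_poly)
qed

text \<open>The powers of the Frobenius orbit of \<open>x\<close> dividing \<open>f\<close> are counted by the multiplicity of
  \<open>x\<close> as a zero of \<open>f\<close>.\<close>

lemma card_conj_poly_dvd:
  fixes f :: "'a :: prime_card mod_ring poly"
  assumes "f \<noteq> 0"
  shows "finite {j. j \<ge> 1 \<and> x \<in> GFq j \<and> conj_poly j x dvd to_acp f} \<and>
    card {j. j \<ge> 1 \<and> x \<in> GFq j \<and> conj_poly j x dvd to_acp f} = order x (to_acp f)"
  using assms
proof (induction "degree f" arbitrary: f rule: less_induct)
  case (less f)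
  let ?p = "CARD('a)"
  let ?J = "\<lambda>f. {j. j \<ge> 1 \<and> x \<in> GFq j \<and> conj_poly j x dvd to_acp f}"
  have F0: "to_acp f \<noteq> 0" using less.prems by simp
  show ?case
  proof (cases "poly (to_acp f) x = 0")
    case False
    have J: "?J f = {}"
    proof (rule ccontr)
      assume "?J f \<noteq> {}"
      then obtain j where j: "j \<ge> 1" "conj_poly j x dvd to_acp f" by blast
      then show False using False poly_conj_poly_self[OF j(1), of x] by (metis dvdE mult_zero_left poly_mult)
    qed
    have "order x (to_acp f) = 0" using False by (simp add: order_root)
    then show ?thesis unfolding J by simp
  next
    case True
    have root: "poly (to_acp f) (x ^ (?p ^ i)) = 0" for i
    proof (induction i)
      case (Suc i)
      have "x ^ (?p ^ Suc i) = (x ^ (?p ^ i)) ^ ?p" by (simp add: power_mult[symmetric] mult.commute)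
      then show ?case using Suc prime_card_gt_1[where 'a = 'a] by (simp add: poly_to_acp_frob)
    qed (use True in auto)
    have shift: "x ^ (?p ^ i) = x ^ (?p ^ i') \<Longrightarrow> i \<le> i' \<Longrightarrow> x ^ (?p ^ (i' - i)) = x" for i i'
    proof -
      assume a: "x ^ (?p ^ i) = x ^ (?p ^ i')" "i \<le> i'"
      have "(x ^ (?p ^ (i' - i))) ^ (?p ^ i) = x ^ (?p ^ i')"
        using a(2) by (simp add: power_mult[symmetric] power_add[symmetric])
      then show ?thesis using a(1) alg_closure_frob_inj[of "x ^ (?p ^ (i' - i))" i x] by simp
    qed
    \<comment> \<open>The orbit of \<open>x\<close> consists of zeros of \<open>f\<close> and is
      finite; as Frobenius is injective, the orbit returns to \<open>x\<close>, for the first time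
      after \<open>e\<close> steps.\<close>
    have "\<not> inj (\<lambda>i. x ^ (?p ^ i))"
    proof
      assume "inj (\<lambda>i. x ^ (?p ^ i))"
      then have "infinite (range (\<lambda>i. x ^ (?p ^ i)))" using finite_imageD by blast
      moreover have "range (\<lambda>i. x ^ (?p ^ i)) \<subseteq> {y. poly (to_acp f) y = 0}" using root by auto
      ultimately show False using poly_roots_finite[OF F0] finite_subset by blast
    qed
    then obtain i i' where "i < i'" "x ^ (?p ^ i) = x ^ (?p ^ i')"
      unfolding inj_def by (metis linorder_neqE_nat)
    then have ex: "\<exists>e. e \<ge> 1 \<and> x ^ (?p ^ e) = x" using shift by (intro exI[of _ "i' - i"]) auto
    define e where "e = (LEAST e. e \<ge> 1 \<and> x ^ (?p ^ e) = x)"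
    have e: "e \<ge> 1" "x ^ (?p ^ e) = x" using LeastI_ex[OF ex] by (auto simp: e_def)
    have e_min: "e \<le> j" if "j \<ge> 1" "x ^ (?p ^ j) = x" for j
      unfolding e_def using that by (intro Least_le) auto
    have xe: "x \<in> GFq e" using e by (simp add: GFq_def)
    have inj: "inj_on (\<lambda>i. x ^ (?p ^ i)) {..<e}"
    proof (rule linorder_inj_onI)
      fix i i' assume i: "i < i'" "i \<in> {..<e}" "i' \<in> {..<e}"
      show "x ^ (?p ^ i) \<noteq> x ^ (?p ^ i')"
      proof
        assume "x ^ (?p ^ i) = x ^ (?p ^ i')"
        then have "x ^ (?p ^ (i' - i)) = x" using shift i by simp
        moreover have "1 \<le> i' - i" using i by simp
        ultimately have "e \<le> i' - i" by (intro e_min)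
        then show False using i by simp
      qed
    qed auto
    have "conj_poly e x = (\<Prod>a\<in>(\<lambda>i. x ^ (?p ^ i)) ` {..<e}. [:- a, 1:])"
      unfolding conj_poly_def by (subst prod.reindex[OF inj]) simp
    also have "\<dots> dvd to_acp f" by (rule prod_linear_dvd) (use root in auto)
    finally have dvd: "conj_poly e x dvd to_acp f" .
    obtain g where g: "to_acp g = conj_poly e x" using conj_poly_rational[OF xe] .
    \<comment> \<open>\<open>conj_poly e x\<close> is the minimal polynomial of \<open>x\<close>,
      with \<open>x\<close> as a simple zero. Splitting it off lowers the multiplicity by one and
      shifts the set of admissible \<open>j\<close> by \<open>e\<close>.\<close>
    have "g dvd f" using dvd unfolding g[symmetric] by (rule to_ac_hom.dvd_map_poly_hom_imp_dvd)
    then obtain h where h: "f = g * h" by blast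
    have h0: "h \<noteq> 0" "g \<noteq> 0" using less.prems h by auto
    have "degree g = e" using arg_cong[OF g, of degree] by simp
    then have "degree h < degree f" using e h h0 by (simp add: degree_mult_eq)
    note IH = less.hyps[OF this h0(1)]
    have Ff: "to_acp f = conj_poly e x * to_acp h" by (simp add: h g to_ac_poly_hom.hom_mult)
    have "order x (conj_poly e x) = 1"
    proof -
      obtain e' where e': "e = Suc e'" using e(1) by (cases e) auto
      have "conj_poly e x = [:- x, 1:] * (\<Prod>i<e'. [:- (x ^ (?p ^ Suc i)), 1:])"
        unfolding conj_poly_def e' by (subst prod.lessThan_Suc_shift) simp
      moreover have "poly (\<Prod>i<e'. [:- (x ^ (?p ^ Suc i)), 1:]) x \<noteq> 0"
      proof
        assume "poly (\<Prod>i<e'. [:- (x ^ (?p ^ Suc i)), 1:]) x = 0"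
        then obtain i where "i < e'" "x = x ^ (?p ^ Suc i)" by (auto simp: poly_prod)
        then show False using e_min[of "Suc i"] e' by simp
      qed
      moreover have "order x [:- x, 1:] = 1" by (rule order_eq_1_if_simple_root) (auto simp: pderiv_pCons)
      ultimately show ?thesis
        by (metis add.right_neutral conj_poly_nonzero order_0I order_mult)
    qed
    then have ord: "order x (to_acp f) = Suc (order x (to_acp h))"
      using F0 unfolding Ff by (subst order_mult) auto
    have "?J f = insert e ((\<lambda>j. e + j) ` ?J h)"
    proof (intro equalityI subsetI)
      fix j assume j: "j \<in> ?J f"
      then have "e \<le> j" using e_min by (simp add: GFq_def)
      then obtain i where i: "j = e + i" using le_Suc_ex by blast
      show "j \<in> insert e ((\<lambda>j. e + j) ` ?J h)"
      proof (cases "i = 0")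
        case False
        have "x = x ^ (?p ^ (e + i))" using j i by (simp add: GFq_def)
        also have "\<dots> = x ^ (?p ^ i)" using e by (simp add: power_add power_mult)
        finally have "x \<in> GFq i" by (simp add: GFq_def)
        moreover have "conj_poly i x dvd to_acp h"
          using j unfolding i Ff by (simp add: conj_poly_add[OF xe])
        ultimately show ?thesis using False i by auto
      qed (use i in auto)
    next
      fix j assume "j \<in> insert e ((\<lambda>j. e + j) ` ?J h)"
      then consider "j = e" | i where "j = e + i" "i \<in> ?J h" by auto
      then show "j \<in> ?J f"
      proof cases
        case 2
        have "x ^ (?p ^ (e + i)) = x" using 2 e by (simp add: GFq_def power_add power_mult)
        then show ?thesis using 2 e unfolding Ff by (auto simp: GFq_def conj_poly_add[OF xe])
      qed (use e xe dvd in auto)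
    qed
    moreover have "e \<notin> (\<lambda>j. e + j) ` ?J h" by auto
    ultimately show ?thesis using IH ord by (auto simp: card_image)
  qed
qed

section \<open>The L-function of a Kloosterman sum\<close>

text \<open>The condition on the constant term removes 0 from the zeros, the point where
  \<open>b / x\<close> has its pole.\<close>

definition monic_polys :: "nat \<Rightarrow> 'b :: field poly set" where
  "monic_polys d = {f. degree f = d \<and> lead_coeff f = 1 \<and> coeff f 0 \<noteq> 0}"

lemma finite_monic_polys: "finite (monic_polys d :: 'a :: prime_card mod_ring poly set)"
proof -
  have "inj_on coeffs (monic_polys d)" by (simp add: inj_on_def coeffs_eq_iff)
  moreover have "coeffs ` monic_polys d \<subseteq> {xs. set xs \<subseteq> (UNIV :: 'a mod_ring set) \<and> length xs \<le> Suc d}"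
    by (auto simp: monic_polys_def length_coeffs_degree coeffs_def)
  moreover have "finite {xs. set xs \<subseteq> (UNIV :: 'a mod_ring set) \<and> length xs \<le> Suc d}"
    by (rule finite_lists_length_le) auto
  ultimately show ?thesis using finite_subset finite_imageD by blast
qed

text \<open>For monic \<open>f = \<Prod>(X - x\<^sub>i)\<close> the two coefficient quotients are \<open>- \<Sum> x\<^sub>i\<close> and \<open>- \<Sum> 1 / x\<^sub>i\<close>.\<close>

definition kl_weight :: "'a :: prime_card mod_ring \<Rightarrow> 'a mod_ring \<Rightarrow> 'a mod_ring poly \<Rightarrow> complex" where
  "kl_weight a b f = ff_char (- (a * coeff (reflect_poly f) 1 + b * (coeff f 1 / coeff f 0)))"

text \<open>Both quotients are logarithmic derivatives, one at infinity and one at 0, hence additive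
  under products.\<close>

lemma kl_weight_mult:
  assumes "lead_coeff f = 1" "lead_coeff g = 1" "coeff f 0 \<noteq> 0" "coeff g 0 \<noteq> 0"
  shows "kl_weight a b (f * g) = kl_weight a b f * kl_weight a b g"
proof -
  have "coeff (f * g) 1 / coeff (f * g) 0 = coeff f 1 / coeff f 0 + coeff g 1 / coeff g 0"
    unfolding coeff_mult_1 coeff_mult_0 using assms by (intro log_deriv_mult_aux)
  moreover have "coeff (reflect_poly (f * g)) 1 = coeff (reflect_poly f) 1 + coeff (reflect_poly g) 1"
    using assms by (simp add: reflect_poly_mult coeff_mult_1 del: One_nat_def)
  ultimately show ?thesis
    unfolding kl_weight_def ff_char_add[symmetric] by (intro arg_cong[of _ _ ff_char]) (simp add: algebra_simps del: One_nat_def)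
qed

text \<open>The coefficient of \<open>T^d\<close> in the L-function.\<close>

definition kl_lsum :: "'a :: prime_card mod_ring \<Rightarrow> 'a mod_ring \<Rightarrow> nat \<Rightarrow> complex" where
  "kl_lsum a b d = (\<Sum>f\<in>monic_polys d. kl_weight a b f)"

text \<open>The Kloosterman sum over the extension of degree \<open>k\<close>; these are the power
  sums that belong to the L-function.\<close>

definition kl_power :: "'a :: prime_card mod_ring \<Rightarrow> 'a mod_ring \<Rightarrow> nat \<Rightarrow> complex" where
  "kl_power a b k = (\<Sum>x\<in>GFq k - {0}. ff_char (of_ac (ac_trace k (to_ac a * x + to_ac b / x))))"

lemma kl_arg_in_GFq:
  assumes "x \<in> GFq k"
  shows "to_ac a * x + to_ac b / x \<in> (GFq k :: 'a :: prime_card mod_ring alg_closure set)"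
  using assms mod_ring_power_card[of a k] mod_ring_power_card[of b k]
  by (auto simp: GFq_def alg_closure_frob_add power_mult_distrib power_divide simp flip: to_ac_power)

text \<open>For \<open>conj_poly j x\<close> the two quotients are minus the traces of
  \<open>1 / x\<close> and \<open>x\<close>, and the sign in \<open>kl_weight\<close>
  cancels.\<close>

lemma kl_weight_conj_poly:
  fixes g :: "'a :: prime_card mod_ring poly"
  assumes x: "x \<in> GFq j" "x \<noteq> 0" and g: "to_acp g = conj_poly j x"
  shows "kl_weight a b g = ff_char (of_ac (ac_trace j (to_ac a * x + to_ac b / x)))"
proof -
  have c: "coeff (conj_poly j x) 0 \<noteq> 0 \<and>
     coeff (conj_poly j x) 1 / coeff (conj_poly j x) 0 = - (\<Sum>i<j. 1 / x ^ (CARD('a) ^ i)) \<and>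
     coeff (reflect_poly (conj_poly j x)) 1 = - (\<Sum>i<j. x ^ (CARD('a) ^ i))"
  proof (induction j)
    case (Suc j)
    define l where "l = [:- (x ^ (CARD('a) ^ j)), 1:]"
    have cp: "conj_poly (Suc j) x = conj_poly j x * l" by (simp add: conj_poly_def l_def)
    have l: "coeff l 0 = - (x ^ (CARD('a) ^ j))" "coeff l 1 = 1" "coeff (reflect_poly l) 1 = - (x ^ (CARD('a) ^ j))"
       "lead_coeff l = 1"
      by (auto simp: l_def coeff_reflect_poly)
    have l0: "coeff l 0 \<noteq> 0" using x l by simp
    have "coeff (conj_poly j x * l) 1 / coeff (conj_poly j x * l) 0 = coeff (conj_poly j x) 1 / coeff (conj_poly j x) 0 + coeff l 1 / coeff l 0"
      unfolding coeff_mult_1 coeff_mult_0 using Suc l0 by (intro log_deriv_mult_aux) auto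
    also have "\<dots> = - (\<Sum>i<Suc j. 1 / x ^ (CARD('a) ^ i))"
      using Suc l by (simp del: One_nat_def)
    finally have 1: "coeff (conj_poly j x * l) 1 / coeff (conj_poly j x * l) 0 = - (\<Sum>i<Suc j. 1 / x ^ (CARD('a) ^ i))" .
    have "coeff (reflect_poly (conj_poly j x * l)) 1 = coeff (reflect_poly (conj_poly j x)) 1 + coeff (reflect_poly l) 1"
      using lead_coeff_conj_poly[of j x] l(4) by (simp add: reflect_poly_mult coeff_mult_1 del: One_nat_def lead_coeff_conj_poly)
    also have "\<dots> = - (\<Sum>i<Suc j. x ^ (CARD('a) ^ i))" using Suc l by (simp del: One_nat_def)
    finally show ?case using 1 Suc l0 by (simp add: cp coeff_mult_0 del: One_nat_def)
  qed (auto simp: conj_poly_def)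
  have cg: "to_ac (coeff g n) = coeff (conj_poly j x) n" "to_ac (coeff (reflect_poly g) n) = coeff (reflect_poly (conj_poly j x)) n" for n
    by (simp_all flip: g coeff_reflect_to_acp)
  have "to_ac (- (a * coeff (reflect_poly g) 1 + b * (coeff g 1 / coeff g 0)))
      = to_ac a * (\<Sum>i<j. x ^ (CARD('a) ^ i)) + to_ac b * (\<Sum>i<j. 1 / x ^ (CARD('a) ^ i))"
    unfolding to_ac_minus to_ac_add to_ac_mult to_ac_divide cg conjunct1[OF conjunct2[OF c]] conjunct2[OF conjunct2[OF c]]
    by (simp del: One_nat_def)
  also have "\<dots> = ac_trace j (to_ac a * x + to_ac b / x)"
    using mod_ring_power_card[of a] mod_ring_power_card[of b]
    by (simp add: ac_trace_def sum_distrib_left sum.distrib[symmetric] alg_closure_frob_add power_mult_distrib power_divide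
        flip: to_ac_power)
  finally have "- (a * coeff (reflect_poly g) 1 + b * (coeff g 1 / coeff g 0)) = of_ac (ac_trace j (to_ac a * x + to_ac b / x))"
    by (metis of_ac_to_ac)
  then show ?thesis by (simp add: kl_weight_def)
qed

text \<open>Coefficientwise form of \<open>T L' = L * S\<close>, where \<open>S\<close> generates
  the sums \<open>kl_power\<close>. The factor \<open>d\<close> is the number of pairs of a zero
  \<open>x\<close> of \<open>f\<close> and a \<open>j\<close> with \<open>conj_poly j x\<close>
  dividing \<open>f\<close>. After interchanging the sums, the \<open>f\<close> divisible by a given
  \<open>conj_poly j x\<close> are its products with all polynomials of degree
  \<open>d - j\<close>.\<close>

theorem kl_newton_identity:
  fixes a b :: "'a :: prime_card mod_ring"
  shows "of_nat d * kl_lsum a b d = (\<Sum>j\<in>{1..d}. kl_power a b j * kl_lsum a b (d - j))"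
proof -
  define J where "J = (\<lambda>(f :: 'a mod_ring poly) x. {j. j \<ge> 1 \<and> x \<in> GFq j \<and> conj_poly j x dvd to_acp f})"
  define R where "R = (\<lambda>f :: 'a mod_ring poly. {x. poly (to_acp f) x = 0})"
  define MP where "MP = (monic_polys d :: 'a mod_ring poly set)"
  let ?w = "kl_weight a b"
  have fMP: "finite MP" unfolding MP_def by (rule finite_monic_polys)
  have f0: "f \<noteq> 0" if "f \<in> MP" for f using that by (auto simp: MP_def monic_polys_def)
  have fR: "finite (R f)" if "f \<in> MP" for f
    unfolding R_def using f0[OF that] by (intro poly_roots_finite) auto
  have fJ: "finite (J f x)" "card (J f x) = order x (to_acp f)" if "f \<in> MP" for f x
    unfolding J_def using card_conj_poly_dvd[OF f0[OF that], of x] by auto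
  have "of_nat d * kl_lsum a b d = (\<Sum>f\<in>MP. of_nat d * ?w f)"
    by (simp add: kl_lsum_def MP_def sum_distrib_left)
  also have "\<dots> = (\<Sum>f\<in>MP. \<Sum>x\<in>R f. \<Sum>j\<in>J f x. ?w f)"
  proof (rule sum.cong[OF refl])
    fix f assume f: "f \<in> MP"
    have "(\<Sum>x\<in>R f. \<Sum>j\<in>J f x. ?w f) = of_nat (\<Sum>x\<in>R f. order x (to_acp f)) * ?w f"
      using fJ(2)[OF f] by (simp add: sum_distrib_right)
    also have "(\<Sum>x\<in>R f. order x (to_acp f)) = d"
      unfolding R_def using f f0[OF f] by (subst sum_order_eq_degree) (auto simp: MP_def monic_polys_def)
    finally show "of_nat d * ?w f = (\<Sum>x\<in>R f. \<Sum>j\<in>J f x. ?w f)" by simp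
  qed
  also have "\<dots> = (\<Sum>f\<in>MP. \<Sum>(x,j)\<in>Sigma (R f) (J f). ?w f)"
    by (intro sum.cong refl sum.Sigma) (auto simp: fR fJ)
  also have "\<dots> = (\<Sum>(f,x,j)\<in>(SIGMA f:MP. Sigma (R f) (J f)). ?w f)"
    by (subst sum.Sigma) (auto simp: fMP fR fJ split_beta)
  also have "\<dots> = (\<Sum>(j,x,f)\<in>(SIGMA j:{1..d}. SIGMA x:GFq j - {0}. {f\<in>MP. conj_poly j x dvd to_acp f}). ?w f)"
  proof (rule sum.reindex_bij_witness[of _ "\<lambda>(j,x,f). (f,x,j)" "\<lambda>(f,x,j). (j,x,f)"])
    fix t assume "t \<in> (SIGMA f:MP. Sigma (R f) (J f))"
    then obtain f x j where t: "t = (f,x,j)" "f \<in> MP" "x \<in> R f" "j \<in> J f x" by auto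
    have "x \<noteq> 0"
    proof
      assume "x = 0"
      then have "to_ac (coeff f 0) = 0" using t(3) by (simp add: R_def poly_0_coeff_0)
      then show False using t(2) by (simp add: MP_def monic_polys_def)
    qed
    moreover have "j \<le> d"
      using dvd_imp_degree_le[of "conj_poly j x" "to_acp f"] t f0[OF t(2)] by (simp add: J_def MP_def monic_polys_def)
    ultimately show "(\<lambda>(f,x,j). (j,x,f)) t \<in> (SIGMA j:{1..d}. SIGMA x:GFq j - {0}. {f\<in>MP. conj_poly j x dvd to_acp f})"
      using t by (auto simp: J_def)
  next
    fix t assume "t \<in> (SIGMA j:{1..d}. SIGMA x:GFq j - {0}. {f\<in>MP. conj_poly j x dvd to_acp f})"
    then obtain f x j where t: "t = (j,x,f)" "f \<in> MP" "x \<in> GFq j" "j \<in> {1..d}" "conj_poly j x dvd to_acp f" by auto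
    have "poly (to_acp f) x = 0" using t(4,5) poly_conj_poly_self[of j x] by (auto elim!: dvdE)
    then show "(\<lambda>(j,x,f). (f,x,j)) t \<in> (SIGMA f:MP. Sigma (R f) (J f))"
      using t by (auto simp: J_def R_def)
  qed auto
  also have "\<dots> = (\<Sum>j\<in>{1..d}. \<Sum>(x,f)\<in>(SIGMA x:GFq j - {0}. {f\<in>MP. conj_poly j x dvd to_acp f}). ?w f)"
    by (subst sum.Sigma) (auto simp: fMP finite_GFq split_beta)
  also have "\<dots> = (\<Sum>j\<in>{1..d}. \<Sum>x\<in>GFq j - {0}. \<Sum>f\<in>{f\<in>MP. conj_poly j x dvd to_acp f}. ?w f)"
    by (intro sum.cong refl, subst sum.Sigma) (auto simp: fMP finite_GFq split_beta)
  also have "\<dots> = (\<Sum>j\<in>{1..d}. \<Sum>x\<in>GFq j - {0}. ff_char (of_ac (ac_trace j (to_ac a * x + to_ac b / x))) * kl_lsum a b (d - j))"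
  proof (intro sum.cong refl)
    fix j and x :: "'a mod_ring alg_closure" assume j: "j \<in> {1..d}" and x: "x \<in> GFq j - {0}"
    obtain g where g: "to_acp g = conj_poly j x" using conj_poly_rational[of x j] x by blast
    have dg: "degree g = j" using arg_cong[OF g, of degree] by simp
    have "to_ac (lead_coeff g) = 1"
      using lead_coeff_conj_poly[of j x] dg unfolding g[symmetric] by simp
    then have lg: "lead_coeff g = 1" by (metis of_ac_to_ac to_ac_1)
    have "poly (conj_poly j x) 0 \<noteq> 0" using x by (auto simp: conj_poly_def poly_prod)
    then have cg: "coeff g 0 \<noteq> 0" by (auto simp: poly_0_coeff_0 simp flip: g)
    have g0: "g \<noteq> 0" using cg by auto
    have "{f\<in>MP. conj_poly j x dvd to_acp f} = (\<lambda>h. g * h) ` monic_polys (d - j)"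
    proof (intro equalityI subsetI)
      fix f assume f: "f \<in> {f\<in>MP. conj_poly j x dvd to_acp f}"
      then have "g dvd f" unfolding g[symmetric] using to_ac_hom.dvd_map_poly_hom_imp_dvd by blast
      then obtain h where h: "f = g * h" by blast
      have "h \<noteq> 0" using f f0[of f] h by auto
      moreover have "lead_coeff h = 1"
        using f lg lead_coeff_mult[of g h] by (simp add: h MP_def monic_polys_def)
      ultimately have "h \<in> monic_polys (d - j)"
        using f h g0 dg lg by (auto simp: MP_def monic_polys_def degree_mult_eq lead_coeff_mult coeff_mult_0)
      then show "f \<in> (\<lambda>h. g * h) ` monic_polys (d - j)" using h by blast
    next
      fix f assume "f \<in> (\<lambda>h. g * h) ` monic_polys (d - j)"
      then obtain h where h: "f = g * h" "h \<in> monic_polys (d - j)" by blast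
      then have "h \<noteq> 0" by (auto simp: monic_polys_def)
      then have "degree f = d" using h g0 dg j by (simp add: degree_mult_eq monic_polys_def)
      moreover have "lead_coeff f = 1" using h lg lead_coeff_mult[of g h] by (auto simp: monic_polys_def)
      ultimately show "f \<in> {f\<in>MP. conj_poly j x dvd to_acp f}"
        using h cg by (simp add: MP_def monic_polys_def coeff_mult_0 to_ac_poly_hom.hom_mult g)
    qed
    then have "(\<Sum>f\<in>{f\<in>MP. conj_poly j x dvd to_acp f}. ?w f) = (\<Sum>h\<in>monic_polys (d - j). ?w (g * h))"
      using g0 by (simp add: sum.reindex inj_on_def)
    also have "\<dots> = (\<Sum>h\<in>monic_polys (d - j). ?w g * ?w h)"
      using lg cg by (intro sum.cong refl kl_weight_mult) (auto simp: monic_polys_def)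
    also have "?w g = ff_char (of_ac (ac_trace j (to_ac a * x + to_ac b / x)))"
      using x g by (intro kl_weight_conj_poly) auto
    finally show "(\<Sum>f\<in>{f\<in>MP. conj_poly j x dvd to_acp f}. ?w f)
       = ff_char (of_ac (ac_trace j (to_ac a * x + to_ac b / x))) * kl_lsum a b (d - j)"
      by (simp add: kl_lsum_def sum_distrib_left)
  qed
  also have "\<dots> = (\<Sum>j\<in>{1..d}. kl_power a b j * kl_lsum a b (d - j))"
    by (simp add: kl_power_def sum_distrib_right)
  finally show ?thesis .
qed

lemma kl_lsum_0: "kl_lsum a b 0 = 1"
proof -
  have "monic_polys 0 = {1 :: 'a mod_ring poly}"
    by (auto simp: monic_polys_def one_pCons elim!: degree_eq_zeroE)
  then show ?thesis by (simp add: kl_lsum_def kl_weight_def)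
qed

text \<open>The linear coefficient \<open>c1\<close> enters only through a character, so the sum
  over it is 0 unless the constant term is \<open>- b / a\<close>, when it is
  \<open>p\<close>.\<close>

lemma kl_lsum_2:
  fixes a b :: "'a :: prime_card mod_ring"
  assumes "a \<noteq> 0" "b \<noteq> 0"
  shows "kl_lsum a b 2 = of_nat CARD('a)"
proof -
  have "kl_lsum a b 2 = (\<Sum>(c0,c1)\<in>(UNIV - {0}) \<times> UNIV. ff_char (- (a + b / c0) * c1))"
    unfolding kl_lsum_def
  proof (rule sum.reindex_bij_witness[of _ "\<lambda>(c0,c1). [:c0, c1, 1:]" "\<lambda>f. (coeff f 0, coeff f 1)"])
    fix f :: "'a mod_ring poly" assume f: "f \<in> monic_polys 2"
    have "f = [:coeff f 0, coeff f 1, 1:]"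
    proof (rule poly_eqI)
      fix n
      have "coeff f 2 = 1" using f by (auto simp: monic_polys_def)
      moreover have "coeff f n = 0" if "n > 2" using f that by (intro coeff_eq_0) (auto simp: monic_polys_def)
      moreover consider "n = 0" | "n = 1" | "n = 2" | "n > 2" by linarith
      ultimately show "coeff f n = coeff [:coeff f 0, coeff f 1, 1:] n"
        by cases (auto simp: numeral_2_eq_2 coeff_pCons split: nat.splits)
    qed
    then show "(\<lambda>(c0,c1). [:c0, c1, 1:]) (coeff f 0, coeff f 1) = f" by simp
    show "(coeff f 0, coeff f 1) \<in> (UNIV - {0}) \<times> UNIV" using f by (simp add: monic_polys_def)
    have "coeff (reflect_poly f) 1 = coeff f 1" using f by (simp add: coeff_reflect_poly monic_polys_def)
    then show "(case (coeff f 0, coeff f 1) of (c0, c1) \<Rightarrow> ff_char (- (a + b / c0) * c1)) = kl_weight a b f"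
      by (simp add: kl_weight_def algebra_simps)
  next
    fix t :: "'a mod_ring \<times> 'a mod_ring" assume "t \<in> (UNIV - {0}) \<times> UNIV"
    then show "(case t of (c0,c1) \<Rightarrow> [:c0, c1, 1:]) \<in> monic_polys 2"
      by (auto simp: monic_polys_def)
  qed auto
  also have "\<dots> = (\<Sum>c0\<in>UNIV - {0}. \<Sum>c1\<in>UNIV. ff_char (- (a + b / c0) * c1))"
    by (simp add: sum.cartesian_product)
  also have "\<dots> = (\<Sum>c0\<in>UNIV - {0}. if c0 = - b / a then of_nat CARD('a) else 0)"
  proof (intro sum.cong refl)
    fix c0 assume "c0 \<in> UNIV - {0 :: 'a mod_ring}"
    then have c0: "c0 \<noteq> 0" by simp
    then have "a + b / c0 = (a * c0 + b) / c0" by (simp add: add_divide_distrib)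
    then have "- (a + b / c0) = 0 \<longleftrightarrow> a * c0 + b = 0"
      using c0 by (simp only: neg_equal_0_iff_equal divide_eq_0_iff) simp
    also have "\<dots> \<longleftrightarrow> c0 = - b / a"
      using assms by (metis add_eq_0_iff2 nonzero_eq_divide_eq mult.commute)
    finally have "- (a + b / c0) = 0 \<longleftrightarrow> c0 = - b / a" .
    then show "(\<Sum>c1\<in>UNIV. ff_char (- (a + b / c0) * c1)) = (if c0 = - b / a then of_nat CARD('a) else 0)"
      by (simp only: ff_char_sum)
  qed
  also have "\<dots> = of_nat CARD('a)" using assms by (simp add: sum.delta)
  finally show ?thesis .
qed

lemma ff_char_nontrivial:
  fixes a :: "'a :: prime_card mod_ring" assumes "a \<noteq> 0" shows "\<exists>c. ff_char (a * c) \<noteq> 1"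
proof (rule ccontr)
  assume "\<not> (\<exists>c. ff_char (a * c) \<noteq> 1)"
  then have "(\<Sum>x\<in>UNIV. ff_char (a * x)) = of_nat (CARD('a))" by simp
  then show False using assms by (simp add: ff_char_sum)
qed

text \<open>For \<open>d >= 3\<close> the coefficient at \<open>d - 1\<close> is independent of the
  two lowest ones; shifting it multiplies every weight by the same nontrivial character
  value.\<close>

lemma kl_lsum_ge_3:
  fixes a b :: "'a :: prime_card mod_ring"
  assumes "a \<noteq> 0" "d \<ge> 3"
  shows "kl_lsum a b d = 0"
proof -
  obtain c where c: "ff_char ((- a) * c) \<noteq> 1" using ff_char_nontrivial[of "- a"] assms by auto
  let ?m = "monom c (d - 1)"
  have mem: "f + monom c' (d - 1) \<in> monic_polys d" if f: "f \<in> monic_polys d" for f and c' :: "'a mod_ring"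
  proof -
    have "degree (f + monom c' (d - 1)) = d"
      using f assms(2) degree_monom_le[of c' "d - 1"] by (subst degree_add_eq_left) (auto simp: monic_polys_def)
    then show ?thesis using f assms(2) by (auto simp: monic_polys_def)
  qed
  have deg: "degree (f + monom c' (d - 1)) = d \<and> coeff (f + monom c' (d - 1)) d = coeff f d"
    if "degree f = d" for f and c' :: "'a mod_ring"
    using that assms(2) degree_monom_le[of c' "d - 1"] by (subst degree_add_eq_left) auto
  have "kl_lsum a b d = (\<Sum>f\<in>monic_polys d. kl_weight a b (f + ?m))"
    unfolding kl_lsum_def
    by (rule sum.reindex_bij_witness[of _ "\<lambda>f. f + ?m" "\<lambda>f. f + monom (- c) (d - 1)"])
       (use mem in \<open>auto simp: add_monom add.assoc\<close>)
  also have "\<dots> = (\<Sum>f\<in>monic_polys d. kl_weight a b f * ff_char ((- a) * c))"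
  proof (intro sum.cong refl)
    fix f :: "'a mod_ring poly" assume f: "f \<in> monic_polys d"
    have "coeff (reflect_poly (f + ?m)) 1 = coeff (reflect_poly f) 1 + c"
      using f deg[of f c] assms(2) by (simp add: coeff_reflect_poly monic_polys_def)
    moreover have "coeff (f + ?m) 1 = coeff f 1" "coeff (f + ?m) 0 = coeff f 0" using assms(2) by auto
    ultimately show "kl_weight a b (f + ?m) = kl_weight a b f * ff_char ((- a) * c)"
      unfolding kl_weight_def ff_char_add[symmetric]
      by (intro arg_cong[of _ _ ff_char]) (simp add: algebra_simps del: One_nat_def)
  qed
  also have "\<dots> = kl_lsum a b d * ff_char ((- a) * c)" by (simp add: kl_lsum_def sum_distrib_right)
  finally show ?thesis using c by simp
qed

text \<open>The \<open>L\<close>-function is the quadratic polynomial \<open>1 + S T + p T\<^sup>2\<close>, so a bound of the right order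
  over infinitely many extension fields, with an arbitrarily bad constant, forces both
  reciprocal zeros to have absolute value at most \<open>\<surd>p\<close>.\<close>

theorem kl_power_1_bound:
  fixes a b :: "'a :: prime_card mod_ring"
  assumes ab: "a \<noteq> 0" "b \<noteq> 0"
    and bound: "\<And>k. k \<ge> k0 \<Longrightarrow> norm (kl_power a b (2 * k)) \<le> C * real CARD('a) ^ k"
  shows "norm (kl_power a b 1) \<le> 2 * sqrt (real CARD('a))"
proof -
  define S where "S = kl_power a b"
  define p where "p = real CARD('a)"
  have p: "p > 0" using prime_card_gt_1[where 'a = 'a] by (simp add: p_def)
  have A1: "kl_lsum a b 1 = S 1" using kl_newton_identity[of 1 a b] by (simp add: kl_lsum_0 S_def)
  have A2: "kl_lsum a b 2 = of_real p" using kl_lsum_2[OF ab] by (simp add: p_def)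
  have S2: "S 2 = 2 * of_real p - (S 1)\<^sup>2"
  proof -
    have "{1..2} = {1,2::nat}" by auto
    then have "2 * kl_lsum a b 2 = S 1 * kl_lsum a b 1 + S 2 * kl_lsum a b 0"
      using kl_newton_identity[of 2 a b] by (simp add: S_def)
    then show ?thesis using A1 A2 by (simp add: kl_lsum_0 power2_eq_square algebra_simps)
  qed
  have Srec: "S (k + 3) = - S 1 * S (k + 2) - of_real p * S (k + 1)" for k
  proof -
    have "0 = (\<Sum>j\<in>{1..k+3}. S j * kl_lsum a b (k + 3 - j))"
      using kl_newton_identity[of "k + 3" a b] kl_lsum_ge_3[OF ab(1), of "k + 3" b] by (simp add: S_def)
    also have "\<dots> = (\<Sum>j\<in>{k+1,k+2,k+3}. S j * kl_lsum a b (k + 3 - j))"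
      by (rule sum.mono_neutral_right) (auto simp: kl_lsum_ge_3[OF ab(1)])
    also have "\<dots> = S (k+1) * of_real p + S (k+2) * S 1 + S (k+3)"
      using A1 A2 by (simp add: kl_lsum_0 numeral_2_eq_2 numeral_3_eq_3)
    finally show ?thesis by (simp add: algebra_simps eq_neg_iff_add_eq_0)
  qed
  \<comment> \<open>The L-function is \<open>(1 - \<alpha> T) (1 - \<beta> T)\<close>, so
    \<open>\<alpha>\<close> and \<open>\<beta>\<close> have sum \<open>- S 1\<close> and product
    \<open>p\<close>.\<close>
  define w where "w = csqrt ((S 1)\<^sup>2 - 4 * of_real p)"
  define \<alpha> \<beta> where "\<alpha> = (- S 1 + w) / 2" and "\<beta> = (- S 1 - w) / 2"
  have w2: "w\<^sup>2 = (S 1)\<^sup>2 - 4 * of_real p" by (simp add: w_def)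
  have sum_: "\<alpha> + \<beta> = - S 1" by (simp add: \<alpha>_def \<beta>_def field_simps)
  have prod_: "\<alpha> * \<beta> = of_real p"
  proof -
    have "\<alpha> * \<beta> = ((S 1)\<^sup>2 - w\<^sup>2) / 4" by (simp add: \<alpha>_def \<beta>_def field_simps power2_eq_square)
    then show ?thesis by (simp add: w2)
  qed
  have S_eq: "S (k + 1) = - (\<alpha> ^ (k + 1) + \<beta> ^ (k + 1)) \<and> S (k + 2) = - (\<alpha> ^ (k + 2) + \<beta> ^ (k + 2))" for k
  proof (induction k)
    case 0
    have "\<alpha>\<^sup>2 + \<beta>\<^sup>2 = (\<alpha> + \<beta>)\<^sup>2 - 2 * (\<alpha> * \<beta>)" by (simp add: power2_eq_square algebra_simps)
    also have "\<dots> = - S 2" unfolding sum_ prod_ S2 by simp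
    finally have "S 2 = - (\<alpha>\<^sup>2 + \<beta>\<^sup>2)" by simp
    moreover have "S 1 = - (\<alpha> + \<beta>)" using sum_ by simp
    ultimately show ?case by (simp only: add_0_left power_one_right)
  next
    case (Suc k)
    have "S (k + 3) = (\<alpha> + \<beta>) * S (k + 2) - \<alpha> * \<beta> * S (k + 1)"
      using Srec[of k] sum_ prod_ by simp
    also have "\<dots> = - (\<alpha> ^ (k + 3) + \<beta> ^ (k + 3))"
      unfolding conjunct1[OF Suc] conjunct2[OF Suc] by (simp add: algebra_simps power_add eval_nat_numeral)
    finally show ?case using Suc by (simp add: eval_nat_numeral)
  qed
  define k1 where "k1 = max k0 1"
  \<comment> \<open>If \<open>norm x\<close> exceeded \<open>sqrt p\<close>, then
    \<open>norm y\<close> would be at most \<open>sqrt p\<close>, and \<open>x ^ (2 * k)\<close>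
    alone would outgrow \<open>C * p ^ k\<close>.\<close>
  have key: "norm x \<le> sqrt p" if xy: "x * y = of_real p" and b: "\<And>k. k \<ge> k1 \<Longrightarrow> norm (x ^ (2 * k) + y ^ (2 * k)) \<le> C * p ^ k"
    for x y :: complex
  proof (rule ccontr)
    assume "\<not> norm x \<le> sqrt p"
    then have x: "norm x > sqrt p" by simp
    then have x2: "(norm x)\<^sup>2 > p" using p by (metis real_le_rsqrt linorder_not_le)
    have "norm x * norm y = p" using arg_cong[OF xy, of norm] p by (simp add: norm_mult)
    then have "(norm x)\<^sup>2 * (norm y)\<^sup>2 = p * p" by (metis power_mult_distrib power2_eq_square)
    moreover have "p * (norm y)\<^sup>2 \<le> (norm x)\<^sup>2 * (norm y)\<^sup>2" using x2 by (intro mult_right_mono) auto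
    ultimately have y2: "(norm y)\<^sup>2 \<le> p" using p by (simp add: mult_le_cancel_left_pos)
    define r where "r = (norm x)\<^sup>2 / p"
    have r: "r > 1" using x2 p by (simp add: r_def)
    have le: "r ^ k \<le> C + 1" if "k \<ge> k1" for k
    proof -
      have "norm (x ^ (2 * k)) \<le> norm (x ^ (2 * k) + y ^ (2 * k)) + norm (y ^ (2 * k))"
        by (metis add_diff_cancel norm_triangle_ineq4)
      also have "\<dots> \<le> C * p ^ k + p ^ k"
      proof (intro add_mono b that)
        show "norm (y ^ (2 * k)) \<le> p ^ k"
          using power_mono[OF y2, of k] by (simp add: norm_power power_mult)
      qed
      finally have "((norm x)\<^sup>2) ^ k \<le> (C + 1) * p ^ k" by (simp add: norm_power power_mult distrib_right)
      then show ?thesis using p by (simp add: r_def power_divide field_simps)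
    qed
    obtain n where "r ^ n > C + 1" using real_arch_pow[OF r] by blast
    moreover have "r ^ n \<le> r ^ (n + k1)" using r by (intro power_increasing) auto
    ultimately show False using le[of "n + k1"] by simp
  qed
  have b: "norm (\<alpha> ^ (2 * k) + \<beta> ^ (2 * k)) \<le> C * p ^ k" if "k \<ge> k1" for k
  proof -
    have k: "k \<ge> k0" "k \<ge> 1" using that by (auto simp: k1_def)
    define i where "i = 2 * k - 1"
    have i: "2 * k = i + 1" using k by (simp add: i_def)
    have "\<alpha> ^ (2 * k) + \<beta> ^ (2 * k) = - S (2 * k)" using S_eq[of i] by (simp add: i)
    then show ?thesis using bound[of k] k by (simp add: S_def p_def)
  qed
  have "norm \<alpha> \<le> sqrt p" "norm \<beta> \<le> sqrt p"
    using key[OF prod_ b] key[of \<beta> \<alpha>] b prod_ by (auto simp: mult.commute add.commute)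
  then have "norm (\<alpha> + \<beta>) \<le> 2 * sqrt p" using norm_triangle_ineq[of \<alpha> \<beta>] by linarith
  then show ?thesis by (simp add: sum_ S_def p_def)
qed

section \<open>The Artin--Schreier curve\<close>

definition ac_eval :: "'a :: prime_card mod_ring alg_closure \<Rightarrow> 'a mod_ring poly \<Rightarrow> 'a mod_ring alg_closure" where
  "ac_eval x c = poly (to_acp c) x"

interpretation ac_eval_hom: comm_ring_hom "ac_eval x" for x :: "'a :: prime_card mod_ring alg_closure"
  by unfold_locales (auto simp: ac_eval_def to_ac_poly_hom.hom_mult to_ac_poly_hom.hom_add)

interpretation ac_eval_poly_hom: map_poly_comm_ring_hom "ac_eval x" for x :: "'a :: prime_card mod_ring alg_closure" ..

lemma ac_eval_monom [simp]: "ac_eval x (monom c n) = to_ac c * x ^ n"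
  by (simp add: ac_eval_def poly_monom)

lemma ac_eval_const [simp]: "ac_eval x [:c:] = to_ac c"
  using ac_eval_monom[of x c 0] by (simp add: monom_0)

text \<open>The outer polynomial variable is \<open>y\<close>; the coefficients are polynomials in
  \<open>x\<close>.\<close>

definition ac_eval2 :: "'a :: prime_card mod_ring alg_closure \<Rightarrow> 'a mod_ring alg_closure \<Rightarrow> 'a mod_ring poly poly \<Rightarrow> 'a mod_ring alg_closure" where
  "ac_eval2 x y P = poly (map_poly (ac_eval x) P) y"

lemma ac_eval2_mult: "ac_eval2 x y (P * Q) = ac_eval2 x y P * ac_eval2 x y Q"
  by (simp add: ac_eval2_def ac_eval_poly_hom.hom_mult)

lemma ac_eval2_add: "ac_eval2 x y (P + Q) = ac_eval2 x y P + ac_eval2 x y Q"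
  by (simp add: ac_eval2_def ac_eval_poly_hom.hom_add)

lemma ac_eval2_power: "ac_eval2 x y (P ^ n) = ac_eval2 x y P ^ n"
  by (simp add: ac_eval2_def ac_eval_poly_hom.hom_power)

lemma ac_eval2_sum: "ac_eval2 x y (\<Sum>i\<in>I. P i) = (\<Sum>i\<in>I. ac_eval2 x y (P i))"
  by (simp add: ac_eval2_def ac_eval_poly_hom.hom_sum poly_sum)

lemma ac_eval2_smult: "ac_eval2 x y (smult c P) = ac_eval x c * ac_eval2 x y P"
  by (simp add: ac_eval2_def ac_eval_hom.map_poly_hom_smult)

lemma ac_eval2_monom: "ac_eval2 x y (monom c n) = ac_eval x c * y ^ n"
  by (simp add: ac_eval2_def poly_monom)

text \<open>One step of the reduction of a polynomial in \<open>y\<close> of degree at most \<open>2p - 2\<close> modulo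
  \<open>y\<^sup>p = y + a x + b / x\<close>, multiplied by \<open>x\<close> to clear the denominator.\<close>

definition as_reduce :: "'a :: prime_card mod_ring \<Rightarrow> 'a mod_ring \<Rightarrow> 'a mod_ring poly poly \<Rightarrow> nat \<Rightarrow> 'a mod_ring poly" where
  "as_reduce a b P s = [:0, 1:] * coeff P s + (if s \<ge> 1 then [:0, 1:] * coeff P (CARD('a) + s - 1) else 0)
     + [:b, 0, a:] * coeff P (CARD('a) + s)"

lemma as_reduce_diff: "as_reduce a b (P - Q) s = as_reduce a b P s - as_reduce a b Q s"
  unfolding as_reduce_def by (simp add: right_diff_distrib del: mult_pCons_left)

lemma sum_lessThan_add: "(\<Sum>n<m + k. g n) = (\<Sum>n<m. g n) + (\<Sum>s<k. g (m + s))"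
  for m k :: nat and g :: "nat \<Rightarrow> 'b :: comm_monoid_add"
  by (induction k) (simp_all add: add.assoc)

lemma as_reduce_eval:
  fixes a b :: "'a :: prime_card mod_ring"
  assumes x: "x \<noteq> 0" and y: "y ^ CARD('a) = y + (to_ac a * x + to_ac b / x)"
    and P: "degree P \<le> 2 * CARD('a) - 2"
  shows "x * ac_eval2 x y P = (\<Sum>s<CARD('a). ac_eval x (as_reduce a b P s) * y ^ s)"
proof -
  let ?p = "CARD('a)"
  have p: "1 < ?p" by (rule prime_card_gt_1)
  define c where "c = (\<lambda>n. ac_eval x (coeff P n))"
  \<comment> \<open>Since coefficient \<open>2 p - 1\<close> vanishes, rewriting
    \<open>y^(p + s)\<close> creates no new \<open>y^p\<close>, and one reduction step
    suffices.\<close>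
  have cz: "c (2 * ?p - 1) = 0" using P p by (simp add: c_def coeff_eq_0)
  have "ac_eval2 x y P = (\<Sum>n\<le>degree (map_poly (ac_eval x) P). c n * y ^ n)"
    by (simp add: ac_eval2_def poly_altdef c_def)
  also have "\<dots> = (\<Sum>n<2 * ?p. c n * y ^ n)"
  proof (rule sum.mono_neutral_left)
    have "degree (map_poly (ac_eval x) P) \<le> degree P" by (rule degree_map_poly_le)
    then show "{..degree (map_poly (ac_eval x) P)} \<subseteq> {..<2 * ?p}" using P p by auto
    show "\<forall>n\<in>{..<2 * ?p} - {..degree (map_poly (ac_eval x) P)}. c n * y ^ n = 0"
    proof
      fix n assume "n \<in> {..<2 * ?p} - {..degree (map_poly (ac_eval x) P)}"
      then have "coeff (map_poly (ac_eval x) P) n = 0" by (intro coeff_eq_0) auto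
      then show "c n * y ^ n = 0" by (simp add: c_def)
    qed
  qed auto
  also have "\<dots> = (\<Sum>n<?p. c n * y ^ n) + (\<Sum>s<?p. c (?p + s) * y ^ (?p + s))"
    unfolding mult_2 by (rule sum_lessThan_add)
  finally have E: "ac_eval2 x y P = (\<Sum>n<?p. c n * y ^ n) + (\<Sum>s<?p. c (?p + s) * y ^ (?p + s))" .
  have xy: "x * y ^ ?p = x * y + (to_ac a * x\<^sup>2 + to_ac b)" unfolding y using x by (simp add: distrib_left power2_eq_square)
  have "x * (c (?p + s) * y ^ (?p + s)) = c (?p + s) * (x * y ^ Suc s) + c (?p + s) * (to_ac a * x\<^sup>2 + to_ac b) * y ^ s" for s
  proof -
    have "x * (c (?p + s) * y ^ (?p + s)) = c (?p + s) * (x * y ^ ?p) * y ^ s" by (simp add: power_add mult_ac)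
    then show ?thesis unfolding xy by (simp add: algebra_simps)
  qed
  then have "x * (\<Sum>s<?p. c (?p + s) * y ^ (?p + s)) = (\<Sum>s<?p. c (?p + s) * (x * y ^ Suc s)) + (\<Sum>s<?p. c (?p + s) * (to_ac a * x\<^sup>2 + to_ac b) * y ^ s)"
    by (simp add: sum_distrib_left sum.distrib)
  also have "(\<Sum>s<?p. c (?p + s) * (x * y ^ Suc s)) = (\<Sum>s<?p. (if s \<ge> 1 then x * c (?p + s - 1) else 0) * y ^ s)"
  proof -
    define h where "h = (\<lambda>s. (if s \<ge> 1 then x * c (?p + s - 1) else 0) * y ^ s)"
    have "h ?p = 0" using cz p by (simp add: h_def mult_2)
    then have "(\<Sum>s<?p. h s) = (\<Sum>s<Suc ?p. h s)" by simp
    also have "\<dots> = h 0 + (\<Sum>s<?p. h (Suc s))" by (rule sum.lessThan_Suc_shift)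
    finally show ?thesis by (simp add: h_def mult_ac)
  qed
  finally have E2: "x * (\<Sum>s<?p. c (?p + s) * y ^ (?p + s)) = (\<Sum>s<?p. ((if s \<ge> 1 then x * c (?p + s - 1) else 0) + c (?p + s) * (to_ac a * x\<^sup>2 + to_ac b)) * y ^ s)"
    by (simp add: sum.distrib distrib_right)
  have lin: "ac_eval x [:0, 1:] = x" "ac_eval x [:b, 0, a:] = to_ac a * x\<^sup>2 + to_ac b"
  proof -
    have "[:b, 0, a:] = monom b 0 + monom a 2"
      by (rule poly_eqI) (auto simp: coeff_pCons numeral_2_eq_2 split: nat.splits)
    then show "ac_eval x [:b, 0, a:] = to_ac a * x\<^sup>2 + to_ac b" by (simp add: ac_eval_hom.hom_add)
  qed (simp add: ac_eval_def)
  have "ac_eval x (as_reduce a b P s) = x * c s + ((if s \<ge> 1 then x * c (?p + s - 1) else 0) + c (?p + s) * (to_ac a * x\<^sup>2 + to_ac b))" for s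
    unfolding as_reduce_def
    by (cases "s \<ge> 1"; simp only: ac_eval_hom.hom_add ac_eval_hom.hom_mult ac_eval_hom.hom_zero lin if_True if_False c_def)
       (simp_all add: mult_ac)
  then show ?thesis unfolding E distrib_left E2
    by (simp add: sum_distrib_left sum.distrib[symmetric] algebra_simps)
qed

text \<open>On the Artin--Schreier curve \<open>y\<close> has a pole of order \<open>1\<close> and \<open>x\<close> one of order \<open>p\<close> at infinity, so the
  weight \<open>p * e + n\<close> of \<open>x\<^sup>e y\<^sup>n\<close> is a pole order; distinct monomials reduced in \<open>y\<close> have distinct weights.\<close>

definition wt_below :: "nat \<Rightarrow> 'b :: comm_ring_1 poly poly \<Rightarrow> nat \<Rightarrow> bool" where
  "wt_below p P w \<longleftrightarrow> (\<forall>n e. coeff (coeff P n) e \<noteq> 0 \<longrightarrow> p * e + n < w)"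

lemma wt_below_0 [simp]: "wt_below p 0 w" by (simp add: wt_below_def)

lemma wt_below_add: "wt_below p P w \<Longrightarrow> wt_below p Q w \<Longrightarrow> wt_below p (P + Q) w"
  unfolding wt_below_def by (metis add.right_neutral coeff_add)

lemma wt_below_mult:
  assumes P: "wt_below p P (Suc v)" and Q: "wt_below p Q w"
  shows "wt_below p (P * Q) (v + w)"
  unfolding wt_below_def
proof (intro allI impI)
  fix n e assume "coeff (coeff (P * Q) n) e \<noteq> 0"
  then have "(\<Sum>i\<le>n. \<Sum>f\<le>e. coeff (coeff P i) f * coeff (coeff Q (n - i)) (e - f)) \<noteq> 0"
    by (simp add: coeff_mult coeff_sum)
  then obtain i where i: "i \<le> n" "(\<Sum>f\<le>e. coeff (coeff P i) f * coeff (coeff Q (n - i)) (e - f)) \<noteq> 0"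
    by (meson atMost_iff sum.not_neutral_contains_not_neutral)
  then obtain f where f: "f \<le> e" "coeff (coeff P i) f * coeff (coeff Q (n - i)) (e - f) \<noteq> 0"
    by (meson atMost_iff sum.not_neutral_contains_not_neutral)
  then have "coeff (coeff P i) f \<noteq> 0" "coeff (coeff Q (n - i)) (e - f) \<noteq> 0" by auto
  then have "p * f + i \<le> v" "p * (e - f) + (n - i) < w"
    using P Q unfolding wt_below_def by (auto simp: less_Suc_eq_le)
  then have "(p * f + i) + (p * (e - f) + (n - i)) < v + w" by linarith
  moreover have "p * f + p * (e - f) = p * e" using f by (metis add_mult_distrib2 le_add_diff_inverse)
  ultimately show "p * e + n < v + w" using i by linarith
qed

lemma wt_below_monom: "p * e + n < w \<Longrightarrow> wt_below p (monom (monom c e) n) w"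
  by (auto simp: wt_below_def)

lemma wt_below_mono: "wt_below p P v \<Longrightarrow> v \<le> w \<Longrightarrow> wt_below p P w"
  unfolding wt_below_def by (meson less_le_trans)

lemma wt_lead_power:
  assumes "wt_below p R (p * e)"
  shows "\<exists>R'. (monom (monom c e) 0 + R) ^ j = monom (monom (c ^ j) (e * j)) 0 + R' \<and> wt_below p R' (p * e * j)"
proof (induction j)
  case 0
  then show ?case by (intro exI[of _ 0]) (simp add: monom_0 one_pCons)
next
  case (Suc j)
  then obtain R' where R': "(monom (monom c e) 0 + R) ^ j = monom (monom (c ^ j) (e * j)) 0 + R'" "wt_below p R' (p * e * j)"
    by blast
  let ?m = "monom (monom c e) 0" and ?mj = "monom (monom (c ^ j) (e * j)) 0"
  have m: "wt_below p ?m (Suc (p * e))" "wt_below p ?mj (Suc (p * e * j))"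
    by (auto intro!: wt_below_monom simp: mult_ac)
  have "wt_below p (?m * R') (p * e + p * e * j)" by (intro wt_below_mult m R')
  moreover have "wt_below p (?mj * R) (p * e * j + p * e)" by (intro wt_below_mult m assms)
  moreover have "wt_below p (R * R') (p * e + p * e * j)"
    by (intro wt_below_mult R' wt_below_mono[OF assms]) auto
  ultimately have "wt_below p (?m * R' + ?mj * R + R * R') (p * e * Suc j)"
    by (intro wt_below_add) (auto simp: add.commute)
  moreover have "(?m + R) ^ Suc j = monom (monom (c ^ Suc j) (e * Suc j)) 0 + (?m * R' + ?mj * R + R * R')"
    unfolding power_Suc R'(1) by (simp add: algebra_simps mult_monom)
  ultimately show ?case by blast
qed

definition coeff_degrees_le :: "'b :: comm_ring_1 poly poly \<Rightarrow> nat \<Rightarrow> bool" where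
  "coeff_degrees_le P D \<longleftrightarrow> (\<forall>n. degree (coeff P n) \<le> D)"

lemma coeff_degrees_le_mult:
  "coeff_degrees_le P D \<Longrightarrow> coeff_degrees_le Q D' \<Longrightarrow> coeff_degrees_le (P * Q) (D + D')"
  unfolding coeff_degrees_le_def coeff_mult
  by (auto intro!: degree_sum_le order_trans[OF degree_mult_le] add_mono)

lemma coeff_degrees_le_power: "coeff_degrees_le P D \<Longrightarrow> coeff_degrees_le (P ^ j) (D * j)"
proof (induction j)
  case 0
  then show ?case by (simp add: coeff_degrees_le_def)
next
  case (Suc j)
  then show ?case using coeff_degrees_le_mult[of P D "P ^ j" "D * j"] by simp
qed

lemma coeff_degrees_le_mono: "coeff_degrees_le P D \<Longrightarrow> D \<le> D' \<Longrightarrow> coeff_degrees_le P D'"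
  unfolding coeff_degrees_le_def by (meson order_trans)

lemma coeff_degrees_le_sum: "finite I \<Longrightarrow> (\<And>i. i \<in> I \<Longrightarrow> coeff_degrees_le (P i) D) \<Longrightarrow> coeff_degrees_le (\<Sum>i\<in>I. smult [:c i:] (P i)) D"
  unfolding coeff_degrees_le_def coeff_sum
  by (auto intro!: degree_sum_le order_trans[OF degree_smult_le])

lemma degree_as_reduce_le:
  assumes "coeff_degrees_le P D"
  shows "degree (as_reduce a b P s) \<le> D + 2"
proof -
  have d: "degree (c * coeff P n) \<le> Suc (Suc D)" if "degree c \<le> 2" for c n
    using order_trans[OF degree_mult_le[of c "coeff P n"]] assms that
    by (metis add.commute add_2_eq_Suc' add_mono coeff_degrees_le_def)
  show ?thesis unfolding as_reduce_def
    by (intro degree_add_le) (auto intro!: d simp del: mult_pCons_left)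
qed

section \<open>Stepanov's method\<close>

lemma card_le_degree_if_roots:
  fixes f :: "'b :: idom poly"
  assumes "f \<noteq> 0" "\<And>x. x \<in> A \<Longrightarrow> poly f x = 0"
  shows "card A \<le> degree f"
proof -
  have "card A \<le> card {x. poly f x = 0}"
    using assms by (intro card_mono poly_roots_finite) auto
  also have "\<dots> \<le> degree f" by (rule card_poly_roots_bound[OF assms(1)])
  finally show ?thesis .
qed

lemma artin_schreier_power:
  fixes y :: "'a :: prime_card mod_ring alg_closure"
  assumes "y ^ CARD('a) = y + z"
  shows "y ^ (CARD('a) ^ k) = y + ac_trace k z"
proof (induction k)
  case (Suc k)
  have "y ^ (CARD('a) ^ Suc k) = (y ^ CARD('a)) ^ (CARD('a) ^ k)" by (simp add: power_mult)
  then show ?case using Suc by (simp add: assms alg_closure_frob_add ac_trace_def add.assoc)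
qed (auto simp: ac_trace_def)

text \<open>At the points counted, \<open>x^(Q * Q) = x\<close> and
  \<open>y^(Q * Q) = y + t\<close>. So the \<open>Q\<close>-th power of
  \<open>x^(e + i Q) y^d y^(Q j)\<close> takes the same value as
  \<open>x^(e Q + i) y^(Q d) (y + t)^j\<close>. The latter has so small a degree that some
  nontrivial combination of these functions is identically zero after reduction, while the
  corresponding combination of the former is not, its leading weights being distinct.\<close>

theorem stepanov_bound:
  fixes a b t :: "'a :: prime_card mod_ring" and \<nu> :: nat
  assumes a: "a \<noteq> 0" and \<nu>: "\<nu> \<ge> 1"
  defines "k \<equiv> 2 * Suc \<nu>"
  shows "card {x \<in> GFq k - {0}. ac_trace k (to_ac a * x + to_ac b / x) = to_ac t}
     \<le> CARD('a) ^ \<nu> * CARD('a) ^ Suc \<nu> + 8 * CARD('a) ^ Suc \<nu>"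
proof -
  define p where "p = CARD('a)"
  define Q1 where "Q1 = p ^ \<nu>"
  define Q where "Q = p ^ Suc \<nu>"
  \<comment> \<open>There are \<open>m * Q1 * p * p = p * m * Q\<close> parameters and
    \<open>p * (D + 1)\<close> conditions, with \<open>D = Q1 * Q + Q + m + 1\<close> below. For
    \<open>m = Q1 + 5\<close> the parameters win as soon as \<open>4 * Q > Q1 + 7\<close>.\<close>
  define m where "m = Q1 + 5"
  have p: "p \<ge> 2" using prime_card_gt_1[where 'a = 'a] by (simp add: p_def)
  have QQ1: "Q = p * Q1" by (simp add: Q_def Q1_def)
  have Q1: "Q1 \<ge> 2" using p \<nu> self_le_power[of p \<nu>] by (simp add: Q1_def)
  have Q4: "Q \<ge> 4" unfolding QQ1 using mult_le_mono[OF p Q1] by simp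
  have Q2: "Q \<ge> 2 * Q1" unfolding QQ1 using p by simp

  \<comment> \<open>On the curve \<open>y ^ Q\<close> is \<open>y\<close> plus a partial trace
    containing negative powers of \<open>x\<close>. Multiplication by \<open>x ^ Q1\<close> clears
    them, as \<open>p ^ i \<le> Q1\<close> for \<open>i \<le> \<nu>\<close>, and \<open>V\<close> is
    the resulting polynomial for \<open>x ^ Q1 * y ^ Q\<close>.\<close>
  define U where "U = (\<Sum>i<Suc \<nu>. monom a (Q1 + p ^ i) + monom b (Q1 - p ^ i))"
  define U' where "U' = (\<Sum>i<\<nu>. monom a (Q1 + p ^ i) + monom b (Q1 - p ^ i)) + monom b 0"
  define V where "V = monom U 0 + monom (monom 1 Q1) 1"
  have UU': "U = monom a (2 * Q1) + U'"
    by (simp add: U_def U'_def Q1_def mult_2)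
  have U'd: "degree U' < 2 * Q1"
  proof -
    have "degree (monom a (Q1 + p ^ i) + monom b (Q1 - p ^ i)) \<le> 2 * Q1 - 1" if "i < \<nu>" for i
    proof -
      have "p ^ i < Q1" unfolding Q1_def using p that by (intro power_strict_increasing) auto
      then show ?thesis
        by (intro degree_add_le order_trans[OF degree_monom_le]) auto
    qed
    then have "degree (\<Sum>i<\<nu>. monom a (Q1 + p ^ i) + monom b (Q1 - p ^ i)) \<le> 2 * Q1 - 1"
      by (intro degree_sum_le) auto
    then have "degree U' \<le> 2 * Q1 - 1" unfolding U'_def by (intro degree_add_le) (auto simp: monom_0)
    then show ?thesis using Q1 by simp
  qed
  have V_lead: "\<exists>R. V ^ j = monom (monom (a ^ j) (2 * Q1 * j)) 0 + R \<and> wt_below p R (p * (2 * Q1) * j)" for j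
  proof -
    have "wt_below p (monom U' 0 + monom (monom 1 Q1) 1) (p * (2 * Q1))"
    proof (intro wt_below_add)
      show "wt_below p (monom U' 0) (p * (2 * Q1))"
        unfolding wt_below_def
      proof (intro allI impI)
        fix n e assume "coeff (coeff (monom U' 0) n) e \<noteq> 0"
        then have "n = 0" "coeff U' e \<noteq> 0" by (auto split: if_splits)
        then show "p * e + n < p * (2 * Q1)" using le_degree[of U' e] U'd p by simp
      qed
      have "p * Q1 + 1 < p * (2 * Q1)" using Q4 by (simp add: QQ1 mult.commute)
      then show "wt_below p (monom (monom 1 Q1) 1) (p * (2 * Q1))" by (rule wt_below_monom)
    qed
    moreover have "V = monom (monom a (2 * Q1)) 0 + (monom U' 0 + monom (monom 1 Q1) 1)"
      by (simp add: V_def UU' monom_0)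
    ultimately show ?thesis using wt_lead_power by metis
  qed
  have V_deg: "coeff_degrees_le V (2 * Q1)"
  proof -
    have "degree U \<le> 2 * Q1" unfolding UU' using U'd by (intro degree_add_le degree_monom_le) auto
    then show ?thesis unfolding coeff_degrees_le_def V_def
      by (auto simp: degree_monom_eq intro!: degree_add_le)
  qed
  have V_degY: "degree V \<le> 1" unfolding V_def
    by (intro degree_add_le order_trans[OF degree_monom_le]) auto

  define Ix where "Ix = {..<m} \<times> {..<Q1} \<times> {..<p} \<times> {..<p}"
  \<comment> \<open>\<open>Ht\<close> and \<open>Gt\<close> represent the two kinds of monomials
    times \<open>x ^ ((p - 1) * Q1)\<close>; the padding powers of \<open>x\<close> make this
    clearing factor the same for all indices.\<close>
  define Ht where "Ht = (\<lambda>(i, e, d, j). monom (monom (1 :: 'a mod_ring) (e + i * Q + (p - 1 - j) * Q1)) d * V ^ j)"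
  define Gt where "Gt = (\<lambda>(i, e, d, j). monom (monom (1 :: 'a mod_ring) (e * Q + i + (p - 1 - d) * Q1)) 0 * V ^ d * [:[:t:], 1:] ^ j)"
  define Hc where "Hc = (\<lambda>c. \<Sum>\<tau>\<in>Ix. smult [:c \<tau>:] (Ht \<tau>))"
  define Gc where "Gc = (\<lambda>c. \<Sum>\<tau>\<in>Ix. smult [:c \<tau>:] (Gt \<tau>))"
  define wt where "wt = (\<lambda>(i, e, d, j). p * (e + i * Q + (p - 1 - j) * Q1 + 2 * Q1 * j) + d)"
  have finIx: "finite Ix" by (simp add: Ix_def)
  have cardIx: "card Ix = m * Q1 * p * p" by (simp add: Ix_def card_cartesian_product)

  \<comment> \<open>The weight is \<open>d + p * e + Q * (p * i + p - 1 + j)\<close>, a mixed radix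
    expansion from which all four indices can be read off.\<close>
  have wt_inj: "\<tau> = \<tau>'" if t: "\<tau> \<in> Ix" "\<tau>' \<in> Ix" "wt \<tau> = wt \<tau>'" for \<tau> \<tau>'
  proof -
    obtain i e d j i' e' d' j' where T: "\<tau> = (i, e, d, j)" "\<tau>' = (i', e', d', j')" by (metis prod_cases4)
    have form: "wt (i, e, d, j) = (p * e + d) + Q * (p * i + (p - 1 + j)) \<and> p * e + d < Q" if "(i, e, d, j) \<in> Ix" for i e d j
    proof
      have b: "e < Q1" "d < p" "j < p" using that by (auto simp: Ix_def)
      define w where "w = p - 1 + j"
      have "(p - 1 - j) * Q1 + 2 * Q1 * j = Q1 * (p - 1 - j + 2 * j)" by (simp add: add_mult_distrib2 mult.commute)
      also have "p - 1 - j + 2 * j = w" using b by (simp add: w_def)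
      finally have "wt (i, e, d, j) = p * (e + i * Q + Q1 * w) + d" by (simp add: wt_def add.assoc)
      also have "\<dots> = (p * e + d) + Q * (p * i + w)" unfolding QQ1 by (simp add: algebra_simps)
      finally show "wt (i, e, d, j) = (p * e + d) + Q * (p * i + (p - 1 + j))" by (simp add: w_def)
      have "p * e + p \<le> p * Q1" using b by (metis Suc_leI mult_Suc_right mult_le_mono2 add.commute)
      then show "p * e + d < Q" using b unfolding QQ1 by linarith
    qed
    have f1: "wt \<tau> = (p * e + d) + Q * (p * i + (p - 1 + j))" "p * e + d < Q"
     and f2: "wt \<tau>' = (p * e' + d') + Q * (p * i' + (p - 1 + j'))" "p * e' + d' < Q"
      using form t T by auto
    have lt: "d < p" "j < p" "d' < p" "j' < p" using t T by (auto simp: Ix_def)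
    have "wt \<tau> mod Q = p * e + d" "wt \<tau>' mod Q = p * e' + d'" using f1 f2 by auto
    then have ed: "p * e + d = p * e' + d'" using t by simp
    then have "(p * e + d) mod p = (p * e' + d') mod p" "(p * e + d) div p = (p * e' + d') div p" by auto
    then have 1: "d = d'" "e = e'" using lt by auto
    have "Q * (p * i + (p - 1 + j)) = Q * (p * i' + (p - 1 + j'))" using f1 f2 ed t by simp
    then have ij: "p * i + j = p * i' + j'" using Q4 by simp
    then have "(p * i + j) mod p = (p * i' + j') mod p" "(p * i + j) div p = (p * i' + j') div p" by auto
    then have "j = j'" "i = i'" using lt by auto
    then show ?thesis using 1 T by simp
  qed

  have Ht_lead: "\<exists>R. Ht (i, e, d, j) = monom (monom (a ^ j) (e + i * Q + (p - 1 - j) * Q1 + 2 * Q1 * j)) d + R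
     \<and> wt_below p R (wt (i, e, d, j))" for i e d j
  proof -
    obtain R where R: "V ^ j = monom (monom (a ^ j) (2 * Q1 * j)) 0 + R" "wt_below p R (p * (2 * Q1) * j)"
      using V_lead by blast
    define \<alpha> where "\<alpha> = e + i * Q + (p - 1 - j) * Q1"
    let ?m = "monom (monom (1 :: 'a mod_ring) \<alpha>) d"
    have "wt_below p (?m * R) ((p * \<alpha> + d) + p * (2 * Q1) * j)"
      by (intro wt_below_mult R wt_below_monom) auto
    then have "wt_below p (?m * R) (wt (i, e, d, j))"
      by (simp add: wt_def \<alpha>_def algebra_simps)
    moreover have "Ht (i, e, d, j) = monom (monom (a ^ j) (\<alpha> + 2 * Q1 * j)) d + ?m * R"
      by (simp add: Ht_def R \<alpha>_def distrib_left mult_monom)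
    ultimately show ?thesis unfolding \<alpha>_def by blast
  qed

  \<comment> \<open>The term of largest weight cannot cancel. The factor \<open>x\<close> in
    \<open>as_reduce\<close> moves it to \<open>Suc E0\<close>; the three other contributions to
    that coefficient come from monomials of at least the same weight and vanish.\<close>
  have H_nonzero: "\<exists>s<p. as_reduce a b (Hc c) s \<noteq> 0" if c: "\<exists>\<tau>\<in>Ix. c \<tau> \<noteq> 0" for c
  proof -
    define A where "A = {\<tau> \<in> Ix. c \<tau> \<noteq> 0}"
    have A: "finite A" "A \<noteq> {}" using finIx c by (auto simp: A_def)
    have "Max (wt ` A) \<in> wt ` A" using A by (intro Max_in) auto
    then obtain \<tau>0 where "\<tau>0 \<in> A" and max: "Max (wt ` A) = wt \<tau>0" by auto
    moreover have "wt \<tau> \<le> wt \<tau>0" if "\<tau> \<in> A" for \<tau>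
      unfolding max[symmetric] using A that by (intro Max_ge) auto
    ultimately have \<tau>0: "\<tau>0 \<in> A" "\<And>\<tau>. \<tau> \<in> A \<Longrightarrow> wt \<tau> \<le> wt \<tau>0" by auto
    obtain i0 e0 d0 j0 where T: "\<tau>0 = (i0, e0, d0, j0)" by (metis prod_cases4)
    define E0 where "E0 = e0 + i0 * Q + (p - 1 - j0) * Q1 + 2 * Q1 * j0"
    have w0: "wt \<tau>0 = p * E0 + d0" by (simp add: T wt_def E0_def)
    have d0: "d0 < p" using \<tau>0 T by (auto simp: A_def Ix_def)
    have co: "coeff (coeff (Hc c) n) E = (if n = d0 \<and> E = E0 then c \<tau>0 * a ^ j0 else 0)"
      if ge: "wt \<tau>0 \<le> p * E + n" for n E
    proof -
      have "coeff (coeff (Hc c) n) E = (\<Sum>\<tau>\<in>Ix. c \<tau> * coeff (coeff (Ht \<tau>) n) E)"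
        by (simp add: Hc_def coeff_sum)
      also have "\<dots> = (\<Sum>\<tau>\<in>Ix. if \<tau> = \<tau>0 then (if n = d0 \<and> E = E0 then c \<tau>0 * a ^ j0 else 0) else 0)"
      proof (intro sum.cong refl)
        fix \<tau> assume \<tau>: "\<tau> \<in> Ix"
        obtain i e d j where T': "\<tau> = (i, e, d, j)" by (metis prod_cases4)
        obtain R where R: "Ht \<tau> = monom (monom (a ^ j) (e + i * Q + (p - 1 - j) * Q1 + 2 * Q1 * j)) d + R" "wt_below p R (wt \<tau>)"
          using Ht_lead T' by blast
        show "c \<tau> * coeff (coeff (Ht \<tau>) n) E = (if \<tau> = \<tau>0 then (if n = d0 \<and> E = E0 then c \<tau>0 * a ^ j0 else 0) else 0)"
        proof (cases "c \<tau> = 0")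
          case True
          then have "\<tau> \<noteq> \<tau>0" using \<tau>0 by (auto simp: A_def)
          then show ?thesis using True by simp
        next
          case False
          then have le: "wt \<tau> \<le> wt \<tau>0" using \<tau> \<tau>0 by (auto simp: A_def)
          then have "coeff (coeff R n) E = 0" using R(2) ge unfolding wt_below_def by (metis leD le_trans)
          then have co: "coeff (coeff (Ht \<tau>) n) E = (if d = n \<and> e + i * Q + (p - 1 - j) * Q1 + 2 * Q1 * j = E then a ^ j else 0)"
            by (simp add: R)
          show ?thesis
          proof (cases "\<tau> = \<tau>0")
            case True
            then show ?thesis using co T T' by (auto simp: E0_def)
          next
            case False
            have "\<not> (d = n \<and> e + i * Q + (p - 1 - j) * Q1 + 2 * Q1 * j = E)"
            proof
              assume "d = n \<and> e + i * Q + (p - 1 - j) * Q1 + 2 * Q1 * j = E"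
              then have "wt \<tau> = p * E + n" by (auto simp: T' wt_def)
              then have "wt \<tau> = wt \<tau>0" using le ge by simp
              then show False using wt_inj \<tau> \<tau>0 False by (auto simp: A_def)
            qed
            then have "coeff (coeff (Ht \<tau>) n) E = 0" unfolding co by (rule if_not_P)
            then show ?thesis using False by simp
          qed
        qed
      qed
      also have "\<dots> = (if n = d0 \<and> E = E0 then c \<tau>0 * a ^ j0 else 0)"
        using finIx \<tau>0 by (simp add: sum.delta A_def)
      finally show ?thesis .
    qed
    have c1: "coeff (coeff (Hc c) d0) E0 = c \<tau>0 * a ^ j0" by (subst co) (auto simp: w0)
    have c2: "coeff (coeff (Hc c) (p + d0 - 1)) E0 = 0" using p by (subst co) (auto simp: w0)
    have c3: "coeff (coeff (Hc c) (p + d0)) (Suc E0) = 0" using p by (subst co) (auto simp: w0)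
    have c4: "coeff (coeff (Hc c) (p + d0)) (E0 - 1) = 0" if "E0 \<ge> 1"
    proof (subst co)
      have "p * (E0 - 1) + p = p * E0" using that by (metis add.commute le_add_diff_inverse2 mult.commute mult_Suc Suc_eq_plus1)
      then show "wt \<tau>0 \<le> p * (E0 - 1) + (p + d0)" unfolding w0 by linarith
    qed (use p in auto)
    have "coeff (as_reduce a b (Hc c) d0) (Suc E0) = c \<tau>0 * a ^ j0"
      unfolding as_reduce_def p_def[symmetric] using c1 c2 c3 c4
      by (cases E0) (auto simp: coeff_pCons)
    moreover have "c \<tau>0 * a ^ j0 \<noteq> 0" using a \<tau>0 by (auto simp: A_def)
    ultimately show ?thesis using d0 by (metis coeff_0)
  qed

  have Gt_deg: "coeff_degrees_le (Gt \<tau>) (Q1 * Q + Q + m - 1) \<and> degree (Gt \<tau>) \<le> 2 * p - 2" if \<tau>: "\<tau> \<in> Ix" for \<tau>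
  proof -
    obtain i e d j where T: "\<tau> = (i, e, d, j)" by (metis prod_cases4)
    have bnd: "i < m" "e < Q1" "d < p" "j < p" using \<tau> T by (auto simp: Ix_def)
    have "coeff_degrees_le (monom (monom (1 :: 'a mod_ring) (e * Q + i + (p - 1 - d) * Q1)) 0) (e * Q + i + (p - 1 - d) * Q1)"
      by (auto simp: coeff_degrees_le_def degree_monom_eq)
    moreover have "coeff_degrees_le [:[:t:], 1:] 0"
      by (auto simp: coeff_degrees_le_def coeff_pCons split: nat.splits)
    ultimately have "coeff_degrees_le (Gt \<tau>) (e * Q + i + (p - 1 - d) * Q1 + 2 * Q1 * d + 0 * j)"
      unfolding Gt_def T prod.case using V_deg by (intro coeff_degrees_le_mult coeff_degrees_le_power)
    moreover have "e * Q + i + (p - 1 - d) * Q1 + 2 * Q1 * d + 0 * j \<le> Q1 * Q + Q + m - 1"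
    proof -
      have "e * Q + Q \<le> Q1 * Q" using bnd by (metis Suc_leI mult_Suc add.commute mult_le_mono1)
      moreover have "(p - 1 - d) * Q1 + 2 * Q1 * d = Q1 * (p - 1 + d)"
      proof -
        have "p - 1 - d + 2 * d = p - 1 + d" using bnd by simp
        moreover have "(p - 1 - d) * Q1 + 2 * Q1 * d = Q1 * (p - 1 - d + 2 * d)" by (simp add: algebra_simps)
        ultimately show ?thesis by simp
      qed
      moreover have "Q1 * (p - 1 + d) \<le> Q1 * (2 * p)" using bnd by (intro mult_le_mono2) auto
      moreover have "Q1 * (2 * p) = 2 * Q" unfolding QQ1 by simp
      ultimately show ?thesis using bnd by linarith
    qed
    moreover have "degree (Gt \<tau>) \<le> 2 * p - 2"
    proof -
      have "degree (V ^ d) \<le> d" using V_degY degree_power_le[of V d] by (metis le_trans mult_le_mono1 mult_1)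
      moreover have "degree ([:[:t:], 1:] ^ j) \<le> j" using degree_power_le[of "[:[:t:], 1:]" j] by simp
      moreover have "degree (Gt \<tau>) \<le> 0 + degree (V ^ d) + degree ([:[:t:], 1:] ^ j)"
        unfolding Gt_def T prod.case
        by (intro order_trans[OF degree_mult_le] add_mono order_trans[OF degree_monom_le]) auto
      ultimately show ?thesis using bnd by linarith
    qed
    ultimately show ?thesis using coeff_degrees_le_mono by blast
  qed
  define D where "D = Q1 * Q + Q + m + 1"
  have Gc_deg: "degree (as_reduce a b (Gc c) s) \<le> D" for c s
  proof -
    have "coeff_degrees_le (Gc c) (Q1 * Q + Q + m - 1)" unfolding Gc_def
      using Gt_deg finIx by (intro coeff_degrees_le_sum) auto
    then show ?thesis using degree_as_reduce_le[of "Gc c" _ a b s] by (fastforce simp: D_def m_def)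
  qed
  have Gc_degY: "degree (Gc c) \<le> 2 * p - 2" for c unfolding Gc_def
    using Gt_deg finIx by (intro degree_sum_le order_trans[OF degree_smult_le]) auto

  have Ht_deg: "coeff_degrees_le (Ht \<tau>) (m * Q + 2 * Q) \<and> degree (Ht \<tau>) \<le> 2 * p - 2" if \<tau>: "\<tau> \<in> Ix" for \<tau>
  proof -
    obtain i e d j where T: "\<tau> = (i, e, d, j)" by (metis prod_cases4)
    have bnd: "i < m" "e < Q1" "d < p" "j < p" using \<tau> T by (auto simp: Ix_def)
    have "coeff_degrees_le (monom (monom (1 :: 'a mod_ring) (e + i * Q + (p - 1 - j) * Q1)) d) (e + i * Q + (p - 1 - j) * Q1)"
      by (auto simp: coeff_degrees_le_def degree_monom_eq)
    then have "coeff_degrees_le (Ht \<tau>) (e + i * Q + (p - 1 - j) * Q1 + 2 * Q1 * j)"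
      unfolding Ht_def T prod.case using V_deg by (intro coeff_degrees_le_mult coeff_degrees_le_power)
    moreover have "e + i * Q + (p - 1 - j) * Q1 + 2 * Q1 * j \<le> m * Q + 2 * Q"
    proof -
      have "i * Q + Q \<le> m * Q" using bnd by (metis Suc_leI mult_Suc add.commute mult_le_mono1)
      moreover have "(p - 1 - j) * Q1 + 2 * Q1 * j = Q1 * (p - 1 + j)"
      proof -
        have "p - 1 - j + 2 * j = p - 1 + j" using bnd by simp
        moreover have "(p - 1 - j) * Q1 + 2 * Q1 * j = Q1 * (p - 1 - j + 2 * j)" by (simp add: algebra_simps)
        ultimately show ?thesis by simp
      qed
      moreover have "Q1 * (p - 1 + j) \<le> Q1 * (2 * p)" using bnd by (intro mult_le_mono2) auto
      moreover have "Q1 * (2 * p) = 2 * Q" unfolding QQ1 by simp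
      ultimately show ?thesis using bnd Q2 by linarith
    qed
    moreover have "degree (Ht \<tau>) \<le> 2 * p - 2"
    proof -
      have "degree (V ^ j) \<le> j" using V_degY degree_power_le[of V j] by (metis le_trans mult_le_mono1 mult_1)
      moreover have "degree (Ht \<tau>) \<le> d + degree (V ^ j)"
        unfolding Ht_def T prod.case
        by (intro order_trans[OF degree_mult_le] add_mono order_trans[OF degree_monom_le]) auto
      ultimately show ?thesis using bnd by linarith
    qed
    ultimately show ?thesis using coeff_degrees_le_mono by blast
  qed
  have Hc_deg: "degree (as_reduce a b (Hc c) s) \<le> m * Q + 2 * Q + 2" for c s
    unfolding Hc_def using Ht_deg finIx by (intro degree_as_reduce_le coeff_degrees_le_sum) auto
  have Hc_degY: "degree (Hc c) \<le> 2 * p - 2" for c unfolding Hc_def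
    using Ht_deg finIx by (intro degree_sum_le order_trans[OF degree_smult_le]) auto

  \<comment> \<open>Pigeonhole in place of linear algebra: there are more coefficient vectors than
    values of \<open>\<Phi>\<close>, and the difference of two vectors with the same value is the
    desired \<open>c\<close>.\<close>
  obtain c where c: "\<exists>\<tau>\<in>Ix. c \<tau> \<noteq> 0" "\<And>s. s < p \<Longrightarrow> as_reduce a b (Gc c) s = 0"
  proof -
    define \<Phi> where "\<Phi> = (\<lambda>c. restrict (\<lambda>(s, E). coeff (as_reduce a b (Gc c) s) E) ({..<p} \<times> {..D}))"
    have "\<not> inj_on \<Phi> (Ix \<rightarrow>\<^sub>E (UNIV :: 'a mod_ring set))"
    proof
      assume inj: "inj_on \<Phi> (Ix \<rightarrow>\<^sub>E (UNIV :: 'a mod_ring set))"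
      have "\<Phi> ` (Ix \<rightarrow>\<^sub>E UNIV) \<subseteq> ({..<p} \<times> {..D}) \<rightarrow>\<^sub>E (UNIV :: 'a mod_ring set)"
        unfolding \<Phi>_def by (auto split: if_splits)
      then have "card (Ix \<rightarrow>\<^sub>E (UNIV :: 'a mod_ring set)) \<le> card (({..<p} \<times> {..D}) \<rightarrow>\<^sub>E (UNIV :: 'a mod_ring set))"
        using inj by (intro card_inj_on_le[OF inj]) (auto intro!: finite_PiE)
      then have "p ^ card Ix \<le> p ^ (p * Suc D)"
        using finIx by (simp add: card_PiE card_cartesian_product p_def)
      then have "card Ix \<le> p * Suc D" using p by (simp add: power_le_imp_le_exp)
      then have "m * Q1 * p * p \<le> p * Suc D" by (simp add: cardIx)
      moreover have "p * (m * Q) = m * Q1 * p * p" by (simp add: QQ1)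
      ultimately have "p * (m * Q) \<le> p * Suc D" by (simp only:)
      then have "m * Q \<le> Suc D" using p by (simp only: mult_le_cancel1)
      moreover have "m * Q = Q1 * Q + 5 * Q" by (simp add: m_def algebra_simps)
      ultimately have "4 * Q \<le> Q1 + 7" by (simp add: D_def m_def)
      then show False using Q2 Q4 by linarith
    qed
    then obtain c1 c2 where cc: "c1 \<in> Ix \<rightarrow>\<^sub>E UNIV" "c2 \<in> Ix \<rightarrow>\<^sub>E (UNIV :: 'a mod_ring set)" "c1 \<noteq> c2" "\<Phi> c1 = \<Phi> c2"
      unfolding inj_on_def by blast
    define c where "c = (\<lambda>\<tau>. c1 \<tau> - c2 \<tau>)"
    have "\<exists>\<tau>\<in>Ix. c1 \<tau> \<noteq> c2 \<tau>" using cc by (metis PiE_ext)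
    then have 1: "\<exists>\<tau>\<in>Ix. c \<tau> \<noteq> 0" by (simp add: c_def)
    have Gd: "Gc c = Gc c1 - Gc c2"
    proof -
      have "smult [:c \<tau>:] (Gt \<tau>) = smult [:c1 \<tau>:] (Gt \<tau>) - smult [:c2 \<tau>:] (Gt \<tau>)" for \<tau>
        by (simp add: c_def smult_diff_left[symmetric])
      then show ?thesis by (simp add: Gc_def sum_subtractf)
    qed
    have "as_reduce a b (Gc c) s = 0" if "s < p" for s
    proof (rule poly_eqI)
      fix E
      show "coeff (as_reduce a b (Gc c) s) E = coeff 0 E"
      proof (cases "E \<le> D")
        case True
        have "\<Phi> c1 (s, E) = \<Phi> c2 (s, E)" using cc by simp
        then show ?thesis using True that by (simp add: \<Phi>_def Gd as_reduce_diff)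
      next
        case False
        then show ?thesis using Gc_deg[of c s] by (simp add: coeff_eq_0)
      qed
    qed
    then show ?thesis using that 1 by blast
  qed

  define Tg where "Tg = {x \<in> GFq k - {0}. ac_trace k (to_ac a * x + to_ac b / x) = to_ac t}"
  have vanish: "ac_eval x (as_reduce a b (Hc c) s) = 0" if x: "x \<in> Tg" and s: "s < p" for x s
  proof -
    define z where "z = to_ac a * x + to_ac b / x"
    have pk: "p ^ k = Q * Q" unfolding k_def Q_def mult_2 by (rule power_add)
    have x0: "x \<noteq> 0" and xk: "x ^ (p ^ k) = x" and tr: "ac_trace k z = to_ac t"
      using x by (auto simp: Tg_def GFq_def z_def p_def)
    have xq: "x ^ (Q * Q) = x" using xk unfolding pk .
    have all_y: "(\<Sum>s<p. ac_eval x (as_reduce a b (Hc c) s) * y ^ s) = 0" if y: "y ^ p = y + z" for y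
    proof -
      define u where "u = ac_trace (Suc \<nu>) z"
      have yQ: "y ^ Q = y + u" using artin_schreier_power[of y z "Suc \<nu>"] y by (simp add: Q_def p_def u_def)
      have "y ^ (p ^ k) = y + to_ac t" using artin_schreier_power[of y z k] y tr by (simp add: p_def)
      then have yq: "y ^ (Q * Q) = y + to_ac t" unfolding pk .
      have evU: "ac_eval x U = x ^ Q1 * u"
      proof -
        have "ac_eval x U = (\<Sum>i<Suc \<nu>. to_ac a * x ^ (Q1 + p ^ i) + to_ac b * x ^ (Q1 - p ^ i))"
          by (simp add: U_def ac_eval_hom.hom_sum ac_eval_hom.hom_add)
        also have "\<dots> = (\<Sum>i<Suc \<nu>. x ^ Q1 * (z ^ (p ^ i)))"
        proof (intro sum.cong refl)
          fix i assume i: "i \<in> {..<Suc \<nu>}"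
          have le: "p ^ i \<le> Q1" unfolding Q1_def using i p by (intro power_increasing) auto
          have "z ^ (p ^ i) = to_ac a * x ^ (p ^ i) + to_ac b / x ^ (p ^ i)"
            unfolding z_def p_def alg_closure_frob_add power_mult_distrib power_divide
            by (simp only: to_ac_power[symmetric] mod_ring_power_card)
          moreover have "x ^ (Q1 - p ^ i) = x ^ Q1 / x ^ (p ^ i)" using x0 le by (simp add: power_diff)
          ultimately show "to_ac a * x ^ (Q1 + p ^ i) + to_ac b * x ^ (Q1 - p ^ i) = x ^ Q1 * (z ^ (p ^ i))"
            by (simp add: power_add distrib_left mult_ac)
        qed
        also have "\<dots> = x ^ Q1 * u" unfolding u_def ac_trace_def p_def by (simp only: sum_distrib_left)
        finally show ?thesis .
      qed
      have evV: "ac_eval2 x y V = x ^ Q1 * y ^ Q"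
      proof -
        have "ac_eval2 x y V = ac_eval x U + x ^ Q1 * y"
          unfolding V_def ac_eval2_add ac_eval2_monom by simp
        then show ?thesis unfolding evU yQ by (simp add: algebra_simps)
      qed
      have evH: "ac_eval2 x y (Ht (i, e, d, j)) = x ^ ((p - 1) * Q1) * (x ^ (e + i * Q) * y ^ d * y ^ (Q * j))"
        if "(i, e, d, j) \<in> Ix" for i e d j
      proof -
        have "j < p" using that by (simp add: Ix_def)
        then have "p - 1 - j + j = p - 1" by simp
        then have "(p - 1 - j) * Q1 + Q1 * j = (p - 1) * Q1" by (metis add_mult_distrib mult.commute)
        then have X: "x ^ ((p - 1) * Q1) = x ^ ((p - 1 - j) * Q1) * (x ^ Q1) ^ j" by (metis power_add power_mult)
        have "ac_eval2 x y (Ht (i, e, d, j)) = x ^ (e + i * Q + (p - 1 - j) * Q1) * y ^ d * (x ^ Q1 * y ^ Q) ^ j"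
          unfolding Ht_def prod.case ac_eval2_mult ac_eval2_power ac_eval2_monom evV ac_eval_monom by simp
        then show ?thesis unfolding X power_add[of x "e + i * Q"] power_mult_distrib power_mult[of y Q j] by (simp only: mult_ac)
      qed
      have evG: "ac_eval2 x y (Gt (i, e, d, j)) = x ^ ((p - 1) * Q1) * (x ^ (e * Q + i) * y ^ (Q * d) * (y + to_ac t) ^ j)"
        if "(i, e, d, j) \<in> Ix" for i e d j
      proof -
        have "d < p" using that by (simp add: Ix_def)
        then have "p - 1 - d + d = p - 1" by simp
        then have "(p - 1 - d) * Q1 + Q1 * d = (p - 1) * Q1" by (metis add_mult_distrib mult.commute)
        then have X: "x ^ ((p - 1) * Q1) = x ^ ((p - 1 - d) * Q1) * (x ^ Q1) ^ d" by (metis power_add power_mult)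
        have "ac_eval2 x y [:[:t:], 1:] = y + to_ac t"
          by (simp add: ac_eval2_def)
        then have "ac_eval2 x y (Gt (i, e, d, j)) = x ^ (e * Q + i + (p - 1 - d) * Q1) * (x ^ Q1 * y ^ Q) ^ d * (y + to_ac t) ^ j"
          unfolding Gt_def prod.case ac_eval2_mult ac_eval2_power ac_eval2_monom evV ac_eval_monom by simp
        then show ?thesis unfolding X power_add[of x "e * Q + i"] power_mult_distrib power_mult[of y Q d] by (simp only: mult_ac)
      qed
      \<comment> \<open>Raising to the power \<open>Q\<close> is additive and fixes the coefficients
        \<open>c\<close>, which lie in the prime field, so it turns \<open>Hc\<close> into a
        multiple of \<open>Gc\<close>.\<close>
      have "ac_eval2 x y (Hc c) ^ Q = (\<Sum>\<tau>\<in>Ix. (to_ac (c \<tau>) * ac_eval2 x y (Ht \<tau>)) ^ Q)"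
        unfolding Hc_def ac_eval2_sum ac_eval2_smult Q_def p_def alg_closure_frob_sum by simp
      also have "\<dots> = (\<Sum>\<tau>\<in>Ix. x ^ ((p - 1) * Q1 * Q) / x ^ ((p - 1) * Q1) * (to_ac (c \<tau>) * ac_eval2 x y (Gt \<tau>)))"
      proof (intro sum.cong refl)
        fix \<tau> assume \<tau>: "\<tau> \<in> Ix"
        obtain i e d j where T: "\<tau> = (i, e, d, j)" by (metis prod_cases4)
        have I: "(i, e, d, j) \<in> Ix" using \<tau> T by simp
        have "to_ac (c \<tau>) ^ Q = to_ac (c \<tau>)" unfolding Q_def p_def by (simp only: to_ac_power[symmetric] mod_ring_power_card)
        moreover have "ac_eval2 x y (Ht \<tau>) ^ Q = x ^ ((p - 1) * Q1 * Q) * (x ^ (e * Q + i) * y ^ (Q * d) * (y + to_ac t) ^ j)"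
        proof -
          have "(x ^ (e + i * Q)) ^ Q = x ^ (e * Q) * (x ^ (Q * Q)) ^ i" by (simp add: power_add[symmetric] power_mult[symmetric] algebra_simps)
          moreover have "(y ^ (Q * j)) ^ Q = (y ^ (Q * Q)) ^ j" by (simp add: power_mult[symmetric] mult_ac)
          moreover have "(y ^ d) ^ Q = y ^ (Q * d)" by (simp add: power_mult[symmetric] mult_ac)
          moreover have "(x ^ ((p - 1) * Q1)) ^ Q = x ^ ((p - 1) * Q1 * Q)" by (simp only: power_mult)
          moreover have "x ^ (e * Q + i) = x ^ (e * Q) * x ^ i" by (rule power_add)
          ultimately show ?thesis unfolding T evH[OF I] power_mult_distrib by (simp only: xq yq mult_ac)
        qed
        ultimately show "(to_ac (c \<tau>) * ac_eval2 x y (Ht \<tau>)) ^ Q = x ^ ((p - 1) * Q1 * Q) / x ^ ((p - 1) * Q1) * (to_ac (c \<tau>) * ac_eval2 x y (Gt \<tau>))"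
          unfolding power_mult_distrib using x0 by (simp add: T evG[OF I])
      qed
      also have "\<dots> = x ^ ((p - 1) * Q1 * Q) / x ^ ((p - 1) * Q1) * ac_eval2 x y (Gc c)"
        unfolding Gc_def ac_eval2_sum ac_eval2_smult by (simp add: sum_distrib_left)
      also have "ac_eval2 x y (Gc c) = 0"
      proof -
        have "x * ac_eval2 x y (Gc c) = (\<Sum>s<p. ac_eval x (as_reduce a b (Gc c) s) * y ^ s)"
          unfolding p_def using x0 y Gc_degY[of c] by (intro as_reduce_eval) (auto simp: z_def p_def)
        also have "\<dots> = 0" using c(2) by (simp add: ac_eval_def)
        finally show ?thesis using x0 by simp
      qed
      finally have "ac_eval2 x y (Hc c) = 0" by simp
      moreover have "x * ac_eval2 x y (Hc c) = (\<Sum>s<p. ac_eval x (as_reduce a b (Hc c) s) * y ^ s)"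
        unfolding p_def using x0 y Hc_degY[of c] by (intro as_reduce_eval) (auto simp: z_def p_def)
      ultimately show ?thesis by simp
    qed
    \<comment> \<open>For fixed \<open>x\<close> the solutions \<open>y\<close> form a coset of the
      prime field. A polynomial in \<open>y\<close> of degree below \<open>p\<close> with these
      \<open>p\<close> zeros is 0, so each coefficient vanishes at \<open>x\<close>.\<close>
    define g where "g = (\<Sum>s<p. monom (ac_eval x (as_reduce a b (Hc c) s)) s)"
    obtain y0 where y0: "y0 ^ p = y0 + z"
    proof -
      have "degree (monom 1 p + (- monom 1 1 - [:z:])) = p"
      proof (subst degree_add_eq_left)
        have "degree (- monom 1 1 - [:z:]) \<le> 1"
          by (intro order_trans[OF degree_diff_le_max]) (auto simp: degree_monom_eq)
        then show "degree (- monom 1 1 - [:z:]) < degree (monom (1 :: 'a mod_ring alg_closure) p)" using p by (simp add: degree_monom_eq)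
      qed (auto simp: degree_monom_eq)
      then obtain y where "poly (monom 1 p + (- monom 1 1 - [:z:])) y = 0"
        using alg_closed_imp_poly_has_root[of "monom 1 p + (- monom 1 1 - [:z:])"] p by auto
      then have "y ^ p = y + z" by (simp add: poly_monom add_eq_0_iff2 add.commute)
      then show ?thesis by (rule that)
    qed
    have roots: "poly g y = 0" if y: "y \<in> (\<lambda>v. y0 + to_ac v) ` (UNIV :: 'a mod_ring set)" for y
    proof -
      obtain v where v: "y = y0 + to_ac v" using y by blast
      have "y ^ p = y + z"
        using alg_closure_frob_add[of y0 "to_ac v" 1] y0 mod_ring_power_card[of v 1]
        unfolding v p_def by (simp flip: to_ac_power)
      then show ?thesis using all_y[of y] by (simp add: g_def poly_sum poly_monom)
    qed
    have "g = 0"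
    proof (rule ccontr)
      assume "g \<noteq> 0"
      then have "card ((\<lambda>v. y0 + to_ac v) ` (UNIV :: 'a mod_ring set)) \<le> degree g"
        using roots by (rule card_le_degree_if_roots)
      moreover have "degree g \<le> p - 1" unfolding g_def
        by (intro degree_sum_le order_trans[OF degree_monom_le]) auto
      moreover have "card ((\<lambda>v. y0 + to_ac v) ` (UNIV :: 'a mod_ring set)) = p"
        by (subst card_image) (auto simp: inj_def p_def)
      ultimately show False using p by simp
    qed
    then have "coeff g s = 0" by simp
    then show ?thesis using s by (simp add: g_def coeff_sum)
  qed
  \<comment> \<open>A nonzero coefficient is a polynomial in \<open>x\<close> alone, and its degree
    bounds the number of its zeros.\<close>
  obtain s where s: "s < p" "as_reduce a b (Hc c) s \<noteq> 0" using H_nonzero[OF c(1)] by blast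
  have "card Tg \<le> degree (to_acp (as_reduce a b (Hc c) s))"
    using s vanish by (intro card_le_degree_if_roots) (auto simp: ac_eval_def)
  also have "\<dots> \<le> m * Q + 2 * Q + 2" using Hc_deg[of c s] by simp
  also have "\<dots> \<le> Q1 * Q + 8 * Q" using Q4 by (simp add: m_def algebra_simps)
  finally show ?thesis by (simp add: Tg_def Q1_def Q_def p_def)
qed

section \<open>The Weil bound\<close>

lemma modular_inverse_unique:
  fixes t x z :: int
  assumes "coprime x t" "[x * z = 1] (mod t)"
  shows "[z = modular_inverse t x] (mod t)"
proof -
  have "[x * z = x * modular_inverse t x] (mod t)"
    using assms cong_modular_inverse1[OF assms(1)] by (metis cong_sym cong_trans)
  then show ?thesis using assms(1) by (simp add: cong_mult_lcancel)
qed

lemma modular_inverse_cong: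
  fixes t x y :: int
  assumes "coprime x t" "[x = y] (mod t)"
  shows "[(modular_inverse t x) = (modular_inverse t y)] (mod t)"
proof -
  have y: "coprime y t" using assms cong_imp_coprime by blast
  have "[y * modular_inverse t x = x * modular_inverse t x] (mod t)"
    using assms by (intro cong_mult) (auto simp: cong_sym)
  then have "[y * modular_inverse t x = 1] (mod t)"
    using cong_modular_inverse1[OF assms(1)] cong_trans by blast
  then show ?thesis by (rule modular_inverse_unique[OF y])
qed

definition kloosterman :: "int \<Rightarrow> int \<Rightarrow> int \<Rightarrow> complex" where
  "kloosterman a b n = (\<Sum>x\<in>{x\<in>{0..<n}. coprime x n}. em n (a * x + b * modular_inverse n x))"

text \<open>Stepanov's argument bounds the fibres of the trace only from above. But the fibres add
  up to \<open>p^(2 k) - 1\<close>, so the defects \<open>B - A t\<close> are nonnegative with a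
  small sum, and the character sum is unchanged up to sign when \<open>A\<close> is replaced by
  \<open>B - A\<close>.\<close>

lemma kl_power_even_bound:
  fixes a b :: "'a :: prime_card mod_ring"
  assumes a: "a \<noteq> 0" and k: "k \<ge> 2"
  shows "norm (kl_power a b (2 * k)) \<le> (8 * real CARD('a) + 1) * real CARD('a) ^ k"
proof -
  define p where "p = CARD('a)"
  have p: "p \<ge> 2" using prime_card_gt_1[where 'a = 'a] by (simp add: p_def)
  define GX where "GX = (GFq (2 * k) - {0} :: 'a mod_ring alg_closure set)"
  define T where "T = (\<lambda>x :: 'a mod_ring alg_closure. of_ac (ac_trace (2 * k) (to_ac a * x + to_ac b / x)))"
  define A where "A = (\<lambda>t. real (card {x\<in>GX. T x = t}))"
  define B where "B = real (p ^ (2 * k - 1) + 8 * p ^ k)"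
  have finGX: "finite GX" unfolding GX_def using k by (intro finite_Diff finite_GFq) auto
  have le: "A t \<le> B" for t
  proof -
    obtain \<nu> where \<nu>: "k = Suc \<nu>" "\<nu> \<ge> 1" using k by (cases k) auto
    have "{x\<in>GX. T x = t} \<subseteq> {x \<in> GFq (2 * k) - {0}. ac_trace (2 * k) (to_ac a * x + to_ac b / x) = to_ac t}"
    proof safe
      fix x assume x: "x \<in> GX"
      have "to_ac (T x) = ac_trace (2 * k) (to_ac a * x + to_ac b / x)"
        unfolding T_def using x by (intro to_ac_of_ac ac_trace_frob kl_arg_in_GFq) (auto simp: GX_def)
      then show "ac_trace (2 * k) (to_ac a * x + to_ac b / x) = to_ac (T x)" by simp
    qed (auto simp: GX_def)
    then have "card {x\<in>GX. T x = t} \<le> card {x \<in> GFq (2 * k) - {0}. ac_trace (2 * k) (to_ac a * x + to_ac b / x) = to_ac t}"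
      using finGX by (intro card_mono) (auto simp: GX_def)
    also have "\<dots> \<le> p ^ \<nu> * p ^ Suc \<nu> + 8 * p ^ Suc \<nu>"
      unfolding p_def \<nu>(1) by (rule stepanov_bound[OF a \<nu>(2)])
    also have "p ^ \<nu> * p ^ Suc \<nu> = p ^ (2 * k - 1)"
      unfolding power_add[symmetric] \<nu>(1) by (rule arg_cong[of _ _ "\<lambda>n. p ^ n"]) simp
    finally show ?thesis unfolding A_def B_def \<nu>(1) by linarith
  qed
  have "(\<Sum>t\<in>UNIV. A t) = real (\<Sum>t\<in>UNIV. card {x\<in>GX. T x = t})" by (simp add: A_def)
  also have "(\<Sum>t\<in>UNIV. card {x\<in>GX. T x = t}) = card GX"
  proof -
    have "(\<Sum>t\<in>UNIV. \<Sum>x\<in>{x\<in>GX. T x = t}. 1 :: nat) = (\<Sum>x\<in>GX. 1)"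
      by (rule sum.group) (auto simp: finGX)
    then show ?thesis by simp
  qed
  also have "card GX = p ^ (2 * k) - 1"
    unfolding GX_def p_def using card_GFq[of "2 * k", where 'a = 'a] k finGX
    by (subst card_Diff_singleton) (auto simp: GFq_def)
  finally have sumA: "(\<Sum>t\<in>UNIV. A t) = real (p ^ (2 * k)) - 1" using p by (simp add: of_nat_diff)
  have "kl_power a b (2 * k) = (\<Sum>x\<in>GX. ff_char (T x))" by (simp add: kl_power_def GX_def T_def)
  also have "\<dots> = (\<Sum>t\<in>UNIV. \<Sum>x\<in>{x\<in>GX. T x = t}. ff_char (T x))"
    by (rule sum.group[symmetric]) (auto simp: finGX)
  also have "\<dots> = (\<Sum>t\<in>UNIV. of_real (A t) * ff_char t)" by (simp add: A_def)
  also have "\<dots> = - (\<Sum>t\<in>UNIV. of_real (B - A t) * ff_char t)"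
    using ff_char_sum[of "1 :: 'a mod_ring"] by (simp add: left_diff_distrib sum_subtractf sum_distrib_left[symmetric])
  also have "norm \<dots> \<le> (\<Sum>t\<in>UNIV. B - A t)"
    unfolding norm_minus_cancel
    by (rule order_trans[OF norm_sum]) (use le in \<open>auto intro!: sum_mono simp: norm_mult simp flip: of_real_diff\<close>)
  also have "\<dots> = real p * B - (real (p ^ (2 * k)) - 1)" by (simp add: sum_subtractf sumA p_def)
  also have "real p * B = real (p ^ (2 * k)) + 8 * real p * real p ^ k"
  proof -
    have "p * p ^ (2 * k - 1) = p ^ (2 * k)" using k by (simp add: power_eq_if)
    then have "real p * real (p ^ (2 * k - 1)) = real (p ^ (2 * k))" by (metis of_nat_mult)
    then show ?thesis unfolding B_def of_nat_add distrib_left by simp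
  qed
  also have "real (p ^ (2 * k)) + 8 * real p * real p ^ k - (real (p ^ (2 * k)) - 1) \<le> (8 * real p + 1) * real p ^ k"
    using p by (simp add: distrib_right)
  finally show ?thesis by (simp add: p_def)
qed

section \<open>From field types to integer residues\<close>

lemma ff_char_of_int: "ff_char (of_int m :: 'a :: prime_card mod_ring) = em (int CARD('a)) m"
proof -
  have "to_int_mod_ring (of_int m :: 'a mod_ring) = m mod int CARD('a)"
    unfolding of_int_of_int_mod_ring by transfer simp
  then show ?thesis unfolding ff_char_def using prime_card_gt_1[where 'a = 'a]
    by (intro em_cong) (auto simp: Cong.cong_def)
qed

lemma of_int_to_int_mod_ring: "of_int (to_int_mod_ring x) = (x :: 'a :: prime_card mod_ring)"
  by (simp add: of_int_of_int_mod_ring)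

lemma of_int_mod_ring_eq_0_iff: "(of_int m :: 'a :: prime_card mod_ring) = 0 \<longleftrightarrow> int CARD('a) dvd m"
  by (simp add: of_int_eq_0_iff_char_dvd)

lemma kloosterman_eq_ff:
  "kloosterman a b (int CARD('a)) = (\<Sum>x\<in>UNIV - {0 :: 'a :: prime_card mod_ring}. ff_char (of_int a * x + of_int b / x))"
proof -
  let ?p = "int CARD('a)"
  have prime: "prime ?p" using prime_card[where 'a = 'a] by simp
  have cop: "coprime x ?p \<longleftrightarrow> \<not> ?p dvd x" for x
    using prime prime_imp_coprime[of ?p x] by (metis coprime_commute coprime_absorb_left not_prime_unit)
  have "(\<Sum>x\<in>UNIV - {0 :: 'a mod_ring}. ff_char (of_int a * x + of_int b / x)) =
     (\<Sum>x\<in>{x\<in>{0..<?p}. coprime x ?p}. ff_char (of_int a * of_int x + of_int b / (of_int x :: 'a mod_ring)))"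
  proof (rule sum.reindex_bij_witness[of _ of_int to_int_mod_ring])
    fix x :: "'a mod_ring" assume x: "x \<in> UNIV - {0}"
    have "\<not> ?p dvd to_int_mod_ring x"
      using x of_int_to_int_mod_ring[of x] of_int_mod_ring_eq_0_iff[of "to_int_mod_ring x", where 'a = 'a] by auto
    then show "to_int_mod_ring x \<in> {x\<in>{0..<?p}. coprime x ?p}"
      using range_to_int_mod_ring[where 'a = 'a] by (auto simp: cop)
  next
    fix x assume x: "x \<in> {x\<in>{0..<?p}. coprime x ?p}"
    show "to_int_mod_ring (of_int x :: 'a mod_ring) = x"
      unfolding of_int_of_int_mod_ring using x by simp
    show "of_int x \<in> UNIV - {0 :: 'a mod_ring}" using x by (auto simp: cop of_int_mod_ring_eq_0_iff)
  qed (auto simp: of_int_to_int_mod_ring)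
  also have "\<dots> = kloosterman a b ?p"
    unfolding kloosterman_def
  proof (intro sum.cong refl)
    fix x assume x: "x \<in> {x\<in>{0..<?p}. coprime x ?p}"
    have "[x * modular_inverse ?p x = 1] (mod ?p)" using x by (intro cong_modular_inverse1) auto
    then have "?p dvd x * modular_inverse ?p x - 1" by (simp add: cong_iff_dvd_diff)
    then have "of_int (x * modular_inverse ?p x - 1) = (0 :: 'a mod_ring)" by (simp only: of_int_mod_ring_eq_0_iff)
    then have "of_int x * of_int (modular_inverse ?p x) = (1 :: 'a mod_ring)" by simp
    then have "of_int (modular_inverse ?p x) = 1 / (of_int x :: 'a mod_ring)"
      by (metis mult.commute mult_zero_right nonzero_eq_divide_eq zero_neq_one)
    then have "of_int a * of_int x + of_int b / (of_int x :: 'a mod_ring) = of_int (a * x + b * modular_inverse ?p x)" by simp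
    then show "ff_char (of_int a * of_int x + of_int b / (of_int x :: 'a mod_ring)) = em ?p (a * x + b * modular_inverse ?p x)"
      by (simp only: ff_char_of_int)
  qed
  finally show ?thesis by simp
qed

text \<open>If \<open>p\<close> divides \<open>a\<close> the sum is a Ramanujan sum, equal to -1.
  Otherwise the constant \<open>8 p + 1\<close> over the even extensions is as good as any other,
  since \<open>kl_power_1_bound\<close> removes it.\<close>

lemma kloosterman_card_bound:
  assumes "\<not> int CARD('a :: prime_card) dvd b"
  shows "norm (kloosterman a b (int CARD('a))) \<le> 2 * sqrt (real CARD('a))"
proof -
  have b: "(of_int b :: 'a mod_ring) \<noteq> 0" using assms by (simp add: of_int_mod_ring_eq_0_iff)
  show ?thesis
  proof (cases "(of_int a :: 'a mod_ring) = 0")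
    case True
    have "kloosterman a b (int CARD('a)) = (\<Sum>x\<in>UNIV - {0 :: 'a mod_ring}. ff_char (of_int b / x))"
      unfolding kloosterman_eq_ff True by simp
    also have "\<dots> = (\<Sum>x\<in>UNIV - {0 :: 'a mod_ring}. ff_char (of_int b * x))"
      by (rule sum.reindex_bij_witness[where i = "\<lambda>x. 1 / x" and j = "\<lambda>x. 1 / x"]) auto
    also have "\<dots> = (\<Sum>x\<in>UNIV. ff_char ((of_int b :: 'a mod_ring) * x)) - 1"
      by (subst sum_diff1) auto
    also have "\<dots> = -1" using b by (simp add: ff_char_sum)
    finally have "norm (kloosterman a b (int CARD('a))) = 1" by simp
    moreover have "sqrt (real CARD('a)) \<ge> 1" using prime_card_gt_1[where 'a = 'a] by simp
    ultimately show ?thesis by linarith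
  next
    case False
    have "kl_power (of_int a :: 'a mod_ring) (of_int b) 1 = (\<Sum>x\<in>UNIV - {0 :: 'a mod_ring}. ff_char (of_int a * x + of_int b / x))"
    proof -
      have "GFq 1 - {0} = to_ac ` (UNIV - {0 :: 'a mod_ring})" unfolding GFq_1 by auto
      moreover have "inj_on to_ac (UNIV - {0 :: 'a mod_ring})" by (auto simp: inj_on_def)
      moreover have "ac_trace 1 (to_ac (of_int a) * to_ac x + to_ac (of_int b) / to_ac x) = to_ac (of_int a * x + of_int b / x)" for x :: "'a mod_ring"
        by (simp add: ac_trace_def)
      ultimately show ?thesis
        unfolding kl_power_def by (simp only: sum.reindex o_def of_ac_to_ac)
    qed
    then show ?thesis
      unfolding kloosterman_eq_ff
      using kl_power_1_bound[OF False b, of 2 "8 * real CARD('a) + 1"] kl_power_even_bound[OF False, of _ "of_int b"] by simp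
  qed
qed

text \<open>The finite fields above are types, so their characteristic cannot depend on a variable. To reach every
  prime it suffices to treat one prime that is a counterexample to the Weil bound if there is any.\<close>

definition weil_counterexample :: "nat \<Rightarrow> bool" where
  "weil_counterexample p \<longleftrightarrow> prime p \<and> (\<exists>a b. \<not> int p dvd b \<and> norm (kloosterman a b (int p)) > 2 * sqrt (real p))"

text \<open>The default 2 makes the number a prime in either case.\<close>

definition weil_prime :: nat where
  "weil_prime = (if Ex weil_counterexample then Eps weil_counterexample else 2)"

lemma prime_weil_prime: "prime weil_prime"
proof (cases "Ex weil_counterexample")
  case True
  then have "weil_counterexample weil_prime" using someI_ex[of weil_counterexample] by (simp add: weil_prime_def)
  then show ?thesis by (simp add: weil_counterexample_def)
qed (simp only: weil_prime_def if_False two_is_prime_nat)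

typedef weil_index = "{..<weil_prime}"
  using prime_gt_0_nat[OF prime_weil_prime] by blast

lemma card_weil_index: "CARD(weil_index) = weil_prime"
  using type_definition.card[OF type_definition_weil_index] by simp

instance weil_index :: finite
  by standard (metis card_weil_index card_eq_0_iff not_prime_0 prime_weil_prime)

instance weil_index :: prime_card
  by standard (simp add: card_weil_index prime_weil_prime)

theorem weil_bound:
  assumes "prime p" "\<not> int p dvd b"
  shows "norm (kloosterman a b (int p)) \<le> 2 * sqrt (real p)"
proof (rule ccontr)
  assume "\<not> ?thesis"
  then have "weil_counterexample p" using assms by (auto simp: weil_counterexample_def not_le)
  then have "weil_counterexample weil_prime" using someI[of weil_counterexample p] by (auto simp: weil_prime_def)
  then obtain a b where "\<not> int weil_prime dvd b" "norm (kloosterman a b (int weil_prime)) > 2 * sqrt (real weil_prime)"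
    by (auto simp: weil_counterexample_def)
  then show False using kloosterman_card_bound[of b a, where 'a = weil_index] by (simp add: card_weil_index)
qed

section \<open>Composite moduli and incomplete sums\<close>

lemma em_crt:
  fixes s t u v m :: int
  assumes st: "s \<ge> 1" "t \<ge> 1" "coprime s t" and u: "[t * u = 1] (mod s)" and v: "[s * v = 1] (mod t)"
  shows "em (s * t) m = em s (u * m) * em t (v * m)"
proof -
  have "[t * u + s * v = 1] (mod s)" using u by (simp add: cong_def Cong.cong_def)
  moreover have "[t * u + s * v = 1] (mod t)" using v by (simp add: cong_def Cong.cong_def)
  ultimately have "[t * u + s * v = 1] (mod (s * t))" using st(3) by (rule coprime_cong_mult)
  then have "[(t * u + s * v) * m = 1 * m] (mod (s * t))" by (rule cong_scalar_right)
  then have "em (s * t) (s * (v * m) + t * (u * m)) = em (s * t) m"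
    using st by (intro em_cong) (auto simp: algebra_simps)
  moreover have "em (s * t) (s * (v * m)) = em t (v * m)" using st by (intro em_scale) auto
  moreover have "em (s * t) (t * (u * m)) = em s (u * m)" using em_scale[of t s "u * m"] st by (simp add: mult.commute)
  ultimately show ?thesis by (simp add: em_add mult.commute)
qed

definition totatives_int :: "int \<Rightarrow> int set" where
  "totatives_int n = {x\<in>{0..<n}. coprime x n}"

text \<open>Twisted multiplicativity from the Chinese remainder theorem: the inverse of the
  complementary factor enters both arguments and is a unit, so coprimality conditions
  survive.\<close>

lemma kloosterman_mult:
  fixes s t u v :: int
  assumes st: "s \<ge> 1" "t \<ge> 1" "coprime s t" and u: "[t * u = 1] (mod s)" and v: "[s * v = 1] (mod t)"
  shows "kloosterman a b (s * t) = kloosterman (u * a) (u * b) s * kloosterman (v * a) (v * b) t"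
proof -
  define f where "f = (\<lambda>x. (x mod s, x mod t))"
  have inv_s: "[(modular_inverse (s * t) x) = (modular_inverse s (x mod s))] (mod s)"
    and inv_t: "[(modular_inverse (s * t) x) = (modular_inverse t (x mod t))] (mod t)" if x: "coprime x (s * t)" for x
  proof -
    have c: "[x * modular_inverse (s * t) x = 1] (mod (s * t))" using x by (rule cong_modular_inverse1)
    have "[(x mod s) * modular_inverse (s * t) x = x * modular_inverse (s * t) x] (mod s)" by (simp add: cong_scalar_right)
    then have "[(x mod s) * modular_inverse (s * t) x = 1] (mod s)"
      using c cong_dvd_modulus[OF c, of s] cong_trans by fastforce
    then show "[(modular_inverse (s * t) x) = (modular_inverse s (x mod s))] (mod s)"
      using x st by (intro modular_inverse_unique) auto
    have "[(x mod t) * modular_inverse (s * t) x = x * modular_inverse (s * t) x] (mod t)" by (simp add: cong_scalar_right)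
    then have "[(x mod t) * modular_inverse (s * t) x = 1] (mod t)"
      using c cong_dvd_modulus[OF c, of t] cong_trans by fastforce
    then show "[(modular_inverse (s * t) x) = (modular_inverse t (x mod t))] (mod t)"
      using x st by (intro modular_inverse_unique) auto
  qed
  have bij: "bij_betw f (totatives_int (s * t)) (totatives_int s \<times> totatives_int t)"
    unfolding bij_betw_def
  proof
    show "inj_on f (totatives_int (s * t))"
    proof (rule inj_onI)
      fix x y assume xy: "x \<in> totatives_int (s * t)" "y \<in> totatives_int (s * t)" "f x = f y"
      then have "[x = y] (mod s)" "[x = y] (mod t)" by (auto simp: f_def Cong.cong_def)
      then have "[x = y] (mod (s * t))" using st(3) by (rule coprime_cong_mult)
      then show "x = y" using xy by (auto simp: Cong.cong_def totatives_int_def)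
    qed
    show "f ` totatives_int (s * t) = totatives_int s \<times> totatives_int t"
    proof (intro equalityI subsetI)
      fix z assume "z \<in> f ` totatives_int (s * t)"
      then obtain x where "x \<in> totatives_int (s * t)" "z = f x" by blast
      then show "z \<in> totatives_int s \<times> totatives_int t"
        using st by (auto simp: f_def totatives_int_def)
    next
      fix z assume "z \<in> totatives_int s \<times> totatives_int t"
      then obtain c d where z: "z = (c, d)" "c \<in> totatives_int s" "d \<in> totatives_int t" by blast
      obtain x0 where x0: "[x0 = c] (mod s)" "[x0 = d] (mod t)"
        using binary_chinese_remainder_int[OF st(3)] by blast
      define x where "x = x0 mod (s * t)"
      have xs: "x mod s = c" "x mod t = d"
        using x0 z by (auto simp: x_def totatives_int_def Cong.cong_def mod_mod_cancel)
      have "coprime x s" "coprime x t"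
        using xs z by (auto simp: totatives_int_def simp flip: coprime_mod_left_iff)
      then have "x \<in> totatives_int (s * t)" using st by (auto simp: totatives_int_def x_def)
      then show "z \<in> f ` totatives_int (s * t)" using xs z by (force simp: f_def)
    qed
  qed
  have "kloosterman (u * a) (u * b) s * kloosterman (v * a) (v * b) t =
     (\<Sum>z\<in>totatives_int s \<times> totatives_int t. em s (u * a * fst z + u * b * modular_inverse s (fst z)) * em t (v * a * snd z + v * b * modular_inverse t (snd z)))"
    unfolding kloosterman_def totatives_int_def[symmetric] sum_product sum.cartesian_product by (simp add: split_beta)
  also have "\<dots> = (\<Sum>x\<in>totatives_int (s * t). em s (u * a * fst (f x) + u * b * modular_inverse s (fst (f x))) * em t (v * a * snd (f x) + v * b * modular_inverse t (snd (f x))))"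
    by (rule sum.reindex_bij_betw[OF bij, symmetric])
  also have "\<dots> = (\<Sum>x\<in>totatives_int (s * t). em (s * t) (a * x + b * modular_inverse (s * t) x))"
  proof (intro sum.cong refl)
    fix x assume "x \<in> totatives_int (s * t)"
    then have x: "coprime x (s * t)" by (simp add: totatives_int_def)
    have "em s (u * a * (x mod s) + u * b * modular_inverse s (x mod s)) = em s (u * (a * x + b * modular_inverse (s * t) x))"
    proof (rule em_cong)
      have "[u * a * (x mod s) + u * b * modular_inverse s (x mod s) = u * a * x + u * b * modular_inverse (s * t) x] (mod s)"
        using inv_s[OF x] by (intro cong_add cong_mult) (auto simp: cong_sym)
      then show "[u * a * (x mod s) + u * b * modular_inverse s (x mod s) = u * (a * x + b * modular_inverse (s * t) x)] (mod s)"
        by (simp add: algebra_simps)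
    qed (use st in auto)
    moreover have "em t (v * a * (x mod t) + v * b * modular_inverse t (x mod t)) = em t (v * (a * x + b * modular_inverse (s * t) x))"
    proof (rule em_cong)
      have "[v * a * (x mod t) + v * b * modular_inverse t (x mod t) = v * a * x + v * b * modular_inverse (s * t) x] (mod t)"
        using inv_t[OF x] by (intro cong_add cong_mult) (auto simp: cong_sym)
      then show "[v * a * (x mod t) + v * b * modular_inverse t (x mod t) = v * (a * x + b * modular_inverse (s * t) x)] (mod t)"
        by (simp add: algebra_simps)
    qed (use st in auto)
    ultimately show "em s (u * a * fst (f x) + u * b * modular_inverse s (fst (f x))) * em t (v * a * snd (f x) + v * b * modular_inverse t (snd (f x)))
        = em (s * t) (a * x + b * modular_inverse (s * t) x)"
      by (simp add: f_def em_crt[OF assms])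
  qed
  finally show ?thesis by (simp add: kloosterman_def totatives_int_def)
qed

theorem kloosterman_squarefree_bound:
  fixes P :: "int set"
  assumes "finite P" "\<And>p. p \<in> P \<Longrightarrow> prime p" "coprime b (\<Prod>P)"
  shows "norm (kloosterman a b (\<Prod>P)) \<le> 2 ^ card P * sqrt (of_int (\<Prod>P))"
  using assms
proof (induction P arbitrary: a b rule: finite_induct)
  case empty
  have "{x :: int. x = 0} = {0}" by auto
  have "{x\<in>{0..<1::int}. coprime x 1} = {0}" by auto
  then have "kloosterman a b 1 = em 1 (a * 0 + b * modular_inverse 1 0)" by (simp add: kloosterman_def)
  then show ?case by simp
next
  case (insert p P)
  have pp: "prime p" using insert.prems by simp
  have p0: "p \<ge> 1" using prime_gt_0_int[OF pp] by simp
  have t0: "\<Prod>P \<ge> 1"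
    using insert.prems by (intro prod_ge_1) (auto dest: prime_gt_0_int intro: order_trans[OF _ prime_ge_2_int])
  have cop: "coprime p (\<Prod>P)"
    using insert by (intro prod_coprime_right) (metis insertI1 insertI2 primes_coprime)
  have prod: "\<Prod>(insert p P) = p * \<Prod>P" using insert.hyps by simp
  define u where "u = modular_inverse p (\<Prod>P)"
  define v where "v = modular_inverse (\<Prod>P) p"
  have u: "[\<Prod>P * u = 1] (mod p)" unfolding u_def using cop by (intro cong_modular_inverse1) (simp add: coprime_commute)
  have v: "[p * v = 1] (mod \<Prod>P)" unfolding v_def using cop by (intro cong_modular_inverse1)
  have bp: "coprime b p" "coprime b (\<Prod>P)" using insert.prems(2) unfolding prod by auto
  have cu: "coprime u p" using u by (metis cong_imp_coprime cong_sym coprime_1_left coprime_mult_left_iff)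
  have cv: "coprime v (\<Prod>P)" using v by (metis cong_imp_coprime cong_sym coprime_1_left coprime_mult_left_iff)
  have "norm (kloosterman (u * a) (u * b) p) \<le> 2 * sqrt (of_int p)"
  proof -
    have "coprime (u * b) p" using cu bp by simp
    then have "\<not> p dvd u * b" using pp by (metis coprime_commute coprime_absorb_left not_prime_unit)
    moreover have "int (nat p) = p" using p0 by simp
    moreover have "prime (nat p)" using pp by simp
    ultimately show ?thesis using weil_bound[of "nat p" "u * b" "u * a"] p0 by simp
  qed
  moreover have "norm (kloosterman (v * a) (v * b) (\<Prod>P)) \<le> 2 ^ card P * sqrt (of_int (\<Prod>P))"
    using insert.prems bp cv by (intro insert.IH) auto
  ultimately have "norm (kloosterman a b (p * \<Prod>P)) \<le> (2 * sqrt (of_int p)) * (2 ^ card P * sqrt (of_int (\<Prod>P)))"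
    unfolding kloosterman_mult[OF p0 t0 cop u v] norm_mult using p0 t0 by (intro mult_mono) auto
  then show ?case unfolding prod using insert.hyps by (simp add: real_sqrt_mult mult_ac)
qed

text \<open>Finite Fourier inversion.\<close>

lemma sum_periodic_shift:
  fixes g :: "int \<Rightarrow> complex" and t :: int
  assumes t: "t \<ge> 1" and per: "\<And>x y. [x = y] (mod t) \<Longrightarrow> g x = g y"
  shows "of_int t * g v = (\<Sum>b\<in>{0..<t}. (\<Sum>x\<in>{0..<t}. g x * em t (- b * x)) * em t (b * v))"
proof -
  have "(\<Sum>b\<in>{0..<t}. (\<Sum>x\<in>{0..<t}. g x * em t (- b * x)) * em t (b * v))
     = (\<Sum>b\<in>{0..<t}. \<Sum>x\<in>{0..<t}. g x * em t (b * (v - x)))"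
    by (intro sum.cong refl, subst sum_distrib_right) (auto intro!: sum.cong simp: em_add[symmetric] algebra_simps)
  also have "\<dots> = (\<Sum>x\<in>{0..<t}. g x * (\<Sum>b\<in>{0..<t}. em t (b * (v - x))))"
    by (subst sum.swap) (simp add: sum_distrib_left)
  also have "\<dots> = (\<Sum>x\<in>{0..<t}. if x = v mod t then g v * of_int t else 0)"
  proof (intro sum.cong refl)
    fix x assume x: "x \<in> {0..<t}"
    have "t dvd v - x \<longleftrightarrow> x = v mod t"
      using x t by (metis atLeastLessThan_iff cong_iff_dvd_diff Cong.cong_def mod_pos_pos_trivial)
    moreover have "g x = g v" if "x = v mod t" using that by (intro per) (simp add: Cong.cong_def)
    ultimately show "g x * (\<Sum>b\<in>{0..<t}. em t (b * (v - x))) = (if x = v mod t then g v * of_int t else 0)"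
      unfolding em_orthogonality[OF t] by auto
  qed
  also have "\<dots> = g v * of_int t" using t by (simp add: sum.delta)
  finally show ?thesis by (simp add: mult.commute)
qed

text \<open>Completion: frequency 0 gives the proportion of the period that is covered, the other
  frequencies give geometric sums of total size \<open>t\<close> times a logarithm.\<close>

lemma completion_bound:
  fixes g :: "int \<Rightarrow> complex" and t u w :: int
  assumes t: "t \<ge> 1" and per: "\<And>x y. [x = y] (mod t) \<Longrightarrow> g x = g y" and uw: "u \<le> w"
    and K: "\<And>b. norm (\<Sum>x\<in>{0..<t}. g x * em t (b * x)) \<le> K"
  shows "norm (\<Sum>v\<in>{u..<w}. g v) \<le> K * (of_int (w - u) / of_int t + 2 * (1 + ln (of_int t)))"
proof -
  have K0: "K \<ge> 0" using order_trans[OF norm_ge_zero K] .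
  have "of_int t * (\<Sum>v\<in>{u..<w}. g v) = (\<Sum>v\<in>{u..<w}. \<Sum>b\<in>{0..<t}. (\<Sum>x\<in>{0..<t}. g x * em t (- b * x)) * em t (b * v))"
    unfolding sum_distrib_left by (intro sum.cong refl sum_periodic_shift t per)
  also have "\<dots> = (\<Sum>b\<in>{0..<t}. (\<Sum>x\<in>{0..<t}. g x * em t (- b * x)) * (\<Sum>v\<in>{u..<w}. em t (b * v)))"
    by (subst sum.swap) (simp add: sum_distrib_left)
  finally have "norm (of_int t * (\<Sum>v\<in>{u..<w}. g v)) \<le> (\<Sum>b\<in>{0..<t}. K * norm (\<Sum>v\<in>{u..<w}. em t (b * v)))"
    by (simp only:) (intro order_trans[OF norm_sum] sum_mono, simp add: norm_mult mult_right_mono K del: mult_minus_left)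
  also have "\<dots> = K * (\<Sum>b\<in>{0..<t}. norm (\<Sum>v\<in>{u..<w}. em t (b * v)))" by (simp add: sum_distrib_left)
  also have "(\<Sum>b\<in>{0..<t}. norm (\<Sum>v\<in>{u..<w}. em t (b * v))) \<le> of_int (w - u) + 2 * of_int t * (1 + ln (of_int t))"
  proof -
    have "{0..<t} = insert 0 {1..<t}" using t by auto
    then have "(\<Sum>b\<in>{0..<t}. norm (\<Sum>v\<in>{u..<w}. em t (b * v))) = of_int (w - u) + (\<Sum>b\<in>{1..<t}. norm (\<Sum>v\<in>{u..<w}. em t (b * v)))"
      using uw by (simp flip: of_int_diff)
    also have "(\<Sum>b\<in>{1..<t}. norm (\<Sum>v\<in>{u..<w}. em t (b * v))) \<le> (\<Sum>b\<in>{1..<t}. of_int t * (1 / of_int b + 1 / of_int (t - b)))"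
      by (intro sum_mono norm_geom_sum_em) auto
    finally show ?thesis using sum_geom_bound[OF t] by linarith
  qed
  finally have "of_int t * norm (\<Sum>v\<in>{u..<w}. g v) \<le> K * (of_int (w - u) + 2 * of_int t * (1 + ln (of_int t)))"
    using K0 t by (simp add: norm_mult mult_left_mono)
  then have "norm (\<Sum>v\<in>{u..<w}. g v) \<le> K * (of_int (w - u) + 2 * of_int t * (1 + ln (of_int t))) / of_int t"
    using t by (simp add: pos_le_divide_eq mult.commute)
  also have "\<dots> = K * (of_int (w - u) / of_int t + 2 * (1 + ln (of_int t)))"
    using t by (simp add: field_simps)
  finally show ?thesis .
qed

text \<open>The substitution \<open>y = c + W v\<close>, invertible modulo \<open>t\<close>, turns
  each completed sum into a Kloosterman sum times a unimodular factor. The coefficient of the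
  inverse remains \<open>B\<close>, a unit, whatever the frequency is.\<close>

theorem incomplete_kloosterman_bound:
  fixes P :: "int set" and B c W u w :: int
  assumes P: "finite P" "\<And>p. p \<in> P \<Longrightarrow> prime p" and B: "coprime B (\<Prod>P)" and W: "coprime W (\<Prod>P)" and uw: "u \<le> w"
  defines "t \<equiv> \<Prod>P"
  shows "norm (\<Sum>v\<in>{v\<in>{u..<w}. coprime (c + W * v) t}. em t (B * modular_inverse t (c + W * v)))
    \<le> 2 ^ card P * sqrt (of_int t) * (of_int (w - u) / of_int t + 2 * (1 + ln (of_int t)))"
proof -
  have t: "t \<ge> 1" unfolding t_def
    using P by (intro prod_ge_1) (auto dest: prime_gt_0_int intro: order_trans[OF _ prime_ge_2_int])
  define g where "g = (\<lambda>v. if coprime (c + W * v) t then em t (B * modular_inverse t (c + W * v)) else 0)"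
  define V where "V = modular_inverse t W"
  have V: "[W * V = 1] (mod t)" unfolding V_def using W by (intro cong_modular_inverse1) (simp add: t_def)
  have per: "g x = g y" if "[x = y] (mod t)" for x y
  proof -
    have xy: "[c + W * x = c + W * y] (mod t)" using that by (intro cong_add cong_mult) auto
    then have "coprime (c + W * x) t \<longleftrightarrow> coprime (c + W * y) t" using cong_imp_coprime cong_sym by blast
    moreover have "em t (B * modular_inverse t (c + W * x)) = em t (B * modular_inverse t (c + W * y))" if "coprime (c + W * x) t"
      using modular_inverse_cong[OF that xy] t by (intro em_cong cong_mult) auto
    ultimately show ?thesis by (auto simp: g_def)
  qed
  have "norm (\<Sum>x\<in>{0..<t}. g x * em t (b * x)) \<le> 2 ^ card P * sqrt (of_int t)" for b
  proof -
    have "(\<Sum>x\<in>{0..<t}. g x * em t (b * x)) = (\<Sum>x\<in>{x\<in>{0..<t}. coprime (c + W * x) t}. em t (B * modular_inverse t (c + W * x)) * em t (b * x))"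
      by (rule sum.mono_neutral_cong_right) (auto simp: g_def)
    also have "\<dots> = (\<Sum>y\<in>totatives_int t. em t (b * V * y + B * modular_inverse t y) * em t (- b * V * c))"
    proof (rule sum.reindex_bij_witness[of _ "\<lambda>y. (V * (y - c)) mod t" "\<lambda>x. (c + W * x) mod t"])
      fix x assume x: "x \<in> {x\<in>{0..<t}. coprime (c + W * x) t}"
      have 1: "[V * ((c + W * x) mod t - c) = x] (mod t)"
      proof -
        have "[V * ((c + W * x) mod t - c) = V * ((c + W * x) - c)] (mod t)" by (intro cong_mult cong_diff) auto
        also have "V * ((c + W * x) - c) = (W * V) * x" by simp
        also have "[(W * V) * x = 1 * x] (mod t)" using V by (rule cong_scalar_right)
        finally show ?thesis by simp
      qed
      then show "(V * ((c + W * x) mod t - c)) mod t = x" using x by (simp add: Cong.cong_def)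
      show "(c + W * x) mod t \<in> totatives_int t" using x t by (simp add: totatives_int_def)
      have "em t (b * V * ((c + W * x) mod t) + B * modular_inverse t ((c + W * x) mod t)) * em t (- b * V * c)
          = em t (b * (V * ((c + W * x) mod t - c)) + B * modular_inverse t ((c + W * x) mod t))"
        by (simp add: em_add[symmetric] algebra_simps)
      also have "\<dots> = em t (b * x + B * modular_inverse t (c + W * x))"
      proof (rule em_cong)
        have "[(modular_inverse t ((c + W * x) mod t)) = (modular_inverse t (c + W * x))] (mod t)"
          using x by (intro modular_inverse_cong) auto
        then show "[b * (V * ((c + W * x) mod t - c)) + B * modular_inverse t ((c + W * x) mod t) = b * x + B * modular_inverse t (c + W * x)] (mod t)"
          using 1 by (intro cong_add cong_mult) auto
      qed (use t in auto)
      finally show "em t (b * V * ((c + W * x) mod t) + B * modular_inverse t ((c + W * x) mod t)) * em t (- b * V * c)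
          = em t (B * modular_inverse t (c + W * x)) * em t (b * x)" by (simp add: em_add mult.commute)
    next
      fix y assume y: "y \<in> totatives_int t"
      have 1: "[c + W * ((V * (y - c)) mod t) = y] (mod t)"
      proof -
        have "[c + W * ((V * (y - c)) mod t) = c + W * (V * (y - c))] (mod t)" by (intro cong_mult cong_add) auto
        also have "c + W * (V * (y - c)) = c + (W * V) * (y - c)" by simp
        also have "[c + (W * V) * (y - c) = c + 1 * (y - c)] (mod t)" using V by (intro cong_add cong_mult) auto
        finally show ?thesis by simp
      qed
      then show "(c + W * ((V * (y - c)) mod t)) mod t = y" using y by (simp add: Cong.cong_def totatives_int_def)
      show "(V * (y - c)) mod t \<in> {x\<in>{0..<t}. coprime (c + W * x) t}"
        using y t cong_imp_coprime[OF cong_sym[OF 1]] by (simp add: totatives_int_def)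
    qed
    also have "\<dots> = kloosterman (b * V) B t * em t (- b * V * c)"
      by (simp add: kloosterman_def totatives_int_def sum_distrib_right)
    also have "norm \<dots> = norm (kloosterman (b * V) B t)" by (simp add: norm_mult)
    also have "\<dots> \<le> 2 ^ card P * sqrt (of_int t)" unfolding t_def
      using P B by (rule kloosterman_squarefree_bound)
    finally show ?thesis .
  qed
  then have "norm (\<Sum>v\<in>{u..<w}. g v) \<le> 2 ^ card P * sqrt (of_int t) * (of_int (w - u) / of_int t + 2 * (1 + ln (of_int t)))"
    by (intro completion_bound t per uw)
  also have "(\<Sum>v\<in>{u..<w}. g v) = (\<Sum>v\<in>{v\<in>{u..<w}. coprime (c + W * v) t}. em t (B * modular_inverse t (c + W * v)))"
    by (rule sum.mono_neutral_cong_right) (auto simp: g_def)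
  finally show ?thesis .
qed

section \<open>The divisor bound\<close>

definition ndiv :: "int \<Rightarrow> nat" where "ndiv k = card {d. 0 < d \<and> d dvd k}"

lemma finite_pos_divisors: "k \<noteq> 0 \<Longrightarrow> finite {d :: int. 0 < d \<and> d dvd k}"
  by (rule finite_subset[of _ "{0..\<bar>k\<bar>}"]) (auto dest!: dvd_imp_le_int)

lemma ndiv_abs: "ndiv \<bar>k\<bar> = ndiv k" by (simp add: ndiv_def)

lemma ndiv_pos: "k \<noteq> 0 \<Longrightarrow> ndiv k \<ge> 1"
  unfolding ndiv_def using finite_pos_divisors[of k]
  by (metis (mono_tags, lifting) One_nat_def Suc_leI card_gt_0_iff empty_iff mem_Collect_eq one_dvd zero_less_one)

lemma card_le_ndiv:
  assumes "k \<noteq> 0" "\<And>d. d \<in> A \<Longrightarrow> 0 < d \<and> d dvd k"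
  shows "card A \<le> ndiv k"
  unfolding ndiv_def using assms by (intro card_mono finite_pos_divisors) auto

lemma ndiv_prime_mult:
  assumes "prime p" "\<not> p dvd m" "m \<noteq> (0 :: int)"
  shows "2 * ndiv m \<le> ndiv (p * m)"
proof -
  let ?A = "{d. 0 < d \<and> d dvd m}"
  have p: "p > 0" using prime_gt_0_int[OF assms(1)] .
  have disj: "?A \<inter> (\<lambda>d. p * d) ` ?A = {}"
    using assms(2) by (auto dest: dvd_mult_left)
  have "card (?A \<union> (\<lambda>d. p * d) ` ?A) = 2 * ndiv m"
    using disj finite_pos_divisors[OF assms(3)] p by (subst card_Un_disjoint) (auto simp: card_image inj_on_def ndiv_def)
  moreover have "card (?A \<union> (\<lambda>d. p * d) ` ?A) \<le> ndiv (p * m)"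
    using p assms(3) by (intro card_le_ndiv) auto
  ultimately show ?thesis by simp
qed

lemma prod_primes_pos: "(\<And>p. p \<in> P \<Longrightarrow> prime p) \<Longrightarrow> (\<Prod>P :: int) \<ge> 1"
proof (intro prod_ge_1)
  fix p assume "p \<in> P" "\<And>p. p \<in> P \<Longrightarrow> prime p"
  then have "p > 0" by (intro prime_gt_0_int) auto
  then show "1 \<le> p" by simp
qed

lemma two_power_card_le_ndiv:
  fixes P :: "int set"
  assumes "finite P" "\<And>p. p \<in> P \<Longrightarrow> prime p"
  shows "2 ^ card P \<le> ndiv (\<Prod>P)"
  using assms
proof (induction P rule: finite_induct)
  case empty
  then show ?case using ndiv_pos[of 1] by simp
next
  case (insert p P)
  have pp: "prime p" using insert.prems by simp
  have "coprime p (\<Prod>P)"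
    using insert by (intro prod_coprime_right) (metis insertI1 insertI2 primes_coprime)
  then have "\<not> p dvd \<Prod>P" using pp by (metis coprime_absorb_left not_prime_unit)
  moreover have "\<Prod>P \<noteq> 0" using prod_primes_pos[of P] insert.prems by fastforce
  ultimately have "2 * ndiv (\<Prod>P) \<le> ndiv (p * \<Prod>P)" by (intro ndiv_prime_mult pp)
  then show ?case using insert by simp
qed

lemma ndiv_prime_power_mult_le:
  assumes "prime p" "m > (0 :: int)"
  shows "ndiv (p ^ v * m) \<le> Suc v * ndiv m"
proof -
  have p: "p > 0" using prime_gt_0_int[OF assms(1)] .
  have "{d. 0 < d \<and> d dvd p ^ v * m} \<subseteq> (\<lambda>(i, d). p ^ i * d) ` ({..v} \<times> {d. 0 < d \<and> d dvd m})"
  proof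
    fix d assume d: "d \<in> {d. 0 < d \<and> d dvd p ^ v * m}"
    then obtain x y where xy: "d = x * y" "x dvd p ^ v" "y dvd m" using division_decomp by blast
    have x0: "x \<noteq> 0" and y0: "y \<noteq> 0" using d xy by auto
    obtain i where i: "i \<le> v" "normalize x = p ^ i"
      using xy(2) divides_primepow assms(1) by (metis normalize_idem normalize_dvd_iff normalize_power normalize_prime)
    have "d = \<bar>x\<bar> * \<bar>y\<bar>" using d xy(1) by (metis abs_mult abs_of_pos mem_Collect_eq)
    then show "d \<in> (\<lambda>(i, d). p ^ i * d) ` ({..v} \<times> {d. 0 < d \<and> d dvd m})"
      using i xy(3) y0 by (intro image_eqI[of _ _ "(i, \<bar>y\<bar>)"]) auto
  qed
  then have "ndiv (p ^ v * m) \<le> card ((\<lambda>(i, d). p ^ i * d) ` ({..v} \<times> {d. 0 < d \<and> d dvd m}))"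
    unfolding ndiv_def using finite_pos_divisors[of m] assms by (intro card_mono) auto
  also have "\<dots> \<le> card ({..v} \<times> {d. 0 < d \<and> d dvd m})"
    using finite_pos_divisors[of m] assms by (intro card_image_le) auto
  finally show ?thesis by (simp add: card_cartesian_product ndiv_def)
qed

text \<open>Prime by prime: \<open>v + 1 \<le> p^(\<epsilon> v)\<close> holds once
  \<open>p^\<epsilon>\<close> is at least 2, and each of the finitely many smaller primes costs a
  factor \<open>K\<close>.\<close>

theorem divisor_bound:
  assumes "\<epsilon> > 0"
  shows "\<exists>C>0. \<forall>n>0. real (ndiv n) \<le> C * of_int n powr \<epsilon>"
proof -
  \<comment> \<open>With this \<open>K\<close> the first order term of
    \<open>exp (\<epsilon> * v * ln 2)\<close> already dominates \<open>v\<close>.\<close>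
  define K where "K = max 1 (1 / (\<epsilon> * ln 2))"
  define P0 where "P0 = \<lceil>2 powr (1 / \<epsilon>)\<rceil>"
  have K1: "K \<ge> 1" by (simp add: K_def)
  have small: "real v + 1 \<le> K * of_int p powr (\<epsilon> * real v)" if "prime p" for p :: int and v
  proof -
    have "1 + real v \<le> K * (1 + \<epsilon> * real v * ln 2)"
    proof -
      have "1 \<le> K * (\<epsilon> * ln 2)"
        using assms by (simp add: K_def max_mult_distrib_right)
      then have "real v \<le> K * (\<epsilon> * ln 2) * real v" using mult_right_mono[of 1 _ "real v"] by simp
      then show ?thesis using K1 by (simp add: algebra_simps)
    qed
    also have "\<dots> \<le> K * exp (\<epsilon> * real v * ln 2)"
      using K1 exp_ge_add_one_self[of "\<epsilon> * real v * ln 2"] by (intro mult_left_mono) auto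
    also have "exp (\<epsilon> * real v * ln 2) = 2 powr (\<epsilon> * real v)" by (simp add: powr_def)
    also have "K * \<dots> \<le> K * of_int p powr (\<epsilon> * real v)"
      using K1 assms prime_ge_2_int[OF that] by (intro mult_left_mono powr_mono2) auto
    finally show ?thesis by simp
  qed
  have large: "real v + 1 \<le> of_int p powr (\<epsilon> * real v)" if "p \<ge> P0" for p :: int and v
  proof -
    have "2 = (2 powr (1 / \<epsilon>)) powr \<epsilon>" using assms by (simp add: powr_powr)
    also have "\<dots> \<le> of_int p powr \<epsilon>"
      using that assms by (intro powr_mono2) (auto simp: P0_def ceiling_le_iff)
    finally have "2 \<le> of_int p powr \<epsilon>" .
    then have "2 ^ v \<le> (of_int p powr \<epsilon>) ^ v" by (intro power_mono) auto
    also have "\<dots> = of_int p powr (\<epsilon> * real v)"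
    proof -
      have "of_int p powr \<epsilon> > 0" using \<open>2 \<le> of_int p powr \<epsilon>\<close> by linarith
      then show ?thesis by (simp add: powr_powr powr_realpow[symmetric])
    qed
    finally have "2 ^ v \<le> of_int p powr (\<epsilon> * real v)" .
    moreover have "real v + 1 \<le> 2 ^ v"
    proof -
      have "Suc v \<le> 2 ^ v" by (induction v) auto
      then have "real (Suc v) \<le> real (2 ^ v)" by (simp only: of_nat_le_iff)
      then show ?thesis by simp
    qed
    ultimately show ?thesis by linarith
  qed
  have main: "real (ndiv n) \<le> K ^ card (prime_factors n \<inter> {0..<P0}) * of_int n powr \<epsilon>" if "n > 0" for n :: int
    using that
  proof (induction "nat n" arbitrary: n rule: less_induct)
    case (less n)
    show ?case
    proof (cases "n = 1")
      case True
      have "{d :: int. 0 < d \<and> d dvd 1} = {1}" by auto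
      then have "ndiv 1 = 1" by (simp add: ndiv_def)
      then show ?thesis using True K1 by (simp add: one_le_power)
    next
      case False
      then obtain p where p: "prime p" "p dvd n" using less.prems prime_factor_int[of n] by auto
      define v where "v = multiplicity p n"
      obtain m where m: "n = p ^ v * m" "\<not> p dvd m"
        using multiplicity_decompose'[of n p] less.prems p unfolding v_def
        by (metis not_prime_unit less_irrefl)
      have v: "v \<ge> 1" unfolding v_def using p less.prems
        by (metis One_nat_def Suc_leI multiplicity_gt_zero_iff not_prime_unit less_irrefl)
      have p2: "p \<ge> 2" using prime_ge_2_int[OF p(1)] .
      have m0: "m > 0" using less.prems m p2 by (simp add: zero_less_mult_iff)
      have "p ^ v \<ge> 2" using p2 v self_le_power[of p v] by linarith
      then have "m < n" using m m0 by (simp add: mult_less_cancel_right2)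
      then have IH: "real (ndiv m) \<le> K ^ card (prime_factors m \<inter> {0..<P0}) * of_int m powr \<epsilon>"
        using m0 less.prems by (intro less.hyps) auto
      have pf: "prime_factors n = insert p (prime_factors m)"
        using m m0 p v by (simp add: prime_factorization_mult prime_factorization_prime_power)
      have pnot: "p \<notin> prime_factors m" using m by auto
      have npow: "of_int n powr \<epsilon> = of_int p powr (\<epsilon> * real v) * of_int m powr \<epsilon>"
      proof -
        have "real_of_int n = of_int p powr real v * of_int m" using m p2 by (simp add: powr_realpow)
        then show ?thesis using p2 m0 by (simp add: powr_mult powr_powr mult.commute)
      qed
      have f: "finite (prime_factors m \<inter> {0..<P0})" by simp
      have "real (ndiv n) \<le> (real v + 1) * real (ndiv m)"
        using ndiv_prime_power_mult_le[OF p(1) m0, of v] m(1)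
        by (metis of_nat_Suc of_nat_le_iff of_nat_mult add.commute)
      also have "\<dots> \<le> K ^ card (prime_factors n \<inter> {0..<P0}) * of_int n powr \<epsilon>"
      proof (cases "p < P0")
        case True
        have "prime_factors n \<inter> {0..<P0} = insert p (prime_factors m \<inter> {0..<P0})" using pf True p2 by auto
        then have c: "card (prime_factors n \<inter> {0..<P0}) = Suc (card (prime_factors m \<inter> {0..<P0}))"
          using f pnot by simp
        have "(real v + 1) * real (ndiv m) \<le> (K * of_int p powr (\<epsilon> * real v)) * (K ^ card (prime_factors m \<inter> {0..<P0}) * of_int m powr \<epsilon>)"
          using small[OF p(1), of v] IH K1 by (intro mult_mono) auto
        then show ?thesis unfolding c npow by (simp add: mult_ac)
      next
        case False
        then have c: "prime_factors n \<inter> {0..<P0} = prime_factors m \<inter> {0..<P0}" using pf by auto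
        have "(real v + 1) * real (ndiv m) \<le> of_int p powr (\<epsilon> * real v) * (K ^ card (prime_factors m \<inter> {0..<P0}) * of_int m powr \<epsilon>)"
          using large[of p v] False IH by (intro mult_mono) auto
        then show ?thesis unfolding c npow by (simp add: mult_ac)
      qed
      finally show ?thesis .
    qed
  qed
  have "real (ndiv n) \<le> K ^ nat P0 * of_int n powr \<epsilon>" if "n > 0" for n
  proof -
    have "card (prime_factors n \<inter> {0..<P0}) \<le> card {0..<P0}" by (intro card_mono) auto
    then have "K ^ card (prime_factors n \<inter> {0..<P0}) \<le> K ^ nat P0" using K1 by (intro power_increasing) auto
    then show ?thesis using main[OF that] by (meson mult_right_mono order_trans powr_ge_zero)
  qed
  then show ?thesis using K1 by (intro exI[of _ "K ^ nat P0"]) auto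
qed

text \<open>A single slowly growing quantity that absorbs divisor functions and logarithms.\<close>

definition dmax :: "int \<Rightarrow> real" where
  "dmax N = real (Max (ndiv ` {1..N ^ 20}))"

text \<open>The largest integers to which this is applied are the products \<open>Dp * a\<close>,
  bounded by \<open>N^14\<close>; the exponent 20 leaves room.\<close>

lemma ndiv_le_dmax: "k \<noteq> 0 \<Longrightarrow> \<bar>k\<bar> \<le> N ^ 20 \<Longrightarrow> real (ndiv k) \<le> dmax N"
  unfolding dmax_def of_nat_le_iff by (subst ndiv_abs[symmetric]) (auto intro!: Max_ge)

lemma dmax_ge_1: "N \<ge> 1 \<Longrightarrow> dmax N \<ge> 1"
  using ndiv_le_dmax[of 1 N] ndiv_pos[of 1] by (simp add: one_le_power)

text \<open>The largest power of 2 up to \<open>N\<close> has more than \<open>log 2 N\<close>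
  divisors, so the same quantity also dominates the logarithm.\<close>

lemma ln_le_dmax:
  assumes "N \<ge> 1" shows "ln (of_int N) \<le> dmax N"
proof -
  define j where "j = nat \<lfloor>log 2 (of_int N)\<rfloor>"
  have l0: "log 2 (of_int N) \<ge> 0" using assms by simp
  have "2 powr real j \<le> 2 powr log 2 (of_int N)" using l0 by (intro powr_mono) (auto simp: j_def)
  also have "\<dots> = of_int N" using assms by simp
  finally have "real_of_int (2 ^ j) \<le> of_int N" by (simp add: powr_realpow)
  then have "2 ^ j \<le> N" by (simp only: of_int_le_iff)
  also have "N \<le> N ^ 20" using assms self_le_power[of N 20] by simp
  finally have le: "2 ^ j \<le> N ^ 20" .
  have "real (card ((\<lambda>i. 2 ^ i :: int) ` {..j})) \<le> real (ndiv (2 ^ j))"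
    unfolding of_nat_le_iff by (intro card_le_ndiv) (auto simp: le_imp_power_dvd)
  also have "card ((\<lambda>i. 2 ^ i :: int) ` {..j}) = Suc j" by (subst card_image) (auto simp: inj_on_def)
  also have "real (ndiv (2 ^ j)) \<le> dmax N" using le by (intro ndiv_le_dmax) auto
  finally have "real j + 1 \<le> dmax N" by simp
  moreover have "log 2 (of_int N) \<le> real j + 1" using l0 unfolding j_def by linarith
  moreover have "ln (of_int N) \<le> log 2 (of_int N)"
  proof -
    have "ln (of_int N) = log 2 (of_int N) * ln 2" by (simp add: log_def)
    also have "\<dots> \<le> log 2 (of_int N) * 1" using l0 ln_2_less_1 by (intro mult_left_mono) auto
    finally show ?thesis by simp
  qed
  ultimately show ?thesis by linarith
qed

lemma dmax_subpolynomial: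
  assumes "\<epsilon> > 0"
  shows "eventually (\<lambda>N. dmax N \<le> of_int N powr \<epsilon>) at_top"
proof -
  \<comment> \<open>On integers up to \<open>N^20\<close> the exponent
    \<open>\<epsilon> / 40\<close> becomes \<open>\<epsilon> / 2\<close>; the other half absorbs
    \<open>C\<close>.\<close>
  obtain C where C: "C > 0" "\<And>n. n > 0 \<Longrightarrow> real (ndiv n) \<le> C * of_int n powr (\<epsilon> / 40)"
    using divisor_bound[of "\<epsilon> / 40"] assms by auto
  have "eventually (\<lambda>x::real. C \<le> x powr (\<epsilon> / 2)) at_top"
    using assms by real_asymp
  then have "eventually (\<lambda>N::int. C \<le> of_int N powr (\<epsilon> / 2)) at_top"
    using filterlim_real_of_int_at_top by (auto simp: filterlim_iff)
  moreover have "eventually (\<lambda>N::int. N \<ge> 1) at_top" by (rule eventually_ge_at_top)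
  ultimately show ?thesis
  proof eventually_elim
    case (elim N)
    have "Max (ndiv ` {1..N ^ 20}) \<in> ndiv ` {1..N ^ 20}"
      using elim by (intro Max_in) (auto simp: one_le_power)
    then obtain n where n: "n \<in> {1..N ^ 20}" "dmax N = real (ndiv n)" by (auto simp: dmax_def)
    have "dmax N \<le> C * of_int n powr (\<epsilon> / 40)" using n C by simp
    also have "\<dots> \<le> C * of_int (N ^ 20) powr (\<epsilon> / 40)"
      using n C assms by (intro mult_left_mono powr_mono2) (auto simp flip: of_int_power)
    also have "of_int (N ^ 20) powr (\<epsilon> / 40) = of_int N powr (\<epsilon> / 2)"
    proof -
      have "real_of_int (N ^ 20) = of_int N powr 20" using elim by simp
      then show ?thesis by (simp only: powr_powr) simp
    qed
    also have "C * \<dots> \<le> of_int N powr (\<epsilon> / 2) * of_int N powr (\<epsilon> / 2)"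
      using elim by (intro mult_right_mono) auto
    also have "\<dots> = of_int N powr \<epsilon>" by (simp flip: powr_add)
    finally show ?case .
  qed
qed

section \<open>Primes in dyadic intervals\<close>

lemma multiplicity_eq_card:
  fixes p :: nat
  assumes "prime p" "n \<ge> 1" "n \<le> B"
  shows "multiplicity p n = card {i\<in>{1..B}. p ^ i dvd n}"
proof -
  have p: "p \<ge> 2" using prime_ge_2_nat[OF assms(1)] .
  have iff: "p ^ i dvd n \<longleftrightarrow> i \<le> multiplicity p n" for i
    using assms p by (intro power_dvd_iff_le_multiplicity) auto
  have "p ^ multiplicity p n \<le> n" using assms by (intro dvd_imp_le multiplicity_dvd) auto
  moreover have "multiplicity p n < p ^ multiplicity p n" using p by (intro power_gt_expt) auto
  ultimately have "multiplicity p n \<le> B" using assms by linarith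
  then have "{i\<in>{1..B}. p ^ i dvd n} = {1..multiplicity p n}" by (auto simp: iff)
  then show ?thesis by simp
qed

text \<open>Legendre's formula, truncated at any \<open>B\<close> not below
  \<open>n\<close>.\<close>

lemma multiplicity_fact:
  fixes p :: nat
  assumes "prime p" "n \<le> B"
  shows "multiplicity p (fact n) = (\<Sum>i\<in>{1..B}. n div p ^ i)"
  using assms(2)
proof (induction n)
  case (Suc n)
  have "multiplicity p (fact (Suc n) :: nat) = multiplicity p (Suc n * fact n)" by simp
  also have "\<dots> = multiplicity p (Suc n) + multiplicity p (fact n :: nat)"
    using assms(1) by (intro prime_elem_multiplicity_mult_distrib) auto
  also have "multiplicity p (Suc n) = (\<Sum>i\<in>{1..B}. if p ^ i dvd Suc n then 1 else 0)"
    using Suc.prems assms(1) by (simp add: multiplicity_eq_card[of p "Suc n" B] sum.If_cases Int_def)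
  also have "\<dots> + multiplicity p (fact n :: nat) = (\<Sum>i\<in>{1..B}. (if p ^ i dvd Suc n then 1 else 0) + n div p ^ i)"
    using Suc by (simp add: sum.distrib)
  also have "\<dots> = (\<Sum>i\<in>{1..B}. Suc n div p ^ i)" by (intro sum.cong refl) (simp add: div_Suc dvd_eq_mod_eq_0)
  finally show ?case .
qed auto

text \<open>By Legendre's formula each exponent \<open>i\<close> contributes
  \<open>2 n div p^i - 2 (n div p^i)\<close>, which is at most 1, and 0 once
  \<open>p^i > 2 n\<close>.\<close>

lemma central_binomial_prime_power_le:
  fixes p :: nat
  assumes p: "prime p" and n: "n \<ge> 1"
  shows "p ^ multiplicity p ((2 * n) choose n) \<le> 2 * n"
proof -
  define v where "v = multiplicity p ((2 * n) choose n)"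
  define A where "A = {i\<in>{1..2 * n}. p ^ i \<le> 2 * n}"
  have p0: "p > 0" using prime_gt_0_nat[OF p] .
  have "fact (2 * n) = fact n * fact n * ((2 * n) choose n)"
    using binomial_fact_lemma[of n "2 * n"] by (simp add: mult_2)
  then have "multiplicity p (fact (2 * n) :: nat) = multiplicity p (fact n :: nat) + multiplicity p (fact n :: nat) + v"
    using p by (simp add: prime_elem_multiplicity_mult_distrib v_def)
  then have "(\<Sum>i\<in>{1..2 * n}. (2 * n) div p ^ i) = (\<Sum>i\<in>{1..2 * n}. 2 * (n div p ^ i)) + v"
    using multiplicity_fact[OF p, of "2 * n" "2 * n"] multiplicity_fact[OF p, of n "2 * n"]
    by (simp add: sum_distrib_left[symmetric])
  moreover have "(\<Sum>i\<in>{1..2 * n}. (2 * n) div p ^ i) \<le> (\<Sum>i\<in>{1..2 * n}. 2 * (n div p ^ i) + (if p ^ i \<le> 2 * n then 1 else 0))"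
  proof (rule sum_mono)
    fix i
    have "(2 * n) div p ^ i \<le> 2 * (n div p ^ i) + 1"
    proof -
      have "n < p ^ i * (n div p ^ i + 1)" using p0 by (simp add: dividend_less_times_div)
      then have "2 * n < p ^ i * (2 * (n div p ^ i) + 2)" by (simp add: algebra_simps)
      then have "(2 * n) div p ^ i < 2 * (n div p ^ i) + 2" using p0 by (simp add: div_less_iff_less_mult mult.commute)
      then show ?thesis by simp
    qed
    then show "(2 * n) div p ^ i \<le> 2 * (n div p ^ i) + (if p ^ i \<le> 2 * n then 1 else 0)" by auto
  qed
  ultimately have "v \<le> (\<Sum>i\<in>{1..2 * n}. if p ^ i \<le> 2 * n then 1 else 0)" by (simp add: sum.distrib)
  also have "\<dots> = card A" by (simp add: A_def sum.If_cases Int_def)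
  finally have vA: "v \<le> card A" .
  show ?thesis
  proof (cases "v = 0")
    case True
    then show ?thesis using n by (simp flip: v_def)
  next
    case False
    have "\<exists>i\<in>A. i \<ge> v"
    proof (rule ccontr)
      assume "\<not> (\<exists>i\<in>A. i \<ge> v)"
      then have "A \<subseteq> {1..<v}" by (auto simp: A_def)
      then have "card A \<le> v - 1" using card_mono[of "{1..<v}" A] by simp
      then show False using vA False by simp
    qed
    then obtain i where "i \<ge> v" "p ^ i \<le> 2 * n" by (auto simp: A_def)
    moreover have "p ^ v \<le> p ^ i" using \<open>i \<ge> v\<close> p0 by (intro power_increasing) auto
    ultimately show ?thesis unfolding v_def by linarith
  qed
qed

text \<open>Chebyshev's argument: the central binomial coefficient is large, yet each of its prime
  power factors is at most \<open>2 n\<close>.\<close>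

lemma two_power_le_prime_count:
  assumes n: "n \<ge> 1"
  shows "2 ^ n \<le> (2 * n) ^ card {p :: nat. prime p \<and> p \<le> 2 * n}"
proof -
  define C where "C = (2 * n) choose n"
  have C0: "C \<noteq> 0" by (simp add: C_def)
  have "2 * n \<le> 2 ^ n"
    using n by (induction n rule: nat_induct_at_least) auto
  then have "(2 * n) * 2 ^ n \<le> (2 ^ n * 2 ^ n :: nat)" by (intro mult_right_mono) auto
  also have "(2 ^ n * 2 ^ n :: nat) = 4 ^ n" by (simp flip: power_mult_distrib)
  finally have "real ((2 * n) * 2 ^ n) \<le> real (4 ^ n)" by (simp only: of_nat_le_iff)
  then have "real (2 ^ n) \<le> 4 ^ n / (2 * real n)" using n by (simp add: field_simps)
  also have "\<dots> \<le> real C" using central_binomial_lower_bound[of n] n by (simp add: C_def)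
  finally have "2 ^ n \<le> C" by (simp only: of_nat_le_iff)
  also have "C = (\<Prod>p\<in>prime_factors C. p ^ multiplicity p C)" by (rule prime_factorization_nat) (use C0 in auto)
  also have "\<dots> \<le> (\<Prod>p\<in>prime_factors C. 2 * n)"
    using n by (intro prod_mono) (auto simp: C_def intro!: central_binomial_prime_power_le)
  also have "\<dots> = (2 * n) ^ card (prime_factors C)" by simp
  also have "\<dots> \<le> (2 * n) ^ card {p. prime p \<and> p \<le> 2 * n}"
  proof -
    have "prime_factors C \<subseteq> {p. prime p \<and> p \<le> 2 * n}"
    proof
      fix p assume p: "p \<in> prime_factors C"
      then have "prime p" "multiplicity p C \<ge> 1" using C0 by (auto simp: prime_factors_multiplicity)
      moreover have "p \<le> p ^ multiplicity p C" using calculation prime_gt_0_nat[of p] by (intro self_le_power) auto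
      ultimately show "p \<in> {p. prime p \<and> p \<le> 2 * n}"
        using central_binomial_prime_power_le[of p n] n by (auto simp: C_def)
    qed
    then have "card (prime_factors C) \<le> card {p. prime p \<and> p \<le> 2 * n}"
      by (intro card_mono) (auto intro: finite_subset[of _ "{..2 * n}"])
    then show ?thesis using n by (intro power_increasing) auto
  qed
  finally show ?thesis .
qed

lemma prime_count_lower:
  fixes L :: real
  assumes L: "L \<ge> 4"
  shows "L / 8 \<le> real (card {p :: int. prime p \<and> of_int p \<le> L}) * ln L"
proof -
  define n where "n = nat \<lfloor>L / 2\<rfloor>"
  have n: "real n \<le> L / 2" "real n \<ge> L / 2 - 1" "n \<ge> 1" using L unfolding n_def by linarith+
  define k where "k = card {p :: nat. prime p \<and> p \<le> 2 * n}"
  have "{p :: int. prime p \<and> of_int p \<le> L} \<supseteq> int ` {p :: nat. prime p \<and> p \<le> 2 * n}"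
    using n by auto
  moreover have "finite {p :: int. prime p \<and> of_int p \<le> L}"
    by (rule finite_subset[of _ "{0..\<lfloor>L\<rfloor>}"]) (auto dest: prime_gt_0_int simp: le_floor_iff)
  ultimately have "card (int ` {p :: nat. prime p \<and> p \<le> 2 * n}) \<le> card {p :: int. prime p \<and> of_int p \<le> L}"
    by (intro card_mono)
  then have k: "k \<le> card {p :: int. prime p \<and> of_int p \<le> L}" by (simp add: card_image k_def)
  have "real (2 ^ n) \<le> real ((2 * n) ^ k)" using two_power_le_prime_count[OF n(3)] unfolding k_def by (simp only: of_nat_le_iff)
  then have "ln (2 ^ n) \<le> ln ((2 * real n) ^ k)" using n by (intro ln_mono) auto
  moreover have "ln (2 ^ n) = real n * ln (2 :: real)" "ln ((2 * real n) ^ k) = real k * ln (2 * real n)"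
    using n by (simp_all only: ln_realpow)
  ultimately have "real n * ln 2 \<le> real k * ln (2 * real n)" by linarith
  also have "\<dots> \<le> real k * ln L" using n L by (intro mult_left_mono ln_mono) auto
  also have "\<dots> \<le> real (card {p :: int. prime p \<and> of_int p \<le> L}) * ln L" using k L by (intro mult_right_mono) auto
  finally have "real n * ln 2 \<le> real (card {p :: int. prime p \<and> of_int p \<le> L}) * ln L" .
  moreover have "L / 8 \<le> real n * ln 2"
  proof -
    have "L / 8 = L / 4 * (1 / 2)" by simp
    also have "\<dots> \<le> real n * ln 2" using n L ln2_ge_two_thirds by (intro mult_mono) auto
    finally show ?thesis .
  qed
  ultimately show ?thesis by linarith
qed

text \<open>Pigeonhole over the dyadic ranges below \<open>L\<close>, at the cost of a logarithm, so
  that Chebyshev's lower bound suffices. The range may end below \<open>L\<close>, but later only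
  the ratio of \<open>L\<close> to the number of primes and \<open>lam <= L\<close> matter.\<close>

lemma dyadic_primes_exist:
  fixes L :: real
  assumes L: "L \<ge> 4"
  shows "\<exists>lam>0. lam \<le> L \<and> L \<le> 24 * (ln L)\<^sup>2 * real (card {p :: int. prime p \<and> lam / 2 < of_int p \<and> of_int p \<le> lam})"
proof -
  define A where "A = (\<lambda>j :: nat. {p :: int. prime p \<and> L / 2 ^ j / 2 < of_int p \<and> of_int p \<le> L / 2 ^ j})"
  define J where "J = nat \<lfloor>log 2 L\<rfloor> + 1"
  define P where "P = {p :: int. prime p \<and> of_int p \<le> L}"
  have finA: "finite (A j)" for j
    by (rule finite_subset[of _ "{0..\<lfloor>L / 2 ^ j\<rfloor>}"]) (auto dest: prime_gt_0_int simp: le_floor_iff A_def)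
  have lL: "ln L \<ge> 1"
  proof -
    have "exp 1 \<le> (3 :: real)" using exp_le by simp
    then have "exp 1 \<le> L" using L by linarith
    then show ?thesis using L by (simp add: ln_ge_iff)
  qed
  have log: "log 2 L \<ge> 0" using L by simp
  have J: "real J \<le> 3 * ln L"
  proof -
    have "log 2 L \<le> 2 * ln L"
    proof -
      have "ln L \<le> (2 * ln L) * ln 2" using lL ln2_ge_two_thirds mult_left_mono[of "1/2" "ln 2" "2 * ln L"] by simp
      then show ?thesis by (simp add: log_def field_simps)
    qed
    then show ?thesis using log lL unfolding J_def by (simp add: of_nat_diff) linarith
  qed
  have Jpow: "L < 2 ^ J"
  proof -
    have "L = 2 powr (log 2 L)" using L by simp
    also have "\<dots> < 2 powr real J" using log unfolding J_def by (intro powr_less_mono) linarith+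
    finally show ?thesis by (simp add: powr_realpow)
  qed
  have "P \<subseteq> (\<Union>j<J. A j)"
  proof
    fix p assume p: "p \<in> P"
    define j where "j = (LEAST j. L / 2 ^ Suc j < of_int p)"
    have pp: "real_of_int p \<ge> 1" using p prime_gt_0_int[of p] by (auto simp: P_def)
    have ex: "L / 2 ^ Suc (J - 1) < of_int p"
    proof -
      have "L / 2 ^ J < 1" using Jpow by simp
      also have "1 \<le> real_of_int p" by (rule pp)
      finally have "L / 2 ^ J < of_int p" .
      moreover have "Suc (J - 1) = J" by (simp add: J_def)
      ultimately show ?thesis by (simp only:)
    qed
    have 1: "L / 2 ^ Suc j < of_int p" unfolding j_def by (rule LeastI[of "\<lambda>j. L / 2 ^ Suc j < of_int p", OF ex])
    have "j \<le> J - 1" unfolding j_def by (rule Least_le[of "\<lambda>j. L / 2 ^ Suc j < of_int p", OF ex])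
    then have 2: "j < J" by (simp add: J_def)
    have "of_int p \<le> L / 2 ^ j"
    proof (cases j)
      case 0
      then show ?thesis using p by (simp add: P_def)
    next
      case (Suc i)
      then have "\<not> L / 2 ^ Suc i < of_int p" unfolding j_def using not_less_Least[of i "\<lambda>j. L / 2 ^ Suc j < of_int p"] by simp
      then show ?thesis using Suc by simp
    qed
    then have "p \<in> A j" using 1 p by (simp add: A_def P_def mult.commute)
    then show "p \<in> (\<Union>j<J. A j)" using 2 by blast
  qed
  then have "card P \<le> card (\<Union>j<J. A j)" using finA by (intro card_mono) auto
  also have "\<dots> \<le> (\<Sum>j<J. card (A j))" by (rule card_UN_le) simp
  finally have le: "card P \<le> (\<Sum>j<J. card (A j))" .
  have "\<exists>j<J. card P \<le> J * card (A j)"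
  proof (rule ccontr)
    assume n: "\<not> (\<exists>j<J. card P \<le> J * card (A j))"
    have "J * (\<Sum>j<J. card (A j)) < J * card P"
    proof -
      have "J * (\<Sum>j<J. card (A j)) = (\<Sum>j<J. J * card (A j))" by (simp add: sum_distrib_left)
      also have "\<dots> < (\<Sum>j<J. card P)" using n by (intro sum_strict_mono) (auto simp: not_le J_def)
      finally show ?thesis by simp
    qed
    then show False using le by simp
  qed
  then obtain j where j: "card P \<le> J * card (A j)" by blast
  have "L \<le> 8 * (real (card P) * ln L)" using prime_count_lower[OF L] by (simp add: P_def)
  also have "\<dots> \<le> 8 * ((3 * ln L * real (card (A j))) * ln L)"
  proof -
    have "real (card P) \<le> real J * real (card (A j))" using j by (simp flip: of_nat_mult)
    also have "\<dots> \<le> 3 * ln L * real (card (A j))" using J by (intro mult_right_mono) auto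
    finally show ?thesis using lL by (intro mult_left_mono mult_right_mono) auto
  qed
  finally have "L \<le> 24 * (ln L)\<^sup>2 * real (card (A j))" by (simp add: power2_eq_square mult_ac)
  moreover have "L / 2 ^ j \<le> L" using L by (simp add: divide_le_eq)
  ultimately show ?thesis using L by (intro exI[of _ "L / 2 ^ j"]) (auto simp: A_def)
qed

section \<open>The part of an integer outside its simple primes\<close>

definition simple_primes :: "int \<Rightarrow> int \<Rightarrow> int set" where
  "simple_primes D m = {p. prime p \<and> p dvd m \<and> \<not> p\<^sup>2 dvd m \<and> \<not> p dvd D}"

lemma finite_simple_primes: "m \<noteq> 0 \<Longrightarrow> finite (simple_primes D m)"
  by (rule finite_subset[OF _ finite_pos_divisors[of m]]) (auto simp: simple_primes_def dest: prime_gt_0_int)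

lemma prod_primes_dvd:
  fixes P :: "int set"
  assumes "finite P" "\<And>p. p \<in> P \<Longrightarrow> prime p \<and> p dvd k"
  shows "\<Prod>P dvd k"
  using assms
proof (induction P rule: finite_induct)
  case (insert p P)
  have "coprime p (\<Prod>P)"
    using insert by (intro prod_coprime_right) (metis insertI1 insertI2 primes_coprime)
  then show ?case using insert by (simp add: divides_mult)
qed auto

lemma prime_dvd_prod_primes_iff:
  fixes P :: "int set"
  assumes "finite P" "\<And>p. p \<in> P \<Longrightarrow> prime p" "prime q"
  shows "q dvd \<Prod>P \<longleftrightarrow> q \<in> P"
proof
  assume "q dvd \<Prod>P"
  then obtain p where "p \<in> P" "q dvd p" using assms prime_dvd_prod_iff[of P q "\<lambda>p. p"] by auto
  then show "q \<in> P" using assms by (metis primes_dvd_imp_eq)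
qed (use assms in auto)

lemma coprime_if_no_common_prime:
  fixes a b :: int
  assumes "a \<noteq> 0 \<or> b \<noteq> 0" "\<And>p. prime p \<Longrightarrow> p dvd a \<Longrightarrow> p dvd b \<Longrightarrow> False"
  shows "coprime a b"
proof (rule ccontr)
  assume "\<not> coprime a b"
  then have "\<bar>gcd a b\<bar> \<noteq> 1" by (simp add: coprime_iff_gcd_eq_1)
  then obtain p where "prime p" "p dvd gcd a b" using prime_factor_int by blast
  then show False using assms by auto
qed

lemma simple_primes_prod_dvd: "m \<noteq> 0 \<Longrightarrow> \<Prod>(simple_primes D m) dvd m"
  by (intro prod_primes_dvd finite_simple_primes) (auto simp: simple_primes_def)

lemma squarefree_dvd_if_primes:
  fixes c k :: int
  assumes "squarefree c" "\<And>p. prime p \<Longrightarrow> p dvd c \<Longrightarrow> p dvd k" "c \<noteq> 0"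
  shows "c dvd k"
proof (cases "k = 0")
  case False
  show ?thesis
  proof (rule multiplicity_le_imp_dvd)
    fix p :: int assume p: "prime p"
    have "multiplicity p c \<le> 1" using assms p by (simp add: squarefree_factorial_semiring'')
    moreover have "multiplicity p k \<ge> 1" if "p dvd c"
      using assms(2)[OF p that] False p by (metis One_nat_def Suc_leI multiplicity_gt_zero_iff not_prime_unit)
    moreover have "multiplicity p c = 0" if "\<not> p dvd c" using that by (rule not_dvd_imp_multiplicity_0)
    ultimately show "multiplicity p c \<le> multiplicity p k" by (cases "p dvd c") auto
  qed (use assms in auto)
qed auto

text \<open>Here \<open>a^2 * c\<close> is the decomposition of the cofactor over \<open>g\<close>
  into a square and a squarefree part. A prime of \<open>c\<close> not dividing \<open>D\<close> is
  not simple, so its square divides \<open>m\<close>, hence the cofactor, and the prime divides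
  \<open>a\<close>.\<close>

lemma simple_primes_cofactor:
  fixes m D g :: int
  assumes m: "m \<ge> 1" and g: "g \<ge> 1" "g dvd D" "g dvd m"
  defines "t \<equiv> \<Prod>(simple_primes D m)"
  shows "\<exists>a\<ge>1. \<exists>c\<ge>1. m div t = g * (a\<^sup>2 * c) \<and> c dvd D * a"
proof -
  let ?P = "simple_primes D m"
  have P: "finite ?P" "\<And>p. p \<in> ?P \<Longrightarrow> prime p" using finite_simple_primes[of m D] m by (auto simp: simple_primes_def)
  have t1: "t \<ge> 1" unfolding t_def by (rule prod_primes_pos) (rule P)
  have tm: "t dvd m" unfolding t_def using simple_primes_prod_dvd m by auto
  define s where "s = m div t"
  have ms: "m = t * s" using tm by (simp add: s_def)
  have tiff: "q dvd t \<longleftrightarrow> q \<in> ?P" if "prime q" for q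
    unfolding t_def using P that by (rule prime_dvd_prod_primes_iff)
  have cgt: "coprime g t"
    using g by (intro coprime_if_no_common_prime) (auto simp: tiff simple_primes_def dest: dvd_trans)
  then have "g dvd s" using g(3) unfolding ms by (simp add: coprime_dvd_mult_right_iff)
  then obtain s' where s': "s = g * s'" by blast
  have s'1: "s' \<ge> 1" using m ms t1 g s' by (smt (verit) mult_nonneg_nonpos mult_pos_neg mult_zero_right)
  define a where "a = square_part s'"
  define c where "c = squarefree_part s'"
  have dec: "s' = c * a\<^sup>2" unfolding a_def c_def by (rule squarefree_decompose)
  have a1: "a \<ge> 1"
  proof -
    have "a \<noteq> 0" using s'1 by (auto simp: a_def)
    moreover have "a \<ge> 0" unfolding a_def by (metis normalize_square_part abs_ge_zero normalize_int_def)
    ultimately show ?thesis by simp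
  qed
  have c1: "c \<ge> 1" using s'1 dec a1 by (smt (verit) mult_nonpos_nonneg zero_le_power2)
  have "c dvd D * a"
  proof (rule squarefree_dvd_if_primes)
    fix p assume p: "prime p" "p dvd c"
    show "p dvd D * a"
    proof (cases "p dvd D")
      case False
      have "p dvd m" using p(2) unfolding ms s' dec by auto
      have "p \<notin> ?P"
      proof
        assume "p \<in> ?P"
        then have "p dvd t" using p tiff by simp
        moreover have "p dvd s" using p(2) unfolding s' dec by auto
        ultimately have "p * p dvd m" unfolding ms by (rule mult_dvd_mono)
        then show False using \<open>p \<in> ?P\<close> by (simp add: simple_primes_def power2_eq_square)
      qed
      then have p2: "p\<^sup>2 dvd m" using p \<open>p dvd m\<close> False by (auto simp: simple_primes_def)
      have "coprime p t" using \<open>p \<notin> ?P\<close> p tiff by (metis prime_imp_coprime)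
      then have "p\<^sup>2 dvd s" using p2 unfolding ms by (simp add: coprime_dvd_mult_right_iff)
      moreover have "coprime p g" using False g p by (metis dvd_trans prime_imp_coprime)
      ultimately have "p\<^sup>2 dvd s'" unfolding s' by (simp add: coprime_dvd_mult_right_iff)
      then have "p dvd a" by (simp add: a_def dvd_square_part_iff)
      then show ?thesis by simp
    qed auto
  qed (use c1 in \<open>auto simp: c_def\<close>)
  then show ?thesis using a1 c1 s' dec unfolding s_def by (intro exI[of _ a] exI[of _ c] conjI) (auto simp: mult_ac)
qed

text \<open>Writing the cofactor as \<open>g a\<^sup>2 c\<close> with \<open>c\<close> dividing \<open>D a\<close> shows that it is bounded on average in
  mean square root, up to divisor functions.\<close>

lemma sum_cofactor_le:
  fixes D G :: int and Y :: int and z :: real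
  assumes D: "D \<noteq> 0" and G: "G \<ge> 1" "G dvd D" and Y: "Y \<ge> 1"
    and z: "\<And>a. 1 \<le> a \<Longrightarrow> a \<le> Y \<Longrightarrow> real (ndiv (D * a)) \<le> z"
  shows "(\<Sum>m\<in>{1..Y}. sqrt (of_int (m div \<Prod>(simple_primes D m) * gcd G m))) \<le> of_int Y * real (ndiv G) * z * (1 + ln (of_int Y))"
proof -
  define T where "T = (SIGMA g:{d. 0 < d \<and> d dvd G}. SIGMA a:{1..Y}. {c. 0 < c \<and> c dvd D * a})"
  define f where "f = (\<lambda>(g :: int, a :: int, c :: int). of_int (g * a) * sqrt (of_int c))"
  have finT: "finite T" unfolding T_def using G D
    by (intro finite_SigmaI finite_pos_divisors) auto
  have f0: "f x \<ge> 0" if "x \<in> T" for x using that by (auto simp: f_def T_def)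
  \<comment> \<open>Each term equals \<open>f\<close> at one triple. Admitting all triples whose
    product divides \<open>m\<close> is an upper bound that allows summation over \<open>m\<close>
    first.\<close>
  have "(\<Sum>m\<in>{1..Y}. sqrt (of_int (m div \<Prod>(simple_primes D m) * gcd G m)))
     \<le> (\<Sum>m\<in>{1..Y}. \<Sum>x\<in>T. if (case x of (g, a, c) \<Rightarrow> g * (a\<^sup>2 * c) dvd m) then f x else 0)"
  proof (rule sum_mono)
    fix m assume m: "m \<in> {1..Y}"
    define g where "g = gcd G m"
    have g: "g \<ge> 1" "g dvd G" "g dvd m" using m by (auto simp: g_def int_one_le_iff_zero_less)
    obtain a c where ac: "a \<ge> 1" "c \<ge> 1" "m div \<Prod>(simple_primes D m) = g * (a\<^sup>2 * c)" "c dvd D * a"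
      using simple_primes_cofactor[of m g D] m g(1,3) dvd_trans[OF g(2) G(2)] by auto
    have dm: "g * (a\<^sup>2 * c) dvd m"
      using simple_primes_prod_dvd[of m D] m unfolding ac(3)[symmetric] by (metis atLeastAtMost_iff dvd_div_mult_self dvd_triv_left not_one_le_zero)
    have "a \<le> Y"
    proof -
      have "a dvd m" using dm by (metis dvd_mult_left dvd_mult_right dvd_trans power2_eq_square)
      then show ?thesis using m zdvd_imp_le[of a m] by simp
    qed
    then have x: "(g, a, c) \<in> T" using g ac by (auto simp: T_def)
    have "sqrt (of_int (m div \<Prod>(simple_primes D m) * gcd G m)) = f (g, a, c)"
    proof -
      have "real_of_int (m div \<Prod>(simple_primes D m) * gcd G m) = (of_int (g * a))\<^sup>2 * of_int c"
        unfolding ac(3) g_def[symmetric] by (simp add: power2_eq_square)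
      then have "sqrt (of_int (m div \<Prod>(simple_primes D m) * gcd G m)) = sqrt ((of_int (g * a))\<^sup>2) * sqrt (of_int c)"
        by (simp only: real_sqrt_mult)
      then show ?thesis using g ac(1,2) by (simp add: f_def)
    qed
    also have "\<dots> \<le> (\<Sum>x\<in>{(g, a, c)}. if (case x of (g, a, c) \<Rightarrow> g * (a\<^sup>2 * c) dvd m) then f x else 0)" using dm by simp
    also have "\<dots> \<le> (\<Sum>x\<in>T. if (case x of (g, a, c) \<Rightarrow> g * (a\<^sup>2 * c) dvd m) then f x else 0)"
      using x finT f0 by (intro sum_mono2) auto
    finally show "sqrt (of_int (m div \<Prod>(simple_primes D m) * gcd G m)) \<le> (\<Sum>x\<in>T. if (case x of (g, a, c) \<Rightarrow> g * (a\<^sup>2 * c) dvd m) then f x else 0)" .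
  qed
  also have "\<dots> = (\<Sum>x\<in>T. \<Sum>m\<in>{1..Y}. if (case x of (g, a, c) \<Rightarrow> g * (a\<^sup>2 * c) dvd m) then f x else 0)"
    by (rule sum.swap)
  also have "\<dots> \<le> (\<Sum>x\<in>T. case x of (g, a, c) \<Rightarrow> of_int Y / of_int a)"
  proof (rule sum_mono)
    fix x assume x: "x \<in> T"
    obtain g a c where xe: "x = (g, a, c)" by (metis prod_cases3)
    have p: "g \<ge> 1" "a \<ge> 1" "c \<ge> 1" using x xe by (auto simp: T_def)
    define k where "k = g * (a\<^sup>2 * c)"
    have k: "k \<ge> 1" unfolding k_def using p by (simp add: int_one_le_iff_zero_less)
    have "{m\<in>{1..Y}. k dvd m} \<subseteq> (\<lambda>i. k * i) ` {1..Y div k}"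
    proof
      fix m assume m: "m \<in> {m\<in>{1..Y}. k dvd m}"
      then obtain i where i: "m = k * i" by auto
      have "i \<ge> 1" using m i k by (smt (verit) mem_Collect_eq atLeastAtMost_iff mult_nonneg_nonpos)
      moreover have "i \<le> Y div k" using m i k by (metis (no_types, lifting) atLeastAtMost_iff mem_Collect_eq nonzero_mult_div_cancel_left not_one_le_zero zdiv_mono1 zero_less_one less_le_trans)
      ultimately show "m \<in> (\<lambda>i. k * i) ` {1..Y div k}" using i by auto
    qed
    then have "card {m\<in>{1..Y}. k dvd m} \<le> card ((\<lambda>i. k * i) ` {1..Y div k})" by (intro card_mono) auto
    also have "\<dots> \<le> nat (Y div k)" using card_image_le[of "{1..Y div k}" "\<lambda>i. k * i"] by simp
    finally have "real (card {m\<in>{1..Y}. k dvd m}) \<le> real (nat (Y div k))" by simp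
    also have "\<dots> = of_int (Y div k)" using Y k by (simp add: pos_imp_zdiv_nonneg_iff)
    also have "\<dots> \<le> of_int Y / of_int k" by (rule real_of_int_div4)
    finally have cnt: "real (card {m\<in>{1..Y}. k dvd m}) \<le> of_int Y / of_int k" .
    have "(\<Sum>m\<in>{1..Y}. if (case x of (g, a, c) \<Rightarrow> g * (a\<^sup>2 * c) dvd m) then f x else 0) = real (card {m\<in>{1..Y}. k dvd m}) * f x"
      by (simp add: xe k_def sum.If_cases Int_def)
    also have "\<dots> \<le> of_int Y / of_int k * f x" using cnt f0[OF x] by (intro mult_right_mono)
    \<comment> \<open>By \<open>sqrt c \<le> c\<close> the numerator \<open>g * a * sqrt c\<close>
      cancels everything in \<open>g * a^2 * c\<close> but one factor \<open>a\<close>.\<close>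
    also have "\<dots> \<le> of_int Y / of_int a"
    proof -
      have "sqrt (of_int c) \<le> sqrt ((of_int c)\<^sup>2)" using p by (intro real_sqrt_le_mono self_le_power) auto
      then have "sqrt (of_int c) \<le> of_int c" using p by simp
      then have "f x \<le> of_int (g * a) * of_int c" using p by (simp add: f_def xe mult_left_mono)
      then have "of_int Y / of_int k * f x \<le> of_int Y / of_int k * (of_int (g * a) * of_int c)"
        using Y k by (intro mult_left_mono) auto
      also have "\<dots> = of_int Y / of_int a" using p by (simp add: k_def power2_eq_square field_simps)
      finally show ?thesis .
    qed
    finally show "(\<Sum>m\<in>{1..Y}. if (case x of (g, a, c) \<Rightarrow> g * (a\<^sup>2 * c) dvd m) then f x else 0) \<le> (case x of (g, a, c) \<Rightarrow> of_int Y / of_int a)"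
      by (simp add: xe)
  qed
  also have "\<dots> = (\<Sum>g\<in>{d. 0 < d \<and> d dvd G}. \<Sum>a\<in>{1..Y}. \<Sum>c\<in>{c. 0 < c \<and> c dvd D * a}. of_int Y / of_int a)"
  proof -
    have "(\<Sum>a\<in>{1..Y}. \<Sum>c\<in>{c. 0 < c \<and> c dvd D * a}. real_of_int Y / of_int a)
       = (\<Sum>(a, c)\<in>(SIGMA a:{1..Y}. {c. 0 < c \<and> c dvd D * a}). of_int Y / of_int a)"
      using D by (intro sum.Sigma ballI finite_pos_divisors) auto
    then show ?thesis unfolding T_def by (simp only: sum.cartesian_product)
  qed
  also have "\<dots> = real (ndiv G) * (\<Sum>a\<in>{1..Y}. real (ndiv (D * a)) * (of_int Y / of_int a))"
    by (simp add: ndiv_def)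
  also have "\<dots> \<le> real (ndiv G) * (\<Sum>a\<in>{1..Y}. z * (of_int Y / of_int a))"
    using Y z by (intro mult_left_mono sum_mono mult_right_mono) auto
  also have "(\<Sum>a\<in>{1..Y}. z * (of_int Y / of_int a)) = z * of_int Y * (\<Sum>a\<in>{1..Y}. 1 / of_int a)"
    by (simp add: sum_distrib_left)
  also have "real (ndiv G) * \<dots> \<le> real (ndiv G) * (z * of_int Y * (1 + ln (of_int Y)))"
  proof -
    have "z \<ge> 0" using z[of 1] Y by (meson dual_order.trans of_nat_0_le_iff order_refl)
    then show ?thesis using sum_inverse_le_ln[OF Y] Y by (intro mult_left_mono) auto
  qed
  finally show ?thesis by (simp add: mult_ac)
qed

section \<open>Correlations of two amplified terms\<close>

lemma convex_int_set_interval: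
  fixes S :: "int set"
  assumes "finite S" "S \<noteq> {}" "\<And>a b c. a \<in> S \<Longrightarrow> c \<in> S \<Longrightarrow> a \<le> b \<Longrightarrow> b \<le> c \<Longrightarrow> b \<in> S"
  shows "S = {Min S..<Max S + 1}"
proof
  show "S \<subseteq> {Min S..<Max S + 1}" using assms(1) by (auto simp: zless_add1_eq intro: Max_ge le_imp_less_or_eq)
  show "{Min S..<Max S + 1} \<subseteq> S"
  proof
    fix b assume "b \<in> {Min S..<Max S + 1}"
    then have "Min S \<le> b" "b \<le> Max S" by auto
    then show "b \<in> S" using assms(3)[OF Min_in[OF assms(1,2)] Max_in[OF assms(1,2)]] by blast
  qed
qed

lemma linear_between:
  fixes a b lo hi v1 v2 v :: int
  assumes "lo < a + b * v1" "a + b * v1 \<le> hi" "lo < a + b * v2" "a + b * v2 \<le> hi" "v1 \<le> v" "v \<le> v2"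
  shows "lo < a + b * v \<and> a + b * v \<le> hi"
proof (cases "b \<ge> 0")
  case True
  then have "b * v1 \<le> b * v" "b * v \<le> b * v2" using assms by (auto intro: mult_left_mono)
  then show ?thesis using assms by linarith
next
  case False
  then have "b * v \<le> b * v1" "b * v2 \<le> b * v" using assms by (auto intro: mult_left_mono_neg)
  then show ?thesis using assms by linarith
qed

lemma cong_scale_modulus: "[a = b] (mod k) \<Longrightarrow> [c * a = c * b] (mod (c * k))" for a b c k :: int
  unfolding cong_iff_dvd_diff by (metis mult_dvd_mono dvd_refl right_diff_distrib)

text \<open>Modulo \<open>g = gcd s k\<close> the inverse depends only on \<open>n\<close> modulo
  \<open>g\<close>, and multiplication by \<open>c\<close> lifts this to modulus \<open>s\<close>,
  because \<open>s\<close> divides \<open>c * g\<close>.\<close>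

lemma inverse_cong_divisor:
  fixes n n' k s c :: int
  assumes n: "coprime n k" "coprime n' k" and nn: "[n = n'] (mod s)" and s: "s dvd c * k"
  shows "[c * modular_inverse k n = c * modular_inverse k n'] (mod s)"
proof -
  define g where "g = gcd s k"
  let ?u = "modular_inverse k n" and ?u' = "modular_inverse k n'"
  have gk: "g dvd k" "g dvd s" by (auto simp: g_def)
  have u: "[n * ?u = 1] (mod g)" using cong_modular_inverse1[OF n(1)] gk cong_dvd_modulus by blast
  have u': "[n' * ?u' = 1] (mod g)" using cong_modular_inverse1[OF n(2)] gk cong_dvd_modulus by blast
  have "[n = n'] (mod g)" using nn gk cong_dvd_modulus by blast
  then have "[n * ?u' = n' * ?u'] (mod g)" by (rule cong_scalar_right)
  then have "[n * ?u' = n * ?u] (mod g)" using u u' by (metis cong_sym cong_trans)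
  moreover have "coprime n g" using n gk by (metis coprime_divisors dvd_refl)
  ultimately have "[?u' = ?u] (mod g)" by (simp add: cong_mult_lcancel)
  then have "[c * ?u' = c * ?u] (mod (c * g))" by (rule cong_scale_modulus)
  moreover have "s dvd c * g"
  proof -
    have "s dvd gcd (c * s) (c * k)" using s by simp
    also have "gcd (c * s) (c * k) = \<bar>c * g\<bar>" by (simp add: g_def abs_mult gcd_mult_left)
    finally show ?thesis by simp
  qed
  ultimately show ?thesis using cong_dvd_modulus cong_sym by blast
qed

text \<open>Two triples \<open>(l1, l2, r)\<close> and \<open>(l1', l2', r')\<close> with a common
  \<open>m2\<close>. The variable \<open>m\<close> below plays the part of \<open>m1\<close>, and
  \<open>nf m\<close>, \<open>nf' m\<close> are the moduli determined by the two triples.\<close>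

locale correlation_pair =
  fixes M N h l1 l2 r l1' l2' r' m2 :: int
  assumes M: "M \<ge> 1" and N: "N \<ge> 1" and h: "h \<ge> 1"
    and primes: "prime l1" "prime l2" "prime l1'" "prime l2'"
    and r: "r \<noteq> 0" "r' \<noteq> 0" and rl: "coprime r l1" "coprime r' l1'"
    and m2: "m2 > M"
begin

definition nf where "nf m = (l1 * m - l2 * m2) div r"
definition nf' where "nf' m = (l1' * m - l2' * m2) div r'"

definition good where "good m \<longleftrightarrow> r dvd l1 * m - l2 * m2 \<and> N < nf m \<and> nf m \<le> 2 * N
   \<and> coprime (nf m) (l2 * m2) \<and> coprime (nf m) (l1 * m)"
definition good' where "good' m \<longleftrightarrow> r' dvd l1' * m - l2' * m2 \<and> N < nf' m \<and> nf' m \<le> 2 * N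
   \<and> coprime (nf' m) (l2' * m2) \<and> coprime (nf' m) (l1' * m)"

text \<open>Once denominators are cleared, the combined phase is \<open>delta\<close> over
  \<open>l1 * l1' * m\<close> modulo \<open>qq\<close>, so this number decides whether it
  oscillates.\<close>

definition delta where "delta = - h * (l1 - l2) * l1' * l2' * r + h * (l1' - l2') * l1 * l2 * r'"
definition qq where "qq = l2 * l2' * m2"
text \<open>Collects what has to be invertible modulo \<open>tt\<close>.\<close>

definition dd where "dd = h * r * r' * l1 * l1' * delta"
definition tt where "tt = \<Prod>(simple_primes dd qq)"
definition ss where "ss = qq div tt"

text \<open>The two fractions of a correlation over their common denominator
  \<open>qq\<close>.\<close>

definition theta where
  "theta m = - h * (l1 - l2) * (l2' * modular_inverse (l2 * m2) (nf m))
     + h * (l1' - l2') * (l2 * modular_inverse (l2' * m2) (nf' m))"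

lemma l_pos: "l1 > 0" "l2 > 0" "l1' > 0" "l2' > 0" using primes prime_gt_0_int by blast+

lemma qq_gt: "qq > M"
proof -
  have "1 * 1 * m2 \<le> l2 * l2' * m2" using l_pos m2 M by (intro mult_mono) auto
  then show ?thesis using m2 by (simp add: qq_def)
qed

lemma sp: "finite (simple_primes dd qq)" "\<And>p. p \<in> simple_primes dd qq \<Longrightarrow> prime p"
  using finite_simple_primes[of qq dd] qq_gt M by (auto simp: simple_primes_def)

lemma tt_ge_1: "tt \<ge> 1" unfolding tt_def by (rule prod_primes_pos) (rule sp)

lemma qq_eq: "qq = ss * tt"
  using simple_primes_prod_dvd[of qq dd] qq_gt M by (simp add: ss_def tt_def)

lemma ss_ge_1: "ss \<ge> 1"
  using qq_gt M tt_ge_1 qq_eq by (smt (verit) mult_nonpos_nonneg)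

lemma prime_dvd_tt: "prime p \<Longrightarrow> p dvd tt \<longleftrightarrow> p \<in> simple_primes dd qq"
  unfolding tt_def by (rule prime_dvd_prod_primes_iff[OF sp])

lemma coprime_tt_if_dvd_dd: "x dvd dd \<Longrightarrow> coprime x tt"
  using tt_ge_1 by (intro coprime_if_no_common_prime) (auto simp: prime_dvd_tt simple_primes_def dest: dvd_trans)

lemma coprime_ss_tt: "coprime ss tt"
proof (rule coprime_if_no_common_prime)
  fix p assume p: "prime p" "p dvd ss" "p dvd tt"
  then have "p * p dvd qq" unfolding qq_eq by (intro mult_dvd_mono)
  moreover have "\<not> p\<^sup>2 dvd qq" using p prime_dvd_tt by (auto simp: simple_primes_def)
  ultimately show False by (simp add: power2_eq_square)
qed (use tt_ge_1 in auto)

lemma good_eq: "good m \<Longrightarrow> r * nf m = l1 * m - l2 * m2" by (simp add: good_def nf_def)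
lemma good'_eq: "good' m \<Longrightarrow> r' * nf' m = l1' * m - l2' * m2" by (simp add: good'_def nf'_def)

lemma em_theta:
  "em (l2 * m2) (- h * (l1 - l2) * modular_inverse (l2 * m2) (nf m)) * cnj (em (l2' * m2) (- h * (l1' - l2') * modular_inverse (l2' * m2) (nf' m)))
    = em qq (theta m)"
proof -
  have 1: "em (l2 * m2) a = em qq (l2' * a)" for a
    using em_scale[of l2' "l2 * m2" a] l_pos by (simp add: qq_def mult_ac)
  have 2: "em (l2' * m2) a = em qq (l2 * a)" for a
    using em_scale[of l2 "l2' * m2" a] l_pos by (simp add: qq_def mult_ac)
  show ?thesis unfolding 1 2 em_uminus[symmetric] em_add[symmetric] theta_def
    by (rule arg_cong[of _ _ "em qq"]) (simp add: algebra_simps)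
qed

text \<open>Modulo \<open>l2 * m2\<close> the equation for \<open>nf m\<close> reads
  \<open>l1 * m = r * nf m\<close>, so \<open>l1 * m\<close> times the inverse of
  \<open>nf m\<close> is \<open>r\<close>; multiplication by \<open>l2'\<close> lifts this to
  modulus \<open>qq\<close>. The other triple is treated in the same way.\<close>

lemma theta_cong:
  assumes "good m" "good' m"
  shows "[l1 * l1' * m * theta m = delta] (mod qq)"
proof -
  let ?u = "modular_inverse (l2 * m2) (nf m)" and ?u' = "modular_inverse (l2' * m2) (nf' m)"
  have "[(l1 * m) * ?u = r] (mod (l2 * m2))"
  proof -
    have "l1 * m = r * nf m + l2 * m2" using good_eq[OF assms(1)] by simp
    then have "(l1 * m) * ?u = r * (nf m * ?u) + (l2 * m2) * ?u" by (simp only: distrib_right mult.assoc)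
    moreover have "[nf m * ?u = 1] (mod (l2 * m2))" using assms by (intro cong_modular_inverse1) (simp add: good_def)
    then have "[r * (nf m * ?u) + (l2 * m2) * ?u = r * 1 + 0] (mod (l2 * m2))"
      by (intro cong_add cong_mult) (auto simp: cong_0_iff)
    ultimately show ?thesis by simp
  qed
  then have c1: "[l2' * ((l1 * m) * ?u) = l2' * r] (mod qq)"
    using cong_scale_modulus[of "(l1 * m) * ?u" r "l2 * m2" l2'] by (simp add: qq_def mult_ac)
  have "[(l1' * m) * ?u' = r'] (mod (l2' * m2))"
  proof -
    have "l1' * m = r' * nf' m + l2' * m2" using good'_eq[OF assms(2)] by simp
    then have "(l1' * m) * ?u' = r' * (nf' m * ?u') + (l2' * m2) * ?u'" by (simp only: distrib_right mult.assoc)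
    moreover have "[nf' m * ?u' = 1] (mod (l2' * m2))" using assms by (intro cong_modular_inverse1) (simp add: good'_def)
    then have "[r' * (nf' m * ?u') + (l2' * m2) * ?u' = r' * 1 + 0] (mod (l2' * m2))"
      by (intro cong_add cong_mult) (auto simp: cong_0_iff)
    ultimately show ?thesis by simp
  qed
  then have c2: "[l2 * ((l1' * m) * ?u') = l2 * r'] (mod qq)"
    using cong_scale_modulus[of "(l1' * m) * ?u'" r' "l2' * m2" l2] by (simp add: qq_def mult_ac)
  have "l1 * l1' * m * theta m = (- h * (l1 - l2) * l1') * (l2' * ((l1 * m) * ?u)) + (h * (l1' - l2') * l1) * (l2 * ((l1' * m) * ?u'))"
    by (simp add: theta_def algebra_simps)
  also have "[\<dots> = (- h * (l1 - l2) * l1') * (l2' * r) + (h * (l1' - l2') * l1) * (l2 * r')] (mod qq)"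
    by (rule cong_add[OF cong_scalar_left[OF c1] cong_scalar_left[OF c2]])
  also have "(- h * (l1 - l2) * l1') * (l2' * r) + (h * (l1' - l2') * l1) * (l2 * r') = delta"
    by (simp add: delta_def algebra_simps)
  finally show ?thesis .
qed

lemma coprime_m_tt:
  assumes "good m" "good' m" shows "coprime m tt"
proof (rule coprime_if_no_common_prime)
  fix p assume p: "prime p" "p dvd m" "p dvd tt"
  then have P: "p dvd qq" "\<not> p dvd dd" using prime_dvd_tt by (auto simp: simple_primes_def)
  have pr: "\<not> p dvd r" "\<not> p dvd r'" using P(2) by (auto simp: dd_def)
  have "p dvd l2 * m2 \<or> p dvd l2' * m2" using P(1) p(1) unfolding qq_def by (auto simp: prime_dvd_mult_iff)
  then show False
  proof
    assume a: "p dvd l2 * m2"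
    then have "p dvd r * nf m" using p(2) unfolding good_eq[OF assms(1)] by auto
    then have "p dvd nf m" using pr p(1) by (simp add: prime_dvd_mult_iff)
    then show False using a assms(1) p(1) unfolding good_def by (meson coprime_common_divisor not_prime_unit)
  next
    assume a: "p dvd l2' * m2"
    then have "p dvd r' * nf' m" using p(2) unfolding good'_eq[OF assms(2)] by auto
    then have "p dvd nf' m" using pr p(1) by (simp add: prime_dvd_mult_iff)
    then show False using a assms(2) p(1) unfolding good'_def by (meson coprime_common_divisor not_prime_unit)
  qed
qed (use tt_ge_1 in auto)

definition lc where "lc = lcm r r'"

lemma lc_pos: "lc \<ge> 1" using r by (simp add: lc_def int_one_le_iff_zero_less lcm_pos_int)

lemma cong_lc:
  assumes "good m" "good' m" "good m0" "good' m0"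
  shows "lc dvd m - m0"
proof -
  have "r dvd l1 * (m - m0)"
    using assms(1,3) unfolding good_def by (metis dvd_diff right_diff_distrib diff_diff_eq2 add_diff_cancel_right' diff_add_cancel)
  then have "r dvd m - m0" using rl by (simp add: coprime_dvd_mult_right_iff)
  moreover have "r' dvd l1' * (m - m0)"
    using assms(2,4) unfolding good'_def by (metis dvd_diff right_diff_distrib diff_diff_eq2 add_diff_cancel_right' diff_add_cancel)
  then have "r' dvd m - m0" using rl by (simp add: coprime_dvd_mult_right_iff)
  ultimately show ?thesis by (simp add: lc_def)
qed

text \<open>Along a progression with this difference \<open>nf\<close> and \<open>nf'\<close> stay
  constant modulo \<open>ss\<close>, which freezes the phase modulo \<open>ss\<close>; the factor
  \<open>lc\<close> preserves divisibility by \<open>r\<close> and \<open>r'\<close>.\<close>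

definition WW where "WW = lc * ss"

lemma nf_shift:
  assumes "good m0"
  shows "nf (m0 + WW * v) = nf m0 + (l1 * (lc div r) * ss) * v" "r dvd l1 * (m0 + WW * v) - l2 * m2"
proof -
  define k where "k = lc div r"
  have lck: "lc = r * k" by (simp add: lc_def k_def)
  have "l1 * (m0 + WW * v) - l2 * m2 = r * nf m0 + l1 * (WW * v)"
    unfolding good_eq[OF assms] by (simp add: distrib_left)
  also have "\<dots> = r * (nf m0 + (l1 * k * ss) * v)" unfolding WW_def lck by (simp add: distrib_left)
  finally have "l1 * (m0 + WW * v) - l2 * m2 = r * (nf m0 + (l1 * (lc div r) * ss) * v)" unfolding k_def .
  then show "nf (m0 + WW * v) = nf m0 + (l1 * (lc div r) * ss) * v" "r dvd l1 * (m0 + WW * v) - l2 * m2"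
    using r unfolding nf_def by auto
qed

lemma nf'_shift:
  assumes "good' m0"
  shows "nf' (m0 + WW * v) = nf' m0 + (l1' * (lc div r') * ss) * v" "r' dvd l1' * (m0 + WW * v) - l2' * m2"
proof -
  define k where "k = lc div r'"
  have lck: "lc = r' * k" by (simp add: lc_def k_def)
  have "l1' * (m0 + WW * v) - l2' * m2 = r' * nf' m0 + l1' * (WW * v)"
    unfolding good'_eq[OF assms] by (simp add: distrib_left)
  also have "\<dots> = r' * (nf' m0 + (l1' * k * ss) * v)" unfolding WW_def lck by (simp add: distrib_left)
  finally have "l1' * (m0 + WW * v) - l2' * m2 = r' * (nf' m0 + (l1' * (lc div r') * ss) * v)" unfolding k_def .
  then show "nf' (m0 + WW * v) = nf' m0 + (l1' * (lc div r') * ss) * v" "r' dvd l1' * (m0 + WW * v) - l2' * m2"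
    using r unfolding nf'_def by auto
qed

text \<open>A prime common to the modulus and to \<open>qq\<close> divides \<open>ss\<close> or
  \<open>tt\<close>. In the first case it already divides \<open>nf m0\<close>, in the second it
  divides \<open>m\<close>. So along the progression goodness is a matter of ranges and of
  coprimality to \<open>tt\<close>.\<close>

lemma good_shift:
  assumes g: "good m0" and v: "N < nf (m0 + WW * v)" "nf (m0 + WW * v) \<le> 2 * N" and c: "coprime (m0 + WW * v) tt"
  shows "good (m0 + WW * v)"
proof -
  let ?m = "m0 + WW * v" let ?n = "nf ?m"
  have eq: "r * ?n = l1 * ?m - l2 * m2" using nf_shift(2)[OF g, of v] by (simp add: nf_def)
  have n0: "?n \<noteq> 0" using v N by simp
  have c1: "coprime ?n (l2 * m2)"
  proof (rule coprime_if_no_common_prime)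
    fix p assume p: "prime p" "p dvd ?n" "p dvd l2 * m2"
    have "p dvd qq" using p(3) unfolding qq_def by (metis dvd_mult mult.assoc mult.commute)
    then have "p dvd ss \<or> p dvd tt" unfolding qq_eq using p(1) by (simp add: prime_dvd_mult_iff)
    then show False
    proof
      assume "p dvd ss"
      then have "p dvd (l1 * (lc div r) * ss) * v" by simp
      then have "p dvd nf m0" using p(2) unfolding nf_shift(1)[OF g] by (simp add: dvd_add_left_iff)
      then show False using g p unfolding good_def by (meson coprime_common_divisor not_prime_unit)
    next
      assume pt: "p dvd tt"
      have "p dvd l1 * ?m" using p eq by (metis diff_add_cancel dvd_add dvd_mult)
      moreover have "\<not> p dvd l1" using pt p(1) prime_dvd_tt by (auto simp: simple_primes_def dd_def)
      ultimately have "p dvd ?m" using p(1) by (simp add: prime_dvd_mult_iff)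
      then show False using c pt p(1) by (meson coprime_common_divisor not_prime_unit)
    qed
  qed (use n0 in auto)
  moreover have "coprime ?n (l1 * ?m)"
  proof (rule coprime_if_no_common_prime)
    fix p assume p: "prime p" "p dvd ?n" "p dvd l1 * ?m"
    have "l2 * m2 = l1 * ?m - r * ?n" using eq by simp
    then have "p dvd l2 * m2" using p by (metis dvd_diff dvd_mult)
    then show False using c1 p by (meson coprime_common_divisor not_prime_unit)
  qed (use n0 in auto)
  ultimately show ?thesis using v nf_shift(2)[OF g] by (simp add: good_def)
qed

lemma good'_shift:
  assumes g: "good' m0" and v: "N < nf' (m0 + WW * v)" "nf' (m0 + WW * v) \<le> 2 * N" and c: "coprime (m0 + WW * v) tt"
  shows "good' (m0 + WW * v)"
proof -
  let ?m = "m0 + WW * v" let ?n = "nf' ?m"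
  have eq: "r' * ?n = l1' * ?m - l2' * m2" using nf'_shift(2)[OF g, of v] by (simp add: nf'_def)
  have n0: "?n \<noteq> 0" using v N by simp
  have c1: "coprime ?n (l2' * m2)"
  proof (rule coprime_if_no_common_prime)
    fix p assume p: "prime p" "p dvd ?n" "p dvd l2' * m2"
    have "p dvd qq" using p(3) unfolding qq_def by (metis dvd_mult mult.assoc)
    then have "p dvd ss \<or> p dvd tt" unfolding qq_eq using p(1) by (simp add: prime_dvd_mult_iff)
    then show False
    proof
      assume "p dvd ss"
      then have "p dvd (l1' * (lc div r') * ss) * v" by simp
      then have "p dvd nf' m0" using p(2) unfolding nf'_shift(1)[OF g] by (simp add: dvd_add_left_iff)
      then show False using g p unfolding good'_def by (meson coprime_common_divisor not_prime_unit)
    next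
      assume pt: "p dvd tt"
      have "p dvd l1' * ?m" using p eq by (metis diff_add_cancel dvd_add dvd_mult)
      moreover have "\<not> p dvd l1'" using pt p(1) prime_dvd_tt by (auto simp: simple_primes_def dd_def)
      ultimately have "p dvd ?m" using p(1) by (simp add: prime_dvd_mult_iff)
      then show False using c pt p(1) by (meson coprime_common_divisor not_prime_unit)
    qed
  qed (use n0 in auto)
  moreover have "coprime ?n (l1' * ?m)"
  proof (rule coprime_if_no_common_prime)
    fix p assume p: "prime p" "p dvd ?n" "p dvd l1' * ?m"
    have "l2' * m2 = l1' * ?m - r' * ?n" using eq by simp
    then have "p dvd l2' * m2" using p by (metis dvd_diff dvd_mult)
    then show False using c1 p by (meson coprime_common_divisor not_prime_unit)
  qed (use n0 in auto)
  ultimately show ?thesis using v nf'_shift(2)[OF g] by (simp add: good'_def)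
qed

lemma theta_shift_cong:
  assumes "good m0" "good' m0" "good (m0 + WW * v)" "good' (m0 + WW * v)"
  shows "[theta (m0 + WW * v) = theta m0] (mod ss)"
proof -
  have n: "[nf (m0 + WW * v) = nf m0] (mod ss)" "[nf' (m0 + WW * v) = nf' m0] (mod ss)"
    unfolding nf_shift(1)[OF assms(1)] nf'_shift(1)[OF assms(2)] by (simp_all add: cong_iff_dvd_diff)
  have c1: "[l2' * modular_inverse (l2 * m2) (nf (m0 + WW * v)) = l2' * modular_inverse (l2 * m2) (nf m0)] (mod ss)"
    using assms n qq_eq by (intro inverse_cong_divisor) (auto simp: good_def qq_def mult_ac)
  have c2: "[l2 * modular_inverse (l2' * m2) (nf' (m0 + WW * v)) = l2 * modular_inverse (l2' * m2) (nf' m0)] (mod ss)"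
    using assms n qq_eq by (intro inverse_cong_divisor) (auto simp: good'_def qq_def mult_ac)
  show ?thesis unfolding theta_def by (rule cong_add[OF cong_scalar_left[OF c1] cong_scalar_left[OF c2]])
qed

lemma class_sum_bound:
  assumes g0: "good m0" "good' m0" "M < m0" "m0 \<le> 2 * M" and dlt: "delta \<noteq> 0"
  shows "norm (\<Sum>m\<in>{m\<in>{M<..2 * M}. good m \<and> good' m \<and> WW dvd m - m0}. em qq (theta m))
    \<le> 2 ^ card (simple_primes dd qq) * sqrt (of_int tt) * (2 + 2 * (1 + ln (of_int tt)))"
proof -
  let ?S = "{m\<in>{M<..2 * M}. good m \<and> good' m \<and> WW dvd m - m0}"
  define I where "I = {v. M < m0 + WW * v \<and> m0 + WW * v \<le> 2 * M \<and> N < nf (m0 + WW * v) \<and> nf (m0 + WW * v) \<le> 2 * N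
     \<and> N < nf' (m0 + WW * v) \<and> nf' (m0 + WW * v) \<le> 2 * N}"
  have W1: "WW \<ge> 1" unfolding WW_def using lc_pos ss_ge_1 by (simp add: int_one_le_iff_zero_less)
  have I0: "0 \<in> I" using g0 by (auto simp: I_def good_def good'_def)
  have finI: "finite I"
  proof (rule finite_subset)
    show "I \<subseteq> {- 2 * M - \<bar>m0\<bar>..2 * M + \<bar>m0\<bar>}"
    proof
      fix v assume v: "v \<in> I"
      have "\<bar>v\<bar> \<le> \<bar>WW * v\<bar>" using W1 by (simp add: abs_mult mult_le_cancel_right1)
      moreover have "M < m0 + WW * v" "m0 + WW * v \<le> 2 * M" using v by (auto simp: I_def)
      ultimately show "v \<in> {- 2 * M - \<bar>m0\<bar>..2 * M + \<bar>m0\<bar>}" using M by auto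
    qed
  qed auto
  \<comment> \<open>\<open>I\<close> is cut out by linear inequalities in \<open>v\<close>, hence an
    interval.\<close>
  have conv: "b \<in> I" if "a \<in> I" "c \<in> I" "a \<le> b" "b \<le> c" for a b c
  proof -
    have Ilin: "v \<in> I \<longleftrightarrow> (M < m0 + WW * v \<and> m0 + WW * v \<le> 2 * M)
       \<and> (N < nf m0 + (l1 * (lc div r) * ss) * v \<and> nf m0 + (l1 * (lc div r) * ss) * v \<le> 2 * N)
       \<and> (N < nf' m0 + (l1' * (lc div r') * ss) * v \<and> nf' m0 + (l1' * (lc div r') * ss) * v \<le> 2 * N)" for v
      unfolding I_def nf_shift(1)[OF g0(1)] nf'_shift(1)[OF g0(2)] by simp
    note A = that(1)[unfolded Ilin] and C = that(2)[unfolded Ilin]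
    note A1 = conjunct1[OF A] and A2 = conjunct1[OF conjunct2[OF A]] and A3 = conjunct2[OF conjunct2[OF A]]
    note C1 = conjunct1[OF C] and C2 = conjunct1[OF conjunct2[OF C]] and C3 = conjunct2[OF conjunct2[OF C]]
    note lb = linear_between[OF conjunct1 conjunct2 conjunct1 conjunct2 that(3,4)]
    have "M < m0 + WW * b \<and> m0 + WW * b \<le> 2 * M" by (rule lb[OF A1 A1 C1 C1])
    moreover have "N < nf m0 + (l1 * (lc div r) * ss) * b \<and> nf m0 + (l1 * (lc div r) * ss) * b \<le> 2 * N"
      by (rule lb[OF A2 A2 C2 C2])
    moreover have "N < nf' m0 + (l1' * (lc div r') * ss) * b \<and> nf' m0 + (l1' * (lc div r') * ss) * b \<le> 2 * N"
      by (rule lb[OF A3 A3 C3 C3])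
    ultimately show ?thesis unfolding Ilin by (intro conjI) simp_all
  qed
  define u w where "u = Min I" and "w = Max I + 1"
  have I: "I = {u..<w}" unfolding u_def w_def
  proof (rule convex_int_set_interval[OF finI])
    show "I \<noteq> {}" using I0 by blast
    fix a b c assume "a \<in> I" "c \<in> I" "a \<le> b" "b \<le> c"
    then show "b \<in> I" by (rule conv)
  qed
  have uw: "u \<le> w" using I0 unfolding I by simp
  \<comment> \<open>The steps have size at least \<open>ss\<close> and
    \<open>M < qq = ss * tt\<close>, so fewer than \<open>tt\<close> steps fit and two periods cover
    the interval.\<close>
  have len: "of_int (w - u) / of_int tt \<le> (2 :: real)"
  proof -
    have "u \<in> I" "w - 1 \<in> I" using I0 unfolding I by auto
    then have "WW * (w - 1) - WW * u < M" by (auto simp: I_def)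
    then have "WW * (w - 1 - u) < M" by (simp add: right_diff_distrib)
    moreover have "ss * (w - 1 - u) \<le> WW * (w - 1 - u)"
    proof (rule mult_right_mono)
      show "ss \<le> WW" unfolding WW_def using lc_pos ss_ge_1 by (simp add: mult_le_cancel_right1)
      show "0 \<le> w - 1 - u" using I0 unfolding I by simp
    qed
    ultimately have "ss * (w - 1 - u) < qq" using qq_gt by linarith
    then have "ss * (w - 1 - u) < ss * tt" by (simp add: qq_eq)
    then have "w - 1 - u < tt" using ss_ge_1 by simp
    then have "w - u \<le> 2 * tt" using tt_ge_1 by linarith
    then have "real_of_int (w - u) \<le> 2 * of_int tt" by (metis of_int_le_iff of_int_mult of_int_numeral)
    then show ?thesis using tt_ge_1 by (simp add: divide_le_eq)
  qed
  have copr: "coprime (l1 * l1') tt" "coprime delta tt" by (rule coprime_tt_if_dvd_dd; simp add: dd_def)+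
  have copW: "coprime WW tt"
  proof -
    have "coprime lc tt"
    proof -
      have "lc dvd dd" unfolding lc_def dd_def by (intro lcm_least) auto
      then show ?thesis by (rule coprime_tt_if_dvd_dd)
    qed
    then show ?thesis unfolding WW_def using coprime_ss_tt by simp
  qed
  \<comment> \<open>The phase difference is a multiple of \<open>ss\<close>. Dividing it by
    \<open>ss\<close> modulo \<open>tt\<close> (factor \<open>\<sigma>\<close>) and solving for
    \<open>theta\<close> (factor \<open>\<kappa>\<close>) leaves \<open>B\<close> times an
    inverse.\<close>
  define \<sigma> where "\<sigma> = modular_inverse tt ss"
  define \<kappa> where "\<kappa> = modular_inverse tt (l1 * l1')"
  define B where "B = \<sigma> * delta * \<kappa>"
  have \<sigma>: "[ss * \<sigma> = 1] (mod tt)" unfolding \<sigma>_def by (rule cong_modular_inverse1[OF coprime_ss_tt])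
  have \<kappa>: "[l1 * l1' * \<kappa> = 1] (mod tt)" unfolding \<kappa>_def by (rule cong_modular_inverse1[OF copr(1)])
  have copB: "coprime B tt"
  proof -
    have "coprime \<sigma> tt" using \<sigma> by (metis cong_imp_coprime cong_sym coprime_1_left coprime_mult_left_iff)
    moreover have "coprime \<kappa> tt" using \<kappa> by (metis cong_imp_coprime cong_sym coprime_1_left coprime_mult_left_iff)
    ultimately show ?thesis unfolding B_def using copr(2) by simp
  qed
  have th: "[theta m = delta * \<kappa> * modular_inverse tt m] (mod tt)" if "good m" "good' m" for m
  proof -
    have cm: "coprime m tt" using coprime_m_tt[OF that] .
    have e1: "[(l1 * l1' * m) * theta m = delta] (mod tt)"
      using theta_cong[OF that] unfolding qq_eq by (metis cong_dvd_modulus dvd_triv_right)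
    have e2: "[(l1 * l1' * m) * (delta * \<kappa> * modular_inverse tt m) = delta] (mod tt)"
    proof -
      have "[(l1 * l1' * \<kappa>) * (m * modular_inverse tt m) * delta = 1 * 1 * delta] (mod tt)"
        using \<kappa> cong_modular_inverse1[OF cm] by (intro cong_mult) auto
      then show ?thesis by (simp add: mult_ac)
    qed
    have "[(l1 * l1' * m) * theta m = (l1 * l1' * m) * (delta * \<kappa> * modular_inverse tt m)] (mod tt)"
      by (rule cong_trans[OF e1 cong_sym[OF e2]])
    moreover have "coprime (l1 * l1' * m) tt" using copr(1) cm by simp
    ultimately show ?thesis by (simp only: cong_mult_lcancel)
  qed
  define K where "K = em qq (theta m0) * em tt (- (B * modular_inverse tt m0))"
  have val: "em qq (theta (m0 + WW * v)) = K * em tt (B * modular_inverse tt (m0 + WW * v))"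
    if g: "good (m0 + WW * v)" "good' (m0 + WW * v)" for v
  proof -
    let ?m = "m0 + WW * v"
    have "ss dvd theta ?m - theta m0" using theta_shift_cong[OF g0(1,2) g] by (simp add: cong_iff_dvd_diff)
    then obtain x where x: "theta ?m - theta m0 = ss * x" by blast
    have "[x = (\<sigma> * ss) * x] (mod tt)" using cong_scalar_right[OF cong_sym[OF \<sigma>], of x] by (simp add: mult.commute)
    also have "(\<sigma> * ss) * x = \<sigma> * (theta ?m - theta m0)" by (simp add: x)
    also have "[\<sigma> * (theta ?m - theta m0) = \<sigma> * (delta * \<kappa> * modular_inverse tt ?m - delta * \<kappa> * modular_inverse tt m0)] (mod tt)"
      using th[OF g] th[OF g0(1,2)] by (intro cong_mult cong_diff) auto
    also have "\<sigma> * (delta * \<kappa> * modular_inverse tt ?m - delta * \<kappa> * modular_inverse tt m0) = B * modular_inverse tt ?m + (- (B * modular_inverse tt m0))"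
      by (simp add: B_def algebra_simps)
    finally have "em tt x = em tt (B * modular_inverse tt ?m) * em tt (- (B * modular_inverse tt m0))"
      unfolding em_add[symmetric] using tt_ge_1 by (intro em_cong) auto
    moreover have "em qq (theta ?m) = em qq (theta m0) * em tt x"
    proof -
      have "theta ?m = theta m0 + ss * x" using x by simp
      then show ?thesis unfolding qq_eq using ss_ge_1 by (simp add: em_add em_scale)
    qed
    ultimately show ?thesis by (simp add: K_def mult_ac)
  qed
  have E: "(\<Sum>m\<in>?S. em qq (theta m)) = (\<Sum>v\<in>{v\<in>{u..<w}. coprime (m0 + WW * v) tt}. K * em tt (B * modular_inverse tt (m0 + WW * v)))"
  proof (rule sum.reindex_bij_witness[of _ "\<lambda>v. m0 + WW * v" "\<lambda>m. (m - m0) div WW"])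
    fix m assume m: "m \<in> ?S"
    have e: "m0 + WW * ((m - m0) div WW) = m" using m by simp
    then show "m0 + WW * ((m - m0) div WW) = m" .
    show "(m - m0) div WW \<in> {v\<in>{u..<w}. coprime (m0 + WW * v) tt}"
      unfolding I[symmetric] using m e coprime_m_tt[of m] by (simp add: I_def good_def good'_def)
    show "K * em tt (B * modular_inverse tt (m0 + WW * ((m - m0) div WW))) = em qq (theta m)"
      using val[of "(m - m0) div WW"] m unfolding e by simp
  next
    fix v assume v: "v \<in> {v\<in>{u..<w}. coprime (m0 + WW * v) tt}"
    then have vI: "v \<in> I" "coprime (m0 + WW * v) tt" unfolding I by auto
    show "(m0 + WW * v - m0) div WW = v" using W1 by simp
    show "m0 + WW * v \<in> ?S"
      using vI good_shift[OF g0(1), of v] good'_shift[OF g0(2), of v] by (simp add: I_def)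
  qed
  have "norm (\<Sum>m\<in>?S. em qq (theta m)) = norm (\<Sum>v\<in>{v\<in>{u..<w}. coprime (m0 + WW * v) tt}. em tt (B * modular_inverse tt (m0 + WW * v)))"
    unfolding E by (simp add: sum_distrib_left[symmetric] norm_mult K_def)
  moreover have "norm (\<Sum>v\<in>{v\<in>{u..<w}. coprime (m0 + WW * v) tt}. em tt (B * modular_inverse tt (m0 + WW * v)))
     \<le> 2 ^ card (simple_primes dd qq) * sqrt (of_int tt) * (of_int (w - u) / of_int tt + 2 * (1 + ln (of_int tt)))"
    unfolding tt_def
    by (rule incomplete_kloosterman_bound) (use sp copB copW uw in \<open>auto simp: tt_def\<close>)
  moreover have "2 ^ card (simple_primes dd qq) * sqrt (of_int tt) * (of_int (w - u) / of_int tt + 2 * (1 + ln (of_int tt)))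
     \<le> 2 ^ card (simple_primes dd qq) * sqrt (of_int tt) * (2 + 2 * (1 + ln (of_int tt)))"
    using len by (intro mult_left_mono) (use tt_ge_1 in auto)
  ultimately show ?thesis by linarith
qed

text \<open>All good \<open>m\<close> agree modulo \<open>lc\<close>, so they fall into at most
  \<open>ss\<close> classes modulo \<open>WW\<close>, each handled by
  \<open>class_sum_bound\<close>.\<close>

theorem correlation_bound:
  assumes dlt: "delta \<noteq> 0"
  shows "norm (\<Sum>m\<in>{m\<in>{M<..2 * M}. good m \<and> good' m}. em qq (theta m))
    \<le> of_int ss * (2 ^ card (simple_primes dd qq) * sqrt (of_int tt) * (2 + 2 * (1 + ln (of_int tt))))"
proof (cases "{m\<in>{M<..2 * M}. good m \<and> good' m} = {}")
  case True
  then show ?thesis using ss_ge_1 tt_ge_1 by (simp only:) simp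
next
  case False
  let ?S = "{m\<in>{M<..2 * M}. good m \<and> good' m}"
  let ?B = "2 ^ card (simple_primes dd qq) * sqrt (of_int tt) * (2 + 2 * (1 + ln (real_of_int tt)))"
  have B0: "?B \<ge> 0" using tt_ge_1 by simp
  obtain mb where mb: "mb \<in> ?S" using False by blast
  define k where "k = (\<lambda>m. ((m - mb) div lc) mod ss)"
  have finS: "finite ?S" by (rule finite_subset[of _ "{M<..2 * M}"]) auto
  have E: "(\<Sum>m\<in>?S. em qq (theta m)) = (\<Sum>i\<in>{0..<ss}. \<Sum>m\<in>{m\<in>?S. k m = i}. em qq (theta m))"
    using finS by (rule sum.group[symmetric]) (use ss_ge_1 in \<open>auto simp: k_def\<close>)
  have "norm (\<Sum>m\<in>?S. em qq (theta m)) \<le> (\<Sum>i\<in>{0..<ss}. ?B)"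
    unfolding E
  proof (rule order_trans[OF norm_sum], rule sum_mono)
    fix i
    show "norm (\<Sum>m\<in>{m\<in>?S. k m = i}. em qq (theta m)) \<le> ?B"
    proof (cases "{m\<in>?S. k m = i} = {}")
      case True
      show ?thesis unfolding True using B0 by simp
    next
      case False
      then obtain m0 where m0: "m0 \<in> ?S" "k m0 = i" by blast
      have "{m\<in>?S. k m = i} = {m\<in>{M<..2 * M}. good m \<and> good' m \<and> WW dvd m - m0}"
      proof -
        have "k m = i \<longleftrightarrow> WW dvd m - m0" if m: "m \<in> ?S" for m
        proof -
          obtain x where x: "m - mb = lc * x" using cong_lc[of m mb] m mb by auto
          obtain y where y: "m0 - mb = lc * y" using cong_lc[of m0 mb] m0 mb by auto
          have "k m = i \<longleftrightarrow> x mod ss = y mod ss" unfolding m0(2)[symmetric] k_def x y using lc_pos by simp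
          also have "\<dots> \<longleftrightarrow> ss dvd x - y" by (simp add: mod_eq_dvd_iff)
          also have "\<dots> \<longleftrightarrow> lc * ss dvd lc * (x - y)" using lc_pos by simp
          also have "lc * (x - y) = m - m0" using x y by (simp add: right_diff_distrib)
          finally show ?thesis by (simp add: WW_def)
        qed
        then show ?thesis by blast
      qed
      then show ?thesis using class_sum_bound[of m0] m0 dlt by (simp only:) auto
    qed
  qed
  also have "\<dots> = of_int ss * ?B" using ss_ge_1 by simp
  finally show ?thesis .
qed

end

section \<open>The setting of the amplification\<close>

lemma prod_primes_mono_dvd:
  fixes P Q :: "int set"
  assumes "finite Q" "P \<subseteq> Q" shows "\<Prod>P dvd \<Prod>Q"
  using assms by (metis prod_dvd_prod_subset)

text \<open>The condition \<open>big\<close> is what keeps the off-diagonal correlations below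
  \<open>(N * lam)^2\<close>. From \<open>100 * M <= N\<close> every \<open>r\<close> that occurs is
  smaller than the primes in \<open>Lam\<close>, hence coprime to them. The condition
  \<open>h * M <= N\<close> makes the error in reciprocity negligible.\<close>

locale amplifier =
  fixes M N h :: int and Lam :: "int set" and lam :: real
  assumes M: "M \<ge> 1" and MN: "100 * M \<le> N" and h: "h \<ge> 1" and hM: "h * M \<le> N"
    and finLam: "finite Lam"
    and Lam: "\<And>l. l \<in> Lam \<Longrightarrow> prime l \<and> lam / 2 < of_int l \<and> of_int l \<le> lam \<and> \<not> l dvd h"
    and lam1: "lam \<ge> 1" and lamN: "lam \<le> of_int N"
    and big: "lam ^ 5 * of_int M ^ 3 * sqrt (of_int M) \<le> of_int N ^ 4"
begin

abbreviation Z where "Z \<equiv> dmax N"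

lemma N1: "N \<ge> 100" using M MN by simp
lemma Z1: "Z \<ge> 1" using dmax_ge_1 N1 by simp
lemma hN: "h \<le> N" using hM M h by (smt (verit) mult_le_cancel_left1)

lemma Lam_le: "l \<in> Lam \<Longrightarrow> 0 < l \<and> l \<le> N"
proof -
  assume l: "l \<in> Lam"
  then have "real_of_int l \<le> of_int N" using Lam[OF l] lamN by linarith
  then show ?thesis using Lam[OF l] prime_gt_0_int by auto
qed

lemma card_Lam: "real (card Lam) \<le> lam"
proof -
  have "Lam \<subseteq> {1..\<lfloor>lam\<rfloor>}" using Lam Lam_le by (auto simp: le_floor_iff int_one_le_iff_zero_less)
  then have "card Lam \<le> card {1..\<lfloor>lam\<rfloor>}" by (intro card_mono) auto
  then show ?thesis using lam1 by simp linarith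
qed

text \<open>The possible \<open>r\<close>, from
  \<open>\<bar>r\<bar> * n = \<bar>l1 * m1 - l2 * m2\<bar>\<close> with
  \<open>n > N\<close>.\<close>

definition Rs where "Rs = {r :: int. r \<noteq> 0 \<and> of_int \<bar>r\<bar> * of_int N \<le> 2 * of_int M * lam}"

lemma Rs_card: "finite Rs" "real (card Rs) \<le> 4 * of_int M * lam / of_int N"
proof -
  define B where "B = 2 * of_int M * lam / of_int N"
  have B0: "B \<ge> 0" using M lam1 N1 by (simp add: B_def)
  have iff: "of_int \<bar>r\<bar> * of_int N \<le> 2 * of_int M * lam \<longleftrightarrow> \<bar>r\<bar> \<le> \<lfloor>B\<rfloor>" for r :: int
    using N1 by (simp add: B_def le_floor_iff pos_le_divide_eq)
  have sub: "Rs \<subseteq> {1..\<lfloor>B\<rfloor>} \<union> {-\<lfloor>B\<rfloor>..-1}" unfolding Rs_def iff by auto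
  show "finite Rs" by (rule finite_subset[OF sub]) auto
  have "card Rs \<le> card ({1..\<lfloor>B\<rfloor>} \<union> {-\<lfloor>B\<rfloor>..-1})" by (rule card_mono[OF _ sub]) auto
  also have "\<dots> \<le> card {1..\<lfloor>B\<rfloor>} + card {-\<lfloor>B\<rfloor>..-1}" by (rule card_Un_le)
  also have "\<dots> = 2 * nat \<lfloor>B\<rfloor>" by simp
  finally have "real (card Rs) \<le> real (2 * nat \<lfloor>B\<rfloor>)" by (simp only: of_nat_le_iff)
  also have "\<dots> \<le> 2 * B" using B0 by simp
  finally show "real (card Rs) \<le> 4 * of_int M * lam / of_int N" by (simp add: B_def)
qed

lemma Rs_less: "r \<in> Rs \<Longrightarrow> l \<in> Lam \<Longrightarrow> \<bar>r\<bar> < l"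
proof -
  assume r: "r \<in> Rs" and l: "l \<in> Lam"
  have "real_of_int (100 * M) \<le> of_int N" using MN by (simp only: of_int_le_iff)
  then have "of_int \<bar>r\<bar> * (100 * of_int M) \<le> of_int \<bar>r\<bar> * real_of_int N"
    by (intro mult_left_mono) auto
  also have "\<dots> \<le> 2 * of_int M * lam" using r by (simp add: Rs_def)
  finally have "of_int M * (of_int \<bar>r\<bar> * 100) \<le> of_int M * (2 * lam)" by (simp add: mult_ac)
  then have "of_int \<bar>r\<bar> * 100 \<le> 2 * lam" using M by (simp only: mult_le_cancel_left)
  then have "of_int \<bar>r\<bar> < real_of_int l" using Lam[OF l] lam1 by linarith
  then show ?thesis by (simp only: of_int_less_iff)
qed

lemma Rs_coprime: "r \<in> Rs \<Longrightarrow> l \<in> Lam \<Longrightarrow> \<not> l dvd r"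
proof
  assume a: "r \<in> Rs" "l \<in> Lam" "l dvd r"
  then have "r \<noteq> 0" by (simp add: Rs_def)
  then have "\<bar>l\<bar> \<le> \<bar>r\<bar>" using a(3) by (rule dvd_imp_le_int)
  then show False using Rs_less[OF a(1,2)] by linarith
qed

text \<open>A triple \<open>(l1, l2, r)\<close> and a pair \<open>m1, m2\<close> determine the modulus \<open>n\<close> through \<open>l1 * m1 - l2 * m2 = r * n\<close>;
  \<open>ph\<close> is the phase \<open>e(h (m1' - m2') / n)\<close> after reciprocity, up to a negligible factor, and \<open>Delta\<close> vanishes only
  for those pairs of triples whose phases need not oscillate against each other.\<close>

definition Taus where "Taus = {(l1, l2, r). l1 \<in> Lam \<and> l2 \<in> Lam \<and> r \<in> Rs \<and> l1 \<noteq> l2}"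

lemma Taus_sub: "Taus \<subseteq> Lam \<times> Lam \<times> Rs" by (auto simp: Taus_def)
lemma finTaus: "finite Taus" by (rule finite_subset[OF Taus_sub]) (auto simp: finLam Rs_card)

definition nn where "nn = (\<lambda>(l1, l2, r) m1 m2. (l1 * m1 - l2 * m2) div r)"
definition valid where "valid = (\<lambda>(l1, l2, r) m1 m2. r dvd l1 * m1 - l2 * m2
   \<and> N < nn (l1, l2, r) m1 m2 \<and> nn (l1, l2, r) m1 m2 \<le> 2 * N
   \<and> coprime (nn (l1, l2, r) m1 m2) (l2 * m2) \<and> coprime (nn (l1, l2, r) m1 m2) (l1 * m1))"
definition ph where "ph = (\<lambda>(l1, l2, r) m1 m2. em (l2 * m2) (- h * (l1 - l2) * modular_inverse (l2 * m2) (nn (l1, l2, r) m1 m2)))"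
definition Delta where "Delta = (\<lambda>(l1, l2, r) (l1', l2', r'). - h * (l1 - l2) * l1' * l2' * r + h * (l1' - l2') * l1 * l2 * r')"
definition corr where "corr \<tau> \<tau>' m2 = (\<Sum>m1\<in>{m1\<in>{M<..2 * M}. valid \<tau> m1 m2 \<and> valid \<tau>' m1 m2}. ph \<tau> m1 m2 * cnj (ph \<tau>' m1 m2))"
text \<open>Loss factor of a pair of triples: coinciding primes may drop out of the simple part of
  the modulus, which costs up to \<open>lam\<close>.\<close>

definition kap where "kap = (\<lambda>(l1, l2, r :: int) (l1', l2', r' :: int). 1 + lam * (of_bool (l2 = l1') + of_bool (l2 = l2') + of_bool (l2' = l1)))"

lemma norm_ph [simp]: "norm (ph \<tau> m1 m2) = 1" by (cases \<tau>) (simp add: ph_def)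

text \<open>In \<open>Delta = 0\<close> the primes \<open>l1'\<close> and \<open>l2'\<close> divide
  one side; they divide neither their difference nor \<open>r'\<close>, so they must be
  \<open>l1\<close> and \<open>l2\<close> in some order, and the order fixes the sign of
  \<open>r'\<close>.\<close>

lemma Delta_zero:
  assumes "\<tau> \<in> Taus" "\<tau>' \<in> Taus" "Delta \<tau> \<tau>' = 0"
  shows "\<tau>' \<in> {\<tau>, (fst (snd \<tau>), fst \<tau>, - snd (snd \<tau>))}"
proof -
  obtain l1 l2 r l1' l2' r' where T: "\<tau> = (l1, l2, r)" "\<tau>' = (l1', l2', r')" by (metis prod_cases3)
  have mem: "l1 \<in> Lam" "l2 \<in> Lam" "l1' \<in> Lam" "l2' \<in> Lam" "r \<in> Rs" "r' \<in> Rs" "l1 \<noteq> l2" "l1' \<noteq> l2'"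
    using assms T by (auto simp: Taus_def)
  have pr: "prime l1" "prime l2" "prime l1'" "prime l2'" using Lam mem by auto
  have "h * ((l1 - l2) * l1' * l2' * r) = h * ((l1' - l2') * l1 * l2 * r')"
    using assms(3) by (simp add: T Delta_def algebra_simps)
  then have eq: "(l1 - l2) * l1' * l2' * r = (l1' - l2') * l1 * l2 * r'" using h by simp
  have nr: "\<not> l1' dvd r'" "\<not> l2' dvd r'" using Rs_coprime mem by auto
  have nd: "\<not> l1' dvd l1' - l2'" "\<not> l2' dvd l1' - l2'"
  proof -
    show "\<not> l1' dvd l1' - l2'"
    proof
      assume "l1' dvd l1' - l2'"
      then have "l1' dvd l2'" by (metis dvd_diff dvd_refl diff_diff_eq2 add_diff_cancel_left')
      then show False using pr mem primes_dvd_imp_eq by blast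
    qed
    show "\<not> l2' dvd l1' - l2'"
    proof
      assume "l2' dvd l1' - l2'"
      then have "l2' dvd l1'" by (metis dvd_add dvd_refl diff_add_cancel)
      then show False using pr mem primes_dvd_imp_eq by blast
    qed
  qed
  have "l1' dvd (l1' - l2') * l1 * l2 * r'" unfolding eq[symmetric] by simp
  then have "l1' dvd l1 \<or> l1' dvd l2" using nr nd pr by (auto simp: prime_dvd_mult_iff)
  then have 1: "l1' = l1 \<or> l1' = l2" using pr primes_dvd_imp_eq by blast
  have "l2' dvd (l1' - l2') * l1 * l2 * r'" unfolding eq[symmetric] by simp
  then have "l2' dvd l1 \<or> l2' dvd l2" using nr nd pr by (auto simp: prime_dvd_mult_iff)
  then have 2: "l2' = l1 \<or> l2' = l2" using pr primes_dvd_imp_eq by blast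
  have c0: "(l1 - l2) * l1 * l2 \<noteq> 0" using mem Lam_le by fastforce
  consider "l1' = l1" "l2' = l2" | "l1' = l2" "l2' = l1" using 1 2 mem by blast
  then show ?thesis
  proof cases
    case 1
    have "((l1 - l2) * l1 * l2) * r = ((l1 - l2) * l1 * l2) * r'" using eq 1 by simp
    then have "r = r'" using c0 by simp
    then show ?thesis using 1 T by simp
  next
    case 2
    have "((l1 - l2) * l1 * l2) * r = ((l1 - l2) * l1 * l2) * (- r')" using eq 2 by (simp add: algebra_simps)
    then have "r = - r'" using c0 by (metis mult_left_cancel)
    then show ?thesis using 2 T by simp
  qed
qed

lemma card_Delta_zero: "\<tau> \<in> Taus \<Longrightarrow> card {\<tau>'\<in>Taus. Delta \<tau> \<tau>' = 0} \<le> 2"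
proof -
  assume t: "\<tau> \<in> Taus"
  have "card {\<tau>'\<in>Taus. Delta \<tau> \<tau>' = 0} \<le> card {\<tau>, (fst (snd \<tau>), fst \<tau>, - snd (snd \<tau>))}"
    using Delta_zero[OF t] by (intro card_mono) auto
  also have "\<dots> \<le> 2" by (simp add: card_insert_if)
  finally show ?thesis .
qed

text \<open>Given \<open>l1\<close> and \<open>l2\<close>, the number \<open>r\<close> divides
  \<open>l1 * m1 - l2 * m2\<close>, which is nonzero for a valid triple.\<close>

lemma card_valid:
  assumes m: "m1 \<in> {M<..2 * M}" "m2 \<in> {M<..2 * M}"
  shows "real (card {\<tau>\<in>Taus. valid \<tau> m1 m2}) \<le> 2 * lam\<^sup>2 * Z"
proof -
  define w where "w = (\<lambda>(l1, l2). l1 * m1 - l2 * m2)"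
  define A where "A = (\<lambda>x :: int \<times> int. {r. w x \<noteq> 0 \<and> r dvd w x})"
  have cardA: "real (card (A x)) \<le> 2 * Z" "finite (A x)" if x: "x \<in> Lam \<times> Lam" for x
  proof -
    have "real (card (A x)) \<le> 2 * Z \<and> finite (A x)"
    proof (cases "w x = 0")
      case True
      then show ?thesis using Z1 by (simp add: A_def)
    next
      case False
      let ?D = "{d. 0 < d \<and> d dvd w x}"
      have sub: "A x \<subseteq> ?D \<union> uminus ` ?D"
      proof
        fix r assume r: "r \<in> A x"
        then have "r \<noteq> 0" using False by (auto simp: A_def)
        then consider "r > 0" | "- r > 0" by linarith
        then show "r \<in> ?D \<union> uminus ` ?D"
          by cases (use r in \<open>auto simp: A_def intro: image_eqI[of _ _ "- r"]\<close>)
      qed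
      have fD: "finite ?D" using False by (rule finite_pos_divisors)
      have "card (A x) \<le> card (?D \<union> uminus ` ?D)" using fD by (intro card_mono sub) auto
      also have "\<dots> \<le> card ?D + card (uminus ` ?D)" by (rule card_Un_le)
      also have "\<dots> \<le> 2 * ndiv (w x)" using card_image_le[OF fD, of uminus] by (simp add: ndiv_def)
      finally have "real (card (A x)) \<le> 2 * real (ndiv (w x))" by simp
      also have "real (ndiv (w x)) \<le> Z"
      proof (rule ndiv_le_dmax[OF False])
        obtain l1 l2 where x2: "x = (l1, l2)" "l1 \<in> Lam" "l2 \<in> Lam" using x by auto
        have "0 \<le> l1 * m1" "l1 * m1 \<le> N * N" "0 \<le> l2 * m2" "l2 * m2 \<le> N * N"
          using Lam_le[OF x2(2)] Lam_le[OF x2(3)] m M MN by (auto intro!: mult_mono)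
        then have "\<bar>w x\<bar> \<le> N ^ 2" by (simp add: w_def x2 power2_eq_square)
        also have "N ^ 2 \<le> N ^ 20" using N1 by (intro power_increasing) auto
        finally show "\<bar>w x\<bar> \<le> N ^ 20" .
      qed
      finally show ?thesis using finite_subset[OF sub] fD by auto
    qed
    then show "real (card (A x)) \<le> 2 * Z" "finite (A x)" by auto
  qed
  have "{\<tau>\<in>Taus. valid \<tau> m1 m2} \<subseteq> (\<lambda>((l1, l2), r). (l1, l2, r)) ` Sigma (Lam \<times> Lam) A"
  proof
    fix \<tau> assume t: "\<tau> \<in> {\<tau>\<in>Taus. valid \<tau> m1 m2}"
    obtain l1 l2 r where T: "\<tau> = (l1, l2, r)" by (metis prod_cases3)
    have "w (l1, l2) \<noteq> 0" using t N1 by (auto simp: T valid_def nn_def w_def)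
    then have "((l1, l2), r) \<in> Sigma (Lam \<times> Lam) A" using t by (auto simp: T Taus_def valid_def A_def w_def)
    then show "\<tau> \<in> (\<lambda>((l1, l2), r). (l1, l2, r)) ` Sigma (Lam \<times> Lam) A" unfolding T by force
  qed
  then have "card {\<tau>\<in>Taus. valid \<tau> m1 m2} \<le> card ((\<lambda>((l1, l2), r). (l1, l2, r)) ` Sigma (Lam \<times> Lam) A)"
    using finLam cardA by (intro card_mono) auto
  also have "\<dots> \<le> card (Sigma (Lam \<times> Lam) A)" using finLam cardA by (intro card_image_le) auto
  also have "\<dots> = (\<Sum>x\<in>Lam \<times> Lam. card (A x))" using finLam cardA by (intro card_SigmaI) auto
  finally have "real (card {\<tau>\<in>Taus. valid \<tau> m1 m2}) \<le> (\<Sum>x\<in>Lam \<times> Lam. real (card (A x)))"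
    by (simp flip: of_nat_sum)
  also have "\<dots> \<le> (\<Sum>x\<in>Lam \<times> Lam. 2 * Z)" using cardA by (intro sum_mono) auto
  also have "\<dots> = (real (card Lam))\<^sup>2 * (2 * Z)" by (simp add: card_cartesian_product power2_eq_square)
  also have "\<dots> \<le> lam\<^sup>2 * (2 * Z)" using card_Lam Z1 by (intro mult_right_mono power_mono) auto
  finally show ?thesis by (simp add: mult_ac)
qed

text \<open>Each coincidence of primes removes a sum over \<open>Lam\<close>, which pays for its
  factor \<open>lam\<close>.\<close>

lemma sum_kap: "(\<Sum>\<tau>\<in>Taus. \<Sum>\<tau>'\<in>Taus. kap \<tau> \<tau>') \<le> 4 * lam ^ 4 * (real (card Rs))\<^sup>2"
proof -
  let ?n = "real (card Lam)"
  have k0: "kap \<tau> \<tau>' \<ge> 0" for \<tau> \<tau>' using lam1 by (cases \<tau>; cases \<tau>') (auto simp: kap_def)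
  have inner: "(\<Sum>\<tau>'\<in>Taus. kap \<tau> \<tau>') \<le> 4 * lam\<^sup>2 * real (card Rs)" if t: "\<tau> \<in> Taus" for \<tau>
  proof -
    obtain l1 l2 r where T: "\<tau> = (l1, l2, r)" by (metis prod_cases3)
    have l: "l1 \<in> Lam" "l2 \<in> Lam" using t T by (auto simp: Taus_def)
    have "(\<Sum>\<tau>'\<in>Taus. kap \<tau> \<tau>') \<le> (\<Sum>\<tau>'\<in>Lam \<times> Lam \<times> Rs. kap \<tau> \<tau>')"
      by (rule sum_mono2[OF _ Taus_sub k0]) (use finLam Rs_card in auto)
    also have "\<dots> = (\<Sum>l1'\<in>Lam. \<Sum>l2'\<in>Lam. \<Sum>r'\<in>Rs. kap \<tau> (l1', l2', r'))"
      by (simp add: sum.cartesian_product)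
    also have "\<dots> = real (card Rs) * (\<Sum>l1'\<in>Lam. \<Sum>l2'\<in>Lam. 1 + lam * (of_bool (l2 = l1') + of_bool (l2 = l2') + of_bool (l2' = l1)))"
      by (simp add: T kap_def sum_distrib_left)
    also have "(\<Sum>l1'\<in>Lam. \<Sum>l2'\<in>Lam. 1 + lam * (of_bool (l2 = l1') + of_bool (l2 = l2') + of_bool (l2' = l1)))
        = ?n * ?n + lam * (\<Sum>l1'\<in>Lam. \<Sum>l2'\<in>Lam. of_bool (l2 = l1') + of_bool (l2 = l2') + of_bool (l2' = l1))"
      unfolding sum.distrib[of "\<lambda>_. 1"] sum_distrib_left[symmetric]
      by (simp only: sum.distrib[of "\<lambda>_. real (card Lam)"] sum_constant sum_distrib_left[symmetric] mult_1_right)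
    also have "(\<Sum>l1'\<in>Lam. \<Sum>l2'\<in>Lam. of_bool (l2 = l1') + of_bool (l2 = l2') + of_bool (l2' = l1)) = 3 * ?n"
    proof -
      have "(\<Sum>l'\<in>Lam. of_bool (l2 = l') :: real) = 1" "(\<Sum>l'\<in>Lam. of_bool (l' = l1) :: real) = 1"
        using l finLam by (simp_all add: of_bool_def)
      then show ?thesis by (simp add: sum.distrib sum_distrib_left[symmetric])
    qed
    also have "?n * ?n + lam * (3 * ?n) \<le> lam * lam + lam * (3 * lam)"
      using card_Lam lam1 by (intro add_mono mult_mono mult_left_mono) auto
    also have "real (card Rs) * (lam * lam + lam * (3 * lam)) = 4 * lam\<^sup>2 * real (card Rs)" by (simp add: power2_eq_square)
    finally show ?thesis by (simp add: mult_left_mono)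
  qed
  have "(\<Sum>\<tau>\<in>Taus. \<Sum>\<tau>'\<in>Taus. kap \<tau> \<tau>') \<le> real (card Taus) * (4 * lam\<^sup>2 * real (card Rs))"
    using sum_bounded_above[of Taus "\<lambda>\<tau>. \<Sum>\<tau>'\<in>Taus. kap \<tau> \<tau>'" "4 * lam\<^sup>2 * real (card Rs)"] inner by simp
  also have "real (card Taus) \<le> lam\<^sup>2 * real (card Rs)"
  proof -
    have "card Taus \<le> card (Lam \<times> Lam \<times> Rs)" using Taus_sub finLam Rs_card by (intro card_mono) auto
    then have "real (card Taus) \<le> ?n * ?n * real (card Rs)" by (simp add: card_cartesian_product flip: of_nat_mult)
    also have "\<dots> \<le> lam * lam * real (card Rs)" using card_Lam lam1 by (intro mult_mono mult_right_mono) auto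
    finally show ?thesis by (simp add: power2_eq_square)
  qed
  finally have "(\<Sum>\<tau>\<in>Taus. \<Sum>\<tau>'\<in>Taus. kap \<tau> \<tau>') \<le> (lam\<^sup>2 * real (card Rs)) * (4 * lam\<^sup>2 * real (card Rs))"
    by (simp add: mult_right_mono)
  then show ?thesis by (simp add: power2_eq_square power4_eq_xxxx mult_ac)
qed

text \<open>\<open>dd * l2 * l2'\<close>, which does not involve \<open>m2\<close>: this allows
  averaging the cofactor over \<open>m2\<close> by \<open>sum_cofactor_le\<close>.\<close>

definition Dp where "Dp = (\<lambda>(l1, l2, r) (l1', l2', r'). h * r * r' * l1 * l1' * Delta (l1, l2, r) (l1', l2', r') * l2 * l2')"
text \<open>Its gcd with \<open>m2\<close> detects when \<open>l2\<close> or \<open>l2'\<close>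
  divides \<open>m2\<close>. For \<open>l2 = l2'\<close> the factor \<open>kap\<close> already
  covers the loss.\<close>

definition Gp where "Gp = (\<lambda>(l1 :: int, l2 :: int, r :: int) (l1' :: int, l2' :: int, r' :: int). if l2 = l2' then 1 else l2 * l2')"

text \<open>\<open>correlation_bound\<close> amounts to \<open>sqrt ss * sqrt qq\<close> up to
  \<open>Z\<close>, and \<open>qq\<close> is at most \<open>2 * M * lam^2\<close>. The work lies in
  comparing \<open>ss\<close>, the cofactor of \<open>l2 * l2' * m2\<close>, with the cofactor
  \<open>s0\<close> of \<open>m2\<close> alone.\<close>

lemma corr_bound:
  assumes t: "\<tau> \<in> Taus" "\<tau>' \<in> Taus" and D: "Delta \<tau> \<tau>' \<noteq> 0" and m2r: "m2 \<in> {M<..2 * M}"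
  shows "norm (corr \<tau> \<tau>' m2) \<le> 10 * Z\<^sup>2 * (lam * sqrt (2 * of_int M)) * kap \<tau> \<tau>'
     * sqrt (of_int (m2 div \<Prod>(simple_primes (Dp \<tau> \<tau>') m2) * gcd (Gp \<tau> \<tau>') m2))"
proof -
  obtain l1 l2 r l1' l2' r' where T: "\<tau> = (l1, l2, r)" "\<tau>' = (l1', l2', r')" by (metis prod_cases3)
  have mem: "l1 \<in> Lam" "l2 \<in> Lam" "l1' \<in> Lam" "l2' \<in> Lam" "r \<in> Rs" "r' \<in> Rs" "l1 \<noteq> l2" "l1' \<noteq> l2'"
    using t T by (auto simp: Taus_def)
  have pr: "prime l1" "prime l2" "prime l1'" "prime l2'" using Lam mem by auto
  have r0: "r \<noteq> 0" "r' \<noteq> 0" using mem by (auto simp: Rs_def)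
  interpret correlation_pair M N h l1 l2 r l1' l2' r' m2
    using M N1 h pr r0 m2r Rs_coprime mem
    by unfold_locales (auto simp: coprime_commute intro!: prime_imp_coprime)
  have dlt: "delta = Delta \<tau> \<tau>'" by (simp add: delta_def Delta_def T)
  have val: "valid \<tau> m m2 \<longleftrightarrow> good m" "valid \<tau>' m m2 \<longleftrightarrow> good' m" for m
    by (auto simp: T valid_def nn_def good_def good'_def nf_def nf'_def)
  have "corr \<tau> \<tau>' m2 = (\<Sum>m\<in>{m\<in>{M<..2 * M}. good m \<and> good' m}. em qq (theta m))"
    unfolding corr_def val em_theta[symmetric] by (simp add: T ph_def nn_def nf_def nf'_def)
  then have 1: "norm (corr \<tau> \<tau>' m2) \<le> of_int ss * (2 ^ card (simple_primes dd qq) * sqrt (of_int tt) * (2 + 2 * (1 + ln (of_int tt))))"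
    using correlation_bound D dlt by simp
  have ll: "0 < l2" "l2 \<le> N" "0 < l2'" "l2' \<le> N" using Lam_le mem by auto
  have tq: "tt \<le> qq" using qq_eq ss_ge_1 tt_ge_1 by (simp add: mult_le_cancel_right1)
  have qN: "qq \<le> N ^ 3"
  proof -
    have "0 \<le> m2" "m2 \<le> N" using m2r MN M by auto
    then have "l2 * l2' * m2 \<le> N * N * N" using ll by (intro mult_mono) auto
    then show ?thesis by (simp add: qq_def power3_eq_cube)
  qed
  have t20: "tt \<le> N ^ 20"
  proof -
    have "N ^ 3 \<le> N ^ 20" using N1 by (intro power_increasing) auto
    then show ?thesis using tq qN by linarith
  qed
  have "real (2 ^ card (simple_primes dd qq)) \<le> real (ndiv tt)"
    unfolding tt_def of_nat_le_iff by (rule two_power_card_le_ndiv) (rule sp)+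
  also have "\<dots> \<le> Z" using tt_ge_1 t20 by (intro ndiv_le_dmax) auto
  finally have c1: "2 ^ card (simple_primes dd qq) \<le> Z" by simp
  have "ln (real_of_int tt) \<le> ln (real_of_int N ^ 3)"
    using tq qN tt_ge_1 by (intro ln_mono) (auto simp flip: of_int_power)
  also have "\<dots> = 3 * ln (of_int N)" using N1 by (simp add: ln_realpow)
  also have "\<dots> \<le> 3 * Z" using ln_le_dmax[of N] N1 by simp
  finally have lnt: "ln (real_of_int tt) \<le> 3 * Z" .
  have c2: "2 + 2 * (1 + ln (real_of_int tt)) \<le> 10 * Z"
  proof -
    have "2 + 2 * (1 + y) \<le> 10 * z" if "y \<le> 3 * z" "1 \<le> z" for y z :: real using that by (simp add: algebra_simps)
    then show ?thesis using lnt Z1 .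
  qed
  have ln0: "ln (real_of_int tt) \<ge> 0" using tt_ge_1 by simp
  have "norm (corr \<tau> \<tau>' m2) \<le> of_int ss * (Z * sqrt (of_int tt) * (10 * Z))"
    using c1 c2 ss_ge_1 tt_ge_1 Z1 ln0
    by (intro order_trans[OF 1] mult_left_mono mult_mono) auto
  also have "\<dots> = 10 * Z\<^sup>2 * (of_int ss * sqrt (of_int tt))" by (simp add: power2_eq_square)
  also have "of_int ss * sqrt (of_int tt) = sqrt (of_int ss) * sqrt (real_of_int qq)"
    using ss_ge_1 unfolding qq_eq by (simp add: real_sqrt_mult)
  finally have 2: "norm (corr \<tau> \<tau>' m2) \<le> 10 * Z\<^sup>2 * (sqrt (of_int ss) * sqrt (of_int qq))" .
  have 3: "sqrt (of_int qq) \<le> lam * sqrt (2 * of_int M)"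
  proof -
    have "real_of_int qq = of_int l2 * of_int l2' * of_int m2" by (simp add: qq_def)
    also have "\<dots> \<le> lam * lam * (2 * of_int M)"
    proof -
      have "real_of_int m2 \<le> 2 * of_int M" using m2r by (metis greaterThanAtMost_iff of_int_le_iff of_int_mult of_int_numeral)
      then show ?thesis using Lam[OF mem(2)] Lam[OF mem(4)] ll m2r M lam1 by (intro mult_mono) auto
    qed
    finally have "sqrt (of_int qq) \<le> sqrt (lam * lam * (2 * of_int M))" by (rule real_sqrt_le_mono)
    then show ?thesis using lam1 by (simp add: real_sqrt_mult)
  qed
  define t0 where "t0 = \<Prod>(simple_primes (Dp \<tau> \<tau>') m2)"
  define s0 where "s0 = m2 div t0"
  define g where "g = gcd (Gp \<tau> \<tau>') m2"
  have m20: "m2 > 0" using m2r M by simp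
  have fin0: "finite (simple_primes (Dp \<tau> \<tau>') m2)" using m20 by (intro finite_simple_primes) auto
  have t01: "t0 \<ge> 1" unfolding t0_def by (rule prod_primes_pos) (simp add: simple_primes_def)
  have ms0: "m2 = s0 * t0" unfolding s0_def t0_def using simple_primes_prod_dvd[of m2 "Dp \<tau> \<tau>'"] m20 by simp
  have s01: "s0 \<ge> 1" using ms0 m20 t01 by (smt (verit) mult_nonpos_nonneg)
  have dd: "Dp \<tau> \<tau>' = dd * l2 * l2'" by (simp add: Dp_def dd_def T dlt mult_ac)
  \<comment> \<open>Under \<open>ok\<close> the prime \<open>l2\<close> divides \<open>qq\<close>
    exactly once and does not divide \<open>dd\<close>, so it joins the simple primes and cancels
    from \<open>ss\<close>.\<close>
  define ok where "ok \<longleftrightarrow> l2 \<noteq> l1' \<and> l2 \<noteq> l2' \<and> \<not> l2 dvd m2"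
  define ok' where "ok' \<longleftrightarrow> l2' \<noteq> l1 \<and> l2' \<noteq> l2 \<and> \<not> l2' dvd m2"
  have neq: "\<not> l dvd l'" if "l \<in> Lam" "l' \<in> Lam" "l \<noteq> l'" for l l'
    using that Lam primes_dvd_imp_eq by blast
  have dl: "\<not> l2 dvd dd" if "ok"
  proof
    assume "l2 dvd dd"
    then have "l2 dvd delta"
      using pr(2) Lam[OF mem(2)] Rs_coprime mem neq[of l2 l1] neq[of l2 l1'] that
      by (auto simp: dd_def prime_dvd_mult_iff ok_def)
    then have "l2 dvd - h * (l1 - l2) * l1' * l2' * r"
      unfolding delta_def by (subst (asm) dvd_add_left_iff) auto
    then have "l2 dvd h * (l1 - l2) * l1' * l2' * r" by simp
    then have "l2 dvd l1 - l2"
      using pr(2) Lam[OF mem(2)] Rs_coprime mem neq[of l2 l2'] neq[of l2 l1'] that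
      by (auto simp: prime_dvd_mult_iff ok_def)
    then have "l2 dvd l1" by (metis dvd_add dvd_refl diff_add_cancel)
    then show False using neq[of l2 l1] mem by blast
  qed
  have dl': "\<not> l2' dvd dd" if "ok'"
  proof
    assume "l2' dvd dd"
    then have "l2' dvd delta"
      using pr(4) Lam[OF mem(4)] Rs_coprime mem neq[of l2' l1] neq[of l2' l1'] that
      by (auto simp: dd_def prime_dvd_mult_iff ok'_def)
    then have "l2' dvd h * (l1' - l2') * l1 * l2 * r'"
      unfolding delta_def by (subst (asm) dvd_add_right_iff) auto
    then have "l2' dvd l1' - l2'"
      using pr(4) Lam[OF mem(4)] Rs_coprime mem neq[of l2' l2] neq[of l2' l1] that
      by (auto simp: prime_dvd_mult_iff ok'_def)
    then have "l2' dvd l1'" by (metis dvd_add dvd_refl diff_add_cancel)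
    then show False using neq[of l2' l1'] mem by blast
  qed
  define A where "A = simple_primes (Dp \<tau> \<tau>') m2 \<union> (if ok then {l2} else {}) \<union> (if ok' then {l2'} else {})"
  have Asub: "A \<subseteq> simple_primes dd qq"
  proof
    fix p assume "p \<in> A"
    then consider "p \<in> simple_primes (Dp \<tau> \<tau>') m2" | "p = l2" "ok" | "p = l2'" "ok'"
      by (auto simp: A_def split: if_splits)
    then show "p \<in> simple_primes dd qq"
    proof cases
      case 1
      then have p: "prime p" "p dvd m2" "\<not> p\<^sup>2 dvd m2" "\<not> p dvd dd" "\<not> p dvd l2" "\<not> p dvd l2'"
        unfolding simple_primes_def dd by auto
      then have "coprime (p\<^sup>2) (l2 * l2')" by (auto intro!: prime_imp_coprime)
      then have "\<not> p\<^sup>2 dvd qq" using p(3) unfolding qq_def by (simp add: coprime_dvd_mult_right_iff)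
      then show ?thesis using p by (simp add: simple_primes_def qq_def)
    next
      case 2
      have "\<not> l2 * l2 dvd l2 * (l2' * m2)"
        using 2 neq[of l2 l2'] mem pr(2) ll by (auto simp: ok_def prime_dvd_mult_iff)
      then have "\<not> l2\<^sup>2 dvd qq" by (simp add: qq_def power2_eq_square mult_ac)
      then show ?thesis using 2 dl pr by (simp add: simple_primes_def qq_def)
    next
      case 3
      have "\<not> l2' * l2' dvd l2' * (l2 * m2)"
        using 3 neq[of l2' l2] mem pr(4) ll by (auto simp: ok'_def prime_dvd_mult_iff)
      then have "\<not> l2'\<^sup>2 dvd qq" by (simp add: qq_def power2_eq_square mult_ac)
      then show ?thesis using 3 dl' pr by (simp add: simple_primes_def qq_def)
    qed
  qed
  define x where "x = (if ok then l2 else 1)"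
  define x' where "x' = (if ok' then l2' else 1)"
  have prodA: "\<Prod>A = t0 * x * x'"
  proof -
    have n1: "l2 \<notin> simple_primes (Dp \<tau> \<tau>') m2" "l2' \<notin> simple_primes (Dp \<tau> \<tau>') m2"
      unfolding simple_primes_def dd by auto
    show ?thesis using fin0 n1 by (auto simp: A_def x_def x'_def t0_def ok_def ok'_def)
  qed
  have "t0 * x * x' \<le> tt"
    unfolding prodA[symmetric] tt_def using prod_primes_mono_dvd[OF sp(1) Asub] tt_ge_1
    by (intro zdvd_imp_le) (auto simp: tt_def)
  then have "ss * (t0 * x * x') \<le> ss * tt" using ss_ge_1 by (intro mult_left_mono) auto
  also have "ss * tt = l2 * l2' * (s0 * t0)" unfolding qq_eq[symmetric] qq_def ms0[symmetric] ..
  finally have "t0 * (ss * x * x') \<le> t0 * (l2 * l2' * s0)" by (simp add: mult_ac)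
  then have sx: "ss * x * x' \<le> l2 * l2' * s0" using t01 by simp
  have g1: "g \<ge> 1" using m20 by (simp add: g_def int_one_le_iff_zero_less)
  have lr: "1 \<le> real_of_int l2" "real_of_int l2 \<le> lam" "1 \<le> real_of_int l2'" "real_of_int l2' \<le> lam"
    using Lam mem ll by (auto simp: int_one_le_iff_zero_less)
  \<comment> \<open>If \<open>l2 = l2'\<close>, then \<open>kap\<close> pays for both primes.
    Otherwise each prime either is absorbed by \<open>tt\<close>, or equals a prime of the other
    triple and is paid for by \<open>kap\<close>, or divides \<open>m2\<close> and is paid for by
    \<open>g\<close>.\<close>
  have 4: "real_of_int ss \<le> (kap \<tau> \<tau>')\<^sup>2 * of_int (s0 * g)"
  proof (cases "l2 = l2'")
    case True
    then have "x = 1" "x' = 1" by (auto simp: x_def x'_def ok_def ok'_def)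
    then have "real_of_int ss \<le> of_int (l2 * l2' * s0)" using sx by (simp only: of_int_le_iff mult_1_right)
    also have "\<dots> \<le> lam * lam * of_int (s0 * g)"
    proof -
      have "s0 \<le> s0 * g" using g1 s01 by (simp add: mult_le_cancel_left1)
      then have "real_of_int s0 \<le> of_int (s0 * g)" by (simp only: of_int_le_iff)
      then show ?thesis unfolding of_int_mult[of "l2 * l2'"] of_int_mult[of l2] using lr s01 by (intro mult_mono) auto
    qed
    also have "\<dots> \<le> (kap \<tau> \<tau>')\<^sup>2 * of_int (s0 * g)"
    proof (rule mult_right_mono)
      have "lam \<le> kap \<tau> \<tau>'" using lam1 True by (auto simp: T kap_def of_bool_def)
      then show "lam * lam \<le> (kap \<tau> \<tau>')\<^sup>2" using lam1 by (simp add: power2_eq_square mult_mono)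
      show "0 \<le> real_of_int (s0 * g)" using s01 g1 by simp
    qed
    finally show ?thesis .
  next
    case False
    define e where "e = (if l2 = l1' then lam else of_int (gcd l2 m2))"
    define e' where "e' = (if l2' = l1 then lam else of_int (gcd l2' m2))"
    have gg: "gcd l2 m2 * gcd l2' m2 \<le> g"
    proof -
      have "coprime l2 l2'" using primes_coprime[OF pr(2,4) False] .
      then have "coprime (gcd l2 m2) (gcd l2' m2)" by (meson coprime_divisors gcd_dvd1)
      then have "gcd l2 m2 * gcd l2' m2 dvd m2" by (intro divides_mult) auto
      moreover have "gcd l2 m2 * gcd l2' m2 dvd l2 * l2'" by (intro mult_dvd_mono) auto
      ultimately have "gcd l2 m2 * gcd l2' m2 dvd g" using False by (simp add: g_def Gp_def T)
      then show ?thesis using g1 by (intro zdvd_imp_le) auto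
    qed
    have "of_int l2 \<le> e * of_int x"
    proof (cases "ok")
      case True
      moreover have "gcd l2 m2 \<ge> 1" using m20 by (simp add: int_one_le_iff_zero_less)
      then have "e \<ge> 1" using lam1 by (simp add: e_def)
      ultimately show ?thesis using lr by (simp add: x_def mult_le_cancel_right1)
    next
      case F: False
      then have "l2 = l1' \<or> gcd l2 m2 = l2" using False ll by (auto simp: ok_def gcd_proj1_iff)
      then show ?thesis using F lr by (auto simp: x_def e_def)
    qed
    moreover have "of_int l2' \<le> e' * of_int x'"
    proof (cases "ok'")
      case True
      moreover have "gcd l2' m2 \<ge> 1" using m20 by (simp add: int_one_le_iff_zero_less)
      then have "e' \<ge> 1" using lam1 by (simp add: e'_def)
      ultimately show ?thesis using lr by (simp add: x'_def mult_le_cancel_right1)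
    next
      case F: False
      then have "l2' = l1 \<or> gcd l2' m2 = l2'" using False ll by (auto simp: ok'_def gcd_proj1_iff)
      then show ?thesis using F lr by (auto simp: x'_def e'_def)
    qed
    ultimately have "of_int l2 * of_int l2' \<le> (e * of_int x) * (e' * of_int x')"
      using lr by (intro mult_mono) auto
    then have "of_int l2 * of_int l2' * of_int s0 \<le> (e * of_int x) * (e' * of_int x') * of_int s0"
      using s01 by (intro mult_right_mono) auto
    moreover have "real_of_int ss * of_int x * of_int x' \<le> of_int l2 * of_int l2' * of_int s0"
      using sx by (simp flip: of_int_mult)
    ultimately have "(real_of_int ss) * (of_int x * of_int x') \<le> (e * e' * of_int s0) * (of_int x * of_int x')" by (simp add: mult_ac)
    moreover have "0 < real_of_int x * of_int x'" using ll by (auto simp: x_def x'_def)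
    ultimately have "real_of_int ss \<le> e * e' * of_int s0" by (metis mult_le_cancel_right_pos)
    also have "e * e' \<le> (kap \<tau> \<tau>')\<^sup>2 * of_int g"
    proof -
      have g2: "real_of_int (gcd l2 m2) \<ge> 1" "real_of_int (gcd l2' m2) \<ge> 1" using m20 by (auto simp: int_one_le_iff_zero_less)
      have k1: "kap \<tau> \<tau>' \<ge> 1" using lam1 by (simp add: T kap_def)
      have a: "e \<le> kap \<tau> \<tau>' * of_int (gcd l2 m2)"
      proof (cases "l2 = l1'")
        case True
        then have "lam * 1 \<le> kap \<tau> \<tau>' * of_int (gcd l2 m2)"
          using lam1 g2 by (intro mult_mono) (auto simp: T kap_def)
        then show ?thesis using True by (simp add: e_def)
      next
        case False
        then show ?thesis using k1 g2 by (simp add: e_def mult_le_cancel_right1)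
      qed
      have b: "e' \<le> kap \<tau> \<tau>' * of_int (gcd l2' m2)"
      proof (cases "l2' = l1")
        case True
        then have "lam * 1 \<le> kap \<tau> \<tau>' * of_int (gcd l2' m2)"
          using lam1 g2 by (intro mult_mono) (auto simp: T kap_def)
        then show ?thesis using True by (simp add: e'_def)
      next
        case False
        then show ?thesis using k1 g2 by (simp add: e'_def mult_le_cancel_right1)
      qed
      have "e * e' \<le> (kap \<tau> \<tau>' * of_int (gcd l2 m2)) * (kap \<tau> \<tau>' * of_int (gcd l2' m2))"
        using a b k1 g2 lam1 by (intro mult_mono) (auto simp: e'_def)
      also have "\<dots> = (kap \<tau> \<tau>')\<^sup>2 * of_int (gcd l2 m2 * gcd l2' m2)" by (simp add: power2_eq_square mult_ac)
      also have "\<dots> \<le> (kap \<tau> \<tau>')\<^sup>2 * of_int g" using gg by (intro mult_left_mono) (auto simp only: of_int_le_iff zero_le_power2)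
      finally show ?thesis .
    qed
    finally have "real_of_int ss \<le> (kap \<tau> \<tau>')\<^sup>2 * of_int g * of_int s0" using s01 by (simp add: mult_right_mono)
    then show ?thesis by (simp add: mult_ac)
  qed
  have k0: "kap \<tau> \<tau>' \<ge> 0" using lam1 by (simp add: T kap_def)
  have "sqrt (of_int ss) \<le> sqrt ((kap \<tau> \<tau>')\<^sup>2 * of_int (s0 * g))" using 4 by (rule real_sqrt_le_mono)
  also have "\<dots> = kap \<tau> \<tau>' * sqrt (of_int (s0 * g))" using k0 by (simp add: real_sqrt_mult)
  finally have 5: "sqrt (of_int ss) \<le> kap \<tau> \<tau>' * sqrt (of_int (s0 * g))" .
  have "norm (corr \<tau> \<tau>' m2) \<le> 10 * Z\<^sup>2 * ((kap \<tau> \<tau>' * sqrt (of_int (s0 * g))) * (lam * sqrt (2 * of_int M)))"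
    using 3 5 k0 s01 g1 qq_gt M
    by (intro order_trans[OF 2] mult_left_mono mult_mono) auto
  then show ?thesis by (simp add: s0_def t0_def g_def mult_ac)
qed

end

section \<open>The second moment over amplified terms\<close>

lemma Cauchy_Schwarz_norm:
  fixes f g :: "'i \<Rightarrow> complex"
  shows "norm (\<Sum>x\<in>A. f x * g x) \<le> sqrt (\<Sum>x\<in>A. (norm (f x))\<^sup>2) * sqrt (\<Sum>x\<in>A. (norm (g x))\<^sup>2)"
proof -
  have "norm (\<Sum>x\<in>A. f x * g x) \<le> (\<Sum>x\<in>A. norm (f x) * norm (g x))"
    by (rule order_trans[OF norm_sum]) (simp add: norm_mult)
  also have "\<dots> \<le> sqrt ((\<Sum>x\<in>A. (norm (f x))\<^sup>2) * (\<Sum>x\<in>A. (norm (g x))\<^sup>2))"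
    by (rule real_le_rsqrt[OF Cauchy_Schwarz_ineq_sum])
  finally show ?thesis by (simp add: real_sqrt_mult)
qed

text \<open>\<open>R\<close> is the sum over the classes of the squared class sums; opened up, it is
  a sum over colliding pairs, which is the form needed later.\<close>

lemma Cauchy_Schwarz_classes:
  fixes f :: "'i \<Rightarrow> int" and a :: "'i \<Rightarrow> complex"
  assumes I: "finite I" and f: "\<And>i. i \<in> I \<Longrightarrow> 0 \<le> f i \<and> f i < n"
  obtains R where "R \<ge> 0" "of_real R = (\<Sum>(i, j)\<in>{(i, j)\<in>I \<times> I. f i = f j}. a i * cnj (a j))"
    "(norm (\<Sum>i\<in>I. a i))\<^sup>2 \<le> of_int n * R"
proof -
  define g where "g = (\<lambda>x. \<Sum>i\<in>{i\<in>I. f i = x}. a i)"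
  define R where "R = (\<Sum>x\<in>{0..<n}. (norm (g x))\<^sup>2)"
  have R0: "R \<ge> 0" by (simp add: R_def sum_nonneg)
  have "(\<Sum>i\<in>I. a i) = (\<Sum>x\<in>{0..<n}. g x)"
    unfolding g_def using I f by (intro sum.group[symmetric]) auto
  then have "norm (\<Sum>i\<in>I. a i) \<le> sqrt (\<Sum>x\<in>{0..<n}. (norm (1 :: complex))\<^sup>2) * sqrt R"
    using Cauchy_Schwarz_norm[of "\<lambda>_. 1" g "{0..<n}"] by (simp add: R_def)
  then have "(norm (\<Sum>i\<in>I. a i))\<^sup>2 \<le> (sqrt (of_int n) * sqrt R)\<^sup>2" if "n \<ge> 0"
    using that by (intro power_mono) auto
  then have 1: "(norm (\<Sum>i\<in>I. a i))\<^sup>2 \<le> of_int n * R"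
  proof (cases "n \<ge> 0")
    case False
    then have "I = {}" using f by fastforce
    then show ?thesis using False R0 by (simp add: R_def)
  qed (use R0 in \<open>simp add: power_mult_distrib\<close>)
  have "complex_of_real R = (\<Sum>x\<in>{0..<n}. g x * cnj (g x))"
    unfolding R_def of_real_sum complex_norm_square ..
  also have "\<dots> = (\<Sum>x\<in>{0..<n}. \<Sum>i\<in>{i\<in>I. f i = x}. \<Sum>j\<in>{j\<in>I. f j = x}. a i * cnj (a j))"
    by (simp add: g_def sum_product)
  also have "\<dots> = (\<Sum>x\<in>{0..<n}. \<Sum>i\<in>{i\<in>I. f i = x}. \<Sum>j\<in>{j\<in>I. f j = f i}. a i * cnj (a j))"
    by (intro sum.cong refl) auto
  also have "\<dots> = (\<Sum>i\<in>I. \<Sum>j\<in>{j\<in>I. f j = f i}. a i * cnj (a j))"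
    using I f by (intro sum.group) auto
  also have "\<dots> = (\<Sum>(i, j)\<in>Sigma I (\<lambda>i. {j\<in>I. f j = f i}). a i * cnj (a j))"
    using I by (intro sum.Sigma) auto
  also have "Sigma I (\<lambda>i. {j\<in>I. f j = f i}) = {(i, j)\<in>I \<times> I. f i = f j}" by auto
  finally show ?thesis using that[OF R0 _ 1] by blast
qed

lemma norm_ee_minus_1: "norm (ee x - 1) \<le> 2 * pi * \<bar>x\<bar>"
proof -
  have "norm (ee x - 1) = 2 * \<bar>sin (pi * x)\<bar>" using norm_1_minus_ee[of x] by (simp add: norm_minus_commute)
  also have "\<bar>sin (pi * x)\<bar> \<le> \<bar>pi * x\<bar>" by (rule abs_sin_x_le_abs_x)
  finally show ?thesis by (simp add: abs_mult)
qed

text \<open>\<open>x * k + n * y - 1\<close> is divisible by \<open>n\<close> and by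
  \<open>k\<close>, hence by \<open>n * k\<close>.\<close>

lemma em_reciprocity:
  fixes n k a :: int
  assumes n: "n \<ge> 1" and k: "k \<ge> 1" and c: "coprime n k"
  shows "em n (a * modular_inverse n k) = em k (- (a * modular_inverse k n)) * ee (of_int a / (of_int n * of_int k))"
proof -
  let ?x = "modular_inverse n k" and ?y = "modular_inverse k n"
  have "n dvd ?x * k + n * ?y - 1"
    using cong_modular_inverse1[of k n] c by (simp add: cong_iff_dvd_diff coprime_commute mult.commute)
      (metis add_diff_eq dvd_add dvd_triv_left add.commute)
  moreover have "k dvd ?x * k + n * ?y - 1"
    using cong_modular_inverse1[of n k] c by (simp add: cong_iff_dvd_diff) (metis add_diff_eq dvd_add dvd_triv_right)
  ultimately have "n * k dvd ?x * k + n * ?y - 1" using c by (intro divides_mult)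
  then obtain j where j: "?x * k + n * ?y - 1 = n * k * j" by blast
  have r: "real_of_int ?x * of_int k + of_int n * of_int ?y - 1 = of_int n * of_int k * of_int j"
    by (metis j of_int_add of_int_diff of_int_mult of_int_1)
  have nk: "real_of_int n > 0" "real_of_int k > 0" using n k by auto
  have "of_int (a * ?x) / real_of_int n - (of_int (- (a * ?y)) / of_int k + of_int a / (of_int n * of_int k))
     = of_int a * ((real_of_int ?x * of_int k + of_int n * of_int ?y - 1) / (of_int n * of_int k))"
    using nk by (simp add: field_simps)
  also have "\<dots> = of_int (a * j)" unfolding r using nk by simp
  finally have "ee (of_int (a * ?x) / real_of_int n) = ee (of_int (- (a * ?y)) / of_int k + of_int a / (of_int n * of_int k))"
    by (intro ee_cong_int) auto
  then show ?thesis unfolding em_def ee_add .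
qed

context amplifier
begin

abbreviation Ms where "Ms \<equiv> {M<..2 * M}"

definition F0 where "F0 \<tau> m1 m2 = (if valid \<tau> m1 m2 then ph \<tau> m1 m2 else 0)"
definition Fp where "Fp m1 m2 = (\<Sum>\<tau>\<in>Taus. F0 \<tau> m1 m2)"

lemma corr_eq: "corr \<tau> \<tau>' m2 = (\<Sum>m1\<in>Ms. F0 \<tau> m1 m2 * cnj (F0 \<tau>' m1 m2))"
  unfolding corr_def by (rule sum.mono_neutral_cong_left) (auto simp: F0_def)

lemma corr_trivial: "norm (corr \<tau> \<tau>' m2) \<le> real (card {m1\<in>Ms. valid \<tau> m1 m2})"
proof -
  have "norm (corr \<tau> \<tau>' m2) \<le> (\<Sum>m1\<in>{m1\<in>Ms. valid \<tau> m1 m2 \<and> valid \<tau>' m1 m2}. 1)"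
    unfolding corr_def by (rule order_trans[OF norm_sum]) (simp add: norm_mult)
  also have "\<dots> \<le> real (card {m1\<in>Ms. valid \<tau> m1 m2})"
    by (simp, intro card_mono) (auto intro: finite_subset[of _ Ms])
  finally show ?thesis .
qed

lemma size_bounds:
  assumes "\<tau> \<in> Taus" "\<tau>' \<in> Taus" "Delta \<tau> \<tau>' \<noteq> 0"
  shows "Dp \<tau> \<tau>' \<noteq> 0" "\<bar>Dp \<tau> \<tau>'\<bar> \<le> N ^ 13" "Gp \<tau> \<tau>' \<ge> 1" "Gp \<tau> \<tau>' dvd Dp \<tau> \<tau>'" "Gp \<tau> \<tau>' \<le> N ^ 2"
proof -
  obtain l1 l2 r l1' l2' r' where T: "\<tau> = (l1, l2, r)" "\<tau>' = (l1', l2', r')" by (metis prod_cases3)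
  have mem: "l1 \<in> Lam" "l2 \<in> Lam" "l1' \<in> Lam" "l2' \<in> Lam" "r \<in> Rs" "r' \<in> Rs" "l1 \<noteq> l2" "l1' \<noteq> l2'"
    using assms T by (auto simp: Taus_def)
  have l: "0 < l1" "l1 \<le> N" "0 < l2" "l2 \<le> N" "0 < l1'" "l1' \<le> N" "0 < l2'" "l2' \<le> N" using Lam_le mem by auto
  have r: "r \<noteq> 0" "r' \<noteq> 0" "\<bar>r\<bar> \<le> N" "\<bar>r'\<bar> \<le> N" using mem Rs_less[of r l1] Rs_less[of r' l1'] l by (auto simp: Rs_def)
  define D where "D = Delta \<tau> \<tau>'"
  have N0: "0 \<le> N" using N1 by simp
  have D: "\<bar>D\<bar> \<le> N ^ 6"
  proof -
    have "\<bar>- h * (l1 - l2) * l1' * l2' * r\<bar> \<le> N * N * N * N * N"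
      unfolding abs_mult using l r h hN N0 by (intro mult_mono) auto
    moreover have "\<bar>h * (l1' - l2') * l1 * l2 * r'\<bar> \<le> N * N * N * N * N"
      unfolding abs_mult using l r h hN N0 by (intro mult_mono) auto
    ultimately have "\<bar>D\<bar> \<le> 2 * N ^ 5" by (simp add: D_def Delta_def T eval_nat_numeral mult_ac)
    also have "\<dots> \<le> N * N ^ 5" using N1 by (intro mult_right_mono) auto
    finally show ?thesis by (simp add: eval_nat_numeral)
  qed
  have Dp: "Dp \<tau> \<tau>' = h * r * r' * l1 * l1' * D * l2 * l2'" by (simp add: Dp_def D_def T)
  show "Dp \<tau> \<tau>' \<noteq> 0" unfolding Dp using assms(3) l r h by (simp add: D_def)
  have "\<bar>Dp \<tau> \<tau>'\<bar> \<le> N * N * N * N * N * N ^ 6 * N * N"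
    unfolding Dp abs_mult using l r h hN N0 D by (intro mult_mono) auto
  also have "\<dots> = N ^ 13" by (simp add: eval_nat_numeral)
  finally show "\<bar>Dp \<tau> \<tau>'\<bar> \<le> N ^ 13" .
  show "Gp \<tau> \<tau>' \<ge> 1" using l by (simp add: Gp_def T int_one_le_iff_zero_less)
  show "Gp \<tau> \<tau>' dvd Dp \<tau> \<tau>'" unfolding Dp by (simp add: Gp_def T mult.assoc)
  show "Gp \<tau> \<tau>' \<le> N ^ 2"
  proof (cases "l2 = l2'")
    case True
    then show ?thesis using N1 by (simp add: Gp_def T one_le_power)
  next
    case False
    then show ?thesis using l N0 mult_mono[of l2 N l2' N] by (simp add: Gp_def T power2_eq_square)
  qed
qed

lemma sum_corr_bound:
  assumes t: "\<tau> \<in> Taus" "\<tau>' \<in> Taus" and D: "Delta \<tau> \<tau>' \<noteq> 0"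
  shows "(\<Sum>m2\<in>Ms. norm (corr \<tau> \<tau>' m2)) \<le> 60 * Z ^ 5 * of_int M * sqrt (of_int M) * lam * kap \<tau> \<tau>'"
proof -
  note sb = size_bounds[OF t D]
  define c where "c = 10 * Z\<^sup>2 * (lam * sqrt (2 * of_int M)) * kap \<tau> \<tau>'"
  define s where "s = (\<lambda>m. sqrt (of_int (m div \<Prod>(simple_primes (Dp \<tau> \<tau>') m) * gcd (Gp \<tau> \<tau>') m)))"
  have k0: "kap \<tau> \<tau>' \<ge> 0" using lam1 by (cases \<tau>; cases \<tau>') (simp add: kap_def)
  have c0: "c \<ge> 0" using k0 lam1 M by (simp add: c_def)
  have s0: "s m \<ge> 0" if "m \<ge> 1" for m
  proof -
    have "\<Prod>(simple_primes (Dp \<tau> \<tau>') m) \<ge> 1" by (rule prod_primes_pos) (simp add: simple_primes_def)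
    then have "0 \<le> m div \<Prod>(simple_primes (Dp \<tau> \<tau>') m)" using that by (simp add: pos_imp_zdiv_nonneg_iff)
    then show ?thesis by (simp add: s_def)
  qed
  have "(\<Sum>m2\<in>Ms. norm (corr \<tau> \<tau>' m2)) \<le> (\<Sum>m2\<in>Ms. c * s m2)"
    unfolding c_def s_def by (intro sum_mono corr_bound t D)
  also have "\<dots> \<le> (\<Sum>m2\<in>{1..2 * M}. c * s m2)"
    using M c0 s0 by (intro sum_mono2) auto
  also have "\<dots> = c * (\<Sum>m2\<in>{1..2 * M}. s m2)" by (simp add: sum_distrib_left)
  also have "(\<Sum>m2\<in>{1..2 * M}. s m2) \<le> of_int (2 * M) * real (ndiv (Gp \<tau> \<tau>')) * Z * (1 + ln (of_int (2 * M)))"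
    unfolding s_def
  proof (rule sum_cofactor_le)
    fix a :: int assume a: "1 \<le> a" "a \<le> 2 * M"
    show "real (ndiv (Dp \<tau> \<tau>' * a)) \<le> Z"
    proof (rule ndiv_le_dmax)
      show "Dp \<tau> \<tau>' * a \<noteq> 0" using sb a by simp
      have "\<bar>Dp \<tau> \<tau>' * a\<bar> \<le> N ^ 13 * N" unfolding abs_mult using sb a MN M by (intro mult_mono) auto
      also have "\<dots> = N ^ 14" by (simp add: eval_nat_numeral)
      also have "\<dots> \<le> N ^ 20" using N1 by (intro power_increasing) auto
      finally show "\<bar>Dp \<tau> \<tau>' * a\<bar> \<le> N ^ 20" .
    qed
  qed (use sb M in auto)
  also have "\<dots> \<le> of_int (2 * M) * Z * Z * (2 * Z)"
  proof -
    have "N ^ 2 \<le> N ^ 20" using N1 by (intro power_increasing) auto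
    then have 1: "real (ndiv (Gp \<tau> \<tau>')) \<le> Z" using sb by (intro ndiv_le_dmax) auto
    have "2 * M \<le> N" using MN M by linarith
    then have "ln (real_of_int (2 * M)) \<le> ln (of_int N)" using M by (intro ln_mono) (auto simp only: of_int_le_iff of_int_0_less_iff)
    then have 2: "1 + ln (real_of_int (2 * M)) \<le> 2 * Z" using ln_le_dmax[of N] N1 Z1 by linarith
    have "ln (real_of_int (2 * M)) \<ge> 0" using M by simp
    then show ?thesis using 1 2 Z1 M by (intro mult_mono) auto
  qed
  finally have "(\<Sum>m2\<in>Ms. norm (corr \<tau> \<tau>' m2)) \<le> c * (of_int (2 * M) * Z * Z * (2 * Z))"
    using c0 by (simp add: mult_left_mono)
  also have "\<dots> = 40 * Z ^ 5 * of_int M * sqrt (of_int M) * lam * kap \<tau> \<tau>' * sqrt 2"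
    by (simp add: c_def real_sqrt_mult eval_nat_numeral mult_ac)
  also have "\<dots> \<le> 40 * Z ^ 5 * of_int M * sqrt (of_int M) * lam * kap \<tau> \<tau>' * (3 / 2)"
  proof (rule mult_left_mono)
    show "sqrt 2 \<le> 3 / 2" by (rule real_le_lsqrt) (auto simp: power2_eq_square)
    show "0 \<le> 40 * Z ^ 5 * of_int M * sqrt (of_int M) * lam * kap \<tau> \<tau>'" using Z1 M lam1 k0 by simp
  qed
  finally show ?thesis by (simp add: mult_ac)
qed

text \<open>Opening the square gives correlations of pairs of triples. For each triple at most two
  partners have \<open>Delta = 0\<close>; they are estimated trivially and counted by
  \<open>card_valid\<close>. The others add up, through \<open>sum_kap\<close> and
  \<open>big\<close>, to the same order.\<close>

theorem sum_Fp_bound: "(\<Sum>m1\<in>Ms. \<Sum>m2\<in>Ms. (norm (Fp m1 m2))\<^sup>2) \<le> 3844 * Z ^ 5 * (of_int N * lam)\<^sup>2"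
proof -
  have N0: "real_of_int N > 0" using N1 by simp
  define S where "S = (\<Sum>m1\<in>Ms. \<Sum>m2\<in>Ms. (norm (Fp m1 m2))\<^sup>2)"
  have S0: "S \<ge> 0" by (simp add: S_def sum_nonneg)
  have "complex_of_real S = (\<Sum>m1\<in>Ms. \<Sum>m2\<in>Ms. \<Sum>\<tau>\<in>Taus. \<Sum>\<tau>'\<in>Taus. F0 \<tau> m1 m2 * cnj (F0 \<tau>' m1 m2))"
    unfolding S_def of_real_sum complex_norm_square by (simp add: Fp_def sum_product)
  also have "\<dots> = (\<Sum>m2\<in>Ms. \<Sum>m1\<in>Ms. \<Sum>\<tau>\<in>Taus. \<Sum>\<tau>'\<in>Taus. F0 \<tau> m1 m2 * cnj (F0 \<tau>' m1 m2))"
    by (rule sum.swap)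
  also have "\<dots> = (\<Sum>m2\<in>Ms. \<Sum>\<tau>\<in>Taus. \<Sum>\<tau>'\<in>Taus. corr \<tau> \<tau>' m2)"
  proof (intro sum.cong refl)
    fix m2
    have "(\<Sum>m1\<in>Ms. \<Sum>\<tau>\<in>Taus. \<Sum>\<tau>'\<in>Taus. F0 \<tau> m1 m2 * cnj (F0 \<tau>' m1 m2))
        = (\<Sum>\<tau>\<in>Taus. \<Sum>m1\<in>Ms. \<Sum>\<tau>'\<in>Taus. F0 \<tau> m1 m2 * cnj (F0 \<tau>' m1 m2))"
      by (rule sum.swap)
    also have "\<dots> = (\<Sum>\<tau>\<in>Taus. \<Sum>\<tau>'\<in>Taus. corr \<tau> \<tau>' m2)"
      unfolding corr_eq by (intro sum.cong refl sum.swap)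
    finally show "(\<Sum>m1\<in>Ms. \<Sum>\<tau>\<in>Taus. \<Sum>\<tau>'\<in>Taus. F0 \<tau> m1 m2 * cnj (F0 \<tau>' m1 m2))
        = (\<Sum>\<tau>\<in>Taus. \<Sum>\<tau>'\<in>Taus. corr \<tau> \<tau>' m2)" .
  qed
  also have "\<dots> = (\<Sum>\<tau>\<in>Taus. \<Sum>m2\<in>Ms. \<Sum>\<tau>'\<in>Taus. corr \<tau> \<tau>' m2)" by (rule sum.swap)
  also have "\<dots> = (\<Sum>\<tau>\<in>Taus. \<Sum>\<tau>'\<in>Taus. \<Sum>m2\<in>Ms. corr \<tau> \<tau>' m2)" by (intro sum.cong refl sum.swap)
  finally have ES: "complex_of_real S = (\<Sum>\<tau>\<in>Taus. \<Sum>\<tau>'\<in>Taus. \<Sum>m2\<in>Ms. corr \<tau> \<tau>' m2)" .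
  have "S = norm (complex_of_real S)" using S0 by simp
  also have "norm (complex_of_real S) \<le> (\<Sum>\<tau>\<in>Taus. \<Sum>\<tau>'\<in>Taus. \<Sum>m2\<in>Ms. norm (corr \<tau> \<tau>' m2))"
    unfolding ES
    by (intro order_trans[OF norm_sum] sum_mono order.refl)
  also have "\<dots> \<le> (\<Sum>\<tau>\<in>Taus. \<Sum>\<tau>'\<in>Taus. (if Delta \<tau> \<tau>' = 0 then (\<Sum>m2\<in>Ms. real (card {m1\<in>Ms. valid \<tau> m1 m2})) else 0)
      + 60 * Z ^ 5 * of_int M * sqrt (of_int M) * lam * kap \<tau> \<tau>')"
  proof (intro sum_mono)
    fix \<tau> \<tau>' assume t: "\<tau> \<in> Taus" "\<tau>' \<in> Taus"
    have k0: "0 \<le> 60 * Z ^ 5 * of_int M * sqrt (of_int M) * lam * kap \<tau> \<tau>'"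
      using lam1 Z1 M by (cases \<tau>; cases \<tau>') (simp add: kap_def)
    show "(\<Sum>m2\<in>Ms. norm (corr \<tau> \<tau>' m2)) \<le> (if Delta \<tau> \<tau>' = 0 then (\<Sum>m2\<in>Ms. real (card {m1\<in>Ms. valid \<tau> m1 m2})) else 0)
      + 60 * Z ^ 5 * of_int M * sqrt (of_int M) * lam * kap \<tau> \<tau>'"
    proof (cases "Delta \<tau> \<tau>' = 0")
      case True
      have "(\<Sum>m2\<in>Ms. norm (corr \<tau> \<tau>' m2)) \<le> (\<Sum>m2\<in>Ms. real (card {m1\<in>Ms. valid \<tau> m1 m2}))"
        by (intro sum_mono corr_trivial)
      then show ?thesis unfolding if_P[OF True] using k0 by linarith
    next
      case False
      then show ?thesis using sum_corr_bound[OF t False] by simp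
    qed
  qed
  also have "\<dots> = (\<Sum>\<tau>\<in>Taus. real (card {\<tau>'\<in>Taus. Delta \<tau> \<tau>' = 0}) * (\<Sum>m2\<in>Ms. real (card {m1\<in>Ms. valid \<tau> m1 m2})))
      + 60 * Z ^ 5 * of_int M * sqrt (of_int M) * lam * (\<Sum>\<tau>\<in>Taus. \<Sum>\<tau>'\<in>Taus. kap \<tau> \<tau>')"
    by (simp only: sum.distrib sum.inter_filter[OF finTaus, symmetric] sum_constant sum_distrib_left)
  also have "(\<Sum>\<tau>\<in>Taus. real (card {\<tau>'\<in>Taus. Delta \<tau> \<tau>' = 0}) * (\<Sum>m2\<in>Ms. real (card {m1\<in>Ms. valid \<tau> m1 m2})))
      \<le> (\<Sum>\<tau>\<in>Taus. 2 * (\<Sum>m2\<in>Ms. real (card {m1\<in>Ms. valid \<tau> m1 m2})))"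
  proof (intro sum_mono mult_right_mono sum_nonneg)
    fix \<tau> assume "\<tau> \<in> Taus"
    from card_Delta_zero[OF this] have "real (card {\<tau>'\<in>Taus. Delta \<tau> \<tau>' = 0}) \<le> real 2" by (simp only: of_nat_le_iff)
    then show "real (card {\<tau>'\<in>Taus. Delta \<tau> \<tau>' = 0}) \<le> 2" by simp
  qed simp
  also have "\<dots> = 2 * (\<Sum>m1\<in>Ms. \<Sum>m2\<in>Ms. real (card {\<tau>\<in>Taus. valid \<tau> m1 m2}))"
  proof -
    have "(\<Sum>\<tau>\<in>Taus. \<Sum>m2\<in>Ms. real (card {m1\<in>Ms. valid \<tau> m1 m2})) = (\<Sum>\<tau>\<in>Taus. \<Sum>m2\<in>Ms. \<Sum>m1\<in>Ms. of_bool (valid \<tau> m1 m2))"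
      by (simp add: of_bool_def sum.If_cases Int_def)
    also have "\<dots> = (\<Sum>m2\<in>Ms. \<Sum>\<tau>\<in>Taus. \<Sum>m1\<in>Ms. of_bool (valid \<tau> m1 m2))" by (rule sum.swap)
    also have "\<dots> = (\<Sum>m2\<in>Ms. \<Sum>m1\<in>Ms. \<Sum>\<tau>\<in>Taus. of_bool (valid \<tau> m1 m2))" by (intro sum.cong refl sum.swap)
    also have "\<dots> = (\<Sum>m1\<in>Ms. \<Sum>m2\<in>Ms. \<Sum>\<tau>\<in>Taus. of_bool (valid \<tau> m1 m2))" by (rule sum.swap)
    also have "\<dots> = (\<Sum>m1\<in>Ms. \<Sum>m2\<in>Ms. real (card {\<tau>\<in>Taus. valid \<tau> m1 m2}))"
      using finTaus by (simp add: of_bool_def sum.If_cases Int_def)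
    finally show ?thesis by (simp add: sum_distrib_left[symmetric])
  qed
  also have "(\<Sum>m1\<in>Ms. \<Sum>m2\<in>Ms. real (card {\<tau>\<in>Taus. valid \<tau> m1 m2})) \<le> (\<Sum>m1\<in>Ms. \<Sum>m2\<in>Ms. 2 * lam\<^sup>2 * Z)"
    by (intro sum_mono card_valid)
  also have "\<dots> = (of_int M)\<^sup>2 * (2 * lam\<^sup>2 * Z)" using M by (simp add: power2_eq_square)
  also have "60 * Z ^ 5 * of_int M * sqrt (of_int M) * lam * (\<Sum>\<tau>\<in>Taus. \<Sum>\<tau>'\<in>Taus. kap \<tau> \<tau>')
     \<le> 60 * Z ^ 5 * of_int M * sqrt (of_int M) * lam * (4 * lam ^ 4 * (4 * of_int M * lam / of_int N)\<^sup>2)"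
  proof (rule mult_left_mono)
    have "(real (card Rs))\<^sup>2 \<le> (4 * of_int M * lam / of_int N)\<^sup>2" using Rs_card(2) by (intro power_mono) auto
    then have "4 * lam ^ 4 * (real (card Rs))\<^sup>2 \<le> 4 * lam ^ 4 * (4 * of_int M * lam / of_int N)\<^sup>2" by (intro mult_left_mono) auto
    then show "(\<Sum>\<tau>\<in>Taus. \<Sum>\<tau>'\<in>Taus. kap \<tau> \<tau>') \<le> 4 * lam ^ 4 * (4 * of_int M * lam / of_int N)\<^sup>2" using sum_kap by linarith
    show "0 \<le> 60 * Z ^ 5 * of_int M * sqrt (of_int M) * lam" using lam1 Z1 M by simp
  qed
  also have "60 * Z ^ 5 * of_int M * sqrt (of_int M) * lam * (4 * lam ^ 4 * (4 * of_int M * lam / of_int N)\<^sup>2)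
     = 3840 * Z ^ 5 * lam\<^sup>2 / (of_int N)\<^sup>2 * (lam ^ 5 * of_int M ^ 3 * sqrt (of_int M))"
    using N0 by (simp add: power_divide power_mult_distrib eval_nat_numeral)
  also have "\<dots> \<le> 3840 * Z ^ 5 * lam\<^sup>2 / (of_int N)\<^sup>2 * of_int N ^ 4"
    using big Z1 by (intro mult_left_mono) auto
  also have "\<dots> = 3840 * Z ^ 5 * (of_int N * lam)\<^sup>2" using N0 by (simp add: eval_nat_numeral)
  also have "2 * ((of_int M)\<^sup>2 * (2 * lam\<^sup>2 * Z)) \<le> 4 * Z ^ 5 * (of_int N * lam)\<^sup>2"
  proof -
    have "(real_of_int M)\<^sup>2 \<le> (of_int N)\<^sup>2" using M MN by (intro power_mono) auto
    moreover have "Z \<le> Z ^ 5" using Z1 by (intro self_le_power) auto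
    ultimately have "(of_int M)\<^sup>2 * (lam\<^sup>2 * Z) \<le> (of_int N)\<^sup>2 * (lam\<^sup>2 * Z ^ 5)" using Z1 by (intro mult_mono) auto
    then show ?thesis by (simp add: power_mult_distrib mult_ac)
  qed
  finally show ?thesis by (simp add: S_def mult_left_mono)
qed

text \<open>The phase before reciprocity; \<open>Fm\<close> is built from it as \<open>Fp\<close> is
  from \<open>ph\<close>.\<close>

definition ph0 where "ph0 \<tau> m1 m2 = em (nn \<tau> m1 m2) (h * (modular_inverse (nn \<tau> m1 m2) m1 - modular_inverse (nn \<tau> m1 m2) m2))"
definition Fm where "Fm m1 m2 = (\<Sum>\<tau>\<in>{\<tau>\<in>Taus. valid \<tau> m1 m2}. ph0 \<tau> m1 m2)"

text \<open>Reciprocity leaves the factor \<open>e(a / (n k))\<close> with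
  \<open>\<bar>a\<bar> * M \<le> n * k\<close>, because the primes lie in one dyadic range and
  \<open>h * M <= N\<close>. The 7 exceeds \<open>2 pi\<close>.\<close>

lemma phase_approx:
  assumes t: "\<tau> \<in> Taus" and m: "m1 \<in> Ms" "m2 \<in> Ms" and v: "valid \<tau> m1 m2"
  shows "norm (ph0 \<tau> m1 m2 - ph \<tau> m1 m2) \<le> 7 / of_int M"
proof -
  obtain l1 l2 r where T: "\<tau> = (l1, l2, r)" by (metis prod_cases3)
  have mem: "l1 \<in> Lam" "l2 \<in> Lam" using t T by (auto simp: Taus_def)
  define n where "n = nn \<tau> m1 m2"
  define k where "k = l2 * m2"
  define x where "x = modular_inverse n k"
  define a where "a = h * (l1 - l2)"
  have n: "N < n" "coprime n k" and rn: "r * n = l1 * m1 - l2 * m2"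
    and cop: "coprime m1 n" "coprime m2 n"
    using v by (auto simp: T valid_def n_def k_def nn_def coprime_commute)
  have l0: "l2 > 0" using Lam_le mem by auto
  have k0: "k \<ge> 1" using l0 m M by (simp add: k_def int_one_le_iff_zero_less)
  have xk: "[k * x = 1] (mod n)" unfolding x_def using n(2) by (intro cong_modular_inverse1) (simp add: coprime_commute)
  \<comment> \<open>Modulo \<open>n\<close> both \<open>l1 * m1\<close> and \<open>l2 * m2\<close>
    equal \<open>k\<close>, so both inverses are multiples of the inverse \<open>x\<close> of
    \<open>k\<close>.\<close>
  have "[l1 * m1 = k] (mod n)" by (metis Cong.cong_iff_dvd_diff dvd_triv_right rn k_def)
  then have "[l1 * m1 * x = k * x] (mod n)" by (rule cong_scalar_right)
  then have "[m1 * (l1 * x) = 1] (mod n)" using xk by (metis cong_trans mult.assoc mult.commute)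
  then have i1: "[(modular_inverse n m1) = l1 * x] (mod n)" using cop by (intro cong_sym[OF modular_inverse_unique])
  have "[m2 * (l2 * x) = 1] (mod n)" using xk by (simp add: k_def mult_ac)
  then have i2: "[(modular_inverse n m2) = l2 * x] (mod n)" using cop by (intro cong_sym[OF modular_inverse_unique])
  have "[(h * (modular_inverse n m1 - modular_inverse n m2)) = h * (l1 * x - l2 * x)] (mod n)"
    by (intro cong_scalar_left cong_diff i1 i2)
  then have "ph0 \<tau> m1 m2 = em n (a * x)"
    unfolding ph0_def n_def[symmetric] using N1 n by (intro em_cong) (auto simp: a_def algebra_simps)
  also have "\<dots> = em k (- (a * modular_inverse k n)) * ee (of_int a / (of_int n * of_int k))"
    unfolding x_def using N1 n k0 by (intro em_reciprocity) auto
  also have "em k (- (a * modular_inverse k n)) = ph \<tau> m1 m2"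
    by (simp add: ph_def T k_def n_def a_def)
  finally have "ph0 \<tau> m1 m2 - ph \<tau> m1 m2 = ph \<tau> m1 m2 * (ee (of_int a / (of_int n * of_int k)) - 1)"
    by (simp add: algebra_simps)
  then have "norm (ph0 \<tau> m1 m2 - ph \<tau> m1 m2) \<le> 2 * pi * \<bar>of_int a / (of_int n * of_int k)\<bar>"
    using norm_ee_minus_1[of "of_int a / (of_int n * of_int k)"] by (simp only: norm_mult norm_ph mult_1)
  also have "\<bar>of_int a / (of_int n * of_int k)\<bar> \<le> 1 / real_of_int M"
  proof -
    have "\<bar>l1 - l2\<bar> \<le> l2"
    proof -
      have "real_of_int \<bar>l1 - l2\<bar> \<le> of_int l2" using Lam[OF mem(1)] Lam[OF mem(2)] by (simp add: abs_if)
      then show ?thesis by (simp only: of_int_le_iff)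
    qed
    then have "\<bar>a\<bar> * M \<le> h * l2 * M" unfolding a_def abs_mult using h M by (intro mult_right_mono mult_mono) auto
    also have "\<dots> = (h * M) * l2" by simp
    also have "\<dots> \<le> n * k"
    proof (rule mult_mono)
      show "l2 \<le> k" using l0 m M by (simp add: k_def mult_le_cancel_left1)
    qed (use hM n l0 N1 in auto)
    finally have "real_of_int (\<bar>a\<bar> * M) \<le> of_int (n * k)" by (simp only: of_int_le_iff)
    moreover have "real_of_int n > 0" "real_of_int k > 0" using n N1 k0 by auto
    ultimately show ?thesis using M by (simp add: field_simps abs_mult)
  qed
  also have "2 * pi * (1 / real_of_int M) \<le> 7 * (1 / of_int M)"
    using M pi_less_4 pi_approx by (intro mult_right_mono) auto
  finally show ?thesis by simp
qed

lemma sum_Fm_bound: "(\<Sum>m1\<in>Ms. \<Sum>m2\<in>Ms. (norm (Fm m1 m2))\<^sup>2) \<le> (90 * Z ^ 3 * (of_int N * lam))\<^sup>2"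
proof -
  let ?Y = "of_int N * lam"
  have diff: "norm (Fm m1 m2 - Fp m1 m2) \<le> 14 * lam\<^sup>2 * Z / of_int M" if m: "m1 \<in> Ms" "m2 \<in> Ms" for m1 m2
  proof -
    have "Fp m1 m2 = (\<Sum>\<tau>\<in>{\<tau>\<in>Taus. valid \<tau> m1 m2}. ph \<tau> m1 m2)"
      unfolding Fp_def using finTaus by (intro sum.mono_neutral_cong_right) (auto simp: F0_def)
    then have "norm (Fm m1 m2 - Fp m1 m2) \<le> (\<Sum>\<tau>\<in>{\<tau>\<in>Taus. valid \<tau> m1 m2}. norm (ph0 \<tau> m1 m2 - ph \<tau> m1 m2))"
      by (simp add: Fm_def norm_sum flip: sum_subtractf)
    also have "\<dots> \<le> real (card {\<tau>\<in>Taus. valid \<tau> m1 m2}) * (7 / of_int M)"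
      using m phase_approx by (intro sum_bounded_above) auto
    also have "\<dots> \<le> (2 * lam\<^sup>2 * Z) * (7 / of_int M)"
      using m M by (intro mult_right_mono card_valid) auto
    finally show ?thesis by simp
  qed
  have "(\<Sum>m1\<in>Ms. \<Sum>m2\<in>Ms. (norm (Fm m1 m2))\<^sup>2)
     \<le> (\<Sum>m1\<in>Ms. \<Sum>m2\<in>Ms. 2 * (norm (Fp m1 m2))\<^sup>2 + 2 * (14 * lam\<^sup>2 * Z / of_int M)\<^sup>2)"
  proof (intro sum_mono)
    fix m1 m2 assume m: "m1 \<in> Ms" "m2 \<in> Ms"
    have "norm (Fm m1 m2) \<le> norm (Fp m1 m2) + 14 * lam\<^sup>2 * Z / of_int M"
      using diff[OF m] norm_triangle_sub[of "Fm m1 m2" "Fp m1 m2"] by linarith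
    then have "(norm (Fm m1 m2))\<^sup>2 \<le> (norm (Fp m1 m2) + 14 * lam\<^sup>2 * Z / of_int M)\<^sup>2" by (intro power_mono) auto
    also have "\<dots> \<le> 2 * (norm (Fp m1 m2))\<^sup>2 + 2 * (14 * lam\<^sup>2 * Z / of_int M)\<^sup>2"
      using sum_squares_ge_zero[of "norm (Fp m1 m2) - 14 * lam\<^sup>2 * Z / of_int M" 0]
      by (simp add: power2_sum power2_diff power2_eq_square[symmetric])
    finally show "(norm (Fm m1 m2))\<^sup>2 \<le> 2 * (norm (Fp m1 m2))\<^sup>2 + 2 * (14 * lam\<^sup>2 * Z / of_int M)\<^sup>2" .
  qed
  also have "\<dots> = 2 * (\<Sum>m1\<in>Ms. \<Sum>m2\<in>Ms. (norm (Fp m1 m2))\<^sup>2) + (of_int M)\<^sup>2 * (2 * (14 * lam\<^sup>2 * Z / of_int M)\<^sup>2)"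
    using M by (simp add: sum.distrib sum_distrib_left[symmetric] power2_eq_square[of "real_of_int M"])
  also have "(of_int M)\<^sup>2 * (2 * (14 * lam\<^sup>2 * Z / of_int M)\<^sup>2) = 392 * (lam * lam)\<^sup>2 * Z\<^sup>2"
    using M by (simp add: power_divide power_mult_distrib power2_eq_square)
  also have "\<dots> \<le> 392 * ?Y\<^sup>2 * Z ^ 6"
    using lam1 lamN Z1 by (intro mult_mono power_mono mult_right_mono power_increasing) auto
  also have "2 * (\<Sum>m1\<in>Ms. \<Sum>m2\<in>Ms. (norm (Fp m1 m2))\<^sup>2) \<le> 2 * (3844 * Z ^ 6 * ?Y\<^sup>2)"
  proof -
    have "3844 * Z ^ 5 * ?Y\<^sup>2 \<le> 3844 * Z ^ 6 * ?Y\<^sup>2"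
      using Z1 by (intro mult_right_mono mult_left_mono power_increasing) auto
    then show ?thesis using sum_Fp_bound by simp
  qed
  finally have "(\<Sum>m1\<in>Ms. \<Sum>m2\<in>Ms. (norm (Fm m1 m2))\<^sup>2) \<le> 8080 * (Z ^ 6 * ?Y\<^sup>2)" by (simp add: mult_ac)
  \<comment> \<open>Rounded up from \<open>2 * 3844 + 392\<close> to the square of 90.\<close>
  also have "\<dots> \<le> 8100 * (Z ^ 6 * ?Y\<^sup>2)" by simp
  finally show ?thesis by (simp add: power_mult_distrib)
qed

end

section \<open>Amplification\<close>

text \<open>Schur's test: \<open>2 w i w j \<le> (w i)^2 + (w j)^2\<close>, and by symmetry both
  squares give the same sum.\<close>

lemma sum_symmetric_relation_le:
  fixes w :: "'i \<Rightarrow> real"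
  assumes fin: "finite Ix" and J: "J \<subseteq> Ix \<times> Ix" and sym: "\<And>i j. (i, j) \<in> J \<Longrightarrow> (j, i) \<in> J"
    and card: "\<And>i. i \<in> Ix \<Longrightarrow> real (card {j. (i, j) \<in> J}) \<le> c" and w: "\<And>i. w i \<ge> 0"
  shows "(\<Sum>(i, j)\<in>J. w i * w j) \<le> c * (\<Sum>i\<in>Ix. (w i)\<^sup>2)"
proof -
  have finJ: "finite J" using fin J by (meson finite_SigmaI finite_subset)
  have 1: "(\<Sum>(i, j)\<in>J. (w i)\<^sup>2) \<le> c * (\<Sum>i\<in>Ix. (w i)\<^sup>2)"
  proof -
    have eq: "J = Sigma Ix (\<lambda>i. {j. (i, j) \<in> J})" using J by auto
    have fin': "finite {j. (i, j) \<in> J}" for i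
      by (rule finite_subset[of _ "snd ` J"]) (use finJ in force)+
    have "(\<Sum>(i, j)\<in>J. (w i)\<^sup>2) = (\<Sum>i\<in>Ix. \<Sum>j\<in>{j. (i, j) \<in> J}. (w i)\<^sup>2)"
      by (subst eq, subst sum.Sigma[symmetric]) (use fin fin' in auto)
    also have "\<dots> = (\<Sum>i\<in>Ix. real (card {j. (i, j) \<in> J}) * (w i)\<^sup>2)" by simp
    also have "\<dots> \<le> (\<Sum>i\<in>Ix. c * (w i)\<^sup>2)" by (intro sum_mono mult_right_mono card) auto
    finally show ?thesis by (simp add: sum_distrib_left)
  qed
  have 2: "(\<Sum>(i, j)\<in>J. (w j)\<^sup>2) = (\<Sum>(i, j)\<in>J. (w i)\<^sup>2)"
    by (rule sum.reindex_bij_witness[of _ prod.swap prod.swap]) (auto intro: sym)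
  have "(\<Sum>(i, j)\<in>J. w i * w j) \<le> (\<Sum>(i, j)\<in>J. ((w i)\<^sup>2 + (w j)\<^sup>2) / 2)"
  proof (intro sum_mono, clarify)
    fix i j show "w i * w j \<le> ((w i)\<^sup>2 + (w j)\<^sup>2) / 2"
      using sum_squares_bound[of "w i" "w j"] by simp
  qed
  also have "\<dots> = ((\<Sum>(i, j)\<in>J. (w i)\<^sup>2) + (\<Sum>(i, j)\<in>J. (w j)\<^sup>2)) / 2"
    by (simp add: sum_divide_distrib[symmetric] sum.distrib case_prod_unfold)
  finally show ?thesis using 1 2 by simp
qed

context amplifier
begin

abbreviation Ns where "Ns \<equiv> {N<..2 * N}"

definition V where "V \<alpha> n = (\<Sum>m\<in>{m\<in>Ms. coprime m n}. \<alpha> m * em n (h * modular_inverse n m))"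
definition In where "In n = {(l, m)\<in>Lam \<times> Ms. coprime l n \<and> coprime m n}"
definition Jn where "Jn n = {((l1, m1), (l2, m2))\<in>In n \<times> In n. (l1 * m1) mod n = (l2 * m2) mod n}"
definition an where "an \<alpha> n = (\<lambda>(l :: int, m). \<alpha> m * em n (h * modular_inverse n m))"
definition diag where "diag = {((l1 :: int, m1 :: int), (l2, m2)). l1 * m1 = l2 * m2}"

lemma finite_In: "finite (In n)"
  by (rule finite_subset[of _ "Lam \<times> Ms"]) (auto simp: In_def finLam)

lemma finite_Jn: "finite (Jn n)"
  by (rule finite_subset[of _ "In n \<times> In n"]) (auto simp: Jn_def finite_In)

text \<open>Each term of \<open>V\<close> is repeated once for every \<open>l\<close> coprime to
  \<open>n\<close>, and Cauchy-Schwarz runs over the \<open>n\<close> residue classes of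
  \<open>l * m\<close>. \<open>R\<close> is real but equals a complex sum, which lets the sums over
  \<open>n\<close> be combined before norms are taken.\<close>

lemma amplify_one:
  assumes n: "n \<in> Ns" and P: "0 \<le> P" "P \<le> real (card {l\<in>Lam. coprime l n})"
  shows "\<exists>R\<ge>0. complex_of_real R = (\<Sum>(i, j)\<in>Jn n. an \<alpha> n i * cnj (an \<alpha> n j)) \<and> P\<^sup>2 * (norm (V \<alpha> n))\<^sup>2 \<le> 2 * of_int N * R"
proof -
  have n0: "0 < n" "n \<le> 2 * N" using n N1 by auto
  define f where "f = (\<lambda>(l, m). (l * m) mod n)"
  have f: "0 \<le> f i \<and> f i < n" for i
    using n0 by (cases i) (auto simp: f_def)
  obtain R where R: "R \<ge> 0" "of_real R = (\<Sum>(i, j)\<in>{(i, j)\<in>In n \<times> In n. f i = f j}. an \<alpha> n i * cnj (an \<alpha> n j))"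
    "(norm (\<Sum>i\<in>In n. an \<alpha> n i))\<^sup>2 \<le> of_int n * R"
    by (rule Cauchy_Schwarz_classes[OF finite_In f, where a = "an \<alpha> n"])
  have "{(i, j)\<in>In n \<times> In n. f i = f j} = Jn n"
    by (auto simp: Jn_def f_def)
  then have R2: "of_real R = (\<Sum>(i, j)\<in>Jn n. an \<alpha> n i * cnj (an \<alpha> n j))" using R(2) by simp
  have "In n = {l\<in>Lam. coprime l n} \<times> {m\<in>Ms. coprime m n}" by (auto simp: In_def)
  then have "(\<Sum>i\<in>In n. an \<alpha> n i) = of_nat (card {l\<in>Lam. coprime l n}) * V \<alpha> n"
    by (simp add: an_def V_def sum.cartesian_product[symmetric])
  then have "P * norm (V \<alpha> n) \<le> norm (\<Sum>i\<in>In n. an \<alpha> n i)"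
    using P by (simp add: norm_mult mult_right_mono)
  then have "(P * norm (V \<alpha> n))\<^sup>2 \<le> (norm (\<Sum>i\<in>In n. an \<alpha> n i))\<^sup>2" using P by (intro power_mono) auto
  also have "\<dots> \<le> of_int n * R" by (rule R(3))
  also have "\<dots> \<le> 2 * of_int N * R"
  proof (rule mult_right_mono[OF _ R(1)])
    have "real_of_int n \<le> of_int (2 * N)" using n0 by (simp only: of_int_le_iff)
    then show "real_of_int n \<le> 2 * of_int N" by simp
  qed
  finally show ?thesis using R(1) R2 by (auto simp: power_mult_distrib)
qed

text \<open>For given \<open>(l, m)\<close> the prime \<open>l2\<close> divides \<open>l * m\<close>
  and determines \<open>m2\<close>, so each pair has at most \<open>Z\<close> partners.\<close>

lemma diagonal_bound:
  assumes n: "n \<in> Ns"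
  shows "norm (\<Sum>(i, j)\<in>Jn n \<inter> diag. an \<alpha> n i * cnj (an \<alpha> n j)) \<le> lam * Z * (\<Sum>m\<in>Ms. (norm (\<alpha> m))\<^sup>2)"
proof -
  define w where "w = (\<lambda>(l :: int, m). norm (\<alpha> m))"
  have "norm (\<Sum>(i, j)\<in>Jn n \<inter> diag. an \<alpha> n i * cnj (an \<alpha> n j)) \<le> (\<Sum>(i, j)\<in>Jn n \<inter> diag. w i * w j)"
    by (rule order_trans[OF norm_sum]) (auto intro!: sum_mono simp: w_def an_def norm_mult)
  also have "\<dots> \<le> Z * (\<Sum>i\<in>Lam \<times> Ms. (w i)\<^sup>2)"
  proof (rule sum_symmetric_relation_le)
    show "Jn n \<inter> diag \<subseteq> (Lam \<times> Ms) \<times> (Lam \<times> Ms)" by (auto simp: Jn_def In_def)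
    show "(j, i) \<in> Jn n \<inter> diag" if "(i, j) \<in> Jn n \<inter> diag" for i j
      using that by (auto simp: Jn_def diag_def)
    fix i assume i: "i \<in> Lam \<times> Ms"
    obtain l m where lm: "i = (l, m)" by (cases i)
    have l: "0 < l" "l \<le> N" "0 < m" "m \<le> N" using i lm Lam_le M MN by auto
    have inj: "inj_on fst {j. (i, j) \<in> Jn n \<inter> diag}"
    proof (rule inj_onI)
      fix x y assume a: "x \<in> {j. (i, j) \<in> Jn n \<inter> diag}" "y \<in> {j. (i, j) \<in> Jn n \<inter> diag}" "fst x = fst y"
      then have "fst x * snd x = fst x * snd y" "fst x \<in> Lam"
        by (auto simp: diag_def lm Jn_def In_def)
      then have "snd x = snd y" using Lam_le by force
      then show "x = y" using a(3) by (simp add: prod_eq_iff)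
    qed
    have "card {j. (i, j) \<in> Jn n \<inter> diag} = card (fst ` {j. (i, j) \<in> Jn n \<inter> diag})"
      using card_image[OF inj] by simp
    also have "\<dots> \<le> ndiv (l * m)"
      by (rule card_le_ndiv) (use l Lam_le in \<open>auto simp: diag_def lm Jn_def In_def\<close>)
    finally have "real (card {j. (i, j) \<in> Jn n \<inter> diag}) \<le> real (ndiv (l * m))" by simp
    also have "\<dots> \<le> Z"
    proof (rule ndiv_le_dmax)
      have "l * m \<le> N * N" using l by (intro mult_mono) auto
      also have "N * N \<le> N ^ 20" using N1 power_increasing[of 2 20 N] by (simp add: power2_eq_square)
      finally show "\<bar>l * m\<bar> \<le> N ^ 20" using l by simp
    qed (use l in auto)
    finally show "real (card {j. (i, j) \<in> Jn n \<inter> diag}) \<le> Z" .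
  qed (auto simp: finLam w_def)
  also have "(\<Sum>i\<in>Lam \<times> Ms. (w i)\<^sup>2) = real (card Lam) * (\<Sum>m\<in>Ms. (norm (\<alpha> m))\<^sup>2)"
  proof -
    have "(\<Sum>i\<in>Lam \<times> Ms. (w i)\<^sup>2) = (\<Sum>l\<in>Lam. \<Sum>m\<in>Ms. (w (l, m))\<^sup>2)"
      unfolding sum.cartesian_product by (intro sum.cong) auto
    then show ?thesis by (simp add: w_def)
  qed
  also have "Z * \<dots> \<le> Z * (lam * (\<Sum>m\<in>Ms. (norm (\<alpha> m))\<^sup>2))"
    using card_Lam Z1 by (intro mult_left_mono mult_right_mono sum_nonneg) auto
  finally show ?thesis by (simp add: mult_ac)
qed

text \<open>A collision off the diagonal determines \<open>r\<close> by
  \<open>l1 * m1 - l2 * m2 = r * n\<close>; conversely the triple with \<open>m1\<close> and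
  \<open>m2\<close> determines \<open>n\<close>. Summing over \<open>r\<close> in place of
  \<open>n\<close> frees \<open>m1\<close> and \<open>m2\<close> from the modulus.\<close>

lemma offdiagonal_identity:
  "(\<Sum>n\<in>Ns. \<Sum>(i, j)\<in>Jn n - diag. an \<alpha> n i * cnj (an \<alpha> n j)) = (\<Sum>m1\<in>Ms. \<Sum>m2\<in>Ms. \<alpha> m1 * cnj (\<alpha> m2) * Fm m1 m2)"
proof -
  have "(\<Sum>n\<in>Ns. \<Sum>(i, j)\<in>Jn n - diag. an \<alpha> n i * cnj (an \<alpha> n j))
     = (\<Sum>(n, i, j)\<in>Sigma Ns (\<lambda>n. Jn n - diag). an \<alpha> n i * cnj (an \<alpha> n j))"
    by (subst sum.Sigma) (auto simp: finite_Jn)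
  also have "\<dots> = (\<Sum>((m1, m2), \<tau>)\<in>Sigma (Ms \<times> Ms) (\<lambda>(m1, m2). {\<tau>\<in>Taus. valid \<tau> m1 m2}). \<alpha> m1 * cnj (\<alpha> m2) * ph0 \<tau> m1 m2)"
  proof (rule sum.reindex_bij_witness[where i = "\<lambda>((m1, m2), (l1, l2, r)). (nn (l1, l2, r) m1 m2, (l1, m1), (l2, m2))"
        and j = "\<lambda>(n, (l1, m1), (l2, m2)). ((m1, m2), (l1, l2, (l1 * m1 - l2 * m2) div n))"])
    fix x assume x: "x \<in> Sigma Ns (\<lambda>n. Jn n - diag)"
    obtain n l1 m1 l2 m2 where X: "x = (n, (l1, m1), (l2, m2))" by (metis prod.exhaust)
    have n: "N < n" "n \<le> 2 * N" "n > 0" and mem: "l1 \<in> Lam" "l2 \<in> Lam" "m1 \<in> Ms" "m2 \<in> Ms"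
      and cop: "coprime l1 n" "coprime m1 n" "coprime l2 n" "coprime m2 n"
      and md: "(l1 * m1) mod n = (l2 * m2) mod n" and ne: "l1 * m1 \<noteq> l2 * m2"
      using x N1 by (auto simp: X Jn_def In_def diag_def)
    define r where "r = (l1 * m1 - l2 * m2) div n"
    have dv: "n dvd l1 * m1 - l2 * m2" using md by (simp add: mod_eq_dvd_iff)
    then have rn: "r * n = l1 * m1 - l2 * m2" by (simp add: r_def)
    have r0: "r \<noteq> 0" using rn ne by auto
    have l0: "l1 > 0" "l2 > 0" "real_of_int l1 \<le> lam" "real_of_int l2 \<le> lam" using mem Lam_le Lam by auto
    have m0: "m1 > 0" "m2 > 0" using mem M by auto
    have "real_of_int m1 \<le> of_int (2 * M)" "real_of_int m2 \<le> of_int (2 * M)"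
      using mem by (simp_all only: of_int_le_iff greaterThanAtMost_iff)
    then have m0': "real_of_int m1 \<le> 2 * of_int M" "real_of_int m2 \<le> 2 * of_int M" by simp_all
    have p1: "real_of_int l1 * of_int m1 \<le> lam * (2 * of_int M)" "real_of_int l2 * of_int m2 \<le> lam * (2 * of_int M)"
      using l0 m0 m0' lam1 by (auto intro!: mult_mono)
    have p0: "0 < real_of_int l1 * of_int m1" "0 < real_of_int l2 * of_int m2" using l0 m0 by auto
    have rR: "r \<in> Rs"
    proof -
      have "of_int \<bar>r\<bar> * of_int N \<le> of_int \<bar>r\<bar> * real_of_int n" using n by (intro mult_left_mono) auto
      also have "\<dots> = \<bar>real_of_int (r * n)\<bar>" using n by (simp add: abs_mult)
      also have "\<dots> = \<bar>real_of_int l1 * of_int m1 - real_of_int l2 * of_int m2\<bar>" unfolding rn by simp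
      also have "\<dots> \<le> 2 * of_int M * lam" using p0 p1 by (simp add: mult_ac abs_le_iff)
      finally show ?thesis using r0 by (simp add: Rs_def)
    qed
    \<comment> \<open>Equal primes would force \<open>n\<close> to divide \<open>m1 - m2\<close>,
      which is smaller than \<open>n\<close>.\<close>
    have l12: "l1 \<noteq> l2"
    proof
      assume "l1 = l2"
      then have "n dvd l1 * (m1 - m2)" using dv by (simp add: algebra_simps)
      then have "n dvd m1 - m2" using cop(1) by (simp add: coprime_dvd_mult_right_iff coprime_commute)
      moreover have "\<bar>m1 - m2\<bar> < n" using mem n MN M by auto
      ultimately have "m1 - m2 = 0" using dvd_imp_le_int[of "m1 - m2" n] n(3) by force
      then show False using ne \<open>l1 = l2\<close> by simp
    qed
    have tT: "(l1, l2, r) \<in> Taus" using mem rR l12 by (simp add: Taus_def)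
    have nn: "nn (l1, l2, r) m1 m2 = n" unfolding nn_def using r0 by (simp flip: rn)
    have val: "valid (l1, l2, r) m1 m2"
      unfolding valid_def prod.case nn using n cop
      by (auto simp: rn[symmetric] coprime_commute)
    show "(\<lambda>((m1, m2), (l1, l2, r)). (nn (l1, l2, r) m1 m2, (l1, m1), (l2, m2)))
        ((\<lambda>(n, (l1, m1), (l2, m2)). ((m1, m2), (l1, l2, (l1 * m1 - l2 * m2) div n))) x) = x"
      using nn by (simp add: X r_def)
    show "(\<lambda>(n, (l1, m1), (l2, m2)). ((m1, m2), (l1, l2, (l1 * m1 - l2 * m2) div n))) x \<in> Sigma (Ms \<times> Ms) (\<lambda>(m1, m2). {\<tau>\<in>Taus. valid \<tau> m1 m2})"
      using mem tT val by (simp add: X r_def)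
    show "(\<lambda>((m1, m2), \<tau>). \<alpha> m1 * cnj (\<alpha> m2) * ph0 \<tau> m1 m2) ((\<lambda>(n, (l1, m1), (l2, m2)). ((m1, m2), (l1, l2, (l1 * m1 - l2 * m2) div n))) x)
        = (\<lambda>(n, i, j). an \<alpha> n i * cnj (an \<alpha> n j)) x"
      unfolding X prod.case r_def[symmetric] ph0_def nn an_def by (simp add: right_diff_distrib em_diff mult_ac)
  next
    fix y assume y: "y \<in> Sigma (Ms \<times> Ms) (\<lambda>(m1, m2). {\<tau>\<in>Taus. valid \<tau> m1 m2})"
    obtain m1 m2 l1 l2 r where Y: "y = ((m1, m2), (l1, l2, r))" by (metis prod.exhaust)
    define n where "n = nn (l1, l2, r) m1 m2"
    have mem: "m1 \<in> Ms" "m2 \<in> Ms" "l1 \<in> Lam" "l2 \<in> Lam" "r \<in> Rs" using y by (auto simp: Y Taus_def)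
    have v: "valid (l1, l2, r) m1 m2" using y by (simp add: Y)
    have dv: "r dvd l1 * m1 - l2 * m2" and n: "N < n" "n \<le> 2 * N" and cop: "coprime n (l2 * m2)" "coprime n (l1 * m1)"
      using v by (auto simp: valid_def n_def)
    have r0: "r \<noteq> 0" using mem by (simp add: Rs_def)
    have n0: "n \<noteq> 0" using n N1 by auto
    have rn: "r * n = l1 * m1 - l2 * m2" using dv by (simp add: n_def nn_def)
    have 1: "(l1 * m1 - l2 * m2) div n = r" using n0 by (simp flip: rn)
    have "n dvd l1 * m1 - l2 * m2" by (simp flip: rn)
    then have md: "(l1 * m1) mod n = (l2 * m2) mod n" by (simp add: mod_eq_dvd_iff)
    have "l1 * m1 - l2 * m2 \<noteq> 0" using r0 n0 by (simp flip: rn)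
    then have ne: "l1 * m1 \<noteq> l2 * m2" by simp
    show "(\<lambda>(n, (l1, m1), (l2, m2)). ((m1, m2), (l1, l2, (l1 * m1 - l2 * m2) div n)))
        ((\<lambda>((m1, m2), (l1, l2, r)). (nn (l1, l2, r) m1 m2, (l1, m1), (l2, m2))) y) = y"
      using 1 by (simp add: Y n_def)
    show "(\<lambda>((m1, m2), (l1, l2, r)). (nn (l1, l2, r) m1 m2, (l1, m1), (l2, m2))) y \<in> Sigma Ns (\<lambda>n. Jn n - diag)"
      using mem n cop md ne by (auto simp: Y n_def[symmetric] Jn_def In_def diag_def coprime_commute)
  qed
  also have "\<dots> = (\<Sum>x\<in>Ms \<times> Ms. \<Sum>\<tau>\<in>(\<lambda>(m1, m2). {\<tau>\<in>Taus. valid \<tau> m1 m2}) x. \<alpha> (fst x) * cnj (\<alpha> (snd x)) * ph0 \<tau> (fst x) (snd x))"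
    by (subst sum.Sigma) (auto simp: finTaus case_prod_unfold)
  also have "\<dots> = (\<Sum>(m1, m2)\<in>Ms \<times> Ms. \<alpha> m1 * cnj (\<alpha> m2) * Fm m1 m2)"
    by (intro sum.cong refl) (auto simp: Fm_def sum_distrib_left)
  also have "\<dots> = (\<Sum>m1\<in>Ms. \<Sum>m2\<in>Ms. \<alpha> m1 * cnj (\<alpha> m2) * Fm m1 m2)"
    by (simp add: sum.cartesian_product)
  finally show ?thesis .
qed

text \<open>The second Cauchy-Schwarz: the coefficients leave as their square mean and only the
  kernel \<open>Fm\<close> remains.\<close>

lemma offdiagonal_bound:
  "norm (\<Sum>m1\<in>Ms. \<Sum>m2\<in>Ms. \<alpha> m1 * cnj (\<alpha> m2) * Fm m1 m2) \<le> 90 * Z ^ 3 * (of_int N * lam) * (\<Sum>m\<in>Ms. (norm (\<alpha> m))\<^sup>2)"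
proof -
  let ?A = "\<Sum>m\<in>Ms. (norm (\<alpha> m))\<^sup>2"
  have A0: "?A \<ge> 0" by (simp add: sum_nonneg)
  have "(\<Sum>m1\<in>Ms. \<Sum>m2\<in>Ms. \<alpha> m1 * cnj (\<alpha> m2) * Fm m1 m2)
     = (\<Sum>x\<in>Ms \<times> Ms. (\<alpha> (fst x) * cnj (\<alpha> (snd x))) * Fm (fst x) (snd x))"
    by (simp add: sum.cartesian_product case_prod_unfold)
  then have "norm (\<Sum>m1\<in>Ms. \<Sum>m2\<in>Ms. \<alpha> m1 * cnj (\<alpha> m2) * Fm m1 m2)
     \<le> sqrt (\<Sum>x\<in>Ms \<times> Ms. (norm (\<alpha> (fst x) * cnj (\<alpha> (snd x))))\<^sup>2) * sqrt (\<Sum>x\<in>Ms \<times> Ms. (norm (Fm (fst x) (snd x)))\<^sup>2)"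
    using Cauchy_Schwarz_norm by metis
  also have "(\<Sum>x\<in>Ms \<times> Ms. (norm (\<alpha> (fst x) * cnj (\<alpha> (snd x))))\<^sup>2) = ?A * ?A"
    by (simp add: norm_mult power_mult_distrib sum_product sum.cartesian_product case_prod_unfold)
  also have "(\<Sum>x\<in>Ms \<times> Ms. (norm (Fm (fst x) (snd x)))\<^sup>2) = (\<Sum>m1\<in>Ms. \<Sum>m2\<in>Ms. (norm (Fm m1 m2))\<^sup>2)"
    by (simp add: sum.cartesian_product case_prod_unfold)
  also have "sqrt (?A * ?A) * sqrt (\<Sum>m1\<in>Ms. \<Sum>m2\<in>Ms. (norm (Fm m1 m2))\<^sup>2) \<le> ?A * (90 * Z ^ 3 * (of_int N * lam))"
  proof (rule mult_mono)
    have "sqrt (\<Sum>m1\<in>Ms. \<Sum>m2\<in>Ms. (norm (Fm m1 m2))\<^sup>2) \<le> sqrt ((90 * Z ^ 3 * (of_int N * lam))\<^sup>2)"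
      by (rule real_sqrt_le_mono[OF sum_Fm_bound])
    also have "\<dots> = 90 * Z ^ 3 * (of_int N * lam)" using Z1 N1 lam1 by simp
    finally show "sqrt (\<Sum>m1\<in>Ms. \<Sum>m2\<in>Ms. (norm (Fm m1 m2))\<^sup>2) \<le> 90 * Z ^ 3 * (of_int N * lam)" .
  qed (use A0 in \<open>auto intro!: sum_nonneg\<close>)
  finally show ?thesis by (simp only: mult.commute)
qed

theorem amplified_bound:
  assumes P: "0 \<le> P" "\<And>n. n \<in> Ns \<Longrightarrow> P \<le> real (card {l\<in>Lam. coprime l n})"
  shows "P\<^sup>2 * (\<Sum>n\<in>Ns. (norm (V \<alpha> n))\<^sup>2) \<le> 182 * Z ^ 3 * (of_int N)\<^sup>2 * lam * (\<Sum>m\<in>Ms. (norm (\<alpha> m))\<^sup>2)"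
proof -
  let ?A = "\<Sum>m\<in>Ms. (norm (\<alpha> m))\<^sup>2"
  have A0: "?A \<ge> 0" by (simp add: sum_nonneg)
  have N0: "real_of_int N > 0" using N1 by simp
  have "\<exists>R. \<forall>n\<in>Ns. R n \<ge> 0 \<and> complex_of_real (R n) = (\<Sum>(i, j)\<in>Jn n. an \<alpha> n i * cnj (an \<alpha> n j))
      \<and> P\<^sup>2 * (norm (V \<alpha> n))\<^sup>2 \<le> 2 * of_int N * R n"
    using amplify_one[OF _ P(1) P(2)] by (intro bchoice) auto
  then obtain R where R: "\<And>n. n \<in> Ns \<Longrightarrow> R n \<ge> 0"
    "\<And>n. n \<in> Ns \<Longrightarrow> complex_of_real (R n) = (\<Sum>(i, j)\<in>Jn n. an \<alpha> n i * cnj (an \<alpha> n j))"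
    "\<And>n. n \<in> Ns \<Longrightarrow> P\<^sup>2 * (norm (V \<alpha> n))\<^sup>2 \<le> 2 * of_int N * R n" by blast
  have "complex_of_real (\<Sum>n\<in>Ns. R n) = (\<Sum>n\<in>Ns. (\<Sum>(i, j)\<in>Jn n \<inter> diag. an \<alpha> n i * cnj (an \<alpha> n j)) + (\<Sum>(i, j)\<in>Jn n - diag. an \<alpha> n i * cnj (an \<alpha> n j)))"
    unfolding of_real_sum
  proof (intro sum.cong refl)
    fix n assume n: "n \<in> Ns"
    show "complex_of_real (R n) = (\<Sum>(i, j)\<in>Jn n \<inter> diag. an \<alpha> n i * cnj (an \<alpha> n j)) + (\<Sum>(i, j)\<in>Jn n - diag. an \<alpha> n i * cnj (an \<alpha> n j))"
      unfolding R(2)[OF n] by (rule sum.Int_Diff[OF finite_Jn])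
  qed
  then have ER: "complex_of_real (\<Sum>n\<in>Ns. R n) = (\<Sum>n\<in>Ns. \<Sum>(i, j)\<in>Jn n \<inter> diag. an \<alpha> n i * cnj (an \<alpha> n j))
      + (\<Sum>m1\<in>Ms. \<Sum>m2\<in>Ms. \<alpha> m1 * cnj (\<alpha> m2) * Fm m1 m2)"
    unfolding sum.distrib offdiagonal_identity .
  have "(\<Sum>n\<in>Ns. R n) \<le> norm (complex_of_real (\<Sum>n\<in>Ns. R n))" unfolding norm_of_real by (rule abs_ge_self)
  also have "\<dots> \<le> norm (\<Sum>n\<in>Ns. \<Sum>(i, j)\<in>Jn n \<inter> diag. an \<alpha> n i * cnj (an \<alpha> n j))
      + norm (\<Sum>m1\<in>Ms. \<Sum>m2\<in>Ms. \<alpha> m1 * cnj (\<alpha> m2) * Fm m1 m2)"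
    unfolding ER by (rule norm_triangle_ineq)
  also have "norm (\<Sum>n\<in>Ns. \<Sum>(i, j)\<in>Jn n \<inter> diag. an \<alpha> n i * cnj (an \<alpha> n j)) \<le> of_int N * (lam * Z * ?A)"
  proof -
    have "norm (\<Sum>n\<in>Ns. \<Sum>(i, j)\<in>Jn n \<inter> diag. an \<alpha> n i * cnj (an \<alpha> n j)) \<le> (\<Sum>n\<in>Ns. lam * Z * ?A)"
      by (rule order_trans[OF norm_sum sum_mono[OF diagonal_bound]])
    then show ?thesis using N1 by simp
  qed
  also note offdiagonal_bound[of \<alpha>]
  finally have "(\<Sum>n\<in>Ns. R n) \<le> of_int N * (lam * Z * ?A) + 90 * Z ^ 3 * (of_int N * lam) * ?A" by simp
  also have "of_int N * (lam * Z * ?A) \<le> of_int N * (lam * Z ^ 3 * ?A)"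
    using Z1 N0 lam1 A0 self_le_power[of Z 3] by (intro mult_left_mono mult_right_mono) auto
  finally have S: "(\<Sum>n\<in>Ns. R n) \<le> 91 * Z ^ 3 * of_int N * lam * ?A" by (simp add: mult_ac)
  have "P\<^sup>2 * (\<Sum>n\<in>Ns. (norm (V \<alpha> n))\<^sup>2) \<le> (\<Sum>n\<in>Ns. 2 * of_int N * R n)"
    unfolding sum_distrib_left[of "P\<^sup>2"] by (intro sum_mono R(3))
  also have "\<dots> = 2 * of_int N * (\<Sum>n\<in>Ns. R n)" by (simp add: sum_distrib_left)
  also have "\<dots> \<le> 2 * of_int N * (91 * Z ^ 3 * of_int N * lam * ?A)" using S N0 by (intro mult_left_mono) auto
  finally show ?thesis by (simp add: power2_eq_square mult_ac)
qed

end

section \<open>Bilinear forms in Kloosterman fractions\<close>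

definition kfrac_sum :: "int \<Rightarrow> int \<Rightarrow> (int \<Rightarrow> complex) \<Rightarrow> int \<Rightarrow> complex" where
  "kfrac_sum M h \<alpha> n = (\<Sum>m\<in>{m\<in>{M<..2 * M}. coprime m n}. \<alpha> m * em n (h * modular_inverse n m))"

lemma kfrac_sum_trivial:
  assumes "M \<ge> 1"
  shows "(norm (kfrac_sum M h \<alpha> n))\<^sup>2 \<le> of_int M * (\<Sum>m\<in>{M<..2 * M}. (norm (\<alpha> m))\<^sup>2)"
proof -
  let ?A = "{m\<in>{M<..2 * M}. coprime m n}"
  have fin: "finite ?A" by (rule finite_subset[of _ "{M<..2 * M}"]) auto
  have "(norm (kfrac_sum M h \<alpha> n))\<^sup>2 \<le> (sqrt (\<Sum>m\<in>?A. (norm (\<alpha> m))\<^sup>2) * sqrt (\<Sum>m\<in>?A. (norm (em n (h * modular_inverse n m)))\<^sup>2))\<^sup>2"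
    unfolding kfrac_sum_def by (intro power_mono Cauchy_Schwarz_norm) auto
  also have "\<dots> = (\<Sum>m\<in>?A. (norm (\<alpha> m))\<^sup>2) * real (card ?A)"
    by (simp add: power_mult_distrib sum_nonneg)
  also have "\<dots> \<le> (\<Sum>m\<in>{M<..2 * M}. (norm (\<alpha> m))\<^sup>2) * of_int M"
  proof (rule mult_mono)
    show "(\<Sum>m\<in>?A. (norm (\<alpha> m))\<^sup>2) \<le> (\<Sum>m\<in>{M<..2 * M}. (norm (\<alpha> m))\<^sup>2)" by (rule sum_mono2) auto
    have "card ?A \<le> card {M<..2 * M}" by (rule card_mono) auto
    then show "real (card ?A) \<le> of_int M" using assms by simp
  qed (auto intro: sum_nonneg)
  finally show ?thesis by (simp add: mult.commute)
qed

theorem kfrac_mean_square: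
  fixes M N h :: int
  assumes M: "M \<ge> 1" and MN: "100 * M \<le> N" and h: "h \<ge> 1" and hM: "h * M \<le> N"
  shows "(\<Sum>n\<in>{N<..2 * N}. (norm (kfrac_sum M h \<alpha> n))\<^sup>2)
    \<le> (648 * dmax N ^ 4 * (of_int M powr (3/10) * of_int N powr (13/20)))\<^sup>2 * (\<Sum>m\<in>{M<..2 * M}. (norm (\<alpha> m))\<^sup>2)"
proof -
  let ?A = "\<Sum>m\<in>{M<..2 * M}. (norm (\<alpha> m))\<^sup>2"
  define z where "z = dmax N"
  define W where "W = real_of_int M powr (3/10) * of_int N powr (13/20)"
  \<comment> \<open>Chosen so that \<open>N^2 / L = W^2\<close>.\<close>
  define L where "L = real_of_int N powr (7/10) * of_int M powr (-3/5)"
  have A0: "?A \<ge> 0" by (simp add: sum_nonneg)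
  have N1: "N \<ge> 100" using M MN by linarith
  have z1: "z \<ge> 1" unfolding z_def using N1 by (intro dmax_ge_1) auto
  have pos: "real_of_int M > 0" "real_of_int N > 0" "real_of_int M \<ge> 1" "real_of_int M \<le> of_int N" using M MN by auto
  have L0: "L > 0" using pos by (simp add: L_def)
  have W0: "W > 0" using pos by (simp add: W_def)
  have pw: "(x powr a) ^ k = x powr (a * real k)" if "x > 0" for x a :: real and k :: nat
    using that by (simp add: powr_realpow[symmetric] powr_powr)
  have WL: "W\<^sup>2 * L = (of_int N)\<^sup>2"
  proof -
    have "W\<^sup>2 * L = (real_of_int M powr (3/5) * of_int N powr (13/10)) * (of_int N powr (7/10) * of_int M powr (-3/5))"
      unfolding W_def L_def power_mult_distrib pw[OF pos(1)] pw[OF pos(2)] by simp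
    also have "\<dots> = real_of_int M powr (3/5 + (-3/5)) * of_int N powr (13/10 + 7/10)"
      unfolding powr_add by (simp add: mult_ac)
    also have "\<dots> = (of_int N)\<^sup>2" using pos powr_realpow[of "of_int N" 2] by simp
    finally show ?thesis .
  qed
  have LN: "L \<le> of_int N"
  proof -
    have "L \<le> of_int N powr 1 * of_int M powr 0"
      unfolding L_def using pos by (intro mult_mono powr_mono) auto
    then show ?thesis using pos by simp
  qed
  \<comment> \<open>For \<open>L \<le> 96 * z ^ 3\<close> the trivial bound is good enough. The
    constant 419904 is the square of 648, the first square above \<open>2304 * 182\<close>.\<close>
  have key: "(\<Sum>n\<in>{N<..2 * N}. (norm (kfrac_sum M h \<alpha> n))\<^sup>2) \<le> 419904 * z ^ 8 * ((of_int N)\<^sup>2 / L) * ?A"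
  proof (cases "L \<le> 96 * z ^ 3")
    case True
    have "(\<Sum>n\<in>{N<..2 * N}. (norm (kfrac_sum M h \<alpha> n))\<^sup>2) \<le> (\<Sum>n\<in>{N<..2 * N}. of_int M * ?A)"
      by (intro sum_mono kfrac_sum_trivial M)
    also have "\<dots> = of_int N * (of_int M * ?A)" using N1 by simp
    also have "\<dots> \<le> of_int N * (of_int N * ?A)" using pos A0 by (intro mult_left_mono mult_right_mono) auto
    also have "\<dots> = 1 * ((of_int N)\<^sup>2 * ?A)" by (simp add: power2_eq_square)
    also have "\<dots> \<le> (419904 * z ^ 8 / L) * ((of_int N)\<^sup>2 * ?A)"
    proof (rule mult_right_mono)
      have "z ^ 3 \<le> z ^ 8" using z1 by (intro power_increasing) auto
      then have "L \<le> 419904 * z ^ 8" using True zero_le_power[of z 8] z1 by linarith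
      then show "1 \<le> 419904 * z ^ 8 / L" using L0 by simp
    qed (use A0 in simp)
    finally show ?thesis by simp
  next
    case False
    have z3: "z ^ 3 \<ge> 1" using z1 by (simp add: one_le_power)
    have L4: "L \<ge> 4" using False z3 by linarith
    obtain lam where lam: "lam > 0" "lam \<le> L"
      "L \<le> 24 * (ln L)\<^sup>2 * real (card {p :: int. prime p \<and> lam / 2 < of_int p \<and> of_int p \<le> lam})"
      using dyadic_primes_exist[OF L4] by blast
    define ps where "ps = {p :: int. prime p \<and> lam / 2 < of_int p \<and> of_int p \<le> lam}"
    define c where "c = real (card ps)"
    define Lam where "Lam = {p\<in>ps. \<not> p dvd h}"
    have finps: "finite ps"
      by (rule finite_subset[of _ "{0..\<lfloor>lam\<rfloor>}"]) (auto simp: ps_def le_floor_iff prime_ge_0_int)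
    have "ln L \<le> ln (of_int N)" using L0 LN by (intro ln_mono) auto
    then have lnL: "ln L \<le> z" unfolding z_def using ln_le_dmax[of N] N1 by linarith
    have lnL0: "0 \<le> ln L" using L4 by simp
    have "L \<le> 24 * (ln L)\<^sup>2 * c" using lam(3) by (simp add: c_def ps_def)
    also have "\<dots> \<le> 24 * z\<^sup>2 * c" using lnL lnL0 by (intro mult_right_mono mult_left_mono power_mono) (auto simp: c_def)
    finally have Lc: "L \<le> 24 * z\<^sup>2 * c" .
    \<comment> \<open>At least \<open>4 * z\<close> primes: at most \<open>z\<close> of them divide
      \<open>h\<close> and at most \<open>z\<close> divide \<open>n\<close>, so half of them survive
      for every \<open>n\<close>.\<close>
    have c4: "c \<ge> 4 * z"
    proof (rule ccontr)
      assume "\<not> c \<ge> 4 * z"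
      then have "24 * z\<^sup>2 * c \<le> 24 * z\<^sup>2 * (4 * z)" by (intro mult_left_mono) auto
      then have "L \<le> 96 * z ^ 3" using Lc by (simp add: power2_eq_square power3_eq_cube mult_ac)
      then show False using False by simp
    qed
    have "ps \<noteq> {}" using c4 z1 by (auto simp: c_def)
    then obtain p where "p \<in> ps" by blast
    then have lam1: "lam \<ge> 1" using prime_gt_1_int[of p] by (auto simp: ps_def)
    interpret amplifier M N h Lam lam
    proof
      \<comment> \<open>\<open>big\<close> holds because
        \<open>L^5 * M^(7/2) = N^(7/2) * M^(1/2)\<close>.\<close>
      have "lam ^ 5 * of_int M ^ 3 * sqrt (of_int M) \<le> L ^ 5 * of_int M ^ 3 * sqrt (of_int M)"
        using lam pos by (intro mult_right_mono power_mono) auto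
      also have "\<dots> = (real_of_int N powr (7/2) * of_int M powr (-3)) * (of_int M powr 3 * of_int M powr (1/2))"
        unfolding L_def power_mult_distrib pw[OF pos(1)] pw[OF pos(2)]
        using pos powr_realpow[of "of_int M" 3] by (simp add: powr_half_sqrt)
      also have "\<dots> = real_of_int N powr (7/2) * of_int M powr (- 3 + 3 + 1 / 2)"
        unfolding powr_add by (simp add: mult_ac)
      also have "\<dots> \<le> real_of_int N powr (7/2) * of_int N powr (1 / 2)"
        using pos by (intro mult_left_mono) (auto intro!: powr_mono2)
      also have "\<dots> = of_int N ^ 4" using pos powr_realpow[of "of_int N" 4] by (simp flip: powr_add)
      finally show "lam ^ 5 * of_int M ^ 3 * sqrt (of_int M) \<le> of_int N ^ 4" .
      show "finite Lam" using finps by (simp add: Lam_def)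
    qed (use M MN h hM lam LN lam1 in \<open>auto simp: Lam_def ps_def\<close>)
    have small: "real (ndiv k) \<le> z" if "0 < k" "k \<le> 2 * N" for k
      unfolding z_def
    proof (rule ndiv_le_dmax)
      have "2 * N \<le> N * N" using N1 by (intro mult_right_mono) auto
      also have "\<dots> = N ^ 2" by (simp add: power2_eq_square)
      also have "\<dots> \<le> N ^ 20" using N1 by (intro power_increasing) auto
      finally show "\<bar>k\<bar> \<le> N ^ 20" using that by simp
    qed (use that in auto)
    have P: "c / 2 \<le> real (card {l\<in>Lam. coprime l n})" if n: "n \<in> {N<..2 * N}" for n
    proof -
      let ?B = "{p\<in>ps. p dvd h}" and ?D = "{p\<in>ps. p dvd n}"
      have "card ?B \<le> ndiv h" using h by (intro card_le_ndiv) (auto simp: ps_def prime_gt_0_int)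
      moreover have "card ?D \<le> ndiv n" using n N1 by (intro card_le_ndiv) (auto simp: ps_def prime_gt_0_int)
      moreover have "real (ndiv h) \<le> z" using h hN N1 by (intro small) auto
      moreover have "real (ndiv n) \<le> z" using n N1 by (intro small) auto
      ultimately have BD: "real (card ?B) \<le> z" "real (card ?D) \<le> z" by linarith+
      have "ps \<subseteq> {l\<in>Lam. coprime l n} \<union> (?B \<union> ?D)"
        by (auto simp: Lam_def ps_def intro: prime_imp_coprime)
      then have "card ps \<le> card ({l\<in>Lam. coprime l n} \<union> (?B \<union> ?D))"
        using finps finLam by (intro card_mono) auto
      also have "\<dots> \<le> card {l\<in>Lam. coprime l n} + (card ?B + card ?D)"
        by (intro order_trans[OF card_Un_le] add_left_mono card_Un_le)
      finally have "c \<le> real (card {l\<in>Lam. coprime l n}) + (real (card ?B) + real (card ?D))"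
        by (simp add: c_def flip: of_nat_add)
      then show ?thesis using BD c4 by linarith
    qed
    let ?S = "\<Sum>n\<in>{N<..2 * N}. (norm (kfrac_sum M h \<alpha> n))\<^sup>2"
    have S0: "?S \<ge> 0" by (simp add: sum_nonneg)
    have c0: "0 \<le> c / 2" by (simp add: c_def)
    have V: "V \<alpha> n = kfrac_sum M h \<alpha> n" for n by (simp add: V_def kfrac_sum_def)
    have "(c / 2)\<^sup>2 * ?S \<le> 182 * z ^ 3 * (of_int N)\<^sup>2 * lam * ?A"
      using amplified_bound[OF c0 P, of \<alpha>] by (simp only: V z_def)
    also have "\<dots> \<le> 182 * z ^ 3 * (of_int N)\<^sup>2 * L * ?A"
      using lam z1 A0 by (intro mult_right_mono mult_left_mono) auto
    finally have 1: "(c / 2)\<^sup>2 * ?S \<le> 182 * z ^ 3 * (of_int N)\<^sup>2 * L * ?A" .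
    have "L\<^sup>2 \<le> (24 * z\<^sup>2 * c)\<^sup>2" using Lc L0 by (intro power_mono) auto
    also have "\<dots> = 2304 * z ^ 4 * (c / 2)\<^sup>2" by (simp add: power_mult_distrib power_divide)
    finally have "L\<^sup>2 * ?S \<le> 2304 * z ^ 4 * (c / 2)\<^sup>2 * ?S" using S0 by (rule mult_right_mono)
    also have "\<dots> = 2304 * z ^ 4 * ((c / 2)\<^sup>2 * ?S)" by (simp only: mult.assoc)
    also have "\<dots> \<le> 2304 * z ^ 4 * (182 * z ^ 3 * (of_int N)\<^sup>2 * L * ?A)" using 1 z1 by (intro mult_left_mono) auto
    also have "\<dots> = L * (419328 * z ^ 7 * (of_int N)\<^sup>2 * ?A)" by (simp add: eval_nat_numeral mult_ac)
    finally have "L * (L * ?S) \<le> L * (419328 * z ^ 7 * (of_int N)\<^sup>2 * ?A)" by (simp add: power2_eq_square mult.assoc)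
    then have "L * ?S \<le> 419328 * z ^ 7 * (of_int N)\<^sup>2 * ?A" using L0 by (simp only: mult_le_cancel_left_pos)
    also have "\<dots> \<le> 419904 * z ^ 8 * (of_int N)\<^sup>2 * ?A"
      using z1 A0 by (intro mult_right_mono mult_mono power_increasing) auto
    finally show ?thesis using L0 by (simp add: pos_le_divide_eq mult_ac)
  qed
  have "(of_int N)\<^sup>2 / L = W\<^sup>2" using WL L0 by (simp add: field_simps)
  then show ?thesis using key unfolding z_def[symmetric] W_def[symmetric] by (simp add: power_mult_distrib)
qed

theorem kfrac_bilinear_bound:
  fixes M N h :: int
  assumes "M \<ge> 1" "100 * M \<le> N" "h \<ge> 1" "h * M \<le> N"
  shows "norm (\<Sum>n\<in>{N<..2 * N}. \<beta> n * kfrac_sum M h \<alpha> n)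
    \<le> 648 * dmax N ^ 4 * (of_int M powr (3/10) * of_int N powr (13/20))
      * sqrt (\<Sum>m\<in>{M<..2 * M}. (norm (\<alpha> m))\<^sup>2) * sqrt (\<Sum>n\<in>{N<..2 * N}. (norm (\<beta> n))\<^sup>2)"
proof -
  let ?A = "\<Sum>m\<in>{M<..2 * M}. (norm (\<alpha> m))\<^sup>2" and ?B = "\<Sum>n\<in>{N<..2 * N}. (norm (\<beta> n))\<^sup>2"
  let ?c = "648 * dmax N ^ 4 * (of_int M powr (3/10) * of_int N powr (13/20))"
  have "dmax N \<ge> 1" using assms by (intro dmax_ge_1) linarith
  then have c0: "?c \<ge> 0" by simp
  have B0: "sqrt ?B \<ge> 0" by (simp add: sum_nonneg)
  have "norm (\<Sum>n\<in>{N<..2 * N}. \<beta> n * kfrac_sum M h \<alpha> n) \<le> sqrt ?B * sqrt (\<Sum>n\<in>{N<..2 * N}. (norm (kfrac_sum M h \<alpha> n))\<^sup>2)"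
    by (rule Cauchy_Schwarz_norm)
  also have "\<dots> \<le> sqrt ?B * sqrt (?c\<^sup>2 * ?A)"
    by (intro mult_left_mono[OF _ B0] real_sqrt_le_mono kfrac_mean_square assms)
  also have "sqrt (?c\<^sup>2 * ?A) = ?c * sqrt ?A" unfolding real_sqrt_mult real_sqrt_abs using c0 by simp
  finally show ?thesis by (simp only: mult_ac)
qed

section \<open>Dedekind sums with restricted arguments\<close>

text \<open>Expands the exponential into its power series. When \<open>u\<close> is a product of a
  function of \<open>m\<close> and a function of \<open>n\<close>, each power of it separates the
  variables.\<close>

lemma exp_kernel_separation:
  fixes c :: "'i \<Rightarrow> complex" and u :: "'i \<Rightarrow> real"
  assumes fin: "finite S" and B: "\<And>j. norm (\<Sum>i\<in>S. c i * of_real (u i ^ j)) \<le> B * r ^ j"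
  shows "norm (\<Sum>i\<in>S. c i * ee (u i)) \<le> B * exp (2 * pi * r)"
proof (rule norm_sums_le)
  show "(\<lambda>j. \<Sum>i\<in>S. c i * ((\<i> * of_real (2 * pi * u i)) ^ j /\<^sub>R fact j)) sums (\<Sum>i\<in>S. c i * ee (u i))"
    unfolding ee_def cis_conv_exp by (intro sums_sum sums_mult exp_converges)
  show "(\<lambda>j. B * ((2 * pi * r) ^ j /\<^sub>R fact j)) sums (B * exp (2 * pi * r))"
    by (intro sums_mult exp_converges)
  fix j
  have "(\<Sum>i\<in>S. c i * ((\<i> * of_real (2 * pi * u i)) ^ j /\<^sub>R fact j))
     = ((\<i> * of_real (2 * pi)) ^ j /\<^sub>R fact j) * (\<Sum>i\<in>S. c i * of_real (u i ^ j))"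
    by (simp add: sum_distrib_left power_mult_distrib scaleR_conv_of_real mult_ac)
  then have "norm (\<Sum>i\<in>S. c i * ((\<i> * of_real (2 * pi * u i)) ^ j /\<^sub>R fact j))
     = ((2 * pi) ^ j / fact j) * norm (\<Sum>i\<in>S. c i * of_real (u i ^ j))"
    by (simp add: norm_mult norm_power divide_inverse power_mult_distrib mult_ac)
  also have "\<dots> \<le> ((2 * pi) ^ j / fact j) * (B * r ^ j)" by (intro mult_left_mono B) simp
  also have "\<dots> = B * ((2 * pi * r) ^ j /\<^sub>R fact j)" by (simp add: power_mult_distrib divide_inverse mult_ac)
  finally show "norm (\<Sum>i\<in>S. c i * ((\<i> * of_real (2 * pi * u i)) ^ j /\<^sub>R fact j)) \<le> B * ((2 * pi * r) ^ j /\<^sub>R fact j)" .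
qed

definition coprime_pairs :: "int \<Rightarrow> int \<Rightarrow> (int \<times> int) set" where
  "coprime_pairs M N = {(m, n). m \<in> {M<..2 * M} \<and> n \<in> {N<..2 * N} \<and> coprime m n}"

lemma finite_coprime_pairs: "finite (coprime_pairs M N)"
  by (rule finite_subset[of _ "{M<..2 * M} \<times> {N<..2 * N}"]) (auto simp: coprime_pairs_def)

lemma sum_coprime_pairs:
  "(\<Sum>(m, n)\<in>coprime_pairs M N. \<alpha> m * \<beta> n * em n (h * modular_inverse n m)) = (\<Sum>n\<in>{N<..2 * N}. \<beta> n * kfrac_sum M h \<alpha> n)"
proof -
  have "(\<Sum>n\<in>{N<..2 * N}. \<beta> n * kfrac_sum M h \<alpha> n)
     = (\<Sum>n\<in>{N<..2 * N}. \<Sum>m\<in>{m\<in>{M<..2 * M}. coprime m n}. \<alpha> m * \<beta> n * em n (h * modular_inverse n m))"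
    by (simp add: kfrac_sum_def sum_distrib_left mult_ac)
  also have "\<dots> = (\<Sum>(n, m)\<in>Sigma {N<..2 * N} (\<lambda>n. {m\<in>{M<..2 * M}. coprime m n}). \<alpha> m * \<beta> n * em n (h * modular_inverse n m))"
    by (rule sum.Sigma) (auto intro: finite_subset[of _ "{M<..2 * M}"])
  also have "\<dots> = (\<Sum>(m, n)\<in>coprime_pairs M N. \<alpha> m * \<beta> n * em n (h * modular_inverse n m))"
    by (rule sum.reindex_bij_witness[of _ prod.swap prod.swap]) (auto simp: coprime_pairs_def)
  finally show ?thesis by simp
qed

lemma sqrt_sum_norm_le:
  fixes \<alpha> :: "int \<Rightarrow> complex"
  assumes "finite S" "T \<subseteq> S" "c \<ge> 0" "\<And>m. m \<in> T \<Longrightarrow> norm (\<alpha> m) \<le> c" "\<And>m. m \<in> S - T \<Longrightarrow> \<alpha> m = 0"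
  shows "sqrt (\<Sum>m\<in>S. (norm (\<alpha> m))\<^sup>2) \<le> c * sqrt (real (card T))"
proof -
  have "(\<Sum>m\<in>S. (norm (\<alpha> m))\<^sup>2) = (\<Sum>m\<in>T. (norm (\<alpha> m))\<^sup>2)"
    using assms by (intro sum.mono_neutral_right) auto
  also have "\<dots> \<le> (\<Sum>m\<in>T. c\<^sup>2)" using assms by (intro sum_mono power_mono) auto
  also have "\<dots> = c\<^sup>2 * real (card T)" by simp
  finally have "sqrt (\<Sum>m\<in>S. (norm (\<alpha> m))\<^sup>2) \<le> sqrt (c\<^sup>2 * real (card T))" by (rule real_sqrt_le_mono)
  then show ?thesis using assms(3) by (simp add: real_sqrt_mult)
qed

text \<open>The twist is \<open>h m / n = (h m / N) * (N / n)\<close> with factors at most 2 and 1;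
  their \<open>j\<close>-th powers go into the coefficients, and the series sums to
  \<open>exp (4 pi)\<close>.\<close>

lemma twisted_bilinear_bound:
  fixes M N h :: int
  assumes M: "M \<ge> 1" and MN: "100 * M \<le> N" and h: "h \<ge> 1" and hM: "h * M \<le> N"
    and MM: "MM \<subseteq> {M<..2 * M}" and NN: "NN \<subseteq> {N<..2 * N}"
    and a: "\<And>m. m \<in> MM \<Longrightarrow> norm (\<alpha> m) \<le> 1" "\<And>m. m \<notin> MM \<Longrightarrow> \<alpha> m = 0"
    and b: "\<And>n. n \<in> NN \<Longrightarrow> norm (\<beta> n) \<le> g" "\<And>n. n \<notin> NN \<Longrightarrow> \<beta> n = 0" and g: "g \<ge> 0"
  shows "norm (\<Sum>(m, n)\<in>coprime_pairs M N. \<alpha> m * \<beta> n * em n (h * modular_inverse n m) * em n (h * m))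
    \<le> 648 * exp (4 * pi) * dmax N ^ 4 * (of_int M powr (3/10) * of_int N powr (13/20)) * (sqrt (real (card MM)) * sqrt (real (card NN))) * g"
proof -
  define c where "c = 648 * dmax N ^ 4 * (of_int M powr (3/10) * of_int N powr (13/20))"
  have N1: "N \<ge> 100" using M MN by linarith
  have c0: "c \<ge> 0" using dmax_ge_1[of N] N1 by (simp add: c_def)
  have "norm (\<Sum>x\<in>coprime_pairs M N. (case x of (m, n) \<Rightarrow> \<alpha> m * \<beta> n * em n (h * modular_inverse n m)) * ee (case x of (m, n) \<Rightarrow> of_int (h * m) / of_int n))
     \<le> (c * (sqrt (real (card MM)) * sqrt (real (card NN))) * g) * exp (2 * pi * 2)"
  proof (rule exp_kernel_separation[OF finite_coprime_pairs])
    fix j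
    define \<alpha>' where "\<alpha>' m = \<alpha> m * of_real ((of_int (h * m) / of_int N) ^ j)" for m
    define \<beta>' where "\<beta>' n = \<beta> n * of_real ((of_int N / of_int n) ^ j)" for n
    have "(\<Sum>x\<in>coprime_pairs M N. (case x of (m, n) \<Rightarrow> \<alpha> m * \<beta> n * em n (h * modular_inverse n m)) * of_real ((case x of (m, n) \<Rightarrow> of_int (h * m) / of_int n) ^ j))
       = (\<Sum>(m, n)\<in>coprime_pairs M N. \<alpha>' m * \<beta>' n * em n (h * modular_inverse n m))"
    proof (intro sum.cong refl, clarify)
      fix m n
      have "complex_of_real ((of_int (h * m) / of_int n) ^ j) = of_real ((of_int (h * m) / of_int N) ^ j) * of_real ((of_int N / of_int n) ^ j)"
        using N1 by (simp flip: of_real_mult power_mult_distrib)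
      then show "\<alpha> m * \<beta> n * em n (h * modular_inverse n m) * of_real ((of_int (h * m) / of_int n) ^ j) = \<alpha>' m * \<beta>' n * em n (h * modular_inverse n m)"
        by (simp only: \<alpha>'_def \<beta>'_def mult_ac)
    qed
    also have "\<dots> = (\<Sum>n\<in>{N<..2 * N}. \<beta>' n * kfrac_sum M h \<alpha>' n)" by (rule sum_coprime_pairs)
    finally have E: "(\<Sum>x\<in>coprime_pairs M N. (case x of (m, n) \<Rightarrow> \<alpha> m * \<beta> n * em n (h * modular_inverse n m)) * of_real ((case x of (m, n) \<Rightarrow> of_int (h * m) / of_int n) ^ j))
       = (\<Sum>n\<in>{N<..2 * N}. \<beta>' n * kfrac_sum M h \<alpha>' n)" .
    have "norm (\<Sum>n\<in>{N<..2 * N}. \<beta>' n * kfrac_sum M h \<alpha>' n)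
      \<le> c * sqrt (\<Sum>m\<in>{M<..2 * M}. (norm (\<alpha>' m))\<^sup>2) * sqrt (\<Sum>n\<in>{N<..2 * N}. (norm (\<beta>' n))\<^sup>2)"
      unfolding c_def by (rule kfrac_bilinear_bound[OF M MN h hM])
    also have "\<dots> \<le> c * (2 ^ j * sqrt (real (card MM))) * (g * sqrt (real (card NN)))"
    proof (intro mult_mono sqrt_sum_norm_le mult_left_mono)
      fix m assume m: "m \<in> MM"
      then have mr: "M < m" "m \<le> 2 * M" using MM by auto
      have "h * m \<le> h * (2 * M)" using mr h by (intro mult_left_mono) auto
      then have "h * m \<le> 2 * N" using hM by linarith
      then have "real_of_int (h * m) \<le> of_int (2 * N)" by (simp only: of_int_le_iff)
      then have "of_int (h * m) / real_of_int N \<le> 2" using N1 by (simp add: divide_le_eq)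
      moreover have "0 \<le> of_int (h * m) / real_of_int N" using N1 h mr M by simp
      ultimately have "(of_int (h * m) / real_of_int N) ^ j \<le> 2 ^ j" "0 \<le> (of_int (h * m) / real_of_int N) ^ j"
        by (auto intro: power_mono)
      then have "norm (\<alpha> m) * \<bar>(of_int (h * m) / real_of_int N) ^ j\<bar> \<le> 1 * 2 ^ j"
        using a(1)[OF m] by (intro mult_mono) auto
      then show "norm (\<alpha>' m) \<le> 2 ^ j" unfolding \<alpha>'_def norm_mult norm_of_real by simp
    next
      fix n assume n: "n \<in> NN"
      then have nr: "N < n" using NN by auto
      have "0 \<le> real_of_int N / of_int n" "real_of_int N / of_int n \<le> 1" using nr N1 by auto
      then have "(real_of_int N / of_int n) ^ j \<le> 1" "0 \<le> (real_of_int N / of_int n) ^ j"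
        by (auto intro: power_le_one)
      then have "norm (\<beta> n) * \<bar>(real_of_int N / of_int n) ^ j\<bar> \<le> g * 1"
        using b(1)[OF n] g by (intro mult_mono) auto
      then show "norm (\<beta>' n) \<le> g" unfolding \<beta>'_def norm_mult norm_of_real by simp
    qed (use c0 g MM NN a b in \<open>auto simp: \<alpha>'_def \<beta>'_def intro!: sum_nonneg\<close>)
    also have "\<dots> = c * (sqrt (real (card MM)) * sqrt (real (card NN))) * g * 2 ^ j" by (simp add: mult_ac)
    finally show "norm (\<Sum>x\<in>coprime_pairs M N. (case x of (m, n) \<Rightarrow> \<alpha> m * \<beta> n * em n (h * modular_inverse n m)) * of_real ((case x of (m, n) \<Rightarrow> of_int (h * m) / of_int n) ^ j))
      \<le> c * (sqrt (real (card MM)) * sqrt (real (card NN))) * g * 2 ^ j" unfolding E .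
  qed
  then show ?thesis by (simp add: em_def case_prod_unfold c_def mult_ac)
qed

text \<open>The interval condition on \<open>m\<close> depends on \<open>n\<close>; as \<open>{M<..2 * M}\<close> is a complete residue system
  modulo \<open>M\<close>, additive characters modulo \<open>M\<close> separate the two variables.\<close>

lemma interval_indicator:
  fixes M m u w :: int
  assumes M: "M \<ge> 1" and m: "m \<in> {M<..2 * M}" and u: "M \<le> u" "w \<le> 2 * M"
  shows "(\<Sum>b\<in>{0..<M}. (\<Sum>v\<in>{u + 1..<w + 1}. em M (b * (- v))) * em M (b * m)) = (if u < m \<and> m \<le> w then of_int M else 0)"
proof -
  have "(\<Sum>b\<in>{0..<M}. (\<Sum>v\<in>{u + 1..<w + 1}. em M (b * (- v))) * em M (b * m))
     = (\<Sum>b\<in>{0..<M}. \<Sum>v\<in>{u + 1..<w + 1}. em M (b * (m - v)))"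
    unfolding sum_distrib_right
    by (intro sum.cong refl) (simp add: right_diff_distrib em_diff em_uminus mult.commute)
  also have "\<dots> = (\<Sum>v\<in>{u + 1..<w + 1}. \<Sum>b\<in>{0..<M}. em M (b * (m - v)))" by (rule sum.swap)
  also have "\<dots> = (\<Sum>v\<in>{u + 1..<w + 1}. if v = m then of_int M else 0)"
  proof (intro sum.cong refl)
    fix v assume v: "v \<in> {u + 1..<w + 1}"
    have "M dvd m - v \<longleftrightarrow> v = m"
    proof
      assume d: "M dvd m - v"
      have "\<bar>m - v\<bar> < M" using v m u by auto
      then have "m - v = 0" using d dvd_imp_le_int[of "m - v" M] M by force
      then show "v = m" by simp
    qed simp
    then show "(\<Sum>b\<in>{0..<M}. em M (b * (m - v))) = (if v = m then of_int M else 0)"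
      using em_orthogonality[OF M, of "m - v"] by simp
  qed
  also have "\<dots> = (if u < m \<and> m \<le> w then of_int M else 0)" by simp
  finally show ?thesis .
qed

lemma adm_pairs_exponential_sum:
  fixes M N k :: int
  assumes M: "M \<ge> 1" and MN: "100 * M \<le> N" and k: "k \<ge> 1" and kM: "k * M \<le> N"
    and KL: "\<And>n. N < n \<Longrightarrow> n \<le> 2 * N \<Longrightarrow> M \<le> K n \<and> K n < K n + L n \<and> K n + L n \<le> 2 * M"
    and MM: "MM \<subseteq> {M<..2 * M}" and NN: "NN \<subseteq> {N<..2 * N}"
  shows "norm (\<Sum>(m, n)\<in>adm_pairs K L MM NN. em n (k * modular_inverse n m) * em n (k * m))
    \<le> 3240 * exp (4 * pi) * dmax N ^ 5 * (of_int M powr (3/10) * of_int N powr (13/20)) * (sqrt (real (card MM)) * sqrt (real (card NN)))"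
proof -
  define c where "c = 648 * exp (4 * pi) * dmax N ^ 4 * (of_int M powr (3/10) * of_int N powr (13/20)) * (sqrt (real (card MM)) * sqrt (real (card NN)))"
  define E where "E = (\<lambda>(m, n). em n (k * modular_inverse n m) * em n (k * m))"
  \<comment> \<open>Fourier coefficients modulo \<open>M\<close> of the interval belonging to
    \<open>n\<close>. They are arbitrary in \<open>n\<close> but, divided by \<open>M\<close>,
    bounded by \<open>g b\<close>, whose sum over \<open>b\<close> is logarithmic.\<close>
  define \<gamma> where "\<gamma> b n = (\<Sum>v\<in>{K n + 1..<K n + L n + 1}. em M (b * (- v)))" for b n
  define \<alpha> where "\<alpha> b m = (if m \<in> MM then em M (b * m) else 0)" for b m
  define \<beta> where "\<beta> b n = (if n \<in> NN then \<gamma> b n / of_int M else 0)" for b n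
  define g :: "int \<Rightarrow> real" where "g b = (if b = 0 then 1 else 1 / of_int b + 1 / of_int (M - b))" for b
  have N1: "N \<ge> 100" using M MN by linarith
  have Z1: "dmax N \<ge> 1" using N1 by (intro dmax_ge_1) auto
  have c0: "c \<ge> 0" using Z1 by (simp add: c_def)
  have g0: "g b \<ge> 0" if "b \<in> {0..<M}" for b using that by (simp add: g_def)
  have adm: "adm_pairs K L MM NN \<subseteq> coprime_pairs M N"
    using MM NN by (auto simp: adm_pairs_def coprime_pairs_def)
  have "(\<Sum>x\<in>adm_pairs K L MM NN. E x) = (\<Sum>(m, n)\<in>coprime_pairs M N. (\<Sum>b\<in>{0..<M}. \<alpha> b m * \<beta> b n) * E (m, n))"
  proof (rule sum.mono_neutral_cong_left[OF finite_coprime_pairs adm])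
    have val: "(\<Sum>b\<in>{0..<M}. \<alpha> b m * \<beta> b n) = (if (m, n) \<in> adm_pairs K L MM NN then 1 else 0)" if mn: "(m, n) \<in> coprime_pairs M N" for m n
    proof (cases "m \<in> MM \<and> n \<in> NN")
      case True
      have r: "m \<in> {M<..2 * M}" "N < n" "n \<le> 2 * N" "coprime m n" using mn by (auto simp: coprime_pairs_def)
      have "(\<Sum>b\<in>{0..<M}. \<alpha> b m * \<beta> b n) = (\<Sum>b\<in>{0..<M}. \<gamma> b n * em M (b * m)) / of_int M"
        using True by (simp add: \<alpha>_def \<beta>_def sum_divide_distrib mult.commute)
      also have "(\<Sum>b\<in>{0..<M}. \<gamma> b n * em M (b * m)) = (if K n < m \<and> m \<le> K n + L n then of_int M else 0)"
        unfolding \<gamma>_def using KL[OF r(2,3)] by (intro interval_indicator[OF M r(1)]) auto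
      finally show ?thesis using True r M by (auto simp: adm_pairs_def)
    next
      case False
      then show ?thesis by (auto simp: \<alpha>_def \<beta>_def adm_pairs_def)
    qed
    show "\<forall>x\<in>coprime_pairs M N - adm_pairs K L MM NN. (case x of (m, n) \<Rightarrow> (\<Sum>b\<in>{0..<M}. \<alpha> b m * \<beta> b n) * E (m, n)) = 0"
      using val by auto
    show "E x = (case x of (m, n) \<Rightarrow> (\<Sum>b\<in>{0..<M}. \<alpha> b m * \<beta> b n) * E (m, n))" if "x \<in> adm_pairs K L MM NN" for x
      using that val adm by (cases x) auto
  qed
  also have "\<dots> = (\<Sum>x\<in>coprime_pairs M N. \<Sum>b\<in>{0..<M}. case x of (m, n) \<Rightarrow> \<alpha> b m * \<beta> b n * em n (k * modular_inverse n m) * em n (k * m))"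
    by (intro sum.cong refl) (auto simp: E_def sum_distrib_right mult.assoc)
  also have "\<dots> = (\<Sum>b\<in>{0..<M}. \<Sum>(m, n)\<in>coprime_pairs M N. \<alpha> b m * \<beta> b n * em n (k * modular_inverse n m) * em n (k * m))"
    by (rule sum.swap)
  finally have EQ: "(\<Sum>x\<in>adm_pairs K L MM NN. E x) = (\<Sum>b\<in>{0..<M}. \<Sum>(m, n)\<in>coprime_pairs M N. \<alpha> b m * \<beta> b n * em n (k * modular_inverse n m) * em n (k * m))" .
  have "norm (\<Sum>x\<in>adm_pairs K L MM NN. E x) \<le> (\<Sum>b\<in>{0..<M}. c * g b)"
    unfolding EQ
  proof (rule order_trans[OF norm_sum], rule sum_mono)
    fix b assume b: "b \<in> {0..<M}"
    show "norm (\<Sum>(m, n)\<in>coprime_pairs M N. \<alpha> b m * \<beta> b n * em n (k * modular_inverse n m) * em n (k * m)) \<le> c * g b"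
      unfolding c_def
    proof (rule twisted_bilinear_bound[OF M MN k kM MM NN])
      fix n assume n: "n \<in> NN"
      then have r: "N < n" "n \<le> 2 * N" using NN by auto
      have "norm (\<gamma> b n) \<le> of_int M * g b"
      proof (cases "b = 0")
        case True
        have "L n \<le> M" "0 < L n" using KL[OF r] by auto
        then show ?thesis using True by (simp add: \<gamma>_def g_def)
      next
        case False
        have "\<gamma> b n = cnj (\<Sum>v\<in>{K n + 1..<K n + L n + 1}. em M (b * v))"
          by (simp add: \<gamma>_def cnj_sum flip: em_uminus)
        then have "norm (\<gamma> b n) = norm (\<Sum>v\<in>{K n + 1..<K n + L n + 1}. em M (b * v))" by (simp only: complex_mod_cnj)
        also have "\<dots> \<le> of_int M * (1 / of_int b + 1 / of_int (M - b))" using False b by (intro norm_geom_sum_em) auto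
        finally show ?thesis using False by (simp add: g_def)
      qed
      then show "norm (\<beta> b n) \<le> g b" using n M by (simp add: \<beta>_def norm_divide divide_le_eq mult.commute)
    qed (use g0[OF b] in \<open>auto simp: \<alpha>_def \<beta>_def\<close>)
  qed
  also have "\<dots> = c * (\<Sum>b\<in>{0..<M}. g b)" by (simp add: sum_distrib_left)
  also have "(\<Sum>b\<in>{0..<M}. g b) \<le> 5 * dmax N"
  proof -
    have "{0..<M} = insert 0 {1..<M}" using M by auto
    then have "(\<Sum>b\<in>{0..<M}. g b) = 1 + (\<Sum>b\<in>{1..<M}. 1 / real_of_int b + 1 / of_int (M - b))"
      by (simp add: g_def)
    moreover have "of_int M * (\<Sum>b\<in>{1..<M}. 1 / real_of_int b + 1 / of_int (M - b)) \<le> of_int M * (2 * (1 + ln (of_int M)))"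
      using sum_geom_bound[OF M] by (simp only: sum_distrib_left mult_ac)
    then have "(\<Sum>b\<in>{1..<M}. 1 / real_of_int b + 1 / of_int (M - b)) \<le> 2 * (1 + ln (of_int M))"
      using M by (simp only: mult_le_cancel_left)
    moreover have "ln (real_of_int M) \<le> ln (of_int N)" using M MN by (intro ln_mono) auto
    then have "ln (real_of_int M) \<le> dmax N" using ln_le_dmax[of N] N1 by linarith
    ultimately show ?thesis using Z1 by (simp only: distrib_left)
  qed
  finally have "norm (\<Sum>x\<in>adm_pairs K L MM NN. E x) \<le> c * (5 * dmax N)" using c0 by (simp add: mult_left_mono)
  then show ?thesis by (simp add: c_def E_def eval_nat_numeral mult_ac)
qed

lemma discrepancy_bound:
  fixes M N :: int
  assumes M: "M \<ge> 1" and MN: "M \<le> N"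
    and KL: "\<And>n. N < n \<Longrightarrow> n \<le> 2 * N \<Longrightarrow> M \<le> K n \<and> K n < K n + L n \<and> K n + L n \<le> 2 * M"
    and MM: "MM \<subseteq> {M<..2 * M}" and NN: "NN \<subseteq> {N<..2 * N}"
  shows "discrepancy K L MM NN
    \<le> 6480 * exp (4 * pi) * (sqrt (real (card (MM \<times> NN))) * of_int M powr (3/10) * (of_int N powr (13/20) * dmax N ^ 6))
      + 10 * (real (count_N K L MM NN) * of_int M powr (1/2) * of_int N powr (-1/2))"
    (is "_ \<le> ?A + 10 * ?B")
proof -
  have pos: "real_of_int M \<ge> 1" "real_of_int N \<ge> 1" "real_of_int M \<le> of_int N" using M MN by auto
  have Z1: "dmax N \<ge> 1" using M MN by (intro dmax_ge_1) auto
  define I where "I = adm_pairs K L MM NN"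
  \<comment> \<open>The smoothing width; it balances \<open>2 d\<close> against
    \<open>2 / (H d)\<close> for \<open>H\<close> about \<open>N / M\<close>.\<close>
  define d where "d = sqrt (real_of_int M / of_int N)"
  have fin: "finite I"
    by (rule finite_subset[OF _ finite_coprime_pairs[of M N]]) (use MM NN in \<open>auto simp: I_def adm_pairs_def coprime_pairs_def\<close>)
  have B: "?B = real (card I) * d"
  proof -
    have "real_of_int M powr (1/2) = sqrt (of_int M)" "real_of_int N powr (1/2) = sqrt (of_int N)"
      using pos by (auto intro: powr_half_sqrt)
    moreover have "real_of_int N powr (-1/2) = inverse (of_int N powr (1/2))" by (simp flip: powr_minus)
    moreover have "d = sqrt (of_int M) * inverse (sqrt (of_int N))" unfolding d_def real_sqrt_divide by (rule divide_inverse)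
    ultimately have "real_of_int M powr (1/2) * of_int N powr (-1/2) = d" by (simp only:)
    then show ?thesis unfolding count_N_def I_def[symmetric] mult.assoc by (rule arg_cong)
  qed
  have A0: "?A \<ge> 0" using Z1 by simp
  have "\<bar>real (count_A K L MM NN lam) - lam * real (count_N K L MM NN)\<bar> \<le> ?A + 10 * ?B" if lam: "lam \<in> {0..1}" for lam
  proof -
    define x where "x = (\<lambda>(m, n). frac (12 * dedekind_sum m n))"
    have x01: "0 \<le> x i \<and> x i < 1" for i by (cases i) (simp add: x_def frac_lt_1)
    have cA: "count_A K L MM NN lam = card {i\<in>I. x i \<le> lam}"
      unfolding count_A_def I_def by (intro arg_cong[of _ _ card]) (auto simp: x_def)
    show ?thesis
    proof (cases "100 * M \<le> N")
      \<comment> \<open>Then \<open>d\<close> is at least 1/10 and the second term exceeds the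
        trivial bound.\<close>
      case False
      have "card {i\<in>I. x i \<le> lam} \<le> card I" using fin by (intro card_mono) auto
      moreover have "0 \<le> lam * real (card I)" "lam * real (card I) \<le> real (card I)"
        using lam by (auto simp: mult_left_le_one_le)
      ultimately have "\<bar>real (card {i\<in>I. x i \<le> lam}) - lam * real (card I)\<bar> \<le> real (card I)" by auto
      also have "\<dots> \<le> real (card I) * (10 * d)"
      proof -
        have "real_of_int N \<le> of_int (100 * M)" using False by (simp only: of_int_le_iff)
        then have "(1 / 10)\<^sup>2 \<le> real_of_int M / of_int N" using pos by (simp add: power2_eq_square field_simps)
        then have "1 / 10 \<le> d" unfolding d_def by (rule real_le_rsqrt)
        then have "real (card I) * 1 \<le> real (card I) * (10 * d)" by (intro mult_left_mono) auto
        then show ?thesis by simp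
      qed
      also have "\<dots> = 10 * ?B" unfolding B by simp
      finally show ?thesis using A0 unfolding cA count_N_def I_def[symmetric] by linarith
    next
      \<comment> \<open>The largest \<open>H\<close> with \<open>H * M <= N\<close>, so that every
        frequency below it meets the hypothesis of the exponential sum bound.\<close>
      case True
      define H where "H = nat (N div M)"
      have H: "int H = N div M" using M MN by (simp add: H_def pos_imp_zdiv_nonneg_iff)
      have HM: "int H * M \<le> N" unfolding H using M pos_mod_sign[of M N] div_mult_mod_eq[of N M] by linarith
      have H1: "int H \<ge> 100" unfolding H using True M zdiv_mono1[of "100 * M" N M] by simp
      have "N < (int H + 1) * M" unfolding H distrib_right using M pos_mod_bound[of M N] div_mult_mod_eq[of N M] by linarith
      moreover have "1 * M \<le> int H * M" using H1 M by (intro mult_right_mono) auto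
      ultimately have "N \<le> 2 * int H * M" unfolding distrib_right by linarith
      then have "real_of_int N \<le> of_int (2 * int H * M)" by (simp only: of_int_le_iff)
      then have HN: "real_of_int N \<le> 2 * real H * of_int M" by simp
      have d0: "d > 0" "d \<le> 1 / 2"
      proof -
        show "d > 0" using pos by (simp add: d_def)
        have "real_of_int (100 * M) \<le> of_int N" using True by (simp only: of_int_le_iff)
        then show "d \<le> 1 / 2" unfolding d_def using pos by (intro real_le_lsqrt) (auto simp: power2_eq_square field_simps)
      qed
      define t where "t = 3240 * exp (4 * pi) * dmax N ^ 5 * (of_int M powr (3/10) * of_int N powr (13/20)) * (sqrt (real (card MM)) * sqrt (real (card NN)))"
      have t0: "t \<ge> 0" using Z1 by (simp add: t_def)
      have T: "norm (\<Sum>i\<in>I. ee (real k * x i)) \<le> t" if k: "k \<in> {1..<H}" for k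
      proof -
        have "(\<Sum>i\<in>I. ee (real k * x i)) = (\<Sum>(m, n)\<in>I. em n (int k * modular_inverse n m) * em n (int k * m))"
        proof (intro sum.cong refl, clarify)
          fix m n assume "(m, n) \<in> I"
          then have mn: "coprime m n" "n \<ge> 1" using NN M MN by (auto simp: I_def adm_pairs_def)
          have "x (m, n) - of_int (m + modular_inverse n m) / of_int n
             = (12 * dedekind_sum m n - of_int (m + modular_inverse n m) / of_int n) - of_int \<lfloor>12 * dedekind_sum m n\<rfloor>"
            by (simp add: x_def frac_def)
          also have "\<dots> \<in> \<int>" using mn by (intro Ints_diff[OF dedekind_sum_mod_1]) auto
          finally have "real k * (x (m, n) - of_int (m + modular_inverse n m) / of_int n) \<in> \<int>" by (intro Ints_mult) auto
          moreover have "real k * (x (m, n) - of_int (m + modular_inverse n m) / of_int n)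
             = real k * x (m, n) - of_int (int k * modular_inverse n m + int k * m) / of_int n"
            by (simp add: algebra_simps add_divide_distrib)
          ultimately have "ee (real k * x (m, n)) = em n (int k * modular_inverse n m + int k * m)"
            unfolding em_def by (intro ee_cong_int) simp
          then show "ee (real k * x (m, n)) = em n (int k * modular_inverse n m) * em n (int k * m)" by (simp only: em_add)
        qed
        then show ?thesis unfolding t_def I_def
        proof (simp only:, intro adm_pairs_exponential_sum[OF M True _ _ KL MM NN])
          have "int k * M \<le> int H * M" using k M by (intro mult_right_mono) auto
          then show "int k * M \<le> N" using HM by linarith
        qed (use k in auto)
      qed
      have lnH: "(\<Sum>k\<in>{1..<H}. 1 / real k) \<le> 2 * dmax N"
      proof -
        have "(\<Sum>k\<in>{1..<H}. 1 / real k) = (\<Sum>b\<in>{1..int H - 1}. 1 / real_of_int b)"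
          by (rule sum.reindex_bij_witness[of _ nat int]) auto
        also have "\<dots> \<le> 1 + ln (of_int (int H - 1))" using H1 by (intro sum_inverse_le_ln) auto
        also have "ln (real_of_int (int H - 1)) \<le> ln (of_int N)"
        proof (rule ln_mono)
          have "int H * 1 \<le> int H * M" using M by (intro mult_left_mono) auto
          then have "int H - 1 \<le> N" using HM by linarith
          then show "real_of_int (int H - 1) \<le> of_int N" by (simp only: of_int_le_iff)
        qed (use H1 in auto)
        also have "ln (real_of_int N) \<le> dmax N" using M MN by (intro ln_le_dmax) auto
        finally show ?thesis using Z1 by simp
      qed
      have "\<bar>real (card {i\<in>I. x i \<le> lam}) - lam * real (card I)\<bar>
        \<le> real (card I) * (2 * d + 2 / (real H * d)) + (\<Sum>k\<in>{1..<H}. norm (\<Sum>i\<in>I. ee (real k * x i)) / real k)"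
        using lam d0 H1 x01 by (intro discrepancy_le_exponential_sums fin) auto
      also have "real (card I) * (2 * d + 2 / (real H * d)) \<le> real (card I) * (10 * d)"
      proof (rule mult_left_mono)
        have dd: "of_int M / of_int N = d * d" using pos by (simp add: d_def)
        have "2 \<le> 4 * (real H * (of_int M / of_int N))" using HN pos by (simp add: field_simps)
        then have "2 \<le> 4 * (real H * (d * d))" unfolding dd .
        then have "2 / (real H * d) \<le> 4 * d" using d0 H1 by (simp add: divide_le_eq mult_ac)
        then show "2 * d + 2 / (real H * d) \<le> 10 * d" using d0 by linarith
      qed simp
      also have "real (card I) * (10 * d) = 10 * ?B" unfolding B by simp
      also have "(\<Sum>k\<in>{1..<H}. norm (\<Sum>i\<in>I. ee (real k * x i)) / real k) \<le> (\<Sum>k\<in>{1..<H}. t * (1 / real k))"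
        using T by (intro sum_mono) (simp add: divide_right_mono)
      also have "\<dots> = t * (\<Sum>k\<in>{1..<H}. 1 / real k)" by (simp only: sum_distrib_left)
      also have "\<dots> \<le> t * (2 * dmax N)" using lnH t0 by (rule mult_left_mono)
      also have "\<dots> = ?A" by (simp add: t_def card_cartesian_product real_sqrt_mult eval_nat_numeral mult_ac)
      finally show ?thesis unfolding cA count_N_def I_def[symmetric] by simp
    qed
  qed
  then show ?thesis unfolding discrepancy_def by (intro cSUP_least) auto
qed

text \<open>\<open>q N\<close> is the exponent with \<open>dmax N ^ 6 = N powr q N\<close>. Its
  supremum over \<open>N >= M\<close> depends on \<open>M\<close> alone and tends to 0, which gives
  the required uniformity in \<open>N\<close>.\<close>

lemma dmax_exponent:
  obtains \<eta> :: "int \<Rightarrow> real" where "(\<eta> \<longlongrightarrow> 0) at_top"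
    "\<forall>\<^sub>F M in at_top. \<forall>N\<ge>M. dmax N ^ 6 \<le> of_int N powr \<eta> M"
proof -
  define q where "q N = 6 * ln (dmax N) / ln (of_int N)" for N
  define \<eta> where "\<eta> M = (SUP N\<in>{M..}. q N)" for M
  have q: "\<forall>\<^sub>F M in at_top. \<forall>N\<ge>M. q N \<le> \<epsilon>" if e: "\<epsilon> > 0" for \<epsilon>
  proof -
    obtain N0 where N0: "\<And>N. N \<ge> N0 \<Longrightarrow> dmax N \<le> of_int N powr (\<epsilon> / 6)"
      using dmax_subpolynomial[of "\<epsilon> / 6"] e by (auto simp: eventually_at_top_linorder)
    have "q N \<le> \<epsilon>" if "N \<ge> max N0 2" for N
    proof -
      have "dmax N \<ge> 1" using that by (intro dmax_ge_1) auto
      then have "ln (dmax N) \<le> ln (of_int N powr (\<epsilon> / 6))" using N0[of N] that by (intro ln_mono) auto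
      also have "\<dots> = \<epsilon> / 6 * ln (of_int N)" using that by (simp add: ln_powr)
      finally have "6 * ln (dmax N) \<le> \<epsilon> * ln (of_int N)" by simp
      moreover have "ln (real_of_int N) > 0" using that by simp
      ultimately show ?thesis by (simp add: q_def divide_le_eq)
    qed
    then show ?thesis unfolding eventually_at_top_linorder by (meson order_trans)
  qed
  have q0: "q N \<ge> 0" if "N \<ge> 1" for N using that dmax_ge_1[of N] by (simp add: q_def)
  have "(\<eta> \<longlongrightarrow> 0) at_top"
  proof (rule tendstoI)
    fix e :: real assume e: "e > 0"
    have "\<forall>\<^sub>F M in at_top. (\<forall>N\<ge>M. q N \<le> e / 2) \<and> M \<ge> (1 :: int)"
      using e by (intro eventually_conj q eventually_ge_at_top) simp
    then show "\<forall>\<^sub>F M in at_top. dist (\<eta> M) 0 < e"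
    proof eventually_elim
      case (elim M)
      have bdd: "bdd_above (q ` {M..})" using elim by (auto intro!: bdd_aboveI[of _ "e / 2"])
      have "\<eta> M \<le> e / 2" unfolding \<eta>_def using elim by (intro cSUP_least) auto
      moreover have "0 \<le> \<eta> M" unfolding \<eta>_def using elim q0[of M] by (intro cSUP_upper2[OF bdd, of M]) auto
      ultimately show ?case using e by simp
    qed
  qed
  moreover have "\<forall>\<^sub>F M in at_top. \<forall>N\<ge>M. dmax N ^ 6 \<le> of_int N powr \<eta> M"
  proof -
    have "\<forall>\<^sub>F M in at_top. (\<forall>N\<ge>M. q N \<le> 1) \<and> M \<ge> (2 :: int)"
      by (intro eventually_conj q eventually_ge_at_top) simp
    then show ?thesis
    proof eventually_elim
      case (elim M)
      have bdd: "bdd_above (q ` {M..})" using elim by (auto intro!: bdd_aboveI[of _ 1])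
      show ?case
      proof (intro allI impI)
        fix N assume N: "N \<ge> M"
        have Z: "dmax N \<ge> 1" using N elim by (intro dmax_ge_1) auto
        have l: "ln (real_of_int N) > 0" using N elim by simp
        have "q N \<le> \<eta> M" unfolding \<eta>_def using N by (intro cSUP_upper[OF _ bdd]) auto
        then have "6 * ln (dmax N) \<le> \<eta> M * ln (of_int N)" using l by (simp add: q_def divide_le_eq)
        then have "exp (6 * ln (dmax N)) \<le> exp (\<eta> M * ln (of_int N))" by simp
        moreover have "exp (6 * ln (dmax N)) = dmax N ^ 6" using Z exp_of_nat_mult[of 6 "ln (dmax N)"] by simp
        ultimately show "dmax N ^ 6 \<le> of_int N powr \<eta> M" using N elim by (simp add: powr_def)
      qed
    qed
  qed
  ultimately show ?thesis using that by blast
qed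

theorem theorem1:
  "\<exists>C > 0. \<exists>\<eta> :: int \<Rightarrow> real. (\<eta> \<longlongrightarrow> 0) at_top \<and>
     (\<forall>\<^sub>F M in at_top. \<forall>(N::int) (K::int \<Rightarrow> int) (L::int \<Rightarrow> int) (MM::int set) (NN::int set).
        1 \<le> M \<longrightarrow> M \<le> N \<longrightarrow>
        (\<forall>n. N < n \<and> n \<le> 2 * N \<longrightarrow> M \<le> K n \<and> K n < K n + L n \<and> K n + L n \<le> 2 * M) \<longrightarrow>
        MM \<subseteq> {M<..2 * M} \<longrightarrow> NN \<subseteq> {N<..2 * N} \<longrightarrow>
        discrepancy K L MM NN \<le>
          C * (sqrt (real (card (MM \<times> NN))) * of_int M powr (3/10) * of_int N powr (13/20 + \<eta> M)
               + real (count_N K L MM NN) * of_int M powr (1/2) * of_int N powr (-1/2)))"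
proof -
  obtain \<eta> where \<eta>: "(\<eta> \<longlongrightarrow> 0) at_top" "\<forall>\<^sub>F M in at_top. \<forall>N\<ge>M. dmax N ^ 6 \<le> of_int N powr \<eta> M"
    by (rule dmax_exponent)
  define C where "C = 6480 * exp (4 * pi) + 10"
  have "exp (4 * pi) > 0" by simp
  then have C: "C > 0" "6480 * exp (4 * pi) \<le> C" "10 \<le> C" unfolding C_def by linarith+
  have "\<forall>\<^sub>F M in at_top. \<forall>(N::int) (K::int \<Rightarrow> int) (L::int \<Rightarrow> int) (MM::int set) (NN::int set).
        1 \<le> M \<longrightarrow> M \<le> N \<longrightarrow>
        (\<forall>n. N < n \<and> n \<le> 2 * N \<longrightarrow> M \<le> K n \<and> K n < K n + L n \<and> K n + L n \<le> 2 * M) \<longrightarrow>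
        MM \<subseteq> {M<..2 * M} \<longrightarrow> NN \<subseteq> {N<..2 * N} \<longrightarrow>
        discrepancy K L MM NN \<le>
          C * (sqrt (real (card (MM \<times> NN))) * of_int M powr (3/10) * of_int N powr (13/20 + \<eta> M)
               + real (count_N K L MM NN) * of_int M powr (1/2) * of_int N powr (-1/2))"
    using \<eta>(2)
  proof eventually_elim
    case (elim M)
    show ?case
    proof (intro allI impI)
      fix N :: int and K L :: "int \<Rightarrow> int" and MM NN :: "int set"
      assume M: "1 \<le> M" "M \<le> N" and KL: "\<forall>n. N < n \<and> n \<le> 2 * N \<longrightarrow> M \<le> K n \<and> K n < K n + L n \<and> K n + L n \<le> 2 * M"
        and S: "MM \<subseteq> {M<..2 * M}" "NN \<subseteq> {N<..2 * N}"
      let ?a = "sqrt (real (card (MM \<times> NN))) * of_int M powr (3/10)"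
      let ?b = "real (count_N K L MM NN) * of_int M powr (1/2) * of_int N powr (-1/2)"
      have "discrepancy K L MM NN \<le> 6480 * exp (4 * pi) * (?a * (of_int N powr (13/20) * dmax N ^ 6)) + 10 * ?b"
        using KL by (intro discrepancy_bound M S) auto
      also have "\<dots> \<le> C * (?a * (of_int N powr (13/20) * of_int N powr \<eta> M)) + C * ?b"
        using elim M C dmax_ge_1[of N] by (intro add_mono mult_mono mult_left_mono) auto
      also have "\<dots> = C * (?a * of_int N powr (13/20 + \<eta> M) + ?b)" by (simp add: powr_add distrib_left)
      finally show "discrepancy K L MM NN \<le> C * (?a * of_int N powr (13/20 + \<eta> M) + ?b)" .
    qed
  qed
  then show ?thesis using C(1) \<eta>(1) by blast
qed

end
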